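(* Let $G$ be a planar trivalent graph and $M$ a perfect matching of $G$. The bigraded space $H^{*,*}(\Gamma)$ of a perfect matching graph $\Gamma$ of $(G,M)$ depends (up to isomorphism of bigraded $\mathbb{Z}_2$-vector spaces) only on the pair $(G,M)$; denote it $H^{*,*}(G,M)$. Furthermore, the graded Euler characteristic of $H^{*,*}(G,M)$ is the $2$-factor polynomial: $$\langle G{:}M\rangle_2(q)=\sum_{i\in\mathbb{Z}}(-1)^i\, q\!\dim\big(H^{i,*}(G,M)\big).$$
   Context: Graphs are finite multigraphs; loops, multiple edges, vertexless "circle" edges (edges with no endpoints) and the empty graph are allowed. A graph is trivalent if every vertex has degree $3$ (loops counted twice), and planar if it embeds in $S^2$. A plane graph of $G$ is (the image $\Gamma\subset S^2$ of) an embedding $G\to S^2$. A perfect matching of $G$ is a set $M$ of edges, none of which is a loop or a vertexless circle, such that every vertex is an endpoint of exactly one edge of $M$. A perfect matching graph for $(G,M)$ is a plane graph $\Gamma$ of $G$ together with $M$. States. Write $M=\{e_1,\dots,e_n\}$. Let $e\in M$ have end vertices $u,v$. Going counterclockwise around $u$ in $\Gamma$ starting from $e$, let $x_1,x_2$ be the other two half-edges; going counterclockwise around $v$ starting from $e$, let $y_1,y_2$ be the other two half-edges. The $0$-smoothing of $e$ replaces a small neighborhood of $e$ by two disjoint arcs parallel to $e$ joining $x_1$ to $y_2$ and $x_2$ to $y_1$; the $1$-smoothing replaces it by two arcs crossing once transversely, joining $x_1$ to $y_1$ and $x_2$ to $y_2$. For $\alpha\in\{0,1\}^n$ the state $\Gamma_\alpha$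 is the collection of (possibly immersed) circles obtained by performing the $\alpha_i$-smoothing at $e_i$ for every $i$; $k_\alpha$ is the number of circles and $|\alpha|=\sum\alpha_i$. $2$-factor polynomial: $\langle G{:}M\rangle_2(q)=\sum_{\alpha\in\{0,1\}^n}(-q)^{|\alpha|}(q^{-1}+q)^{k_\alpha}$, computed from any perfect matching graph $\Gamma$ of $(G,M)$. Cochain complex. Let $V=\mathbb{Z}_2[x]/(x^2)$, graded by $\deg 1=1$, $\deg x=-1$. For a graded vector space, $(W\{\ell\})^m=W^{m-\ell}$ and $q\!\dim W=\sum_m q^m\dim W^m$. To $\alpha$ associate $V_\alpha=V^{\otimes k_\alpha}\{|\alpha|\}$, with one tensor factor $V_c\cong V$ for each circle $c$ of $\Gamma_\alpha$. Set $C^{i,*}(\Gamma)=\bigoplus_{|\alpha|=i}V_\alpha$, where the second grading $j$ is the grading of $V_\alpha$ (so $j=\deg v+|\alpha|$). If $\alpha'$ is obtained from $\alpha$ by changing a single $\alpha_k$ from $0$ to $1$, define $\partial_{\alpha\alpha'}:V_\alpha\to V_{\alpha'}$ as the tensor product of the identity on factors of circles not passing through the smoothing of $e_k$ with: (a) if two circles fuse into one, multiplication $m$: $1\otimes1\mapsto1$, $1\otimes x,\ x\otimes1\mapsto x$, $x\otimes x\mapsto0$; (b) if one circle splits into two, $\Delta$: $1\mapsto 1\otimes x+x\otimes1$, $x\mapsto x\otimes x$; (c) if one circle becomes one circle, the zero map. The differential $\partial^i:C^{i,*}(\Gamma)\to C^{i+1,*}(\Gamma)$ is the sum of all the maps $\partial_{\alpha\alpha'}$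 with $|\alpha|=i$. $H^{i,j}(\Gamma)=\ker(\partial:C^{i,j}\to C^{i+1,j})/\operatorname{Im}(\partial:C^{i-1,j}\to C^{i,j})$. *)

theory Defs
  imports
    "HOL-Analysis.Analysis"
    "HOL-Library.Z2"
    "HOL-Library.Groups_Big_Fun"
    "HOL-Computational_Algebra.Formal_Laurent_Series"
    "HOL-Algebra.AbelCoset"
    "HOL-Algebra.Module"
    "Jordan_Normal_Form.Missing_VectorSpace"
begin

hide_const (open) Multiset.mult

section \<open>Graphs and perfect matchings\<close>

text \<open>
  An edge \<open>e\<close> with \<open>ends G e = Some (u, v)\<close> joins \<open>u\<close> and \<open>v\<close> (a loop if \<open>u = v\<close>); the order
  of the pair only names the two half-edges of \<open>e\<close>. An edge with \<open>ends G e = None\<close> is a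
  vertexless circle.
\<close>

record ('v, 'e) mgraph =
  verts :: "'v set"
  edges :: "'e set"
  ends :: "'e \<Rightarrow> ('v \<times> 'v) option"

definition multigraph :: "('v, 'e) mgraph \<Rightarrow> bool" where
  "multigraph G \<longleftrightarrow> finite (verts G) \<and> finite (edges G) \<and>
     (\<forall>e\<in>edges G. \<forall>u v. ends G e = Some (u, v) \<longrightarrow> u \<in> verts G \<and> v \<in> verts G)"

definition half_edges :: "('v, 'e) mgraph \<Rightarrow> ('e \<times> bool) set" where
  "half_edges G = {(e, b). e \<in> edges G \<and> ends G e \<noteq> None}"

text \<open>\<open>(e, False)\<close> is the half-edge of \<open>e\<close> at its first end, \<open>(e, True)\<close> the one at its second end.\<close>

definition hvert :: "('v, 'e) mgraph \<Rightarrow> 'e \<times> bool \<Rightarrow> 'v" where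
  "hvert G h = (if snd h then snd else fst) (the (ends G (fst h)))"

definition half_edges_at :: "('v, 'e) mgraph \<Rightarrow> 'v \<Rightarrow> ('e \<times> bool) set" where
  "half_edges_at G v = {h \<in> half_edges G. hvert G h = v}"

definition trivalent :: "('v, 'e) mgraph \<Rightarrow> bool" where
  "trivalent G \<longleftrightarrow> (\<forall>v\<in>verts G. card (half_edges_at G v) = 3)"

definition endpoint :: "('v, 'e) mgraph \<Rightarrow> 'e \<Rightarrow> 'v \<Rightarrow> bool" where
  "endpoint G e v \<longleftrightarrow> (\<exists>u w. ends G e = Some (u, w) \<and> (v = u \<or> v = w))"

definition perfect_matching :: "('v, 'e) mgraph \<Rightarrow> 'e set \<Rightarrow> bool" where
  "perfect_matching G M \<longleftrightarrow> M \<subseteq> edges G \<and>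
     (\<forall>e\<in>M. \<exists>u v. ends G e = Some (u, v) \<and> u \<noteq> v) \<and>
     (\<forall>v\<in>verts G. \<exists>!e. e \<in> M \<and> endpoint G e v)"


section \<open>Plane graphs\<close>

text \<open>
  An embedding into the unit sphere is given by the images of the vertices and, for every edge,
  a parametrisation over \<open>{0..1}\<close> of its image, running from the first end to the second end
  (a closed curve if the edge is a loop or a vertexless circle).
\<close>

record ('v, 'e) drawing =
  vpoint :: "'v \<Rightarrow> real^3"
  epath :: "'e \<Rightarrow> real \<Rightarrow> real^3"

definition open_edge :: "('v, 'e) mgraph \<Rightarrow> ('v, 'e) drawing \<Rightarrow> 'e \<Rightarrow> (real^3) set" where
  "open_edge G \<Gamma> e =
     (case ends G e of None \<Rightarrow> path_image (epath \<Gamma> e) | Some _ \<Rightarrow> epath \<Gamma> e ` {0<..<1})"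

definition plane_graph :: "('v, 'e) mgraph \<Rightarrow> ('v, 'e) drawing \<Rightarrow> bool" where
  "plane_graph G \<Gamma> \<longleftrightarrow>
     inj_on (vpoint \<Gamma>) (verts G) \<and> vpoint \<Gamma> ` verts G \<subseteq> sphere 0 1 \<and>
     (\<forall>e\<in>edges G. simple_path (epath \<Gamma> e) \<and> path_image (epath \<Gamma> e) \<subseteq> sphere 0 1 \<and>
        (case ends G e of
           None \<Rightarrow> pathfinish (epath \<Gamma> e) = pathstart (epath \<Gamma> e)
         | Some (u, v) \<Rightarrow> pathstart (epath \<Gamma> e) = vpoint \<Gamma> u \<and> pathfinish (epath \<Gamma> e) = vpoint \<Gamma> v)) \<and>
     (\<forall>e\<in>edges G. open_edge G \<Gamma> e \<inter> vpoint \<Gamma> ` verts G = {}) \<and>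
     (\<forall>e\<in>edges G. \<forall>f\<in>edges G. e \<noteq> f \<longrightarrow> open_edge G \<Gamma> e \<inter> open_edge G \<Gamma> f = {})"

definition planar :: "('v, 'e) mgraph \<Rightarrow> bool" where
  "planar G \<longleftrightarrow> (\<exists>\<Gamma> :: ('v, 'e) drawing. plane_graph G \<Gamma>)"

text \<open>
  Counterclockwise order of three curves issuing from the point \<open>u\<close> of the sphere: their first
  points on any small enough circle around \<open>u\<close> follow each other counterclockwise, as seen from
  outside the sphere. Three points \<open>a, b, c\<close> of a circle around \<open>u\<close> lie in a plane orthogonal to
  \<open>u\<close>, and are in counterclockwise order iff \<open>(b - a) \<times> (c - a)\<close> is a positive multiple of \<open>u\<close>.
\<close>

definition first_hit :: "real^3 \<Rightarrow> real \<Rightarrow> (real \<Rightarrow> real^3) \<Rightarrow> real^3" where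
  "first_hit u r g = g (Inf {t \<in> {0..1}. dist u (g t) = r})"

definition ccw_curves ::
    "real^3 \<Rightarrow> (real \<Rightarrow> real^3) \<Rightarrow> (real \<Rightarrow> real^3) \<Rightarrow> (real \<Rightarrow> real^3) \<Rightarrow> bool" where
  "ccw_curves u g0 g1 g2 \<longleftrightarrow>
     (\<forall>\<^sub>F r in at_right 0.
        u \<bullet> cross3 (first_hit u r g1 - first_hit u r g0) (first_hit u r g2 - first_hit u r g0) > 0)"

text \<open>The curve of a half-edge starts at its vertex and runs along the whole edge.\<close>

definition half_edge_path :: "('v, 'e) drawing \<Rightarrow> 'e \<times> bool \<Rightarrow> real \<Rightarrow> real^3" where
  "half_edge_path \<Gamma> h = (if snd h then reversepath (epath \<Gamma> (fst h)) else epath \<Gamma> (fst h))"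

text \<open>Going counterclockwise around the vertex \<open>v\<close> from \<open>h\<close>, the other half-edges are \<open>x1\<close>, \<open>x2\<close>.\<close>

definition ccw_at ::
    "('v, 'e) mgraph \<Rightarrow> ('v, 'e) drawing \<Rightarrow> 'v \<Rightarrow> 'e \<times> bool \<Rightarrow> 'e \<times> bool \<Rightarrow> 'e \<times> bool \<Rightarrow> bool" where
  "ccw_at G \<Gamma> v h x1 x2 \<longleftrightarrow>
     distinct [h, x1, x2] \<and> half_edges_at G v = {h, x1, x2} \<and>
     ccw_curves (vpoint \<Gamma> v) (half_edge_path \<Gamma> h) (half_edge_path \<Gamma> x1) (half_edge_path \<Gamma> x2)"


section \<open>States\<close>

text \<open>
  A vector \<open>\<alpha> \<in> {0,1}^n\<close> is given by the set \<open>S \<subseteq> M\<close> of the edges \<open>e\<^sub>i\<close> with \<open>\<alpha>\<^sub>i = 1\<close>, so that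
  \<open>|\<alpha>| = card S\<close>. The relation below says that an arc of the state of \<open>S\<close> joins \<open>h\<close> to \<open>h'\<close>.
\<close>

definition arc_joins ::
    "('v, 'e) mgraph \<Rightarrow> 'e set \<Rightarrow> ('v, 'e) drawing \<Rightarrow> 'e set \<Rightarrow> 'e \<times> bool \<Rightarrow> 'e \<times> bool \<Rightarrow> bool" where
  "arc_joins G M \<Gamma> S h h' \<longleftrightarrow>
     (\<exists>e\<in>M. \<exists>u v x1 x2 y1 y2.
        ends G e = Some (u, v) \<and>
        ccw_at G \<Gamma> u (e, False) x1 x2 \<and> ccw_at G \<Gamma> v (e, True) y1 y2 \<and>
        {h, h'} \<in> (if e \<in> S then {{x1, y1}, {x2, y2}} else {{x1, y2}, {x2, y1}}))"

text \<open>
  The state is obtained by gluing the edges not in \<open>M\<close> along these arcs. A circle is a connected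
  component of the result, and is represented by the set of the edges it traverses.
\<close>

definition adjacent_in_state ::
    "('v, 'e) mgraph \<Rightarrow> 'e set \<Rightarrow> ('v, 'e) drawing \<Rightarrow> 'e set \<Rightarrow> ('e \<times> 'e) set" where
  "adjacent_in_state G M \<Gamma> S =
     {(f, f'). f \<in> edges G - M \<and> f' \<in> edges G - M \<and> (\<exists>b b'. arc_joins G M \<Gamma> S (f, b) (f', b'))}"

definition circles ::
    "('v, 'e) mgraph \<Rightarrow> 'e set \<Rightarrow> ('v, 'e) drawing \<Rightarrow> 'e set \<Rightarrow> 'e set set" where
  "circles G M \<Gamma> S = (edges G - M) // (adjacent_in_state G M \<Gamma> S)\<^sup>*"

text \<open>
  A circle contains an arc of the smoothing of \<open>e\<close> iff it traverses an edge (other than \<open>e\<close>) with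
  an end in common with \<open>e\<close>.
\<close>

definition circles_through ::
    "('v, 'e) mgraph \<Rightarrow> 'e set \<Rightarrow> ('v, 'e) drawing \<Rightarrow> 'e set \<Rightarrow> 'e \<Rightarrow> 'e set set" where
  "circles_through G M \<Gamma> S e =
     {c \<in> circles G M \<Gamma> S. \<exists>f\<in>c. \<exists>v. endpoint G e v \<and> endpoint G f v}"


section \<open>The 2-factor polynomial\<close>

text \<open>Laurent polynomials in \<open>q\<close> are taken in the ring of formal Laurent series, with \<open>q\<close> = \<open>fls_X\<close>.\<close>

definition two_factor_polynomial ::
    "('v, 'e) mgraph \<Rightarrow> 'e set \<Rightarrow> ('v, 'e) drawing \<Rightarrow> int fls" where
  "two_factor_polynomial G M \<Gamma> =
     (\<Sum>S\<in>Pow M. (- fls_X) ^ card S * (fls_X_inv + fls_X) ^ card (circles G M \<Gamma> S))"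


section \<open>Vector spaces over the field with two elements\<close>

definition F2 :: "bit ring" where
  "F2 = \<lparr>carrier = UNIV, mult = (*), one = 1, zero = 0, add = (+)\<rparr>"

text \<open>The vector space with basis \<open>X\<close>; the multiplicative part of the record is irrelevant.\<close>

definition free_space :: "'x set \<Rightarrow> (bit, 'x \<Rightarrow> bit) module" where
  "free_space X =
     \<lparr>carrier = {c. \<forall>s. s \<notin> X \<longrightarrow> c s = 0}, mult = undefined, one = undefined,
      zero = (\<lambda>_. 0), add = (\<lambda>c d s. c s + d s), smult = (\<lambda>a c s. a * c s)\<rparr>"

definition quotient_space :: "(bit, 'w) module \<Rightarrow> 'w set \<Rightarrow> (bit, 'w set) module" where
  "quotient_space W N =
     \<lparr>carrier = a_rcosets\<^bsub>W\<^esub> N, mult = undefined, one = undefined,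
      zero = N, add = (\<lambda>A B. A <+>\<^bsub>W\<^esub> B),
      smult = (\<lambda>a A. \<Union>w\<in>A. N +>\<^bsub>W\<^esub> (a \<odot>\<^bsub>W\<^esub> w))\<rparr>"

definition isomorphic_spaces :: "(bit, 'w) module \<Rightarrow> (bit, 'w') module \<Rightarrow> bool" where
  "isomorphic_spaces W W' \<longleftrightarrow>
     (\<exists>\<phi> \<in> LinearCombinations.module_hom F2 W W'. bij_betw \<phi> (carrier W) (carrier W'))"

definition bigraded_isomorphic ::
    "(int \<Rightarrow> int \<Rightarrow> (bit, 'w) module) \<Rightarrow> (int \<Rightarrow> int \<Rightarrow> (bit, 'w') module) \<Rightarrow> bool" where
  "bigraded_isomorphic W W' \<longleftrightarrow> (\<forall>i j. isomorphic_spaces (W i j) (W' i j))"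

text \<open>\<open>Sum_any\<close> is the sum over all indices of a finitely supported family.\<close>

definition qdim :: "(int \<Rightarrow> (bit, 'w) module) \<Rightarrow> int fls" where
  "qdim W = Sum_any (\<lambda>m. fls_const (int (vectorspace.dim F2 (W m))) * fls_X_intpow m)"

definition graded_euler_characteristic :: "(int \<Rightarrow> int \<Rightarrow> (bit, 'w) module) \<Rightarrow> int fls" where
  "graded_euler_characteristic W = Sum_any (\<lambda>i. (- 1) ^ nat \<bar>i\<bar> * qdim (W i))"


section \<open>The cochain complex\<close>

text \<open>
  The basis \<open>1, x\<close> of \<open>V = \<int>\<^sub>2[x]/(x\<^sup>2)\<close>, with the structure constants of multiplication and
  comultiplication: \<open>mult_coeff a b c\<close> is the coefficient of \<open>c\<close> in \<open>m(a \<otimes> b)\<close>, and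
  \<open>comult_coeff a b c\<close> that of \<open>b \<otimes> c\<close> in \<open>\<Delta>(a)\<close>.
\<close>

datatype gen = One | X

fun gen_deg :: "gen \<Rightarrow> int" where
  "gen_deg One = 1"
| "gen_deg X = -1"

fun mult_coeff :: "gen \<Rightarrow> gen \<Rightarrow> gen \<Rightarrow> bit" where
  "mult_coeff One One c = of_bool (c = One)"
| "mult_coeff One X c = of_bool (c = X)"
| "mult_coeff X One c = of_bool (c = X)"
| "mult_coeff X X c = 0"

fun comult_coeff :: "gen \<Rightarrow> gen \<Rightarrow> gen \<Rightarrow> bit" where
  "comult_coeff One b c = of_bool ((b, c) = (One, X) \<or> (b, c) = (X, One))"
| "comult_coeff X b c = of_bool ((b, c) = (X, X))"

text \<open>
  The tensor product of the \<open>V\<^sub>c\<close> over the circles \<open>c\<close> of the state of \<open>S\<close> has a basis indexed by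
  the labellings of the circles by \<open>1\<close> and \<open>x\<close>. A basis element of \<open>C\<^sup>i\<^sup>,\<^sup>j\<close> is thus a pair of a
  set \<open>S\<close> with \<open>card S = i\<close> and a labelling of degree \<open>j - card S\<close>.
\<close>

type_synonym 'e labelling = "'e set \<Rightarrow> gen"

definition labellings ::
    "('v, 'e) mgraph \<Rightarrow> 'e set \<Rightarrow> ('v, 'e) drawing \<Rightarrow> 'e set \<Rightarrow> 'e labelling set" where
  "labellings G M \<Gamma> S = (circles G M \<Gamma> S \<rightarrow>\<^sub>E UNIV)"

definition cochain_basis ::
    "('v, 'e) mgraph \<Rightarrow> 'e set \<Rightarrow> ('v, 'e) drawing \<Rightarrow> int \<Rightarrow> int \<Rightarrow> ('e set \<times> 'e labelling) set" where
  "cochain_basis G M \<Gamma> i j =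
     {(S, l). S \<subseteq> M \<and> l \<in> labellings G M \<Gamma> S \<and> int (card S) = i \<and>
        (\<Sum>c\<in>circles G M \<Gamma> S. gen_deg (l c)) + int (card S) = j}"

definition cochains ::
    "('v, 'e) mgraph \<Rightarrow> 'e set \<Rightarrow> ('v, 'e) drawing \<Rightarrow> int \<Rightarrow> int \<Rightarrow>
     (bit, 'e set \<times> 'e labelling \<Rightarrow> bit) module" where
  "cochains G M \<Gamma> i j = free_space (cochain_basis G M \<Gamma> i j)"

text \<open>
  The matrix coefficient at \<open>(l, l')\<close> of the map \<open>V\<^sub>S \<rightarrow> V\<^sub>S\<^sub>'\<close> for \<open>S' = insert e S\<close>. The maps \<open>m\<close>
  and \<open>\<Delta>\<close> are (co)commutative, so the order in which two circles are listed does not matter.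
\<close>

definition local_coeff :: "'e set set \<Rightarrow> 'e set set \<Rightarrow> 'e labelling \<Rightarrow> 'e labelling \<Rightarrow> bit" where
  "local_coeff T T' l l' =
     of_bool
       ((\<exists>a b c. a \<noteq> b \<and> T = {a, b} \<and> T' = {c} \<and> mult_coeff (l a) (l b) (l' c) = 1) \<or>
        (\<exists>a b c. b \<noteq> c \<and> T = {a} \<and> T' = {b, c} \<and> comult_coeff (l a) (l' b) (l' c) = 1))"

definition edge_coeff ::
    "('v, 'e) mgraph \<Rightarrow> 'e set \<Rightarrow> ('v, 'e) drawing \<Rightarrow> 'e \<Rightarrow> 'e set \<Rightarrow> 'e labelling \<Rightarrow> 'e labelling \<Rightarrow> bit" where
  "edge_coeff G M \<Gamma> e S l l' =
     (let T = circles_through G M \<Gamma> S e; T' = circles_through G M \<Gamma> (insert e S) e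
      in of_bool (\<forall>c \<in> circles G M \<Gamma> S - T. l' c = l c) * local_coeff T T' l l')"

text \<open>
  The coefficient of \<open>\<partial>c\<close> at \<open>(S', l')\<close> collects the contributions of all \<open>S\<close> from which \<open>S'\<close>
  arises by changing one entry from \<open>0\<close> to \<open>1\<close>, i.e. \<open>S = S' - {e}\<close> with \<open>e \<in> S'\<close>.
\<close>

definition differential ::
    "('v, 'e) mgraph \<Rightarrow> 'e set \<Rightarrow> ('v, 'e) drawing \<Rightarrow>
     ('e set \<times> 'e labelling \<Rightarrow> bit) \<Rightarrow> ('e set \<times> 'e labelling \<Rightarrow> bit)" where
  "differential G M \<Gamma> c = (\<lambda>(S', l').
     if S' \<subseteq> M \<and> l' \<in> labellings G M \<Gamma> S'
     then \<Sum>e\<in>S'. \<Sum>l\<in>labellings G M \<Gamma> (S' - {e}). edge_coeff G M \<Gamma> e (S' - {e}) l l' * c (S' - {e}, l)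
     else 0)"

definition cohomology ::
    "('v, 'e) mgraph \<Rightarrow> 'e set \<Rightarrow> ('v, 'e) drawing \<Rightarrow> int \<Rightarrow> int \<Rightarrow>
     (bit, ('e set \<times> 'e labelling \<Rightarrow> bit) set) module" where
  "cohomology G M \<Gamma> i j =
     (let Z = {c \<in> carrier (cochains G M \<Gamma> i j). differential G M \<Gamma> c = (\<lambda>_. 0)};
          B = differential G M \<Gamma> ` carrier (cochains G M \<Gamma> (i - 1) j)
      in quotient_space ((cochains G M \<Gamma> i j)\<lparr>carrier := Z\<rparr>) B)"

end

theory Submission
  imports Defs "HOL-Complex_Analysis.Complex_Analysis"
begin

text \<open>
  A state depends on the plane graph only through the rotations at the vertices. Let \<open>F\<close> be the set
  of vertices at which the rotations of two plane graphs \<open>\<Gamma>\<close>, \<open>\<Gamma>'\<close> of \<open>G\<close> differ. Three arcs on the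
  sphere with common ends and otherwise disjoint leave one end in the opposite cyclic order in which
  they arrive at the other, so \<open>F\<close> contains both or none of two vertices joined by three disjoint
  paths. Hence a cycle changes sides of \<open>F\<close> an even number of times along each class of matching
  edges forming 2-edge cuts with each other, and there is a potential \<open>\<Psi>\<close> on the vertices with values
  in \<open>\<int>\<^sub>2\<^sup>M\<close>, constant along the edges outside \<open>M\<close>, whose difference along \<open>e \<in> M\<close> is, up to the
  coboundary of a function on the vertices, \<open>e\<close> itself if exactly one end of \<open>e\<close> is in \<open>F\<close> and \<open>0\<close>
  otherwise.

  The space of a state is the algebra of squarefree polynomials in variables indexed by its circles.
  Let \<open>s\<^sub>e\<close> be the sum of the variables of the two edges that meet \<open>e\<close> at an end. The substitution
  \<open>x\<^sub>f \<mapsto> x\<^sub>f + (\<Sum>d. \<Psi> f d * s\<^sub>d)\<close> carries the states of \<open>\<Gamma>\<close> to those of \<open>\<Gamma>'\<close>, fixes every \<open>s\<^sub>e\<close>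
  and is its own inverse. Every component of the differential is multiplication by \<open>1\<close> or by \<open>s\<^sub>e\<close> on
  representatives in the variables \<open>x\<^sub>f\<close>, so the substitution is an isomorphism of cochain complexes.
  The Euler characteristic follows by counting dimensions, once \<open>\<partial>\<^sup>2 = 0\<close> is read off from the
  numbers of circles around a square of the cube.
\<close>

section \<open>Theta curves on the sphere\<close>

text \<open>The curves are only continuous, so a rotation cannot be read from tangents; it is
  recovered from continuous logarithms of differences of two curves, and winding numbers compare the
  two ends of a theta. Between the states of two plane graphs there is no evident bijection of
  circles, hence a linear change of variables which is defined on the edges, before passing to
  circles. Coboundaries are harmless for the following reason. If the coboundary of \<xi> vanishes
  off \<open>M\<close>, every edge outside \<open>M\<close> has one value of \<xi>, and summing its
  variable with this coefficient over both ends gives 0; this is the relation stating that the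
  combination of the elements \<open>s\<^sub>d\<close> with the values of the coboundary as
  coefficients vanishes in every state. So a bridge has \<open>s\<^sub>e = 0\<close> and needs no
  correction, and two edges forming a cut have the same element. Evenness makes the flipped edges of
  a class a cut, so that a potential with jumps exactly there exists. Characteristic 2 enters twice:
  linear forms have square 0, so linear substitutions respect the algebra, and a correction applied
  twice cancels.\<close>

definition orient :: "complex \<Rightarrow> complex \<Rightarrow> complex \<Rightarrow> real" where
  "orient a b c = Im (cnj (b - a) * (c - a))"

text \<open>Two logarithms of one number differ by a multiple of 2 pi i, so different values are at
  distance at least 2 pi and connectedness leaves only one.\<close>

lemma exp_const_imp_constant:
  fixes f :: "'a::topological_space \<Rightarrow> complex"
  assumes "connected S" "continuous_on S f" "\<And>x. x \<in> S \<Longrightarrow> exp (f x) = c"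
  shows "f constant_on S"
proof (rule continuous_discrete_range_constant[OF assms(1,2)])
  fix x assume "x \<in> S"
  show "\<exists>e>0. \<forall>y. y \<in> S \<and> f y \<noteq> f x \<longrightarrow> e \<le> norm (f y - f x)"
  proof (intro exI[of _ "2 * pi"] conjI allI impI)
    fix y assume y: "y \<in> S \<and> f y \<noteq> f x"
    then have "exp (f y) = exp (f x)" using assms(3) \<open>x \<in> S\<close> by simp
    then obtain m :: int where m: "f y = f x + of_int (2 * m) * (of_real pi * \<i>)"
      by (metis exp_eq mult.assoc of_real_mult of_real_of_int_eq)
    then have "m \<noteq> 0" using y by auto
    then have "1 \<le> \<bar>real_of_int m\<bar>" by linarith
    then show "2 * pi \<le> norm (f y - f x)" using m
      by (simp add: norm_mult)
  qed simp
qed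

lemma log_unique:
  fixes f g :: "'a::topological_space \<Rightarrow> complex"
  assumes "connected S" "continuous_on S f" "continuous_on S g"
    and "\<And>x. x \<in> S \<Longrightarrow> exp (f x) = c * exp (g x)"
  obtains k where "\<And>x. x \<in> S \<Longrightarrow> f x = g x + k"
proof -
  have "(\<lambda>x. f x - g x) constant_on S"
    by (rule exp_const_imp_constant[where c = c])
       (use assms in \<open>auto intro!: continuous_intros simp: exp_diff\<close>)
  then show ?thesis unfolding constant_on_def
    by (metis add.commute diff_add_cancel that)
qed

text \<open>The imaginary part starts at 0 and could leave the strip between - pi and pi only
  through a value whose exponential lies on the negative real axis. Hence the continuous logarithm
  stays the principal one.\<close>

lemma log_eq_Ln:
  fixes h :: "real \<Rightarrow> complex"
  assumes ab: "0 \<le> a" and cont: "continuous_on {0..a} h" and h0: "h 0 = 0"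
    and ex: "\<And>s. s \<in> {0..a} \<Longrightarrow> exp (h s) \<notin> \<real>\<^sub>\<le>\<^sub>0"
  shows "h a = Ln (exp (h a))"
proof -
  have conn: "connected ((\<lambda>s. Im (h s)) ` {0..a})"
    by (intro connected_continuous_image continuous_intros cont) simp
  have no: "Im (h s) \<noteq> pi \<and> Im (h s) \<noteq> - pi" if "s \<in> {0..a}" for s
  proof (rule ccontr)
    assume "\<not> ?thesis"
    then have "exp (h s) = - of_real (exp (Re (h s)))"
      by (auto simp: complex_eq_iff Re_exp Im_exp)
    then show False using ex[OF that] by (simp add: complex_nonpos_Reals_iff)
  qed
  have "Im (h a) < pi"
  proof (rule ccontr)
    assume "\<not> Im (h a) < pi"
    then have "pi \<in> (\<lambda>s. Im (h s)) ` {0..a}"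
      using connectedD_interval[OF conn, of "Im (h 0)" "Im (h a)" pi] h0 ab imageI[of 0 "{0..a}" "\<lambda>s. Im (h s)"] by auto
    then obtain s where "s \<in> {0..a}" "pi = Im (h s)" by (rule imageE)
    then show False using no[of s] by argo
  qed
  moreover have "Im (h a) > -pi"
  proof (rule ccontr)
    assume "\<not> Im (h a) > - pi"
    then have "-pi \<in> (\<lambda>s. Im (h s)) ` {0..a}"
      using connectedD_interval[OF conn, of "Im (h a)" "Im (h 0)" "- pi"] h0 ab imageI[of 0 "{0..a}" "\<lambda>s. Im (h s)"] by auto
    then obtain s where "s \<in> {0..a}" "-pi = Im (h s)" by (rule imageE)
    then show False using no[of s] by argo
  qed
  ultimately show ?thesis by simp
qed

text \<open>A disc lies strictly on one side of its tangent at \<open>a\<close>, apart from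
  \<open>a\<close> itself.\<close>

lemma disc_halfplane:
  fixes a c z :: complex
  assumes "z \<in> cball c \<rho>" "a \<in> sphere c \<rho>" "z \<noteq> a"
  shows "(z - a) \<bullet> (c - a) > 0"
proof -
  have "(norm (z - c))\<^sup>2 \<le> (norm (a - c))\<^sup>2"
    using assms by (intro power_mono) (auto simp: dist_norm norm_minus_commute)
  moreover have "(norm (z - c))\<^sup>2 = (norm (z - a))\<^sup>2 - 2 * ((z - a) \<bullet> (c - a)) + (norm (a - c))\<^sup>2"
    unfolding power2_norm_eq_inner by (simp add: algebra_simps inner_commute)
  moreover have "(norm (z - a))\<^sup>2 > 0" using assms by simp
  ultimately show ?thesis by linarith
qed

lemma halfplane_ratio:
  fixes z w d :: complex
  assumes "z \<bullet> d > 0" "w \<bullet> d > 0"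
  shows "z / w \<notin> \<real>\<^sub>\<le>\<^sub>0"
proof
  assume "z / w \<in> \<real>\<^sub>\<le>\<^sub>0"
  then obtain r where r: "r \<le> 0" "z / w = of_real r" by (rule nonpos_Reals_cases)
  have "w \<noteq> 0" using assms(2) by auto
  then have "z = r *\<^sub>R w" using r(2) by (simp add: divide_simps scaleR_conv_of_real)
  then have "z \<bullet> d = r * (w \<bullet> d)" by simp
  then show False using assms r(1) by (metis mult_nonpos_nonneg less_le_not_le linorder_not_le)
qed

text \<open>Both differences lie in the open half plane bounded by the tangent at \<open>a\<close>.
  This keeps the quotients occurring in \<open>corner_angle\<close> off the branch cut of
  \<open>Ln\<close>.\<close>

lemma disc_ratio:
  fixes a c z w :: complex
  assumes "a \<in> sphere c \<rho>" "z \<in> cball c \<rho>" "w \<in> cball c \<rho>" "z \<noteq> a" "w \<noteq> a"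
  shows "(z - a) / (w - a) \<notin> \<real>\<^sub>\<le>\<^sub>0"
  by (rule halfplane_ratio[where d = "c - a"]; rule disc_halfplane; fact assms)

text \<open>The change of the logarithm of the difference f - g of two curves issuing from
  \<open>u\<close>: f runs from \<open>u\<close> to \<open>a\<close> while g stays at
  \<open>b\<close>, then g runs back from \<open>b\<close> to \<open>u\<close>.\<close>

definition corner_angle :: "complex \<Rightarrow> complex \<Rightarrow> complex \<Rightarrow> complex" where
  "corner_angle u a b = Ln ((a - b) / (u - b)) + Ln ((a - u) / (a - b))"

lemma Im_Ln_polar:
  assumes "r > 0" "t \<in> {- pi<..pi}"
  shows "Im (Ln (of_real r * cis t)) = t"
proof -
  have "exp (of_real (ln r) + \<i> * of_real t) = of_real r * cis t"
    using assms(1) by (simp add: exp_add cis_conv_exp exp_of_real)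
  then have "Ln (of_real r * cis t) = of_real (ln r) + \<i> * of_real t"
    using assms by (subst Ln_exp[symmetric]) auto
  then show ?thesis by simp
qed

text \<open>Both quotients have argument (\<delta> - pi) / 2, as the base angles of an isosceles
  triangle with apex angle \<delta> at the centre.\<close>

lemma corner_angle_polar:
  assumes "0 < \<delta>" "\<delta> < 2 * pi" "b \<noteq> c" "a - c = (b - c) * cis \<delta>"
  shows "Im (corner_angle c a b) = \<delta> - pi"
proof -
  have s: "sin (\<delta> / 2) > 0" using assms by (intro sin_gt_zero) auto
  have one: "1 - cis \<delta> = of_real (2 * sin (\<delta> / 2)) * cis ((\<delta> - pi) / 2)"
  proof -
    have "cos \<delta> = 1 - 2 * (sin (\<delta> / 2))\<^sup>2" using cos_double_sin[of "\<delta> / 2"] by simp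
    moreover have "sin \<delta> = 2 * sin (\<delta> / 2) * cos (\<delta> / 2)" using sin_double[of "\<delta> / 2"] by simp
    moreover have "cos ((\<delta> - pi) / 2) = sin (\<delta> / 2)" "sin ((\<delta> - pi) / 2) = - cos (\<delta> / 2)"
      by (simp_all add: diff_divide_distrib cos_diff sin_diff)
    ultimately show ?thesis by (simp add: complex_eq_iff power2_eq_square)
  qed
  have arg: "(\<delta> - pi) / 2 \<in> {- pi<..pi}" using assms by auto
  have e1: "(a - b) / (c - b) = 1 - cis \<delta>"
  proof -
    have "a - b = (b - c) * cis \<delta> - (b - c)" using assms(4) by (simp add: algebra_simps)
    then show ?thesis using assms(3) by (simp add: divide_simps) (simp add: algebra_simps)
  qed
  have nz: "1 - cis \<delta> \<noteq> 0" using one s by simp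
  have e2: "(a - c) / (a - b) = cis \<delta> / (cis \<delta> - 1)"
  proof -
    have "a - b = (b - c) * (cis \<delta> - 1)" using assms(4) by (simp add: algebra_simps)
    then show ?thesis using assms by simp
  qed
  have e3: "cis \<delta> / (cis \<delta> - 1) = of_real (1 / (2 * sin (\<delta> / 2))) * cis ((\<delta> - pi) / 2)"
  proof -
    have "cis ((\<delta> - pi) / 2) * cis ((\<delta> - pi) / 2) = - cis \<delta>"
      by (simp add: cis_mult complex_eq_iff cos_diff sin_diff)
    then have "of_real (1 / (2 * sin (\<delta> / 2))) * cis ((\<delta> - pi) / 2) * (1 - cis \<delta>) = - cis \<delta>"
      unfolding one using s by (simp add: field_simps)
    then show ?thesis using nz by (metis minus_diff_eq minus_divide_divide nonzero_eq_divide_eq)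
  qed
  have L1: "Im (Ln (1 - cis \<delta>)) = (\<delta> - pi) / 2"
    unfolding one by (rule Im_Ln_polar) (use s arg in auto)
  have L2: "Im (Ln (cis \<delta> / (cis \<delta> - 1))) = (\<delta> - pi) / 2"
    unfolding e3 by (rule Im_Ln_polar) (use s arg in auto)
  show ?thesis unfolding corner_angle_def e1 e2 using L1 L2 by simp
qed

text \<open>The area of an inscribed triangle is a product of sines of half the central angles. For
  angles between 0 and 2 pi only the last factor can be negative.\<close>

lemma orient_polar:
  assumes "b - c = (a - c) * cis \<delta>" "d - c = (a - c) * cis \<delta>'"
  shows "orient a b d = 4 * (cmod (a - c))\<^sup>2 * (sin (\<delta> / 2) * sin (\<delta>' / 2) * sin ((\<delta>' - \<delta>) / 2))"
proof -
  have "b - a = (a - c) * (cis \<delta> - 1)" "d - a = (a - c) * (cis \<delta>' - 1)"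
    using assms by (simp_all add: algebra_simps)
  then have "cnj (b - a) * (d - a) = (cnj (a - c) * (a - c)) * (cnj (cis \<delta> - 1) * (cis \<delta>' - 1))"
    by simp
  also have "cnj (a - c) * (a - c) = of_real ((cmod (a - c))\<^sup>2)"
    by (simp add: complex_norm_square mult.commute del: of_real_power)
  finally have 1: "orient a b d = (cmod (a - c))\<^sup>2 * Im (cnj (cis \<delta> - 1) * (cis \<delta>' - 1))"
    unfolding orient_def by (simp only: Im_complex_of_real Re_complex_of_real times_complex.simps)
  define x y where "x = \<delta> / 2" and "y = \<delta>' / 2"
  have xy: "\<delta> = 2 * x" "\<delta>' = 2 * y" "(\<delta>' - \<delta>) / 2 = y - x" by (auto simp: x_def y_def diff_divide_distrib)
  have d: "cos (2 * x) = 1 - 2 * sin x * sin x" "cos (2 * y) = 1 - 2 * sin y * sin y"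
      "sin (2 * x) = 2 * sin x * cos x" "sin (2 * y) = 2 * sin y * cos y"
    using cos_double_sin[of x] cos_double_sin[of y] sin_double[of x] sin_double[of y]
    unfolding power2_eq_square by linarith+
  have "Im (cnj (cis \<delta> - 1) * (cis \<delta>' - 1)) = (cos (2 * x) - 1) * sin (2 * y) - sin (2 * x) * (cos (2 * y) - 1)"
    by (simp only: xy(1,2)) simp
  also have "\<dots> = 4 * (sin x * sin y * sin (y - x))"
    unfolding d sin_diff by (simp add: algebra_simps)
  finally have "Im (cnj (cis \<delta> - 1) * (cis \<delta>' - 1)) = 4 * (sin x * sin y * sin (y - x))" .
  then show ?thesis using 1 unfolding xy(3) by (simp only: x_def y_def mult.assoc mult.left_commute[of 4])
qed

text \<open>Each corner contributes its central angle minus pi. The three central angles add up to 2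
  pi if the points follow each other counterclockwise and to 4 pi otherwise.\<close>

lemma corner_sum_centre:
  assumes "\<rho> > 0" and a: "a1 \<in> sphere c \<rho>" "a2 \<in> sphere c \<rho>" "a3 \<in> sphere c \<rho>"
    and ne: "a1 \<noteq> a2" "a2 \<noteq> a3" "a1 \<noteq> a3"
  shows "orient a1 a2 a3 \<noteq> 0 \<and>
    Im (corner_angle c a1 a3 + corner_angle c a2 a1 + corner_angle c a3 a2) = - pi * sgn (orient a1 a2 a3)"
proof -
  have cn: "cmod (a1 - c) = \<rho>" "cmod (a2 - c) = \<rho>" "cmod (a3 - c) = \<rho>"
    using a by (auto simp: dist_norm norm_minus_commute)
  have nz: "a1 \<noteq> c" "a2 \<noteq> c" "a3 \<noteq> c" using cn \<open>\<rho> > 0\<close> by auto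
  define \<delta> \<delta>' where "\<delta> = Arg2pi ((a2 - c) / (a1 - c))" and "\<delta>' = Arg2pi ((a3 - c) / (a1 - c))"
  have pol: "z - c = (a1 - c) * cis (Arg2pi ((z - c) / (a1 - c)))" if "cmod (z - c) = \<rho>" for z
  proof -
    have "cmod ((z - c) / (a1 - c)) = 1" using that cn \<open>\<rho> > 0\<close> by (simp add: norm_divide)
    then have "(z - c) / (a1 - c) = cis (Arg2pi ((z - c) / (a1 - c)))"
      using Arg2pi_eq[of "(z - c) / (a1 - c)"] by (simp add: cis_conv_exp)
    then show ?thesis using nz by (simp add: field_simps)
  qed
  have p2: "a2 - c = (a1 - c) * cis \<delta>" and p3: "a3 - c = (a1 - c) * cis \<delta>'"
    using pol cn by (auto simp: \<delta>_def \<delta>'_def)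
  have "\<delta> \<ge> 0" "\<delta> < 2 * pi" "\<delta>' \<ge> 0" "\<delta>' < 2 * pi" unfolding \<delta>_def \<delta>'_def
    using Arg2pi by (auto simp: Arg2pi_ge_0 Arg2pi_lt_2pi)
  moreover have "\<delta> \<noteq> 0" "\<delta>' \<noteq> 0" "\<delta> \<noteq> \<delta>'" using p2 p3 ne by auto (metis diff_add_cancel)
  ultimately have b: "0 < \<delta>" "\<delta> < 2 * pi" "0 < \<delta>'" "\<delta>' < 2 * pi" "\<delta> \<noteq> \<delta>'" by auto
  have k21: "Im (corner_angle c a2 a1) = \<delta> - pi"
    using corner_angle_polar[OF b(1,2) nz(1) p2] .
  have "a1 - c = (a3 - c) * cis (2 * pi - \<delta>')"
    unfolding p3 by (simp add: cis_mult mult.assoc)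
  then have k13: "Im (corner_angle c a1 a3) = 2 * pi - \<delta>' - pi"
    using corner_angle_polar[of "2 * pi - \<delta>'" a3 c a1] b nz by auto
  have s: "sin (\<delta> / 2) > 0" "sin (\<delta>' / 2) > 0" using b by (auto intro!: sin_gt_zero)
  have o: "orient a1 a2 a3 = 4 * \<rho>\<^sup>2 * (sin (\<delta> / 2) * sin (\<delta>' / 2) * sin ((\<delta>' - \<delta>) / 2))"
    using orient_polar[OF p2 p3] cn by simp
  show ?thesis
  proof (cases "\<delta> < \<delta>'")
    case True
    have "a3 - c = (a2 - c) * cis (\<delta>' - \<delta>)"
      unfolding p3 p2 by (simp add: cis_mult mult.assoc)
    then have k32: "Im (corner_angle c a3 a2) = \<delta>' - \<delta> - pi"
      using corner_angle_polar[of "\<delta>' - \<delta>" a2 c a3] b nz True by auto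
    have "sin ((\<delta>' - \<delta>) / 2) > 0" using True b by (intro sin_gt_zero) auto
    then have "orient a1 a2 a3 > 0" using o s \<open>\<rho> > 0\<close> by simp
    then show ?thesis using k21 k13 k32 by simp
  next
    case False
    have "a3 - c = (a2 - c) * cis (2 * pi + (\<delta>' - \<delta>))"
      unfolding p3 p2 by (simp add: cis_mult mult.assoc flip: cis_mult[of "2 * pi"])
    then have k32: "Im (corner_angle c a3 a2) = 2 * pi + (\<delta>' - \<delta>) - pi"
      using corner_angle_polar[of "2 * pi + (\<delta>' - \<delta>)" a2 c a3] b nz False by auto
    have "sin ((\<delta> - \<delta>') / 2) > 0" using False b by (intro sin_gt_zero) auto
    moreover have "sin ((\<delta>' - \<delta>) / 2) = - sin ((\<delta> - \<delta>') / 2)"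
      by (metis minus_diff_eq minus_divide_left sin_minus)
    ultimately have "orient a1 a2 a3 < 0" using o s \<open>\<rho> > 0\<close> by (simp add: mult_pos_neg)
    then show ?thesis using k21 k13 k32 by simp
  qed
qed

lemma exp_corner_angle:
  assumes "a \<noteq> b" "u \<noteq> a" "u \<noteq> b"
  shows "exp (corner_angle u a b) = (a - u) / (u - b)"
  using assms by (simp add: corner_angle_def exp_add)

text \<open>The exponentials multiply to -1 for every \<open>u\<close> in the open disc, so the sum
  of logarithms, being continuous in \<open>u\<close>, is constant there and can be evaluated at the
  centre.\<close>

lemma corner_sum:
  assumes "u \<in> ball c \<rho>" and a: "a1 \<in> sphere c \<rho>" "a2 \<in> sphere c \<rho>" "a3 \<in> sphere c \<rho>"
    and ne: "a1 \<noteq> a2" "a2 \<noteq> a3" "a1 \<noteq> a3"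
  shows "orient a1 a2 a3 \<noteq> 0 \<and>
    Im (corner_angle u a1 a3 + corner_angle u a2 a1 + corner_angle u a3 a2) = - pi * sgn (orient a1 a2 a3)"
proof -
  have "\<rho> > 0" using assms(1) by (metis dist_not_less_zero less_le_trans linorder_not_le mem_ball order.strict_trans1)
  let ?f = "\<lambda>u. corner_angle u a1 a3 + corner_angle u a2 a1 + corner_angle u a3 a2"
  have sub: "z \<in> cball c \<rho>" if "z \<in> sphere c \<rho>" for z using that by auto
  have sub2: "z \<in> cball c \<rho>" if "z \<in> ball c \<rho>" for z using that by auto
  have neq: "z \<noteq> a1" "z \<noteq> a2" "z \<noteq> a3" if "z \<in> ball c \<rho>" for z using that a by auto
  have cont: "continuous_on (ball c \<rho>) (\<lambda>u. corner_angle u a b)"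
    if "a \<in> sphere c \<rho>" "b \<in> sphere c \<rho>" "a \<noteq> b" for a b
  proof -
    have n: "z \<noteq> a" "z \<noteq> b" if "z \<in> ball c \<rho>" for z using that \<open>a \<in> _\<close> \<open>b \<in> _\<close> by auto
    have "(a - b) / (z - b) \<notin> \<real>\<^sub>\<le>\<^sub>0" if "z \<in> ball c \<rho>" for z
      by (rule disc_ratio[where c = c and \<rho> = \<rho>]) (use \<open>a \<in> _\<close> \<open>b \<in> _\<close> \<open>a \<noteq> b\<close> that sub sub2 n in auto)
    moreover have "(a - z) / (a - b) \<notin> \<real>\<^sub>\<le>\<^sub>0" if "z \<in> ball c \<rho>" for z
    proof -
      have "(z - a) / (b - a) \<notin> \<real>\<^sub>\<le>\<^sub>0"
        by (rule disc_ratio[where c = c and \<rho> = \<rho>]) (use \<open>a \<in> _\<close> \<open>b \<in> _\<close> \<open>a \<noteq> b\<close> that sub sub2 n in auto)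
      then show ?thesis by (metis minus_diff_eq minus_divide_divide)
    qed
    ultimately show ?thesis unfolding corner_angle_def
      using n \<open>a \<noteq> b\<close> by (auto intro!: continuous_intros)
  qed
  have "?f constant_on ball c \<rho>"
  proof (rule exp_const_imp_constant[where c = "-1"])
    show "continuous_on (ball c \<rho>) ?f" by (intro continuous_intros cont a ne) (use ne in auto)
    fix z assume z: "z \<in> ball c \<rho>"
    have "exp (?f z) = (a1 - z) / (z - a3) * ((a2 - z) / (z - a1)) * ((a3 - z) / (z - a2))"
      using neq[OF z] ne by (auto simp: exp_add exp_corner_angle)
    also have "\<dots> = -1" using neq[OF z] by (simp add: divide_simps) (simp add: algebra_simps)
    finally show "exp (?f z) = -1" .
  qed simp
  then have "?f u = ?f c" using assms(1) \<open>\<rho> > 0\<close> unfolding constant_on_def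
    by (metis centre_in_ball)
  then show ?thesis using corner_sum_centre[OF \<open>\<rho> > 0\<close> a ne] by simp
qed

section \<open>Turning of plane curves with common ends\<close>

lemma convex_punctured_box:
  "convex ({0..a} \<times> {0..b} - {(0, 0)} :: (real \<times> real) set)"
proof -
  have "{0..a} \<times> {0..b} - {(0, 0)} = {0..a} \<times> {0..b} \<inter> {p::real \<times> real. (1, 1) \<bullet> p > 0}"
    by auto
  then show ?thesis by (simp add: convex_Int convex_Times convex_halfspace_gt)
qed

text \<open>Removing an extreme point preserves convexity. The two corners are the parameters at
  which arcs with common ends coincide; convexity supplies the contractible domain on which a
  logarithm of the difference exists.\<close>

lemma convex_twice_punctured_square:
  "convex ({0..1} \<times> {0..1} - {(0, 0), (1, 1)} :: (real \<times> real) set)"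
proof -
  have "{0..1} \<times> {0..1} - {(0, 0), (1, 1)} =
    {0..1} \<times> {0..1} \<inter> {p::real \<times> real. (1, 1) \<bullet> p > 0} \<inter> {p. (1, 1) \<bullet> p < 2}"
    by auto
  then show ?thesis by (simp add: convex_Int convex_Times convex_halfspace_gt convex_halfspace_lt)
qed

text \<open>A continuous logarithm of the difference of two curves is defined on the pairs of
  parameters for which the curves differ; its values on the two axes near the common starting
  point determine how the curves turn around that point.\<close>

definition log_diff :: "(real \<times> real) set \<Rightarrow> (real \<times> real \<Rightarrow> complex) \<Rightarrow> (real \<Rightarrow> complex) \<Rightarrow> (real \<Rightarrow> complex) \<Rightarrow> bool" where
  "log_diff Q L f g \<longleftrightarrow> continuous_on Q L \<and> (\<forall>s t. (s, t) \<in> Q \<longrightarrow> exp (L (s, t)) = f s - g t)"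

lemma log_difference:
  fixes f g :: "real \<Rightarrow> complex"
  assumes "convex Q" "Q \<subseteq> A \<times> B" "continuous_on A f" "continuous_on B g"
    and "\<And>s t. (s, t) \<in> Q \<Longrightarrow> f s \<noteq> g t"
  obtains L where "log_diff Q L f g"
proof -
  have "continuous_on Q (\<lambda>p. f (fst p) - g (snd p))"
    by (intro continuous_intros continuous_on_compose2[OF assms(3)] continuous_on_compose2[OF assms(4)])
       (use assms(2) in auto)
  moreover have "f (fst p) - g (snd p) \<noteq> 0" if "p \<in> Q" for p
    using assms(5)[of "fst p" "snd p"] that by simp
  ultimately obtain L where L: "continuous_on Q L" "\<And>p. p \<in> Q \<Longrightarrow> f (fst p) - g (snd p) = exp (L p)"
    using continuous_logarithm_on_contractible[of Q "\<lambda>p. f (fst p) - g (snd p)"]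
      convex_imp_contractible[OF assms(1)] by blast
  show ?thesis by (rule that[of L]) (simp add: log_diff_def L flip: L(2))
qed

text \<open>The path from (0, b) over (a, b) to (a, 0) keeps one of the two points fixed on the
  circle while the other runs through the disc. On each side the quotient avoids the negative real
  axis, so the logarithm changes by a principal value.\<close>

lemma corner_log:
  fixes f g :: "real \<Rightarrow> complex"
  assumes T: "0 < a" "0 < b"
    and ld: "log_diff Q L f g"
    and Q: "{0..a} \<times> {0..b} - {(0, 0)} \<subseteq> Q"
    and fg: "f 0 = u" "g 0 = u" "u \<in> ball c \<rho>"
    and f: "\<And>s. s \<in> {0..<a} \<Longrightarrow> f s \<in> ball c \<rho>" "f a \<in> sphere c \<rho>"
    and g: "\<And>s. s \<in> {0..<b} \<Longrightarrow> g s \<in> ball c \<rho>" "g b \<in> sphere c \<rho>"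
    and ne: "f a \<noteq> g b"
  shows "L (a, 0) - L (0, b) = corner_angle u (f a) (g b)"
proof -
  have L: "continuous_on Q L" "\<And>s t. (s, t) \<in> Q \<Longrightarrow> exp (L (s, t)) = f s - g t"
    using ld by (auto simp: log_diff_def)
  have inQ: "(s, t) \<in> Q" if "s \<in> {0..a}" "t \<in> {0..b}" "s \<noteq> 0 \<or> t \<noteq> 0" for s t using that Q by auto
  have cb: "z \<in> cball c \<rho>" if "z \<in> ball c \<rho> \<or> z \<in> sphere c \<rho>" for z using that by auto
  have fs: "f s \<in> cball c \<rho>" if "s \<in> {0..a}" for s using f(1)[of s] f(2) that cb by (cases "s = a") (auto simp: less_eq_real_def)
  have gs: "g s \<in> cball c \<rho>" if "s \<in> {0..b}" for s using g(1)[of s] g(2) that cb by (cases "s = b") (auto simp: less_eq_real_def)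
  have une: "u \<noteq> f a" "u \<noteq> g b" using fg f g by auto
  have neq1: "f s \<noteq> g b" if "s \<in> {0..a}" for s using f(1)[of s] g(2) ne that by (cases "s = a") auto
  have neq2: "g s \<noteq> f a" if "s \<in> {0..b}" for s using g(1)[of s] f(2) ne that by (cases "s = b") auto
  define h where "h s = L (s, b) - L (0, b)" for s
  have eh: "exp (h s) = (f s - g b) / (u - g b)" if "s \<in> {0..a}" for s
    unfolding h_def using that T L(2)[OF inQ, of s b] L(2)[OF inQ, of 0 b] fg by (simp add: exp_diff)
  have "h a = Ln (exp (h a))"
  proof (rule log_eq_Ln)
    show "continuous_on {0..a} h" unfolding h_def
      by (intro continuous_intros continuous_on_compose2[OF L(1)]) (use T inQ in auto)
    show "exp (h s) \<notin> \<real>\<^sub>\<le>\<^sub>0" if "s \<in> {0..a}" for s unfolding eh[OF that]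
      by (rule disc_ratio[where c = c and \<rho> = \<rho>]) (use g fs[OF that] neq1[OF that] cb fg une in auto)
  qed (use T in \<open>auto simp: h_def\<close>)
  then have 1: "L (a, b) - L (0, b) = Ln ((f a - g b) / (u - g b))"
    using eh[of a] T by (simp add: h_def)
  \<comment> \<open>This side is run through from (a, b) down to (a, 0), hence the parameter b -
    t.\<close>
  define k where "k t = L (a, b - t) - L (a, b)" for t
  have ek: "exp (k t) = (f a - g (b - t)) / (f a - g b)" if "t \<in> {0..b}" for t
    unfolding k_def using that T L(2)[OF inQ, of a "b - t"] L(2)[OF inQ, of a b] by (simp add: exp_diff)
  have "k b = Ln (exp (k b))"
  proof (rule log_eq_Ln)
    show "continuous_on {0..b} k" unfolding k_def
      by (intro continuous_intros continuous_on_compose2[OF L(1)]) (use T inQ in auto)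
    show "exp (k t) \<notin> \<real>\<^sub>\<le>\<^sub>0" if "t \<in> {0..b}" for t
    proof -
      have "(g (b - t) - f a) / (g b - f a) \<notin> \<real>\<^sub>\<le>\<^sub>0"
        by (rule disc_ratio[where c = c and \<rho> = \<rho>])
           (use f gs[of "b - t"] neq2[of "b - t"] cb ne that g(2) in auto)
      then show ?thesis unfolding ek[OF that] by (metis minus_diff_eq minus_divide_divide)
    qed
  qed (use T in \<open>auto simp: k_def\<close>)
  then have 2: "L (a, 0) - L (a, b) = Ln ((f a - u) / (f a - g b))"
    using ek[of b] T fg by (simp add: k_def)
  show ?thesis unfolding corner_angle_def using 1 2 by (metis add.commute diff_add_cancel add_diff_eq)
qed

text \<open>On the axes \<open>L13 (s, 0)\<close> is a logarithm of f1 s - u and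
  \<open>L21 (0, s)\<close> one of u - f1 s. They differ by a logarithm of -1, which cannot vary
  over the connected interval, and likewise for the other two pairs; so the cyclic sum does not
  depend on the times.\<close>

lemma axis_logs_constant:
  fixes f1 f2 f3 :: "real \<Rightarrow> complex"
  assumes T: "0 < T" and start: "f1 0 = u" "f2 0 = u" "f3 0 = u"
    and l13: "log_diff Q13 L13 f1 f3"
    and l21: "log_diff Q21 L21 f2 f1"
    and l32: "log_diff Q32 L32 f3 f2"
    and Q: "{0..T} \<times> {0..T} - {(0, 0)} \<subseteq> Q13" "{0..T} \<times> {0..T} - {(0, 0)} \<subseteq> Q21"
      "{0..T} \<times> {0..T} - {(0, 0)} \<subseteq> Q32"
  shows "\<exists>k. \<forall>t1\<in>{0<..T}. \<forall>t2\<in>{0<..T}. \<forall>t3\<in>{0<..T}.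
    (L13 (t1, 0) - L13 (0, t3)) + (L21 (t2, 0) - L21 (0, t1)) + (L32 (t3, 0) - L32 (0, t2)) = k"
proof -
  have L13: "continuous_on Q13 L13" "\<And>s t. (s, t) \<in> Q13 \<Longrightarrow> exp (L13 (s, t)) = f1 s - f3 t"
    using l13 by (auto simp: log_diff_def)
  have L21: "continuous_on Q21 L21" "\<And>s t. (s, t) \<in> Q21 \<Longrightarrow> exp (L21 (s, t)) = f2 s - f1 t"
    using l21 by (auto simp: log_diff_def)
  have L32: "continuous_on Q32 L32" "\<And>s t. (s, t) \<in> Q32 \<Longrightarrow> exp (L32 (s, t)) = f3 s - f2 t"
    using l32 by (auto simp: log_diff_def)
  have co: "continuous_on {0<..T} (\<lambda>s. L (s, 0)) \<and> continuous_on {0<..T} (\<lambda>s. L (0, s))"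
    if "continuous_on Q L" "{0..T} \<times> {0..T} - {(0, 0)} \<subseteq> Q" for L :: "real \<times> real \<Rightarrow> complex" and Q
    by (intro conjI continuous_on_compose2[OF that(1)] continuous_intros) (use that(2) T in auto)
  have in1: "(s, 0) \<in> {0..T} \<times> {0..T} - {(0, 0)}" "(0, s) \<in> {0..T} \<times> {0..T} - {(0, 0)}" if "s \<in> {0<..T}" for s
    using that T by auto
  have cn: "connected {0<..T}" by simp
  have e1: "exp (L13 (s, 0)) = (-1) * exp (L21 (0, s))" if "s \<in> {0<..T}" for s
    using L13(2)[of s 0] L21(2)[of 0 s] in1[OF that] Q[THEN subsetD, of "(s, 0)"] Q[THEN subsetD, of "(0, s)"] start by simp
  have e2: "exp (L21 (s, 0)) = (-1) * exp (L32 (0, s))" if "s \<in> {0<..T}" for s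
    using L21(2)[of s 0] L32(2)[of 0 s] in1[OF that] Q[THEN subsetD, of "(s, 0)"] Q[THEN subsetD, of "(0, s)"] start by simp
  have e3: "exp (L32 (s, 0)) = (-1) * exp (L13 (0, s))" if "s \<in> {0<..T}" for s
    using L32(2)[of s 0] L13(2)[of 0 s] in1[OF that] Q[THEN subsetD, of "(s, 0)"] Q[THEN subsetD, of "(0, s)"] start by simp
  obtain k1 where k1: "\<And>s. s \<in> {0<..T} \<Longrightarrow> L13 (s, 0) = L21 (0, s) + k1"
    by (rule log_unique[OF cn, of "\<lambda>s. L13 (s, 0)" "\<lambda>s. L21 (0, s)" "-1"])
       (use co[OF L13(1) Q(1)] co[OF L21(1) Q(2)] e1 in auto)
  obtain k2 where k2: "\<And>s. s \<in> {0<..T} \<Longrightarrow> L21 (s, 0) = L32 (0, s) + k2"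
    by (rule log_unique[OF cn, of "\<lambda>s. L21 (s, 0)" "\<lambda>s. L32 (0, s)" "-1"])
       (use co[OF L32(1) Q(3)] co[OF L21(1) Q(2)] e2 in auto)
  obtain k3 where k3: "\<And>s. s \<in> {0<..T} \<Longrightarrow> L32 (s, 0) = L13 (0, s) + k3"
    by (rule log_unique[OF cn, of "\<lambda>s. L32 (s, 0)" "\<lambda>s. L13 (0, s)" "-1"])
       (use co[OF L32(1) Q(3)] co[OF L13(1) Q(1)] e3 in auto)
  show ?thesis by (rule exI[of _ "k1 + k2 + k3"]) (simp add: k1 k2 k3)
qed

text \<open>A winding number is the total change of a logarithm along the loop, here along
  \<open>g1\<close> and then backwards along \<open>g2\<close>. The factors \<open>c1\<close> and
  \<open>c2\<close> admit a logarithm of z - g2 in place of one of g2 - z.\<close>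

lemma winding_number_two_arcs:
  fixes g1 g2 :: "real \<Rightarrow> complex"
  assumes p: "path g1" "path g2" "pathfinish g2 = pathfinish g1" "pathstart g2 = pathstart g1"
    and z: "z \<notin> path_image g1" "z \<notin> path_image g2"
    and l1: "continuous_on {0..1} l1" "\<And>s. s \<in> {0..1} \<Longrightarrow> g1 s - z = c1 * exp (l1 s)"
    and l2: "continuous_on {0..1} l2" "\<And>s. s \<in> {0..1} \<Longrightarrow> g2 s - z = c2 * exp (l2 s)"
  shows "2 * of_real pi * \<i> * winding_number (g1 +++ reversepath g2) z = (l1 1 - l1 0) - (l2 1 - l2 0)"
proof -
  let ?p = "g1 +++ reversepath g2"
  have "path ?p" using p by simp
  moreover have "z \<notin> path_image ?p" using p z by (simp add: path_image_join)
  ultimately obtain q where q: "path q" "pathfinish q - pathstart q = 2 * of_real pi * \<i> * winding_number ?p z"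
      "\<And>t. t \<in> {0..1} \<Longrightarrow> ?p t = z + exp (q t)"
    using winding_number_as_continuous_log by blast
  have cq: "continuous_on {0..1} q" using q(1) by (simp add: path_def)
  have c1: "c1 \<noteq> 0" using l1(2)[of 0] z by (auto simp: path_image_def)
  have c2: "c2 \<noteq> 0" using l2(2)[of 0] z by (auto simp: path_image_def)
  obtain k1 where k1: "\<And>s. s \<in> {0..1} \<Longrightarrow> q (s / 2) = l1 s + k1"
  proof (rule log_unique[of "{0..1}" "\<lambda>s. q (s / 2)" l1 c1])
    show "continuous_on {0..1} (\<lambda>s::real. q (s / 2))"
      by (intro continuous_on_compose2[OF cq] continuous_intros) auto
    fix s :: real assume s: "s \<in> {0..1}"
    have "?p (s / 2) = g1 s" using s by (simp add: joinpaths_def)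
    then show "exp (q (s / 2)) = c1 * exp (l1 s)" using q(3)[of "s / 2"] l1(2)[OF s] s by simp
  qed (use l1 in auto)
  obtain k2 where k2: "\<And>s. s \<in> {0..1} \<Longrightarrow> q (1 - s / 2) = l2 s + k2"
  proof (rule log_unique[of "{0..1}" "\<lambda>s. q (1 - s / 2)" l2 c2])
    show "continuous_on {0..1} (\<lambda>s::real. q (1 - s / 2))"
      by (intro continuous_on_compose2[OF cq] continuous_intros) auto
    fix s :: real assume s: "s \<in> {0..1}"
    have "?p (1 - s / 2) = g2 s"
      using s p by (auto simp: joinpaths_def reversepath_def pathfinish_def algebra_simps)
    then show "exp (q (1 - s / 2)) = c2 * exp (l2 s)" using q(3)[of "1 - s / 2"] l2(2)[OF s] s by simp
  qed (use l2 in auto)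
  have "pathfinish q - pathstart q = (q 1 - q (1/2)) + (q (1/2) - q 0)"
    by (simp add: pathfinish_def pathstart_def)
  also have "q 1 - q (1/2) = l2 0 - l2 1" using k2[of 0] k2[of 1] by simp
  also have "q (1/2) - q 0 = l1 1 - l1 0" using k1[of 0] k1[of 1] by simp
  finally show ?thesis using q(2) by simp
qed

definition exits :: "(real \<Rightarrow> complex) \<Rightarrow> complex \<Rightarrow> real \<Rightarrow> real \<Rightarrow> bool" where
  "exits f c \<rho> t \<longleftrightarrow> 0 < t \<and> (\<forall>s\<in>{0..<t}. f s \<in> ball c \<rho>) \<and> f t \<in> sphere c \<rho>"

text \<open>Each of the three logarithms changes by a corner angle, and the sum of the corner angles
  depends only on the orientation of the three exit points.\<close>

lemma turning_at_start:
  fixes f1 f2 f3 :: "real \<Rightarrow> complex"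
  assumes start: "f1 0 = u" "f2 0 = u" "f3 0 = u"
    and l13: "log_diff Q13 L13 f1 f3"
    and l21: "log_diff Q21 L21 f2 f1"
    and l32: "log_diff Q32 L32 f3 f2"
    and Q: "{0..T} \<times> {0..T} - {(0, 0)} \<subseteq> Q13" "{0..T} \<times> {0..T} - {(0, 0)} \<subseteq> Q21"
      "{0..T} \<times> {0..T} - {(0, 0)} \<subseteq> Q32"
    and ex: "exits f1 c \<rho> t1" "exits f2 c \<rho> t2" "exits f3 c \<rho> t3" "t1 \<le> T" "t2 \<le> T" "t3 \<le> T"
  shows "orient (f1 t1) (f2 t2) (f3 t3) \<noteq> 0 \<and>
    Im ((L13 (t1, 0) - L13 (0, t3)) + (L21 (t2, 0) - L21 (0, t1)) + (L32 (t3, 0) - L32 (0, t2)))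
      = - pi * sgn (orient (f1 t1) (f2 t2) (f3 t3))"
proof -
  have t: "0 < t1" "0 < t2" "0 < t3" using ex by (auto simp: exits_def)
  have u: "u \<in> ball c \<rho>" using ex(1)[unfolded exits_def] start(1) by auto
  have L13: "continuous_on Q13 L13" "\<And>s t. (s, t) \<in> Q13 \<Longrightarrow> exp (L13 (s, t)) = f1 s - f3 t"
    using l13 by (auto simp: log_diff_def)
  have L21: "continuous_on Q21 L21" "\<And>s t. (s, t) \<in> Q21 \<Longrightarrow> exp (L21 (s, t)) = f2 s - f1 t"
    using l21 by (auto simp: log_diff_def)
  have L32: "continuous_on Q32 L32" "\<And>s t. (s, t) \<in> Q32 \<Longrightarrow> exp (L32 (s, t)) = f3 s - f2 t"
    using l32 by (auto simp: log_diff_def)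
  have box: "{0..a} \<times> {0..b} - {(0, 0)} \<subseteq> Q" if "{0..T} \<times> {0..T} - {(0, 0)} \<subseteq> Q" "a \<le> T" "b \<le> T" for a b Q
    by (rule order_trans[OF _ that(1)]) (use that(2,3) in auto)
  have pt: "(a, b) \<in> Q" if "{0..T} \<times> {0..T} - {(0, 0)} \<subseteq> Q" "a \<le> T" "b \<le> T" "0 < a" "0 < b" for a b Q
    using that by (intro subsetD[OF that(1)]) auto
  have ne: "f1 t1 \<noteq> f3 t3" "f2 t2 \<noteq> f1 t1" "f3 t3 \<noteq> f2 t2"
    using L13(2)[OF pt[OF Q(1) ex(4,6) t(1,3)]] L21(2)[OF pt[OF Q(2) ex(5,4) t(2,1)]]
      L32(2)[OF pt[OF Q(3) ex(6,5) t(3,2)]] by auto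
  note e = ex(1-3)[unfolded exits_def]
  have k13: "L13 (t1, 0) - L13 (0, t3) = corner_angle u (f1 t1) (f3 t3)"
    by (rule corner_log[OF t(1,3) l13 box[OF Q(1) ex(4,6)] start(1,3) u]) (use e ne in auto)
  have k21: "L21 (t2, 0) - L21 (0, t1) = corner_angle u (f2 t2) (f1 t1)"
    by (rule corner_log[OF t(2,1) l21 box[OF Q(2) ex(5,4)] start(2,1) u]) (use e ne in auto)
  have k32: "L32 (t3, 0) - L32 (0, t2) = corner_angle u (f3 t3) (f2 t2)"
    by (rule corner_log[OF t(3,2) l32 box[OF Q(3) ex(6,5)] start(3,2) u]) (use e ne in auto)
  show ?thesis unfolding k13 k21 k32
    by (rule corner_sum[OF u]) (use ex ne in \<open>auto simp: exits_def\<close>)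
qed

text \<open>The cyclic sum of logarithms near the start is a single constant, and each of the two
  discs expresses its imaginary part by the orientation of the points where the curves leave that
  disc.\<close>

lemma orientation_at_start_constant:
  fixes f1 f2 f3 :: "real \<Rightarrow> complex"
  assumes T: "0 < T" and cont: "continuous_on {0..T} f1" "continuous_on {0..T} f2" "continuous_on {0..T} f3"
    and start: "f1 0 = u" "f2 0 = u" "f3 0 = u"
    and dis: "\<And>s t. s \<in> {0..T} \<Longrightarrow> t \<in> {0..T} \<Longrightarrow> (s, t) \<noteq> (0, 0) \<Longrightarrow> f1 s \<noteq> f3 t \<and> f2 s \<noteq> f1 t \<and> f3 s \<noteq> f2 t"
    and ex: "exits f1 c \<rho> t1" "exits f2 c \<rho> t2" "exits f3 c \<rho> t3" "t1 \<le> T" "t2 \<le> T" "t3 \<le> T"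
    and ex': "exits f1 c' \<rho>' s1" "exits f2 c' \<rho>' s2" "exits f3 c' \<rho>' s3" "s1 \<le> T" "s2 \<le> T" "s3 \<le> T"
  shows "orient (f1 t1) (f2 t2) (f3 t3) \<noteq> 0"
    and "sgn (orient (f1 s1) (f2 s2) (f3 s3)) = sgn (orient (f1 t1) (f2 t2) (f3 t3))"
proof -
  let ?Q = "{0..T} \<times> {0..T} - {(0, 0)}"
  obtain L13 where l13: "log_diff ?Q L13 f1 f3"
    by (rule log_difference[OF convex_punctured_box[of T T] _ cont(1,3)]) (use dis in auto)
  obtain L21 where l21: "log_diff ?Q L21 f2 f1"
    by (rule log_difference[OF convex_punctured_box[of T T] _ cont(2,1)]) (use dis in auto)
  obtain L32 where l32: "log_diff ?Q L32 f3 f2"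
    by (rule log_difference[OF convex_punctured_box[of T T] _ cont(3,2)]) (use dis in auto)
  note turn = turning_at_start[OF start l13 l21 l32 subset_refl subset_refl subset_refl]
  obtain k where k: "\<forall>t1\<in>{0<..T}. \<forall>t2\<in>{0<..T}. \<forall>t3\<in>{0<..T}.
    (L13 (t1, 0) - L13 (0, t3)) + (L21 (t2, 0) - L21 (0, t1)) + (L32 (t3, 0) - L32 (0, t2)) = k"
    using axis_logs_constant[OF T start l13 l21 l32 subset_refl subset_refl subset_refl] by blast
  have t: "t1 \<in> {0<..T}" "t2 \<in> {0<..T}" "t3 \<in> {0<..T}" "s1 \<in> {0<..T}" "s2 \<in> {0<..T}" "s3 \<in> {0<..T}"
    using ex ex' by (auto simp: exits_def)
  show "orient (f1 t1) (f2 t2) (f3 t3) \<noteq> 0" using turn[OF ex] by blast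
  have "Im k = - pi * sgn (orient (f1 t1) (f2 t2) (f3 t3))" "Im k = - pi * sgn (orient (f1 s1) (f2 s2) (f3 s3))"
    using turn[OF ex] turn[OF ex'] k[rule_format, OF t(1-3)] k[rule_format, OF t(4-6)] by auto
  then have "pi * sgn (orient (f1 t1) (f2 t2) (f3 t3)) = pi * sgn (orient (f1 s1) (f2 s2) (f3 s3))" by linarith
  then show "sgn (orient (f1 s1) (f2 s2) (f3 s3)) = sgn (orient (f1 t1) (f2 t2) (f3 t3))"
    by (simp only: mult_cancel_left pi_neq_zero) simp
qed

text \<open>The third arc cuts the inside of the loop of the first two into the insides of the two
  other loops. So the first arc lies outside the loop of the second and third, the second outside
  the loop of the third and first, and only the third is encircled.\<close>

lemma theta_winding:
  fixes f1 f2 f3 :: "real \<Rightarrow> complex"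
  assumes arcs: "arc f1" "arc f2" "arc f3"
    and start: "pathstart f1 = u" "pathstart f2 = u" "pathstart f3 = u"
    and fin: "pathfinish f1 = w" "pathfinish f2 = w" "pathfinish f3 = w"
    and int: "path_image f1 \<inter> path_image f2 = {u, w}" "path_image f1 \<inter> path_image f3 = {u, w}"
      "path_image f2 \<inter> path_image f3 = {u, w}"
    and ins: "path_image f3 \<inter> inside (path_image f1 \<union> path_image f2) \<noteq> {}"
    and h: "h1 \<in> path_image f1 - {u, w}" "h2 \<in> path_image f2 - {u, w}" "h3 \<in> path_image f3 - {u, w}"
  shows "winding_number (f1 +++ reversepath f2) h3 \<in> {1, -1}"
    and "winding_number (f2 +++ reversepath f3) h1 = 0"
    and "winding_number (f3 +++ reversepath f1) h2 = 0"
proof -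
  have uw: "u \<noteq> w" using arcs(1) start fin arc_distinct_ends by blast
  have sp: "simple_path (f1 +++ reversepath f2)" "simple_path (f2 +++ reversepath f3)" "simple_path (f3 +++ reversepath f1)"
    using arcs start fin int by (auto simp: simple_path_join_loop_eq arc_reversepath)
  have im: "path_image (f1 +++ reversepath f2) = path_image f1 \<union> path_image f2"
     "path_image (f2 +++ reversepath f3) = path_image f2 \<union> path_image f3"
     "path_image (f3 +++ reversepath f1) = path_image f3 \<union> path_image f1"
    using start fin by (simp_all add: path_image_join)
  obtain "inside (path_image f1 \<union> path_image f3) \<inter> inside (path_image f2 \<union> path_image f3) = {}"
    and eq: "inside (path_image f1 \<union> path_image f3) \<union> inside (path_image f2 \<union> path_image f3) \<union>
           (path_image f3 - {u, w}) = inside (path_image f1 \<union> path_image f2)"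
    by (rule split_inside_simple_closed_curve[OF arc_imp_simple_path[OF arcs(1)] start(1) fin(1)
        arc_imp_simple_path[OF arcs(2)] start(2) fin(2) arc_imp_simple_path[OF arcs(3)] start(3) fin(3) uw int ins])
  have "h3 \<in> inside (path_image (f1 +++ reversepath f2))" using eq h(3) unfolding im by blast
  then show "winding_number (f1 +++ reversepath f2) h3 \<in> {1, -1}"
    using simple_closed_path_winding_number_inside[OF sp(1)] by (metis insertCI)
  have no: "inside (path_image f1 \<union> path_image f2) \<inter> (path_image f1 \<union> path_image f2) = {}"
    by (rule inside_no_overlap)
  have "h1 \<notin> path_image f2 \<union> path_image f3" using h(1) int by blast
  moreover have "h1 \<notin> inside (path_image f2 \<union> path_image f3)" using eq no h(1) by blast
  ultimately have "h1 \<in> outside (path_image (f2 +++ reversepath f3))" unfolding im outside_inside by blast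
  then show "winding_number (f2 +++ reversepath f3) h1 = 0"
    by (rule winding_number_zero_in_outside[rotated 2]) (use sp start fin in \<open>auto simp: simple_path_imp_path\<close>)
  have "h2 \<notin> path_image f3 \<union> path_image f1" using h(2) int by blast
  moreover have "h2 \<notin> inside (path_image f1 \<union> path_image f3)" using eq no h(2) by blast
  ultimately have "h2 \<in> outside (path_image (f3 +++ reversepath f1))" unfolding im outside_inside
    by (simp add: Un_commute)
  then show "winding_number (f3 +++ reversepath f1) h2 = 0"
    by (rule winding_number_zero_in_outside[rotated 2]) (use sp start fin in \<open>auto simp: simple_path_imp_path\<close>)
qed

text \<open>Let k and k' be the cyclic sums at the two ends. Their difference is 2 pi i times the
  sum of the winding numbers of the three loops around the midpoint of the respective remaining arc.
  Just one of these is nonzero, and it is 1 or -1; since Im k and Im k' are each pi or - pi, they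
  have opposite signs.\<close>

lemma theta_orientation_planar:
  fixes f1 f2 f3 :: "real \<Rightarrow> complex"
  assumes arcs: "arc f1" "arc f2" "arc f3"
    and start: "pathstart f1 = u" "pathstart f2 = u" "pathstart f3 = u"
    and fin: "pathfinish f1 = w" "pathfinish f2 = w" "pathfinish f3 = w"
    and int: "path_image f1 \<inter> path_image f2 = {u, w}" "path_image f1 \<inter> path_image f3 = {u, w}"
      "path_image f2 \<inter> path_image f3 = {u, w}"
    and ins: "path_image f3 \<inter> inside (path_image f1 \<union> path_image f2) \<noteq> {}"
    and ex: "exits f1 c \<rho> t1" "exits f2 c \<rho> t2" "exits f3 c \<rho> t3" "t1 < 1" "t2 < 1" "t3 < 1"
    and ex': "exits (reversepath f1) c' \<rho>' s1" "exits (reversepath f2) c' \<rho>' s2" "exits (reversepath f3) c' \<rho>' s3"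
       "s1 < 1" "s2 < 1" "s3 < 1"
  shows "sgn (orient (reversepath f1 s1) (reversepath f2 s2) (reversepath f3 s3)) =
    - sgn (orient (f1 t1) (f2 t2) (f3 t3))"
proof -
  let ?Q = "{0..1} \<times> {0..1} - {(0, 0), (1, 1)} :: (real \<times> real) set"
  have cont: "continuous_on {0..1} f1" "continuous_on {0..1} f2" "continuous_on {0..1} f3"
    using arcs by (auto simp: arc_def path_def)
  have st: "f1 0 = u" "f2 0 = u" "f3 0 = u" "f1 1 = w" "f2 1 = w" "f3 1 = w"
    using start fin by (auto simp: pathstart_def pathfinish_def)
  have inner: "f s = u \<longleftrightarrow> s = 0" "f s = w \<longleftrightarrow> s = 1" if "arc f" "f 0 = u" "f 1 = w" "s \<in> {0..1}" for f s
    using that by (auto simp: arc_def inj_on_def)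
  have uw: "u \<noteq> w" using arcs(1) start fin arc_distinct_ends by blast
  have sep: "f s \<noteq> g t" if fg: "arc f" "arc g" "f 0 = u" "f 1 = w" "g 0 = u" "g 1 = w"
    and i: "path_image f \<inter> path_image g = {u, w}" and m: "(s, t) \<in> ?Q" for f g s t
  proof
    assume e: "f s = g t"
    have "f s \<in> path_image f" "g t \<in> path_image g" using m by (auto simp: path_image_def)
    then have "f s \<in> path_image f \<inter> path_image g" using e by simp
    then have "f s = u \<or> f s = w" using i by blast
    then show False
    proof
      assume "f s = u"
      then have "s = 0" "t = 0" using e inner(1)[of f s] inner(1)[of g t] fg m by auto
      then show False using m by simp
    next
      assume "f s = w"
      then have "s = 1" "t = 1" using e inner(2)[of f s] inner(2)[of g t] fg m by auto
      then show False using m by simp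
    qed
  qed
  have sub: "?Q \<subseteq> {0..1} \<times> {0..1}" by blast
  have int': "path_image f2 \<inter> path_image f1 = {u, w}" "path_image f3 \<inter> path_image f2 = {u, w}"
    using int by blast+
  obtain L13 where l13: "log_diff ?Q L13 f1 f3"
    using log_difference[OF convex_twice_punctured_square sub cont(1,3)]
      sep[OF arcs(1,3) st(1,4) st(3,6) int(2)] by blast
  obtain L21 where l21: "log_diff ?Q L21 f2 f1"
    using log_difference[OF convex_twice_punctured_square sub cont(2,1)]
      sep[OF arcs(2,1) st(2,5) st(1,4) int'(1)] by blast
  obtain L32 where l32: "log_diff ?Q L32 f3 f2"
    using log_difference[OF convex_twice_punctured_square sub cont(3,2)]
      sep[OF arcs(3,2) st(3,6) st(2,5) int'(2)] by blast
  have L13: "continuous_on ?Q L13" "\<And>s t. (s, t) \<in> ?Q \<Longrightarrow> exp (L13 (s, t)) = f1 s - f3 t"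
    using l13 by (auto simp: log_diff_def)
  have L21: "continuous_on ?Q L21" "\<And>s t. (s, t) \<in> ?Q \<Longrightarrow> exp (L21 (s, t)) = f2 s - f1 t"
    using l21 by (auto simp: log_diff_def)
  have L32: "continuous_on ?Q L32" "\<And>s t. (s, t) \<in> ?Q \<Longrightarrow> exp (L32 (s, t)) = f3 s - f2 t"
    using l32 by (auto simp: log_diff_def)
  \<comment> \<open>The reflection through the centre of the square exchanges its two missing
    corners, so the same logarithms serve for the reversed arcs at the other end.\<close>
  define R where "R = (\<lambda>p::real \<times> real. (1 - fst p, 1 - snd p))"
  have R: "continuous_on ?Q R" "R ` ?Q \<subseteq> ?Q" unfolding R_def by (auto intro!: continuous_intros)
  define K13 K21 K32 where "K13 = L13 \<circ> R" and "K21 = L21 \<circ> R" and "K32 = L32 \<circ> R"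
  have RQ: "R (s, t) \<in> ?Q" if "(s, t) \<in> ?Q" for s t using R(2) that by blast
  have K13: "continuous_on ?Q K13" "\<And>s t. (s, t) \<in> ?Q \<Longrightarrow> exp (K13 (s, t)) = reversepath f1 s - reversepath f3 t"
    using continuous_on_compose[OF R(1) continuous_on_subset[OF L13(1) R(2)]] L13(2) RQ
    by (auto simp: K13_def R_def reversepath_def)
  have K21: "continuous_on ?Q K21" "\<And>s t. (s, t) \<in> ?Q \<Longrightarrow> exp (K21 (s, t)) = reversepath f2 s - reversepath f1 t"
    using continuous_on_compose[OF R(1) continuous_on_subset[OF L21(1) R(2)]] L21(2) RQ
    by (auto simp: K21_def R_def reversepath_def)
  have K32: "continuous_on ?Q K32" "\<And>s t. (s, t) \<in> ?Q \<Longrightarrow> exp (K32 (s, t)) = reversepath f3 s - reversepath f2 t"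
    using continuous_on_compose[OF R(1) continuous_on_subset[OF L32(1) R(2)]] L32(2) RQ
    by (auto simp: K32_def R_def reversepath_def)
  have k13: "log_diff ?Q K13 (reversepath f1) (reversepath f3)"
    using K13 by (auto simp: log_diff_def)
  have k21: "log_diff ?Q K21 (reversepath f2) (reversepath f1)"
    using K21 by (auto simp: log_diff_def)
  have k32: "log_diff ?Q K32 (reversepath f3) (reversepath f2)"
    using K32 by (auto simp: log_diff_def)
  define h where "h = (1/2 :: real)"
  \<comment> \<open>All exit times are below 1, so a box that omits the far corner (1, 1) contains
    them together with the midpoint parameter.\<close>
  define T where "T = Max {t1, t2, t3, s1, s2, s3, h}"
  have T: "T < 1" "t1 \<le> T" "t2 \<le> T" "t3 \<le> T" "s1 \<le> T" "s2 \<le> T" "s3 \<le> T" "h \<le> T" "0 < T"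
  proof -
    show "T < 1" unfolding T_def by (subst Max_less_iff) (use ex(4-6) ex'(4-6) in \<open>simp_all add: h_def\<close>)
    show "t1 \<le> T" "t2 \<le> T" "t3 \<le> T" "s1 \<le> T" "s2 \<le> T" "s3 \<le> T" "h \<le> T"
      unfolding T_def by (rule Max_ge; simp)+
    then show "0 < T" by (simp add: h_def)
  qed
  have TQ: "{0..T} \<times> {0..T} - {(0, 0)} \<subseteq> ?Q" using T by auto
  have ht: "h \<in> {0<..T}" using T by (simp add: h_def)
  have r0: "reversepath f1 0 = w" "reversepath f2 0 = w" "reversepath f3 0 = w" using st by (auto simp: reversepath_def)
  obtain k where k: "\<forall>t1\<in>{0<..T}. \<forall>t2\<in>{0<..T}. \<forall>t3\<in>{0<..T}.
    (L13 (t1, 0) - L13 (0, t3)) + (L21 (t2, 0) - L21 (0, t1)) + (L32 (t3, 0) - L32 (0, t2)) = k"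
    using axis_logs_constant[OF T(9) st(1-3) l13 l21 l32 TQ TQ TQ] by blast
  obtain k' where k': "\<forall>t1\<in>{0<..T}. \<forall>t2\<in>{0<..T}. \<forall>t3\<in>{0<..T}.
    (K13 (t1, 0) - K13 (0, t3)) + (K21 (t2, 0) - K21 (0, t1)) + (K32 (t3, 0) - K32 (0, t2)) = k'"
    using axis_logs_constant[OF T(9) r0 k13 k21 k32 TQ TQ TQ] by blast
  have tT: "t1 \<in> {0<..T}" "t2 \<in> {0<..T}" "t3 \<in> {0<..T}" "s1 \<in> {0<..T}" "s2 \<in> {0<..T}" "s3 \<in> {0<..T}"
    using ex ex' T by (auto simp: exits_def)
  let ?o = "orient (f1 t1) (f2 t2) (f3 t3)" and ?o' = "orient (reversepath f1 s1) (reversepath f2 s2) (reversepath f3 s3)"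
  have kap: "?o \<noteq> 0" "Im k = - pi * sgn ?o"
    using turning_at_start[OF st(1-3) l13 l21 l32 TQ TQ TQ ex(1-3) T(2-4)] k[rule_format, OF tT(1-3)] by auto
  have kap': "?o' \<noteq> 0" "Im k' = - pi * sgn ?o'"
    using turning_at_start[OF r0 k13 k21 k32 TQ TQ TQ ex'(1-3) T(5-7)] k'[rule_format, OF tT(4-6)] by auto
  have hin: "f h \<in> path_image f - {u, w}" if "arc f" "f 0 = u" "f 1 = w" for f
    using inner[OF that, of h] by (auto simp: h_def path_image_def)
  have h3: "f3 h \<in> path_image f3 - {u, w}" "f2 h \<in> path_image f2 - {u, w}" "f1 h \<in> path_image f1 - {u, w}"
    using hin arcs st by auto
  note W = theta_winding[OF arcs start fin int ins h3(3,2,1)]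
  have cl: "continuous_on {0..1} (\<lambda>s. L (s, h))" "continuous_on {0..1} (\<lambda>s. L (h, s))"
    if "continuous_on ?Q L" for L :: "real \<times> real \<Rightarrow> complex"
  proof -
    show "continuous_on {0..1} (\<lambda>s. L (s, h))"
      by (rule continuous_on_compose2[OF that, of "{0..1}" "\<lambda>s. (s, h)"]) (auto intro!: continuous_intros simp: h_def)
    show "continuous_on {0..1} (\<lambda>s. L (h, s))"
      by (rule continuous_on_compose2[OF that, of "{0..1}" "\<lambda>s. (h, s)"]) (auto intro!: continuous_intros simp: h_def)
  qed
  have hQ: "(s, h) \<in> ?Q" "(h, s) \<in> ?Q" if "s \<in> {0..1}" for s using that by (auto simp: h_def)
  have pth: "path f1" "path f2" "path f3" using arcs arc_imp_path by auto
  have E13: "exp (L13 (s, h)) = f1 s - f3 h" "exp (L13 (h, s)) = f1 h - f3 s" if "s \<in> {0..1}" for s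
    using L13(2) hQ[OF that] by blast+
  have E21: "exp (L21 (s, h)) = f2 s - f1 h" "exp (L21 (h, s)) = f2 h - f1 s" if "s \<in> {0..1}" for s
    using L21(2) hQ[OF that] by blast+
  have E32: "exp (L32 (s, h)) = f3 s - f2 h" "exp (L32 (h, s)) = f3 h - f2 s" if "s \<in> {0..1}" for s
    using L32(2) hQ[OF that] by blast+
  have off: "f3 h \<notin> path_image f1" "f3 h \<notin> path_image f2" "f1 h \<notin> path_image f2"
      "f1 h \<notin> path_image f3" "f2 h \<notin> path_image f3" "f2 h \<notin> path_image f1"
    using h3 int by blast+
  have N3: "2 * of_real pi * \<i> * winding_number (f1 +++ reversepath f2) (f3 h) =
      (L13 (1, h) - L13 (0, h)) - (L32 (h, 1) - L32 (h, 0))"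
  proof (rule winding_number_two_arcs[where ?c1.0 = 1 and ?c2.0 = "-1" and ?l1.0 = "\<lambda>s. L13 (s, h)" and ?l2.0 = "\<lambda>s. L32 (h, s)"])
    show "f1 s - f3 h = 1 * exp (L13 (s, h))" "f2 s - f3 h = - 1 * exp (L32 (h, s))" if "s \<in> {0..1}" for s
      by (simp_all add: E13[OF that] E32[OF that])
  qed (use pth start fin off cl[OF L13(1)] cl[OF L32(1)] in simp_all)
  have N1: "2 * of_real pi * \<i> * winding_number (f2 +++ reversepath f3) (f1 h) =
      (L21 (1, h) - L21 (0, h)) - (L13 (h, 1) - L13 (h, 0))"
  proof (rule winding_number_two_arcs[where ?c1.0 = 1 and ?c2.0 = "-1" and ?l1.0 = "\<lambda>s. L21 (s, h)" and ?l2.0 = "\<lambda>s. L13 (h, s)"])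
    show "f2 s - f1 h = 1 * exp (L21 (s, h))" "f3 s - f1 h = - 1 * exp (L13 (h, s))" if "s \<in> {0..1}" for s
      by (simp_all add: E13[OF that] E21[OF that])
  qed (use pth start fin off cl[OF L13(1)] cl[OF L21(1)] in simp_all)
  have N2: "2 * of_real pi * \<i> * winding_number (f3 +++ reversepath f1) (f2 h) =
      (L32 (1, h) - L32 (0, h)) - (L21 (h, 1) - L21 (h, 0))"
  proof (rule winding_number_two_arcs[where ?c1.0 = 1 and ?c2.0 = "-1" and ?l1.0 = "\<lambda>s. L32 (s, h)" and ?l2.0 = "\<lambda>s. L21 (h, s)"])
    show "f3 s - f2 h = 1 * exp (L32 (s, h))" "f1 s - f2 h = - 1 * exp (L21 (h, s))" if "s \<in> {0..1}" for s
      by (simp_all add: E32[OF that] E21[OF that])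
  qed (use pth start fin off cl[OF L21(1)] cl[OF L32(1)] in simp_all)
  have kk: "k = (L13 (h, 0) - L13 (0, h)) + (L21 (h, 0) - L21 (0, h)) + (L32 (h, 0) - L32 (0, h))"
    using k[rule_format, OF ht ht ht] by simp
  have kk': "k' = (L13 (h, 1) - L13 (1, h)) + (L21 (h, 1) - L21 (1, h)) + (L32 (h, 1) - L32 (1, h))"
    using k'[rule_format, OF ht ht ht] by (simp add: K13_def K21_def K32_def R_def h_def)
  \<comment> \<open>Evaluated at the midpoint parameter, the twelve values of the logarithms regroup
    into the three winding numbers.\<close>
  have "k - k' = 2 * of_real pi * \<i> * winding_number (f1 +++ reversepath f2) (f3 h)"
  proof -
    have "(L21 (1, h) - L21 (0, h)) - (L13 (h, 1) - L13 (h, 0)) = 0" using N1 W(2) by simp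
    moreover have "(L32 (1, h) - L32 (0, h)) - (L21 (h, 1) - L21 (h, 0)) = 0" using N2 W(3) by simp
    ultimately show ?thesis unfolding N3 kk kk' by (simp add: algebra_simps)
  qed
  then have "Im k - Im k' = 2 * pi \<or> Im k - Im k' = - 2 * pi"
    using W(1) by (auto simp: complex_eq_iff)
  then have "- sgn ?o + sgn ?o' = 2 \<or> - sgn ?o + sgn ?o' = -2"
  proof -
    have "Im k - Im k' = pi * (- sgn ?o + sgn ?o')" using kap kap' by (simp add: algebra_simps)
    then have "pi * (- sgn ?o + sgn ?o') = pi * 2 \<or> pi * (- sgn ?o + sgn ?o') = pi * (-2)"
      using \<open>Im k - Im k' = 2 * pi \<or> Im k - Im k' = - 2 * pi\<close> by linarith
    then show ?thesis by (simp only: mult_cancel_left pi_neq_zero) simp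
  qed
  then show ?thesis using kap(1) kap'(1) by (auto simp: sgn_if split: if_splits)
qed

section \<open>Stereographic projection in a right-handed orthonormal frame\<close>

locale frame =
  fixes p q n :: "real^3"
  assumes unit: "p \<bullet> p = 1" "q \<bullet> q = 1" "n \<bullet> n = 1"
    and orth: "p \<bullet> q = 0" "p \<bullet> n = 0" "q \<bullet> n = 0"
    and pq: "cross3 p q = n"
begin

lemma qn: "cross3 q n = p" and np: "cross3 n p = q"
proof -
  show "cross3 q n = p" unfolding pq[symmetric] Lagrange using unit orth by (simp add: inner_commute)
  have "cross3 p n = - q" unfolding pq[symmetric] Lagrange using unit orth by (simp add: inner_commute)
  then show "cross3 n p = q" using cross_skew[of n p] by simp
qed

lemma orth': "q \<bullet> p = 0" "n \<bullet> p = 0" "n \<bullet> q = 0"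
  using orth by (simp_all add: inner_commute)

lemma expand: "x = (x \<bullet> p) *\<^sub>R p + (x \<bullet> q) *\<^sub>R q + (x \<bullet> n) *\<^sub>R n"
proof -
  define y where "y = x - (x \<bullet> p) *\<^sub>R p - (x \<bullet> q) *\<^sub>R q"
  have y: "y \<bullet> p = 0" "y \<bullet> q = 0" "y \<bullet> n = x \<bullet> n"
    unfolding y_def using orth unit orth' by (auto simp: inner_diff_left)
  have "cross3 y n = 0" unfolding pq[symmetric] by (simp add: Lagrange y)
  then have "(norm y)\<^sup>2 * (norm n)\<^sup>2 = (y \<bullet> n)\<^sup>2" using norm_cross_dot[of y n]
    by (simp add: power_mult_distrib)
  then have 1: "y \<bullet> y = (y \<bullet> n)\<^sup>2" by (simp add: power2_norm_eq_inner unit)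
  have "(y - (y \<bullet> n) *\<^sub>R n) \<bullet> (y - (y \<bullet> n) *\<^sub>R n) = y \<bullet> y - (y \<bullet> n)\<^sup>2"
    by (simp add: inner_diff_left inner_diff_right unit inner_commute power2_eq_square)
  then have "y - (y \<bullet> n) *\<^sub>R n = 0" using 1 by simp
  then have "y = (x \<bullet> n) *\<^sub>R n" unfolding y(3) by simp
  moreover have "x = (x \<bullet> p) *\<^sub>R p + (x \<bullet> q) *\<^sub>R q + y" by (simp add: y_def)
  ultimately show ?thesis by metis
qed

lemma inner_expand: "x \<bullet> y = (x \<bullet> p) * (y \<bullet> p) + (x \<bullet> q) * (y \<bullet> q) + (x \<bullet> n) * (y \<bullet> n)"
  by (subst expand[of y]) (simp add: inner_add_right algebra_simps)

lemma cross_expand: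
  "cross3 x y \<bullet> p = (x \<bullet> q) * (y \<bullet> n) - (x \<bullet> n) * (y \<bullet> q)"
  "cross3 x y \<bullet> q = (x \<bullet> n) * (y \<bullet> p) - (x \<bullet> p) * (y \<bullet> n)"
  "cross3 x y \<bullet> n = (x \<bullet> p) * (y \<bullet> q) - (x \<bullet> q) * (y \<bullet> p)"
  using dot_cross[of x y q n] dot_cross[of x y n p] dot_cross[of x y p q]
  unfolding pq qn np by (simp_all add: inner_commute algebra_simps)

definition stereo :: "real^3 \<Rightarrow> complex" where
  "stereo x = Complex ((x \<bullet> p) / (1 - x \<bullet> n)) ((x \<bullet> q) / (1 - x \<bullet> n))"

definition unstereo :: "complex \<Rightarrow> real^3" where
  "unstereo z = (1 / ((cmod z)\<^sup>2 + 1)) *\<^sub>R ((2 * Re z) *\<^sub>R p + (2 * Im z) *\<^sub>R q + ((cmod z)\<^sup>2 - 1) *\<^sub>R n)"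

lemma sphere_lt: assumes "x \<in> sphere 0 1" "x \<noteq> n" shows "x \<bullet> n < 1"
proof -
  have "(x - n) \<bullet> (x - n) > 0" using assms(2) by simp
  moreover have "x \<bullet> x = 1" using assms(1) by (simp add: dot_square_norm)
  ultimately show ?thesis by (simp add: inner_diff_left inner_diff_right unit inner_commute)
qed

lemma sphere_coords: assumes "x \<in> sphere 0 1" shows "(x \<bullet> p)\<^sup>2 + (x \<bullet> q)\<^sup>2 + (x \<bullet> n)\<^sup>2 = 1"
proof -
  have "x \<bullet> x = 1" using assms by (simp add: dot_square_norm)
  then show ?thesis using inner_expand[of x x] by (simp add: power2_eq_square)
qed

lemma cmod_stereo:
  assumes "x \<in> sphere 0 1" "x \<noteq> n"
  shows "(cmod (stereo x))\<^sup>2 * (1 - x \<bullet> n) = 1 + x \<bullet> n"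
proof -
  have d: "1 - x \<bullet> n > 0" using sphere_lt[OF assms] by simp
  have e: "(x \<bullet> p)\<^sup>2 + (x \<bullet> q)\<^sup>2 = (1 + x \<bullet> n) * (1 - x \<bullet> n)"
    using sphere_coords[OF assms(1)] by (simp add: power2_eq_square algebra_simps)
  have "(cmod (stereo x))\<^sup>2 = ((x \<bullet> p)\<^sup>2 + (x \<bullet> q)\<^sup>2) / (1 - x \<bullet> n)\<^sup>2"
    by (simp add: stereo_def cmod_power2 power_divide add_divide_distrib)
  then show ?thesis unfolding e using d by (simp add: power2_eq_square)
qed

lemma unstereo_stereo:
  assumes "x \<in> sphere 0 1" "x \<noteq> n"
  shows "unstereo (stereo x) = x"
proof -
  define d where "d = 1 - x \<bullet> n"
  have d: "d > 0" using sphere_lt[OF assms] by (simp add: d_def)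
  have xn: "x \<bullet> n = 1 - d" by (simp add: d_def)
  have m: "(cmod (stereo x))\<^sup>2 = (2 - d) / d" using cmod_stereo[OF assms] d by (simp add: d_def field_simps)
  have a: "(cmod (stereo x))\<^sup>2 + 1 = 2 / d" "(cmod (stereo x))\<^sup>2 - 1 = (2 - 2 * d) / d"
    unfolding m using d by (simp_all add: field_simps)
  have c: "1 / (2 / d) * (2 * Re (stereo x)) = x \<bullet> p" "1 / (2 / d) * (2 * Im (stereo x)) = x \<bullet> q"
      "1 / (2 / d) * ((2 - 2 * d) / d) = x \<bullet> n"
    using d by (simp_all add: stereo_def xn field_simps)
  have "unstereo (stereo x) = (x \<bullet> p) *\<^sub>R p + (x \<bullet> q) *\<^sub>R q + (x \<bullet> n) *\<^sub>R n"
    unfolding unstereo_def a scaleR_add_right scaleR_scaleR c ..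
  then show ?thesis using expand by simp
qed

lemma unstereo_props: "unstereo z \<in> sphere 0 1" "unstereo z \<noteq> n" "stereo (unstereo z) = z"
proof -
  define m where "m = (cmod z)\<^sup>2 + 1"
  have m: "m > 0" by (simp add: m_def add_pos_nonneg add.commute)
  have c: "unstereo z \<bullet> p = 2 * Re z / m" "unstereo z \<bullet> q = 2 * Im z / m" "unstereo z \<bullet> n = (m - 2) / m"
    unfolding unstereo_def m_def[symmetric] using unit orth orth'
    by (simp_all add: inner_add_left m_def)
  have ri: "(Re z)\<^sup>2 + (Im z)\<^sup>2 = m - 1" by (simp add: m_def cmod_power2)
  have "unstereo z \<bullet> unstereo z = (4 * ((Re z)\<^sup>2 + (Im z)\<^sup>2) + (m - 2)\<^sup>2) / m\<^sup>2"
    unfolding inner_expand[of "unstereo z" "unstereo z"] c using m by (simp add: field_simps power2_eq_square)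
  also have "\<dots> = 1" unfolding ri using m by (simp add: field_simps power2_eq_square)
  finally show "unstereo z \<in> sphere 0 1" by (simp add: norm_eq_sqrt_inner)
  have "unstereo z \<bullet> n \<noteq> 1" unfolding c using m by (simp add: field_simps)
  then show "unstereo z \<noteq> n" using unit by auto
  have "1 - unstereo z \<bullet> n = 2 / m" unfolding c using m by (simp add: field_simps)
  then show "stereo (unstereo z) = z" unfolding stereo_def c using m by (simp add: complex_eq_iff)
qed

lemma continuous_on_unstereo: "continuous_on S unstereo"
proof -
  have "(cmod z)\<^sup>2 + 1 \<noteq> 0" for z by (smt (verit) zero_le_power2)
  then show ?thesis unfolding unstereo_def[abs_def] by (intro continuous_intros) auto
qed

lemma continuous_on_stereo: "continuous_on (sphere 0 1 - {n}) stereo"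
  unfolding stereo_def[abs_def] Complex_eq
  by (intro continuous_intros) (use sphere_lt in force)+

lemma inj_on_stereo: "inj_on stereo (sphere 0 1 - {n})"
  by (rule inj_on_inverseI[of _ unstereo]) (simp add: unstereo_stereo)

text \<open>The open cap of the points whose distance to \<open>u\<close> is less than \<open>r\<close> consists of the points
  \<open>x\<close> of the sphere with \<open>u \<bullet> x > 1 - r\<^sup>2/2\<close>; it is mapped to a disc provided the centre \<open>n\<close> of
  the projection is outside of its closure.\<close>

lemma stereo_cap:
  assumes u: "u \<in> sphere 0 1" and \<kappa>: "u \<bullet> n < \<kappa>"
  defines "c \<equiv> Complex ((u \<bullet> p) / (\<kappa> - u \<bullet> n)) ((u \<bullet> q) / (\<kappa> - u \<bullet> n))"
    and "\<rho> \<equiv> sqrt (1 - \<kappa>\<^sup>2) / (\<kappa> - u \<bullet> n)"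
  assumes x: "x \<in> sphere 0 1" "x \<noteq> n" and k1: "\<kappa> < 1"
  shows "u \<bullet> x > \<kappa> \<Longrightarrow> stereo x \<in> ball c \<rho>" "u \<bullet> x = \<kappa> \<Longrightarrow> stereo x \<in> sphere c \<rho>"
proof -
  define d where "d = \<kappa> - u \<bullet> n"
  define e where "e = 1 - x \<bullet> n"
  define z where "z = stereo x"
  have d: "d > 0" using \<kappa> by (simp add: d_def)
  have e: "e > 0" using sphere_lt[OF x] by (simp add: e_def)
  have un: "u \<bullet> n \<ge> -1"
    using Cauchy_Schwarz_ineq2[of u n] u unit by (simp add: norm_eq_sqrt_inner)
  have "\<kappa>\<^sup>2 \<le> 1" using un \<kappa> k1 by (auto simp: power2_le_iff_abs_le abs_le_iff abs_square_le_1)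
  then have r0: "\<rho> \<ge> 0" using d by (simp add: \<rho>_def d_def)
  have r2: "\<rho>\<^sup>2 = (1 - \<kappa>\<^sup>2) / d\<^sup>2" using \<open>\<kappa>\<^sup>2 \<le> 1\<close> by (simp add: \<rho>_def d_def power_divide)
  have xp: "x \<bullet> p = Re z * e" "x \<bullet> q = Im z * e" using e by (simp_all add: z_def stereo_def e_def)
  have zz: "((Re z)\<^sup>2 + (Im z)\<^sup>2) * e = 2 - e"
    using cmod_stereo[OF x] by (simp add: z_def e_def cmod_power2)
  have uu: "(u \<bullet> p)\<^sup>2 + (u \<bullet> q)\<^sup>2 = 1 - (u \<bullet> n)\<^sup>2" using sphere_coords[OF u] by simp
  have ux: "u \<bullet> x = ((u \<bullet> p) * Re z + (u \<bullet> q) * Im z) * e + (u \<bullet> n) * (1 - e)"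
    unfolding inner_expand[of u x] xp by (simp add: e_def algebra_simps)
  have "(cmod (z - c))\<^sup>2 * d\<^sup>2 = (Re z * d - u \<bullet> p)\<^sup>2 + (Im z * d - u \<bullet> q)\<^sup>2"
  proof -
    have "(Re z - (u \<bullet> p) / d) * d = Re z * d - u \<bullet> p" "(Im z - (u \<bullet> q) / d) * d = Im z * d - u \<bullet> q"
      using d by (simp_all add: field_simps)
    then show ?thesis unfolding c_def d_def[symmetric] cmod_power2
      by (simp add: distrib_right flip: power_mult_distrib)
  qed
  also have "\<dots> = ((Re z)\<^sup>2 + (Im z)\<^sup>2) * d\<^sup>2 - 2 * d * ((u \<bullet> p) * Re z + (u \<bullet> q) * Im z) + (1 - (u \<bullet> n)\<^sup>2)"
    unfolding uu[symmetric] by (simp add: power2_eq_square algebra_simps)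
  finally have "(cmod (z - c))\<^sup>2 * d\<^sup>2 * e = (((Re z)\<^sup>2 + (Im z)\<^sup>2) * e) * d\<^sup>2
      - 2 * d * (((u \<bullet> p) * Re z + (u \<bullet> q) * Im z) * e) + (1 - (u \<bullet> n)\<^sup>2) * e"
    by (simp only:) (simp add: algebra_simps)
  moreover have "((u \<bullet> p) * Re z + (u \<bullet> q) * Im z) * e = u \<bullet> x - (u \<bullet> n) * (1 - e)" using ux by simp
  ultimately have "(cmod (z - c))\<^sup>2 * d\<^sup>2 * e = (2 - e) * d\<^sup>2 - 2 * d * (u \<bullet> x - (u \<bullet> n) * (1 - e)) + (1 - (u \<bullet> n)\<^sup>2) * e"
    using zz by simp
  also have "\<dots> = (1 - \<kappa>\<^sup>2) * e + 2 * d * (\<kappa> - u \<bullet> x)"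
    by (simp add: d_def power2_eq_square algebra_simps)
  finally have "((cmod (z - c))\<^sup>2 * d\<^sup>2) * e = (\<rho>\<^sup>2 * d\<^sup>2) * e + 2 * d * (\<kappa> - u \<bullet> x)"
    unfolding r2 using d by simp
  then have key: "((cmod (z - c))\<^sup>2 - \<rho>\<^sup>2) * (d\<^sup>2 * e) = 2 * d * (\<kappa> - u \<bullet> x)" by (simp add: algebra_simps)
  have de: "d\<^sup>2 * e > 0" using d e by simp
  show "stereo x \<in> ball c \<rho>" if "u \<bullet> x > \<kappa>"
  proof -
    have "2 * d * (\<kappa> - u \<bullet> x) < 0" using that d by (simp add: mult_pos_neg)
    then have "(cmod (z - c))\<^sup>2 - \<rho>\<^sup>2 < 0" unfolding key[symmetric] using de by (smt (verit) mult_nonneg_nonneg)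
    then have "cmod (z - c) < \<rho>" using r0 by (simp add: power_less_imp_less_base)
    then show ?thesis by (simp add: z_def dist_norm norm_minus_commute)
  qed
  show "stereo x \<in> sphere c \<rho>" if "u \<bullet> x = \<kappa>"
  proof -
    have "((cmod (z - c))\<^sup>2 - \<rho>\<^sup>2) * (d\<^sup>2 * e) = 0" using key that by simp
    then have "(cmod (z - c))\<^sup>2 = \<rho>\<^sup>2" using de by (metis eq_iff_diff_eq_0 less_irrefl mult_eq_0_iff)
    then have "cmod (z - c) = \<rho>" using r0 by (simp add: power2_eq_iff_nonneg)
    then show ?thesis by (simp add: z_def dist_norm norm_minus_commute)
  qed
qed

text \<open>The three points lie in a plane orthogonal to \<open>u\<close>, so (b - a) \<times> (c -
  a) is a multiple of \<open>u\<close>. Up to the positive denominators, the signed area of the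
  projected triangle is this multiple times u \<bullet> n - \<kappa>, which is negative because the
  pole is outside the cap: projection from \<open>n\<close> reverses the orientation seen from
  outside.\<close>

lemma stereo_orient:
  assumes u: "u \<in> sphere 0 1" and \<kappa>: "u \<bullet> n < \<kappa>"
    and a: "a \<in> sphere 0 1" "a \<noteq> n" "u \<bullet> a = \<kappa>"
    and b: "b \<in> sphere 0 1" "b \<noteq> n" "u \<bullet> b = \<kappa>"
    and c: "c \<in> sphere 0 1" "c \<noteq> n" "u \<bullet> c = \<kappa>"
  shows "sgn (orient (stereo a) (stereo b) (stereo c)) = - sgn (u \<bullet> cross3 (b - a) (c - a))"
proof -
  define N where "N = cross3 (b - a) (c - a)"
  define lam where "lam = u \<bullet> N"
  have uu: "u \<bullet> u = 1" using u by (simp add: dot_square_norm)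
  have "cross3 u N = 0" unfolding N_def Lagrange using a b c by (simp add: inner_diff_right)
  then have "(N \<bullet> N) = (u \<bullet> N)\<^sup>2" using norm_cross_dot[of u N] uu
    by (simp add: power_mult_distrib power2_norm_eq_inner)
  then have "(N - lam *\<^sub>R u) \<bullet> (N - lam *\<^sub>R u) = 0"
    by (simp add: lam_def inner_diff_left inner_diff_right uu inner_commute power2_eq_square)
  then have N: "N = lam *\<^sub>R u" by simp
  have Nn: "N \<bullet> n = lam * (u \<bullet> n)" and Na: "a \<bullet> N = lam * \<kappa>" using N a by (simp_all add: inner_commute)
  have pos: "1 - a \<bullet> n > 0" "1 - b \<bullet> n > 0" "1 - c \<bullet> n > 0" using sphere_lt a b c by force+
  let ?P = "(1 - a \<bullet> n)\<^sup>2 * (1 - b \<bullet> n) * (1 - c \<bullet> n)"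
  define A B C where "A = 1 - a \<bullet> n" and "B = 1 - b \<bullet> n" and "C = 1 - c \<bullet> n"
  have sa: "Re (stereo a) * A = a \<bullet> p" "Im (stereo a) * A = a \<bullet> q"
    "Re (stereo b) * B = b \<bullet> p" "Im (stereo b) * B = b \<bullet> q"
    "Re (stereo c) * C = c \<bullet> p" "Im (stereo c) * C = c \<bullet> q"
    using pos by (simp_all add: stereo_def A_def B_def C_def)
  have "orient (stereo a) (stereo b) (stereo c) * (A * B * C)
    = (Re (stereo b) * B) * (Im (stereo c) * C) * A - (Re (stereo c) * C) * (Im (stereo b) * B) * A
    - (Re (stereo a) * A) * (Im (stereo c) * C) * B + (Re (stereo c) * C) * (Im (stereo a) * A) * B
    + (Re (stereo a) * A) * (Im (stereo b) * B) * C - (Re (stereo b) * B) * (Im (stereo a) * A) * C"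
    by (simp add: orient_def algebra_simps)
  also have "\<dots> = N \<bullet> n - a \<bullet> N"
    unfolding sa unfolding A_def B_def C_def
    by (subst inner_expand[of a N]) (simp add: N_def cross_expand inner_diff_left algebra_simps)
  also have "\<dots> = - lam * (\<kappa> - u \<bullet> n)" unfolding Nn Na by (simp add: algebra_simps)
  finally have "orient (stereo a) (stereo b) (stereo c) * (A * B * C) = - lam * (\<kappa> - u \<bullet> n)" .
  then have "sgn (orient (stereo a) (stereo b) (stereo c)) * sgn (A * B * C) = - sgn lam * sgn (\<kappa> - u \<bullet> n)"
    by (metis sgn_mult sgn_minus)
  moreover have "A * B * C > 0" using pos by (simp add: A_def B_def C_def)
  ultimately show ?thesis using \<kappa> by (simp add: lam_def N_def)
qed

end

lemma frame_exists:
  assumes "n \<in> sphere 0 1"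
  obtains p q where "frame p q n"
proof -
  have "n \<noteq> 0" using assms by auto
  then obtain p :: "real^3" where p: "p \<noteq> 0" "orthogonal n p"
    using cross_basis_nonzero[of n] orthogonal_cross(1) by (metis orthogonal_commute)
  define p' where "p' = p /\<^sub>R norm p"
  have a: "p' \<bullet> p' = 1" "n \<bullet> p' = 0" using p by (simp_all add: p'_def orthogonal_def dot_square_norm power2_eq_square field_simps)
  have n: "n \<bullet> n = 1" using assms by (simp add: dot_square_norm)
  define q where "q = cross3 n p'"
  have q: "q \<bullet> q = 1" unfolding q_def by (simp add: dot_cross a n inner_commute)
  have "frame p' q n"
  proof
    show "p' \<bullet> n = 0" using a(2) by (simp add: inner_commute)
    show "p' \<bullet> q = 0" "q \<bullet> n = 0" by (simp_all add: q_def dot_cross_self)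
    show "cross3 p' q = n" unfolding q_def Lagrange using a by (simp add: inner_commute)
  qed (use a n q in simp_all)
  then show ?thesis by (rule that)
qed

section \<open>First hits of small circles on the sphere\<close>

lemma first_hit_time:
  fixes g :: "real \<Rightarrow> real^3"
  assumes g: "path g" "pathstart g = u" and r: "r > 0" and s: "s \<in> {0..1}" "dist u (g s) \<ge> r"
  obtains t where "first_hit u r g = g t" "0 < t" "t \<le> s" "dist u (g t) = r"
    "\<And>x. x \<in> {0..<t} \<Longrightarrow> dist u (g x) < r"
proof -
  let ?A = "{t \<in> {0..1}. dist u (g t) = r}"
  have cont: "continuous_on {0..1} g" using g by (simp add: path_def)
  have cd: "continuous_on {0..b} (\<lambda>x. dist u (g x))" if "b \<le> 1" for b
    by (intro continuous_intros continuous_on_subset[OF cont]) (use that in auto)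
  have g0: "g 0 = u" using g by (simp add: pathstart_def)
  have hit: "\<exists>x\<in>{0..b}. dist u (g x) = r" if "b \<in> {0..1}" "dist u (g b) \<ge> r" for b
    using IVT'[of "\<lambda>x. dist u (g x)" 0 r b] that cd[of b] g0 r by auto
  have cl: "closed ?A"
    using continuous_closed_preimage[OF cd[of 1], of "{r}"] by (simp add: vimage_def Int_def)
  have ne: "?A \<noteq> {}"
  proof -
    obtain x where "x \<in> {0..s}" "dist u (g x) = r" using hit[OF s] by blast
    then have "x \<in> ?A" using s(1) by simp
    then show ?thesis by blast
  qed
  have bb: "bdd_below ?A" by (rule bdd_belowI[of _ 0]) auto
  define t where "t = Inf ?A"
  have t: "t \<in> ?A" unfolding t_def by (rule closed_contains_Inf[OF ne bb cl])
  have low: "t \<le> x" if "x \<in> ?A" for x unfolding t_def by (rule cInf_lower[OF that bb])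
  show ?thesis
  proof (rule that[of t])
    show "first_hit u r g = g t" by (simp add: first_hit_def t_def)
    show "0 < t" using t g0 r by (cases "t = 0") auto
    show "dist u (g t) = r" using t by simp
    show "t \<le> s" using hit[OF s] low s by fastforce
    fix x assume x: "x \<in> {0..<t}"
    show "dist u (g x) < r"
    proof (rule ccontr)
      assume "\<not> dist u (g x) < r"
      then obtain y where "y \<in> {0..x}" "dist u (g y) = r" using hit[of x] x t by auto
      then have "t \<le> y" using low[of y] x t by auto
      then show False using x \<open>y \<in> {0..x}\<close> by auto
    qed
  qed
qed

definition hit_sign :: "real^3 \<Rightarrow> real \<Rightarrow> (real \<Rightarrow> real^3) \<Rightarrow> (real \<Rightarrow> real^3) \<Rightarrow> (real \<Rightarrow> real^3) \<Rightarrow> real" where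
  "hit_sign u r g0 g1 g2 =
     u \<bullet> cross3 (first_hit u r g1 - first_hit u r g0) (first_hit u r g2 - first_hit u r g0)"

lemma hit_sign_swap: "hit_sign u r g0 g2 g1 = - hit_sign u r g0 g1 g2"
  unfolding hit_sign_def by (metis cross_skew inner_minus_right)

lemma ccw_curves_hit_sign:
  "ccw_curves u g0 g1 g2 \<longleftrightarrow> (\<forall>\<^sub>F r in at_right 0. hit_sign u r g0 g1 g2 > 0)"
  by (simp add: ccw_curves_def hit_sign_def)

lemma sphere_dist:
  fixes u x :: "real^3"
  assumes "u \<in> sphere 0 1" "x \<in> sphere 0 1"
  shows "(dist u x)\<^sup>2 = 2 - 2 * (u \<bullet> x)"
proof -
  have "u \<bullet> u = 1" "x \<bullet> x = 1" using assms by (simp_all add: dot_square_norm)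
  then show ?thesis unfolding dist_norm power2_norm_eq_inner
    by (simp add: inner_diff_left inner_diff_right inner_commute)
qed

lemma sphere_dist_less:
  fixes u x :: "real^3"
  assumes "u \<in> sphere 0 1" "x \<in> sphere 0 1" "r > 0"
  shows "dist u x < r \<longleftrightarrow> u \<bullet> x > 1 - r\<^sup>2 / 2" "dist u x = r \<longleftrightarrow> u \<bullet> x = 1 - r\<^sup>2 / 2"
proof -
  have "dist u x < r \<longleftrightarrow> (dist u x)\<^sup>2 < r\<^sup>2" using assms(3) power_strict_mono[of "dist u x" r 2] power_less_imp_less_base[of "dist u x" 2 r] by auto
  also have "\<dots> \<longleftrightarrow> u \<bullet> x > 1 - r\<^sup>2 / 2" unfolding sphere_dist[OF assms(1,2)] by (rule iffI; linarith)
  finally show "dist u x < r \<longleftrightarrow> u \<bullet> x > 1 - r\<^sup>2 / 2" .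
  have "dist u x = r \<longleftrightarrow> (dist u x)\<^sup>2 = r\<^sup>2" using assms(3) by (simp add: power2_eq_iff_nonneg)
  also have "\<dots> \<longleftrightarrow> u \<bullet> x = 1 - r\<^sup>2 / 2" unfolding sphere_dist[OF assms(1,2)] by (rule iffI; linarith)
  finally show "dist u x = r \<longleftrightarrow> u \<bullet> x = 1 - r\<^sup>2 / 2" .
qed

lemma (in frame) n_sphere: "n \<in> sphere 0 1"
  using unit(3) by (simp add: norm_eq_sqrt_inner)

text \<open>On the unit sphere a distance less than \<open>r\<close> from \<open>u\<close> means an
  inner product with \<open>u\<close> above \<open>1 - r\<^sup>2 / 2\<close>. With this value of
  \<kappa> the cap projects to the displayed disc, and first hitting the circle of radius
  \<open>r\<close> becomes leaving that disc.\<close>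

lemma (in frame) first_hit_exits:
  fixes g :: "real \<Rightarrow> real^3"
  assumes g: "path g" "pathstart g = u" "path_image g \<subseteq> sphere 0 1" and r: "0 < r" "r < dist u n"
    and s: "s \<in> {0..1}" "dist u (g s) \<ge> r" and n: "n \<notin> g ` {0..s}"
  obtains t where "first_hit u r g = g t" "0 < t" "t \<le> s"
    "u \<bullet> g t = 1 - r\<^sup>2 / 2" "g t \<in> sphere 0 1" "g t \<noteq> n"
    "exits (stereo \<circ> g) (Complex ((u \<bullet> p) / (1 - r\<^sup>2 / 2 - u \<bullet> n)) ((u \<bullet> q) / (1 - r\<^sup>2 / 2 - u \<bullet> n)))
      (sqrt (1 - (1 - r\<^sup>2 / 2)\<^sup>2) / (1 - r\<^sup>2 / 2 - u \<bullet> n)) t"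
proof -
  obtain t where t: "first_hit u r g = g t" "0 < t" "t \<le> s" "dist u (g t) = r"
    "\<And>x. x \<in> {0..<t} \<Longrightarrow> dist u (g x) < r"
    using first_hit_time[OF g(1,2) r(1) s] by blast
  have u: "u \<in> sphere 0 1" using g(2,3) pathstart_in_path_image by blast
  have \<kappa>: "u \<bullet> n < 1 - r\<^sup>2 / 2"
    using sphere_dist_less[OF u n_sphere r(1)] r(2) by (smt (verit))
  have k1: "1 - r\<^sup>2 / 2 < 1" using r by simp
  have gs: "g x \<in> sphere 0 1" "g x \<noteq> n" if "x \<in> {0..t}" for x
  proof -
    have "x \<in> {0..1}" "x \<in> {0..s}" using that t(3) s(1) by auto
    then have "g x \<in> path_image g" "g x \<in> g ` {0..s}" by (simp_all add: path_image_def)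
    then show "g x \<in> sphere 0 1" "g x \<noteq> n" using g(3) n by blast+
  qed
  show ?thesis
  proof (rule that[OF t(1-3)])
    show k: "u \<bullet> g t = 1 - r\<^sup>2 / 2" using sphere_dist_less(2)[OF u gs(1) r(1)] t by auto
    show "g t \<in> sphere 0 1" "g t \<noteq> n" using gs[of t] t by auto
    show "exits (stereo \<circ> g) (Complex ((u \<bullet> p) / (1 - r\<^sup>2 / 2 - u \<bullet> n)) ((u \<bullet> q) / (1 - r\<^sup>2 / 2 - u \<bullet> n)))
      (sqrt (1 - (1 - r\<^sup>2 / 2)\<^sup>2) / (1 - r\<^sup>2 / 2 - u \<bullet> n)) t"
      unfolding exits_def o_def
    proof (intro conjI ballI)
      fix x assume x: "x \<in> {0..<t}"
      then have "x \<in> {0..t}" by simp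
      note gx = gs[OF this]
      show "stereo (g x) \<in> ball (Complex ((u \<bullet> p) / (1 - r\<^sup>2 / 2 - u \<bullet> n)) ((u \<bullet> q) / (1 - r\<^sup>2 / 2 - u \<bullet> n)))
          (sqrt (1 - (1 - r\<^sup>2 / 2)\<^sup>2) / (1 - r\<^sup>2 / 2 - u \<bullet> n))"
        by (rule stereo_cap(1)[OF u \<kappa> gx k1]) (use sphere_dist_less(1)[OF u gx(1) r(1)] t(5)[OF x] in simp)
    next
      have "t \<in> {0..t}" using t by simp
      note gt = gs[OF this]
      show "stereo (g t) \<in> sphere (Complex ((u \<bullet> p) / (1 - r\<^sup>2 / 2 - u \<bullet> n)) ((u \<bullet> q) / (1 - r\<^sup>2 / 2 - u \<bullet> n)))
          (sqrt (1 - (1 - r\<^sup>2 / 2)\<^sup>2) / (1 - r\<^sup>2 / 2 - u \<bullet> n))"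
        by (rule stereo_cap(2)[OF u \<kappa> gt k1 k])
    qed (rule t)
  qed
qed

text \<open>Projection from the antipode of \<open>u\<close> turns the small circles around
  \<open>u\<close> into plane circles, all exited by the same three plane curves, and the
  orientation at the exit is the same for all of them. So the order of the first points cannot
  oscillate as the radius shrinks.\<close>

lemma hit_sign_constant:
  fixes g1 g2 g3 :: "real \<Rightarrow> real^3"
  assumes g: "path g1" "path g2" "path g3" "pathstart g1 = u" "pathstart g2 = u" "pathstart g3 = u"
    and sub: "path_image g1 \<subseteq> sphere 0 1" "path_image g2 \<subseteq> sphere 0 1" "path_image g3 \<subseteq> sphere 0 1"
    and T: "0 < T" "T \<le> 1"
    and dis: "\<And>s t. s \<in> {0..T} \<Longrightarrow> t \<in> {0..T} \<Longrightarrow> (s, t) \<noteq> (0, 0) \<Longrightarrow> g1 s \<noteq> g3 t \<and> g2 s \<noteq> g1 t \<and> g3 s \<noteq> g2 t"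
  shows "\<exists>R>0. \<forall>r. 0 < r \<longrightarrow> r \<le> R \<longrightarrow>
    hit_sign u r g1 g2 g3 \<noteq> 0 \<and> sgn (hit_sign u r g1 g2 g3) = sgn (hit_sign u R g1 g2 g3)"
proof -
  have u: "u \<in> sphere 0 1" using g(4) sub(1) pathstart_in_path_image by blast
  have g0: "g1 0 = u" "g2 0 = u" "g3 0 = u" using g by (auto simp: pathstart_def)
  have near: "\<exists>d>0. \<forall>x\<in>{0..1}. x < d \<longrightarrow> dist u (f x) < 2" if "path f" "f 0 = u" for f :: "real \<Rightarrow> real^3"
  proof -
    have "continuous_on {0..1} f" using that by (simp add: path_def)
    then obtain d where "d > 0" "\<forall>x\<in>{0..1}. dist x 0 < d \<longrightarrow> dist (f x) (f 0) < 2"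
      unfolding continuous_on_iff by (metis atLeastAtMost_iff order_refl zero_le_one zero_less_numeral)
    then show ?thesis using that by (intro exI[of _ d]) (auto simp: dist_commute)
  qed
  obtain d1 d2 d3 where d: "d1 > 0" "d2 > 0" "d3 > 0"
     "\<forall>x\<in>{0..1}. x < d1 \<longrightarrow> dist u (g1 x) < 2" "\<forall>x\<in>{0..1}. x < d2 \<longrightarrow> dist u (g2 x) < 2"
     "\<forall>x\<in>{0..1}. x < d3 \<longrightarrow> dist u (g3 x) < 2"
    using near[OF g(1) g0(1)] near[OF g(2) g0(2)] near[OF g(3) g0(3)] by metis
  \<comment> \<open>Up to time \<open>S\<close> no curve reaches the antipode, which is at distance
    2 from \<open>u\<close>.\<close>
  define S where "S = min T (min (d1/2) (min (d2/2) (d3/2)))"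
  have S: "0 < S" "S \<le> T" "S < d1" "S < d2" "S < d3" unfolding S_def using T d by linarith+
  have far: "dist u (g1 S) > 0" "dist u (g2 S) > 0" "dist u (g3 S) > 0"
    using dis[of S 0] S g0 by auto
  \<comment> \<open>Every curve reaches each radius up to \<open>R\<close> by time \<open>S\<close>;
    the bound 1 keeps the antipode outside of these circles.\<close>
  define R where "R = min 1 (min (dist u (g1 S)) (min (dist u (g2 S)) (dist u (g3 S))))"
  have R: "0 < R" "R \<le> 1" "R \<le> dist u (g1 S)" "R \<le> dist u (g2 S)" "R \<le> dist u (g3 S)"
    unfolding R_def using far by auto
  have S1: "S \<in> {0..1}" using S T by simp
  obtain p q where fr: "frame p q (- u)" using frame_exists[of "- u"] u by auto
  interpret frame p q "- u" by (rule fr)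
  have du: "dist u (- u) = 2" using u by (simp add: dist_norm flip: scaleR_2)
  have off: "- u \<notin> g1 ` {0..S}" "- u \<notin> g2 ` {0..S}" "- u \<notin> g3 ` {0..S}"
    using d S S1 du by (auto, (metis atLeastAtMost_iff less_irrefl order.strict_trans1 order_trans)+)
  have inS: "f x \<in> sphere 0 1 - {- u}" if "path_image f \<subseteq> sphere 0 1" "- u \<notin> f ` {0..S}" "x \<in> {0..S}"
    for f :: "real \<Rightarrow> real^3" and x
  proof -
    have "x \<in> {0..1}" using that(3) S1 by auto
    then have "f x \<in> path_image f" "f x \<in> f ` {0..S}" using that(3) by (simp_all add: path_image_def)
    then show ?thesis using that(1,2) by (metis DiffI singletonD subsetD)
  qed
  have cS: "continuous_on {0..S} (stereo \<circ> f)" if "path f" "path_image f \<subseteq> sphere 0 1" "- u \<notin> f ` {0..S}" for f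
  proof (rule continuous_on_compose)
    show "continuous_on {0..S} f"
      by (rule continuous_on_subset[OF that(1)[unfolded path_def]]) (use S1 in auto)
    have "f ` {0..S} \<subseteq> sphere 0 1 - {- u}" by (rule image_subsetI) (rule inS[OF that(2,3)])
    then show "continuous_on (f ` {0..S}) stereo"
      by (rule continuous_on_subset[OF continuous_on_stereo])
  qed
  have st_ne: "stereo x \<noteq> stereo y" if "x \<noteq> y" "x \<in> sphere 0 1 - {- u}" "y \<in> sphere 0 1 - {- u}" for x y
    using inj_on_stereo that by (auto simp: inj_on_def)
  have dis': "(stereo \<circ> g1) s \<noteq> (stereo \<circ> g3) t \<and> (stereo \<circ> g2) s \<noteq> (stereo \<circ> g1) t \<and> (stereo \<circ> g3) s \<noteq> (stereo \<circ> g2) t"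
    if "s \<in> {0..S}" "t \<in> {0..S}" "(s, t) \<noteq> (0, 0)" for s t
  proof -
    have "g1 s \<noteq> g3 t \<and> g2 s \<noteq> g1 t \<and> g3 s \<noteq> g2 t" using dis[of s t] that S by auto
    then show ?thesis unfolding o_def using st_ne inS[OF sub(1) off(1)] inS[OF sub(2) off(2)] inS[OF sub(3) off(3)] that by metis
  qed
  let ?c = "\<lambda>r. Complex ((u \<bullet> p) / (1 - r\<^sup>2 / 2 - u \<bullet> - u)) ((u \<bullet> q) / (1 - r\<^sup>2 / 2 - u \<bullet> - u))"
  let ?\<rho> = "\<lambda>r. sqrt (1 - (1 - r\<^sup>2 / 2)\<^sup>2) / (1 - r\<^sup>2 / 2 - u \<bullet> - u)"
  have main: "\<exists>t1 t2 t3. exits (stereo \<circ> g1) (?c r) (?\<rho> r) t1 \<and> exits (stereo \<circ> g2) (?c r) (?\<rho> r) t2 \<and>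
      exits (stereo \<circ> g3) (?c r) (?\<rho> r) t3 \<and> t1 \<le> S \<and> t2 \<le> S \<and> t3 \<le> S \<and>
      sgn (orient ((stereo \<circ> g1) t1) ((stereo \<circ> g2) t2) ((stereo \<circ> g3) t3)) = - sgn (hit_sign u r g1 g2 g3)"
    if r: "0 < r" "r \<le> R" for r
  proof -
    have rn: "r < dist u (- u)" using r R du by simp
    obtain t1 where t1: "first_hit u r g1 = g1 t1" "t1 \<le> S"
      "u \<bullet> g1 t1 = 1 - r\<^sup>2 / 2" "g1 t1 \<in> sphere 0 1" "g1 t1 \<noteq> - u" "exits (stereo \<circ> g1) (?c r) (?\<rho> r) t1"
      by (rule first_hit_exits[OF g(1,4) sub(1) r(1) rn S1 _ off(1)]) (use r R in auto)
    obtain t2 where t2: "first_hit u r g2 = g2 t2" "t2 \<le> S"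
      "u \<bullet> g2 t2 = 1 - r\<^sup>2 / 2" "g2 t2 \<in> sphere 0 1" "g2 t2 \<noteq> - u" "exits (stereo \<circ> g2) (?c r) (?\<rho> r) t2"
      by (rule first_hit_exits[OF g(2,5) sub(2) r(1) rn S1 _ off(2)]) (use r R in auto)
    obtain t3 where t3: "first_hit u r g3 = g3 t3" "t3 \<le> S"
      "u \<bullet> g3 t3 = 1 - r\<^sup>2 / 2" "g3 t3 \<in> sphere 0 1" "g3 t3 \<noteq> - u" "exits (stereo \<circ> g3) (?c r) (?\<rho> r) t3"
      by (rule first_hit_exits[OF g(3,6) sub(3) r(1) rn S1 _ off(3)]) (use r R in auto)
    have \<kappa>: "u \<bullet> - u < 1 - r\<^sup>2 / 2"
      using sphere_dist_less[OF u n_sphere r(1)] rn by (smt (verit))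
    have "sgn (orient (stereo (g1 t1)) (stereo (g2 t2)) (stereo (g3 t3))) = - sgn (hit_sign u r g1 g2 g3)"
      unfolding hit_sign_def t1(1) t2(1) t3(1)
      by (rule stereo_orient[OF u \<kappa>]) (use t1 t2 t3 in auto)
    then show ?thesis using t1 t2 t3 unfolding o_def by blast
  qed
  note const = orientation_at_start_constant[OF S(1) cS[OF g(1) sub(1) off(1)] cS[OF g(2) sub(2) off(2)] cS[OF g(3) sub(3) off(3)],
     of "stereo u"]
  have s0: "(stereo \<circ> g1) 0 = stereo u" "(stereo \<circ> g2) 0 = stereo u" "(stereo \<circ> g3) 0 = stereo u" using g0 by auto
  show ?thesis
  proof (intro exI[of _ R] conjI allI impI R(1))
    fix r assume r: "0 < r" "r \<le> R"
    obtain t1 t2 t3 where t: "exits (stereo \<circ> g1) (?c r) (?\<rho> r) t1" "exits (stereo \<circ> g2) (?c r) (?\<rho> r) t2"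
      "exits (stereo \<circ> g3) (?c r) (?\<rho> r) t3" "t1 \<le> S" "t2 \<le> S" "t3 \<le> S"
      "sgn (orient ((stereo \<circ> g1) t1) ((stereo \<circ> g2) t2) ((stereo \<circ> g3) t3)) = - sgn (hit_sign u r g1 g2 g3)"
      using main[OF r] by blast
    have "orient ((stereo \<circ> g1) t1) ((stereo \<circ> g2) t2) ((stereo \<circ> g3) t3) \<noteq> 0"
      by (rule const(1)[OF s0 dis' t(1-6) t(1-6)])
    then show "hit_sign u r g1 g2 g3 \<noteq> 0" using t(7) by (metis sgn_0 sgn_0_0 minus_zero)
    have r': "0 < R" "R \<le> R" using R by auto
    obtain s1 s2 s3 where s: "exits (stereo \<circ> g1) (?c R) (?\<rho> R) s1" "exits (stereo \<circ> g2) (?c R) (?\<rho> R) s2"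
      "exits (stereo \<circ> g3) (?c R) (?\<rho> R) s3" "s1 \<le> S" "s2 \<le> S" "s3 \<le> S"
      "sgn (orient ((stereo \<circ> g1) s1) ((stereo \<circ> g2) s2) ((stereo \<circ> g3) s3)) = - sgn (hit_sign u R g1 g2 g3)"
      using main[OF r'] by blast
    show "sgn (hit_sign u r g1 g2 g3) = sgn (hit_sign u R g1 g2 g3)"
      using const(2)[OF s0 dis' t(1-6) s(1-6)] t(7) s(7) by simp
  qed
qed

text \<open>Among three points of a disc in the image one has the middle parameter. Removing it
  leaves the disc connected but separates the parameters of the other two, against the continuity of
  the inverse of the arc.\<close>

lemma arc_image_interior_empty:
  fixes g :: "real \<Rightarrow> complex"
  assumes "arc g"
  shows "interior (path_image g) = {}"
proof (rule ccontr)
  assume "interior (path_image g) \<noteq> {}"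
  then obtain x e where e: "e > 0" "ball x e \<subseteq> path_image g"
    by (meson ex_in_conv mem_interior)
  obtain q where q: "homeomorphism {0..1} (path_image g) g q"
    using homeomorphism_arc[OF assms] by blast
  have q1: "continuous_on (path_image g) q" "\<And>y. y \<in> path_image g \<Longrightarrow> q y \<in> {0..1} \<and> g (q y) = y"
      "\<And>s. s \<in> {0..1} \<Longrightarrow> q (g s) = s"
    using q by (auto simp: homeomorphism_def)
  let ?B = "ball x e"
  have conn: "connected (q ` (?B - {y}))" if "y \<in> ?B" for y
  proof (rule connected_continuous_image)
    show "continuous_on (?B - {y}) q" by (rule continuous_on_subset[OF q1(1)]) (use e in auto)
    show "connected (?B - {y})" by (rule connected_open_delete) auto
  qed
  have inj: "q y = q z \<Longrightarrow> y = z" if "y \<in> ?B" "z \<in> ?B" for y z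
    using q1(2) e that by (metis subsetD)
  obtain y z w where yzw: "y \<in> ?B" "z \<in> ?B" "w \<in> ?B" "y \<noteq> z" "z \<noteq> w" "y \<noteq> w"
  proof -
    have "x \<in> ?B" "x + of_real (e/2) \<in> ?B" "x - of_real (e/2) \<in> ?B"
      using e by (auto simp: dist_norm)
    moreover have "x \<noteq> x + of_real (e/2)" "x + of_real (e/2) \<noteq> x - of_real (e/2)" "x \<noteq> x - of_real (e/2)"
      using e by (auto simp: complex_eq_iff)
    ultimately show ?thesis using that by blast
  qed
  have no: False if "a \<in> ?B" "b \<in> ?B" "c \<in> ?B" "q a < q b" "q b < q c" for a b c
  proof -
    have "q a \<in> q ` (?B - {b})" "q c \<in> q ` (?B - {b})" using that by auto
    then have "q b \<in> q ` (?B - {b})"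
      using connectedD_interval[OF conn[OF that(2)], of "q a" "q c" "q b"] that by auto
    then show False using inj that(2) by auto
  qed
  have "q y \<noteq> q z" "q z \<noteq> q w" "q y \<noteq> q w" using inj yzw by blast+
  then consider "q y < q z \<and> q z < q w" | "q y < q w \<and> q w < q z" | "q z < q y \<and> q y < q w"
     | "q z < q w \<and> q w < q y" | "q w < q y \<and> q y < q z" | "q w < q z \<and> q z < q y" by linarith
  then show False by cases (use no yzw in blast)+
qed

lemma (in frame) arc_stereo:
  assumes "arc g" "path_image g \<subseteq> sphere 0 1 - {n}"
  shows "arc (stereo \<circ> g)" "path_image (stereo \<circ> g) = stereo ` path_image g"
proof -
  show "arc (stereo \<circ> g)" unfolding arc_def
  proof
    show "path (stereo \<circ> g)"
      by (rule path_continuous_image[OF arc_imp_path[OF assms(1)] continuous_on_subset[OF continuous_on_stereo assms(2)]])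
    show "inj_on (stereo \<circ> g) {0..1}"
      using assms(1) inj_on_subset[OF inj_on_stereo assms(2)] unfolding arc_def path_image_def
      by (intro comp_inj_on) auto
  qed
qed (simp add: path_image_compose)

text \<open>After projection from \<open>u\<close> each arc without an initial piece is a closed set
  with empty interior, and so is the union of the three. The initial pieces stay within half the
  distance from \<open>u\<close> to \<open>w\<close>; if the arcs covered the sphere, a
  neighbourhood of \<open>w\<close> would be covered by the remaining pieces.\<close>

lemma arcs_miss_point:
  fixes g1 g2 g3 :: "real \<Rightarrow> real^3"
  assumes arcs: "arc g1" "arc g2" "arc g3"
    and start: "pathstart g1 = u" "pathstart g2 = u" "pathstart g3 = u"
    and fin: "pathfinish g1 = w"
    and sub: "path_image g1 \<subseteq> sphere 0 1" "path_image g2 \<subseteq> sphere 0 1" "path_image g3 \<subseteq> sphere 0 1"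
  obtains n where "n \<in> sphere 0 1" "n \<notin> path_image g1 \<union> path_image g2 \<union> path_image g3"
proof (rule ccontr)
  assume "\<not> thesis"
  then have cover: "sphere 0 1 \<subseteq> path_image g1 \<union> path_image g2 \<union> path_image g3" using that by blast
  have u: "u \<in> sphere 0 1" using start(1) sub(1) pathstart_in_path_image by blast
  have w: "w \<in> sphere 0 1" using fin sub(1) pathfinish_in_path_image by blast
  have uw: "u \<noteq> w" using arc_distinct_ends[OF arcs(1)] start fin by simp
  obtain p q where fr: "frame p q u" using frame_exists u by blast
  interpret frame p q u by (rule fr)
  define d where "d = dist u w / 2"
  have d: "d > 0" using uw by (simp add: d_def)
  have tail: "\<exists>e\<in>{0<..<1}. \<forall>x\<in>{0..e}. dist (g x) u < d" if "arc g" "pathstart g = u" for g :: "real \<Rightarrow> real^3"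
  proof -
    have "continuous_on {0..1} g" using that by (simp add: arc_def path_def)
    then obtain k where "k > 0" "\<forall>x\<in>{0..1}. dist x 0 < k \<longrightarrow> dist (g x) (g 0) < d"
      unfolding continuous_on_iff using d by (metis atLeastAtMost_iff order_refl zero_le_one)
    then show ?thesis using that(2)
      by (intro bexI[of _ "min (1/2) (k/2)"]) (auto simp: pathstart_def)
  qed
  have small: "interior (stereo ` (g ` {e..1})) = {} \<and> closed (stereo ` (g ` {e..1}))"
    if "arc g" "pathstart g = u" "path_image g \<subseteq> sphere 0 1" "e \<in> {0<..<1}" for g e
  proof -
    have a: "arc (subpath e 1 g)" using that(1,4) by (intro arc_subpath_arc) auto
    have im: "path_image (subpath e 1 g) = g ` {e..1}" using that(4) by (simp add: path_image_subpath)
    have "u \<notin> g ` {e..1}"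
    proof
      assume "u \<in> g ` {e..1}"
      then obtain x where x: "x \<in> {e..1}" "u = g x" by blast
      then have x0: "g 0 = g x" using that(2) by (simp add: pathstart_def)
      have "inj_on g {0..1}" using that(1) by (simp add: arc_def)
      then have "0 = x" using inj_onD[of g "{0..1}" 0 x] x0 x(1) that(4) by auto
      then show False using x that(4) by simp
    qed
    moreover have "g ` {e..1} \<subseteq> path_image g" using that(4) by (auto simp: path_image_def)
    ultimately have "path_image (subpath e 1 g) \<subseteq> sphere 0 1 - {u}" using that(3) im by auto
    note s = arc_stereo[OF a this]
    show ?thesis using arc_image_interior_empty[OF s(1)] closed_path_image[OF arc_imp_path[OF s(1)]]
      unfolding s(2) im by simp
  qed
  obtain e1 e2 e3 where e: "e1 \<in> {0<..<1}" "e2 \<in> {0<..<1}" "e3 \<in> {0<..<1}"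
    and near: "\<forall>x\<in>{0..e1}. dist (g1 x) u < d" "\<forall>x\<in>{0..e2}. dist (g2 x) u < d" "\<forall>x\<in>{0..e3}. dist (g3 x) u < d"
    using tail[OF arcs(1) start(1)] tail[OF arcs(2) start(2)] tail[OF arcs(3) start(3)] by blast
  define A where "A = stereo ` (g1 ` {e1..1}) \<union> (stereo ` (g2 ` {e2..1}) \<union> stereo ` (g3 ` {e3..1}))"
  note sm = small[OF arcs(1) start(1) sub(1) e(1)] small[OF arcs(2) start(2) sub(2) e(2)] small[OF arcs(3) start(3) sub(3) e(3)]
  have "interior (stereo ` (g2 ` {e2..1}) \<union> stereo ` (g3 ` {e3..1})) = {}"
    using sm interior_closed_Un_empty_interior by metis
  then have iA: "interior A = {}" unfolding A_def
    using sm interior_closed_Un_empty_interior by metis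
  define W where "W = unstereo -` ball w d"
  have "open W" unfolding W_def using continuous_on_unstereo[of UNIV] by (simp add: open_vimage)
  moreover have "stereo w \<in> W" unfolding W_def using unstereo_stereo[of w] w uw d by auto
  moreover have "W \<subseteq> A"
  proof
    fix z assume z: "z \<in> W"
    define y where "y = unstereo z"
    have y: "y \<in> sphere 0 1" "y \<in> ball w d" "stereo y = z"
      using z unstereo_props[of z] by (auto simp: W_def y_def)
    have far: "dist y u \<ge> d"
      using y(2) dist_triangle[of u w y] by (simp add: d_def dist_commute)
    have *: "y \<in> g ` {e..1}" if "y \<in> path_image g" "\<forall>x\<in>{0..e}. dist (g x) u < d" for g e
    proof -
      obtain x where x: "x \<in> {0..1}" "y = g x" using \<open>y \<in> path_image g\<close> by (auto simp: path_image_def)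
      have "\<not> x \<le> e"
      proof
        assume "x \<le> e"
        then have "dist (g x) u < d" using that(2) x by auto
        then show False using far x by simp
      qed
      then show ?thesis using x by auto
    qed
    have "y \<in> path_image g1 \<union> path_image g2 \<union> path_image g3" using cover y by blast
    then have "y \<in> g1 ` {e1..1} \<union> (g2 ` {e2..1} \<union> g3 ` {e3..1})" using * near by blast
    then show "z \<in> A" unfolding A_def y(3)[symmetric] by blast
  qed
  ultimately have "stereo w \<in> interior A" by (meson interiorI)
  then show False using iA by simp
qed

text \<open>If the third arc lies outside of the closed curve formed by the first two, seen from the
  point \<open>n\<close>, then it lies inside when seen from a point of the inside.\<close>

lemma theta_frame:
  fixes g1 g2 g3 :: "real \<Rightarrow> real^3"
  assumes arcs: "arc g1" "arc g2" "arc g3"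
    and start: "pathstart g1 = u" "pathstart g2 = u" "pathstart g3 = u"
    and fin: "pathfinish g1 = w" "pathfinish g2 = w" "pathfinish g3 = w"
    and int: "path_image g1 \<inter> path_image g2 = {u, w}" "path_image g1 \<inter> path_image g3 = {u, w}"
      "path_image g2 \<inter> path_image g3 = {u, w}"
    and sub: "path_image g1 \<subseteq> sphere 0 1" "path_image g2 \<subseteq> sphere 0 1" "path_image g3 \<subseteq> sphere 0 1"
  obtains p q n where "frame p q n" "n \<notin> path_image g1 \<union> path_image g2 \<union> path_image g3"
    "frame.stereo p q n ` path_image g3 \<inter>
      inside (frame.stereo p q n ` path_image g1 \<union> frame.stereo p q n ` path_image g2) \<noteq> {}"
proof -
  obtain n where n: "n \<in> sphere 0 1" "n \<notin> path_image g1 \<union> path_image g2 \<union> path_image g3"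
    by (rule arcs_miss_point[OF arcs start fin(1) sub])
  obtain p q where fr: "frame p q n" using frame_exists[OF n(1)] by blast
  let ?s = "frame.stereo p q n"
  let ?J = "path_image g1 \<union> path_image g2"
  have sub': "path_image g1 \<subseteq> sphere 0 1 - {n}" "path_image g2 \<subseteq> sphere 0 1 - {n}" "path_image g3 \<subseteq> sphere 0 1 - {n}"
    using sub n by auto
  show ?thesis
  proof (cases "?s ` path_image g3 \<inter> inside (?s ` ?J) \<noteq> {}")
    case True
    then show ?thesis using that[OF fr n(2)] by (simp add: image_Un)
  next
    case False
    interpret F: frame p q n by (rule fr)
    define J where "J = F.stereo ` ?J"
    define I where "I = inside J"
    have aF: "arc (F.stereo \<circ> g1)" "arc (F.stereo \<circ> g2)"
      and imF: "path_image (F.stereo \<circ> g1) = F.stereo ` path_image g1" "path_image (F.stereo \<circ> g2) = F.stereo ` path_image g2"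
      using F.arc_stereo arcs sub' by auto
    have st: "pathstart (F.stereo \<circ> g) = F.stereo (pathstart g)" "pathfinish (F.stereo \<circ> g) = F.stereo (pathfinish g)" for g
      by (auto simp: pathstart_def pathfinish_def)
    have "F.stereo ` path_image g1 \<inter> F.stereo ` path_image g2 = F.stereo ` {u, w}"
      unfolding int(1)[symmetric] by (rule inj_on_image_Int[OF F.inj_on_stereo sub'(1,2), symmetric])
    then have sp: "simple_path ((F.stereo \<circ> g1) +++ reversepath (F.stereo \<circ> g2))"
      using aF start fin by (subst simple_path_join_loop_eq) (auto simp: arc_reversepath st imF)
    have pJ: "path_image ((F.stereo \<circ> g1) +++ reversepath (F.stereo \<circ> g2)) = J"
      using fin by (subst path_image_join) (auto simp: st imF J_def image_Un)
    have jo: "I \<noteq> {}" "open I" "bounded I" "I \<inter> J = {}"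
      using Jordan_inside_outside[OF sp] start inside_no_overlap[of J] unfolding pJ I_def by (auto simp: st)
    have cJ: "compact J" unfolding pJ[symmetric] by (rule compact_path_image[OF simple_path_imp_path[OF sp]])
    have "frontier I \<subseteq> J" unfolding I_def by (rule frontier_inside_subset[OF compact_imp_closed[OF cJ]])
    then have cIJ: "closed (I \<union> J)" using jo(2) cJ
      by (metis closure_Un_frontier closed_Un closed_closure compact_imp_closed sup.absorb_iff2 sup_assoc sup_commute)
    have kIJ: "compact (I \<union> J)" using cIJ jo(3) cJ by (simp add: compact_eq_bounded_closed bounded_Un)
    obtain z where z: "z \<in> I" using jo(1) by blast
    define m where "m = F.unstereo z"
    have m: "m \<in> sphere 0 1" "m \<noteq> n" "F.stereo m = z" using F.unstereo_props[of z] by (auto simp: m_def)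
    obtain p' q' where fr': "frame p' q' m" using frame_exists[OF m(1)] by blast
    interpret G: frame p' q' m by (rule fr')
    define A where "A = F.unstereo ` I"
    define K where "K = F.unstereo ` (I \<union> J)"
    have KJ: "K = A \<union> ?J"
    proof -
      have "F.unstereo (F.stereo x) = x" if "x \<in> ?J" for x
        using sub' that by (intro F.unstereo_stereo) auto
      then have "F.unstereo ` J = (\<lambda>x. x) ` ?J" unfolding J_def image_image by (rule image_cong[OF refl])
      then have "F.unstereo ` J = ?J" by simp
      then show ?thesis by (simp add: K_def A_def image_Un)
    qed
    have "compact K" unfolding K_def by (rule compact_continuous_image[OF F.continuous_on_unstereo kIJ])
    then have "closed K" by (rule compact_imp_closed)
    have notI: "x \<notin> A" if "x \<in> ?J" for x
    proof
      assume "x \<in> A"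
      then obtain y where y: "y \<in> I" "x = F.unstereo y" by (auto simp: A_def)
      then have "F.stereo x = y" using F.unstereo_props by simp
      then have "y \<in> J" using that unfolding J_def by blast
      then show False using y jo(4) by blast
    qed
    have n3: "x \<notin> A" if "x \<in> path_image g3" for x
    proof
      assume "x \<in> A"
      then obtain y where y: "y \<in> I" "x = F.unstereo y" by (auto simp: A_def)
      then have "F.stereo x = y" using F.unstereo_props by simp
      then show False using y False that by (auto simp: J_def I_def)
    qed
    have mA: "m \<in> A" using z by (auto simp: A_def m_def)
    have off: "m \<notin> path_image g1 \<union> path_image g2 \<union> path_image g3" using notI n3 mA by blast
    have sub2: "path_image g1 \<subseteq> sphere 0 1 - {m}" "path_image g2 \<subseteq> sphere 0 1 - {m}" "path_image g3 \<subseteq> sphere 0 1 - {m}"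
      using sub off by auto
    define N where "N = {x \<in> sphere 0 1 - {n}. F.stereo x \<in> I}"
    have NA: "N \<subseteq> A" using F.unstereo_stereo by (force simp: N_def A_def)
    obtain e where e: "e > 0" "ball z e \<subseteq> I" using jo(2) z by (meson openE)
    \<comment> \<open>\<open>A\<close> contains all points of the sphere close to the new pole. A
      set avoiding \<open>A\<close> therefore has a bounded projection from
      \<open>m\<close>.\<close>
    obtain \<delta> where \<delta>: "\<delta> > 0" "\<And>x. x \<in> sphere 0 1 \<Longrightarrow> dist x m < \<delta> \<Longrightarrow> x \<in> A"
    proof -
      have "continuous (at m within (sphere 0 1 - {n})) F.stereo"
        using F.continuous_on_stereo m by (auto simp: continuous_on_eq_continuous_within)
      then obtain \<delta>1 where d1: "\<delta>1 > 0" "\<And>x. x \<in> sphere 0 1 - {n} \<Longrightarrow> dist x m < \<delta>1 \<Longrightarrow> dist (F.stereo x) (F.stereo m) < e"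
        using e(1) unfolding continuous_within_eps_delta by blast
      show ?thesis
      proof (rule that[of "min \<delta>1 (dist n m)"])
        show "min \<delta>1 (dist n m) > 0" using d1 m(2) by auto
        fix x assume x: "x \<in> sphere 0 1" "dist x m < min \<delta>1 (dist n m)"
        then have "x \<noteq> n" by auto
        then have "dist (F.stereo x) z < e" using d1(2)[of x] x m(3) by auto
        then have "F.stereo x \<in> I" using e(2) by (auto simp: dist_commute)
        then have "x \<in> N" using x \<open>x \<noteq> n\<close> by (simp add: N_def)
        then show "x \<in> A" using NA by blast
      qed
    qed
    define J' where "J' = G.stereo ` ?J"
    obtain h where h: "h \<in> path_image g3" "h \<notin> {u, w}"
    proof -
      have "g3 (1/2) \<in> path_image g3" by (auto simp: path_image_def)
      moreover have "inj_on g3 {0..1}" using arcs(3) by (simp add: arc_def)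
      then have "g3 (1/2) \<noteq> g3 0" "g3 (1/2) \<noteq> g3 1" using inj_onD[of g3 "{0..1}" "1/2"] by force+
      ultimately show ?thesis using that start fin by (auto simp: pathstart_def pathfinish_def)
    qed
    have hJ: "h \<notin> ?J" using h int by blast
    have hm: "h \<in> sphere 0 1 - {m}" using h sub2 by blast
    \<comment> \<open>The goal is that the component of a point of the third arc in the complement
      of the new loop is bounded.\<close>
    define X where "X = connected_component_set (- J') (G.stereo h)"
    have hX: "G.stereo h \<notin> J'"
    proof
      assume "G.stereo h \<in> J'"
      then obtain y where "y \<in> ?J" "G.stereo h = G.stereo y" by (auto simp: J'_def)
      then show False using G.inj_on_stereo hm hJ sub2 unfolding inj_on_def by blast
    qed
    have conX: "connected (G.unstereo ` X)"
      by (rule connected_continuous_image[OF G.continuous_on_unstereo]) (simp add: X_def)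
    have XJ: "G.unstereo ` X \<inter> ?J = {}"
    proof (rule ccontr)
      assume "\<not> ?thesis"
      then obtain x where x: "x \<in> X" "G.unstereo x \<in> ?J" by blast
      then have "x \<in> J'" unfolding J'_def using G.unstereo_props(3) by (metis imageI)
      then show False using x(1) connected_component_subset[of "- J'"] by (auto simp: X_def)
    qed
    have hin: "h \<in> G.unstereo ` X"
    proof -
      have "G.stereo h \<in> X" unfolding X_def using hX by (simp add: connected_component_refl)
      then have "G.unstereo (G.stereo h) \<in> G.unstereo ` X" by (rule imageI)
      then show ?thesis using G.unstereo_stereo[of h] hm by simp
    qed
    \<comment> \<open>Within the component \<open>A\<close> is relatively open, and also relatively
      closed since \<open>A\<close> together with the loop is compact and the component misses the
      loop. Being connected, the component would lie in \<open>A\<close> as soon as it met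
      \<open>A\<close>.\<close>
    have XA: "G.unstereo ` X \<inter> A = {}"
    proof (rule ccontr)
      assume ne: "G.unstereo ` X \<inter> A \<noteq> {}"
      have opA: "openin (top_of_set (G.unstereo ` X)) (G.unstereo ` X \<inter> A)"
      proof -
        have "openin (top_of_set (sphere 0 1 - {n})) N"
          unfolding N_def using continuous_openin_preimage[OF F.continuous_on_stereo, of UNIV I] jo(2)
          by (simp add: vimage_def Int_def openin_open_eq)
        then obtain T where T: "open T" "N = (sphere 0 1 - {n}) \<inter> T" by (auto simp: openin_open)
        have "A \<subseteq> N" using F.unstereo_props by (auto simp: A_def N_def)
        then have AN: "A = N" using NA by blast
        have "G.unstereo ` X \<inter> A = G.unstereo ` X \<inter> (T - {n})"
          unfolding AN T(2) using G.unstereo_props(1) by auto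
        then show ?thesis using T(1) by (metis openin_open open_delete)
      qed
      have clA: "closedin (top_of_set (G.unstereo ` X)) (G.unstereo ` X \<inter> A)"
      proof -
        have "G.unstereo ` X \<inter> A = G.unstereo ` X \<inter> K" using XJ KJ by blast
        then show ?thesis using \<open>closed K\<close> by (metis closedin_closed)
      qed
      have "G.unstereo ` X \<inter> A = G.unstereo ` X"
        using conX opA clA ne unfolding connected_clopen by blast
      then show False using hin n3 h(1) by blast
    qed
    have "bounded X"
    proof -
      have "cmod x \<le> sqrt (4 / \<delta>\<^sup>2)" if x: "x \<in> X" for x
      proof -
        define y where "y = G.unstereo x"
        have y: "y \<in> sphere 0 1" "y \<noteq> m" "G.stereo y = x" using G.unstereo_props[of x] by (auto simp: y_def)
        have "y \<notin> A" using XA x by (auto simp: y_def)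
        then have "dist y m \<ge> \<delta>" using \<delta>(2) y(1) by (meson not_le)
        then have "\<delta>\<^sup>2 \<le> (dist y m)\<^sup>2" using \<delta>(1) by (intro power_mono) auto
        then have b: "\<delta>\<^sup>2 / 2 \<le> 1 - y \<bullet> m" using sphere_dist[OF y(1) m(1)] by simp
        have "(cmod x)\<^sup>2 * (1 - y \<bullet> m) = 1 + y \<bullet> m" using G.cmod_stereo[OF y(1,2)] y(3) by simp
        also have "\<dots> \<le> 2" using G.sphere_lt[OF y(1,2)] by simp
        finally have "(cmod x)\<^sup>2 * (\<delta>\<^sup>2 / 2) \<le> 2" using mult_left_mono[OF b, of "(cmod x)\<^sup>2"] by simp
        then have "(cmod x)\<^sup>2 \<le> 4 / \<delta>\<^sup>2" using \<delta>(1) by (simp add: field_simps)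
        then show ?thesis by (rule real_le_rsqrt)
      qed
      then show ?thesis unfolding bounded_iff by blast
    qed
    then have "G.stereo h \<in> inside J'" using hX unfolding inside_def X_def by simp
    then have "G.stereo ` path_image g3 \<inter> inside (G.stereo ` path_image g1 \<union> G.stereo ` path_image g2) \<noteq> {}"
      using h(1) unfolding J'_def image_Un by blast
    then show ?thesis by (rule that[OF fr' off])
  qed
qed

text \<open>The bound \<open>R\<close> keeps the circles around \<open>u\<close> and
  \<open>w\<close> away from the pole and from the opposite end, so the arcs exit before time 1. The
  projection reverses the orientation at both ends alike, so the planar comparison carries
  over.\<close>

lemma hit_sign_theta:
  fixes g1 g2 g3 :: "real \<Rightarrow> real^3"
  assumes arcs: "arc g1" "arc g2" "arc g3"
    and start: "pathstart g1 = u" "pathstart g2 = u" "pathstart g3 = u"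
    and fin: "pathfinish g1 = w" "pathfinish g2 = w" "pathfinish g3 = w"
    and int: "path_image g1 \<inter> path_image g2 = {u, w}" "path_image g1 \<inter> path_image g3 = {u, w}"
      "path_image g2 \<inter> path_image g3 = {u, w}"
    and sub: "path_image g1 \<subseteq> sphere 0 1" "path_image g2 \<subseteq> sphere 0 1" "path_image g3 \<subseteq> sphere 0 1"
  shows "\<exists>R>0. \<forall>r. 0 < r \<longrightarrow> r \<le> R \<longrightarrow>
    sgn (hit_sign w r (reversepath g1) (reversepath g2) (reversepath g3)) = - sgn (hit_sign u r g1 g2 g3)"
proof -
  obtain p q n where fr: "frame p q n" and n: "n \<notin> path_image g1 \<union> path_image g2 \<union> path_image g3"
    and ins: "frame.stereo p q n ` path_image g3 \<inter>
      inside (frame.stereo p q n ` path_image g1 \<union> frame.stereo p q n ` path_image g2) \<noteq> {}"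
    by (rule theta_frame[OF arcs start fin int sub])
  interpret frame p q n by (rule fr)
  have sub': "path_image g1 \<subseteq> sphere 0 1 - {n}" "path_image g2 \<subseteq> sphere 0 1 - {n}" "path_image g3 \<subseteq> sphere 0 1 - {n}"
    using sub n by auto
  have uw: "u \<noteq> w" using arc_distinct_ends[OF arcs(1)] start fin by simp
  have u: "u \<in> path_image g1" "w \<in> path_image g1" using start(1) fin(1) pathstart_in_path_image pathfinish_in_path_image by blast+
  have un: "u \<noteq> n" "w \<noteq> n" using u n by auto
  have us: "u \<in> sphere 0 1" "w \<in> sphere 0 1" using u sub by auto
  define R where "R = min (dist u n) (min (dist w n) (dist u w)) / 2"
  have "dist u n > 0" "dist w n > 0" "dist u w > 0" using un uw by auto
  then have R: "R > 0" "R < dist u n" "R < dist w n" "R < dist u w" unfolding R_def by linarith+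
  note A = arc_stereo[OF arcs(1) sub'(1)] arc_stereo[OF arcs(2) sub'(2)] arc_stereo[OF arcs(3) sub'(3)]
  have st: "pathstart (stereo \<circ> g) = stereo (pathstart g)" "pathfinish (stereo \<circ> g) = stereo (pathfinish g)" for g
    by (auto simp: pathstart_def pathfinish_def)
  have rs: "reversepath (stereo \<circ> g) = stereo \<circ> reversepath g" for g by (auto simp: reversepath_def)
  have im: "stereo ` S \<inter> stereo ` T = {stereo u, stereo w}" if "S \<inter> T = {u, w}" "S \<subseteq> sphere 0 1 - {n}" "T \<subseteq> sphere 0 1 - {n}" for S T
    using inj_on_image_Int[OF inj_on_stereo that(2,3)] that(1) by simp
  let ?c = "\<lambda>u r. Complex ((u \<bullet> p) / (1 - r\<^sup>2 / 2 - u \<bullet> n)) ((u \<bullet> q) / (1 - r\<^sup>2 / 2 - u \<bullet> n))"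
  let ?\<rho> = "\<lambda>u r. sqrt (1 - (1 - r\<^sup>2 / 2)\<^sup>2) / (1 - r\<^sup>2 / 2 - u \<bullet> n)"
  have main: "\<exists>t. first_hit a r g = g t \<and> t < 1 \<and> a \<bullet> g t = 1 - r\<^sup>2 / 2 \<and> g t \<in> sphere 0 1 \<and> g t \<noteq> n \<and>
      exits (stereo \<circ> g) (?c a r) (?\<rho> a r) t"
    if "arc g" "pathstart g = a" "pathfinish g = b" "path_image g \<subseteq> sphere 0 1 - {n}" "0 < r" "r < dist a n" "r < dist a b"
    for g a b r
  proof -
    have "n \<notin> g ` {0..1}" "path_image g \<subseteq> sphere 0 1" using that(4) by (auto simp: path_image_def)
    moreover have g1: "g 1 = b" using that by (simp add: pathfinish_def)
    moreover have "r \<le> dist a (g 1)" using that(7) g1 by simp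
    ultimately have "\<exists>t. first_hit a r g = g t \<and> 0 < t \<and> t \<le> 1 \<and> a \<bullet> g t = 1 - r\<^sup>2 / 2 \<and>
       g t \<in> sphere 0 1 \<and> g t \<noteq> n \<and> exits (stereo \<circ> g) (?c a r) (?\<rho> a r) t"
      using first_hit_exits[OF arc_imp_path[OF \<open>arc g\<close>] \<open>pathstart g = a\<close> _ \<open>0 < r\<close> \<open>r < dist a n\<close>, of 1]
      by (metis atLeastAtMost_iff order_refl zero_le_one)
    then obtain t where t: "first_hit a r g = g t" "0 < t" "t \<le> 1" "a \<bullet> g t = 1 - r\<^sup>2 / 2"
       "g t \<in> sphere 0 1" "g t \<noteq> n" "exits (stereo \<circ> g) (?c a r) (?\<rho> a r) t"
      by blast
    have as: "a \<in> sphere 0 1" using that(2,4) pathstart_in_path_image by blast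
    have "dist a (g t) = r" using sphere_dist_less(2)[OF as t(5) that(5)] t(4) by simp
    then have "t \<noteq> 1" using g1 \<open>r < dist a b\<close> by auto
    then show ?thesis using t by force
  qed
  show ?thesis
  proof (intro exI[of _ R] conjI allI impI R(1))
    fix r assume r: "0 < r" "r \<le> R"
    then have ru: "r < dist u n" "r < dist u w" and rw: "r < dist w n" "r < dist w u"
      using R by (auto simp: dist_commute)
    have ra: "arc (reversepath g)" "pathstart (reversepath g) = pathfinish g" "pathfinish (reversepath g) = pathstart g"
       "path_image (reversepath g) = path_image g" if "arc g" for g :: "real \<Rightarrow> real^3"
      using that by (auto simp: arc_reversepath)
    obtain t1 where t1: "first_hit u r g1 = g1 t1" "t1 < 1" "u \<bullet> g1 t1 = 1 - r\<^sup>2 / 2" "g1 t1 \<in> sphere 0 1" "g1 t1 \<noteq> n"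
      "exits (stereo \<circ> g1) (?c u r) (?\<rho> u r) t1" using main[OF arcs(1) start(1) fin(1) sub'(1) r(1) ru] by blast
    obtain t2 where t2: "first_hit u r g2 = g2 t2" "t2 < 1" "u \<bullet> g2 t2 = 1 - r\<^sup>2 / 2" "g2 t2 \<in> sphere 0 1" "g2 t2 \<noteq> n"
      "exits (stereo \<circ> g2) (?c u r) (?\<rho> u r) t2" using main[OF arcs(2) start(2) fin(2) sub'(2) r(1) ru] by blast
    obtain t3 where t3: "first_hit u r g3 = g3 t3" "t3 < 1" "u \<bullet> g3 t3 = 1 - r\<^sup>2 / 2" "g3 t3 \<in> sphere 0 1" "g3 t3 \<noteq> n"
      "exits (stereo \<circ> g3) (?c u r) (?\<rho> u r) t3" using main[OF arcs(3) start(3) fin(3) sub'(3) r(1) ru] by blast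
    let ?h1 = "reversepath g1" and ?h2 = "reversepath g2" and ?h3 = "reversepath g3"
    have rr: "\<exists>t. first_hit w r (reversepath g) = reversepath g t \<and> t < 1 \<and> w \<bullet> reversepath g t = 1 - r\<^sup>2 / 2 \<and>
      reversepath g t \<in> sphere 0 1 \<and> reversepath g t \<noteq> n \<and> exits (stereo \<circ> reversepath g) (?c w r) (?\<rho> w r) t"
      if "arc g" "pathstart g = u" "pathfinish g = w" "path_image g \<subseteq> sphere 0 1 - {n}" for g
      by (rule main[OF ra(1)[OF that(1)] _ _ _ r(1) rw]) (use that in simp_all)
    obtain s1 where s1: "first_hit w r ?h1 = ?h1 s1" "s1 < 1" "w \<bullet> ?h1 s1 = 1 - r\<^sup>2 / 2" "?h1 s1 \<in> sphere 0 1" "?h1 s1 \<noteq> n"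
      "exits (stereo \<circ> ?h1) (?c w r) (?\<rho> w r) s1" using rr[OF arcs(1) start(1) fin(1) sub'(1)] by blast
    obtain s2 where s2: "first_hit w r ?h2 = ?h2 s2" "s2 < 1" "w \<bullet> ?h2 s2 = 1 - r\<^sup>2 / 2" "?h2 s2 \<in> sphere 0 1" "?h2 s2 \<noteq> n"
      "exits (stereo \<circ> ?h2) (?c w r) (?\<rho> w r) s2" using rr[OF arcs(2) start(2) fin(2) sub'(2)] by blast
    obtain s3 where s3: "first_hit w r ?h3 = ?h3 s3" "s3 < 1" "w \<bullet> ?h3 s3 = 1 - r\<^sup>2 / 2" "?h3 s3 \<in> sphere 0 1" "?h3 s3 \<noteq> n"
      "exits (stereo \<circ> ?h3) (?c w r) (?\<rho> w r) s3" using rr[OF arcs(3) start(3) fin(3) sub'(3)] by blast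
    have \<kappa>: "u \<bullet> n < 1 - r\<^sup>2 / 2" "w \<bullet> n < 1 - r\<^sup>2 / 2"
      using sphere_dist_less[OF us(1) n_sphere r(1)] sphere_dist_less[OF us(2) n_sphere r(1)] ru rw by (smt (verit))+
    have ou: "sgn (orient (stereo (g1 t1)) (stereo (g2 t2)) (stereo (g3 t3))) = - sgn (hit_sign u r g1 g2 g3)"
      unfolding hit_sign_def t1(1) t2(1) t3(1)
      by (rule stereo_orient[OF us(1) \<kappa>(1) t1(4,5,3) t2(4,5,3) t3(4,5,3)])
    have ow: "sgn (orient (stereo (?h1 s1)) (stereo (?h2 s2)) (stereo (?h3 s3))) = - sgn (hit_sign w r ?h1 ?h2 ?h3)"
      unfolding hit_sign_def s1(1) s2(1) s3(1)
      by (rule stereo_orient[OF us(2) \<kappa>(2) s1(4,5,3) s2(4,5,3) s3(4,5,3)])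
    have ins': "path_image (stereo \<circ> g3) \<inter> inside (path_image (stereo \<circ> g1) \<union> path_image (stereo \<circ> g2)) \<noteq> {}"
      using ins unfolding A(2,4,6) .
    have stt: "pathstart (stereo \<circ> g1) = stereo u" "pathstart (stereo \<circ> g2) = stereo u" "pathstart (stereo \<circ> g3) = stereo u"
       "pathfinish (stereo \<circ> g1) = stereo w" "pathfinish (stereo \<circ> g2) = stereo w" "pathfinish (stereo \<circ> g3) = stereo w"
      using start fin by (simp_all add: st)
    have ii: "path_image (stereo \<circ> g1) \<inter> path_image (stereo \<circ> g2) = {stereo u, stereo w}"
       "path_image (stereo \<circ> g1) \<inter> path_image (stereo \<circ> g3) = {stereo u, stereo w}"
       "path_image (stereo \<circ> g2) \<inter> path_image (stereo \<circ> g3) = {stereo u, stereo w}"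
      unfolding A(2,4,6) by (rule im[OF int(1) sub'(1,2)] im[OF int(2) sub'(1,3)] im[OF int(3) sub'(2,3)])+
    have e: "exits (reversepath (stereo \<circ> g1)) (?c w r) (?\<rho> w r) s1" "exits (reversepath (stereo \<circ> g2)) (?c w r) (?\<rho> w r) s2"
      "exits (reversepath (stereo \<circ> g3)) (?c w r) (?\<rho> w r) s3"
      unfolding rs using s1(6) s2(6) s3(6) by blast+
    have "sgn (orient (reversepath (stereo \<circ> g1) s1) (reversepath (stereo \<circ> g2) s2) (reversepath (stereo \<circ> g3) s3)) =
        - sgn (orient ((stereo \<circ> g1) t1) ((stereo \<circ> g2) t2) ((stereo \<circ> g3) t3))"
      by (rule theta_orientation_planar[OF A(1,3,5) stt ii ins' t1(6) t2(6) t3(6) t1(2) t2(2) t3(2) e s1(2) s2(2) s3(2)])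
    then show "sgn (hit_sign w r ?h1 ?h2 ?h3) = - sgn (hit_sign u r g1 g2 g3)"
      using ou ow unfolding rs unfolding o_def by simp
  qed
qed

section \<open>The cyclic order of three curves\<close>

lemma eventually_at_right_0:
  assumes "R > (0::real)" "\<And>r. 0 < r \<Longrightarrow> r \<le> R \<Longrightarrow> P r"
  shows "\<forall>\<^sub>F r in at_right 0. P r"
  using eventually_at_right_less[of 0] eventually_at_right_real[OF assms(1)]
  by eventually_elim (use assms in auto)

text \<open>Being eventually counterclockwise and being eventually clockwise are not complementary
  by definition; the dichotomy comes from the constancy of the nonzero sign on small
  circles.\<close>

lemma ccw_curves_total:
  fixes g1 g2 g3 :: "real \<Rightarrow> real^3"
  assumes "path g1" "path g2" "path g3" "pathstart g1 = u" "pathstart g2 = u" "pathstart g3 = u"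
    and "path_image g1 \<subseteq> sphere 0 1" "path_image g2 \<subseteq> sphere 0 1" "path_image g3 \<subseteq> sphere 0 1"
    and "0 < T" "T \<le> 1"
    and "\<And>s t. s \<in> {0..T} \<Longrightarrow> t \<in> {0..T} \<Longrightarrow> (s, t) \<noteq> (0, 0) \<Longrightarrow> g1 s \<noteq> g3 t \<and> g2 s \<noteq> g1 t \<and> g3 s \<noteq> g2 t"
  shows "ccw_curves u g1 g2 g3 \<noteq> ccw_curves u g1 g3 g2"
proof -
  obtain R where R: "R > 0" "\<forall>r. 0 < r \<longrightarrow> r \<le> R \<longrightarrow>
    hit_sign u r g1 g2 g3 \<noteq> 0 \<and> sgn (hit_sign u r g1 g2 g3) = sgn (hit_sign u R g1 g2 g3)"
    using hit_sign_constant[OF assms] by blast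
  have not_both: "\<not> (ccw_curves u g1 g2 g3 \<and> ccw_curves u g1 g3 g2)"
  proof
    assume "ccw_curves u g1 g2 g3 \<and> ccw_curves u g1 g3 g2"
    then have "\<forall>\<^sub>F r in at_right 0. hit_sign u r g1 g2 g3 > 0 \<and> - hit_sign u r g1 g2 g3 > 0"
      unfolding ccw_curves_hit_sign hit_sign_swap[of u _ g1 g3 g2] by (simp add: eventually_conj)
    then have "\<forall>\<^sub>F r in at_right (0::real). False" by (rule eventually_mono) auto
    then show False by (simp add: trivial_limit_at_right_real)
  qed
  show ?thesis
  proof (cases "hit_sign u R g1 g2 g3 > 0")
    case True
    have "\<forall>\<^sub>F r in at_right 0. hit_sign u r g1 g2 g3 > 0"
    proof (rule eventually_at_right_0[OF R(1)])
      fix r assume "0 < r" "r \<le> R"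
      then show "hit_sign u r g1 g2 g3 > 0" using R(2)[rule_format, of r] True by (metis sgn_greater)
    qed
    then show ?thesis using not_both unfolding ccw_curves_hit_sign by blast
  next
    case False
    then have neg: "hit_sign u R g1 g2 g3 < 0" using R(2)[rule_format, of R] R(1) by simp
    have "\<forall>\<^sub>F r in at_right 0. hit_sign u r g1 g3 g2 > 0"
    proof (rule eventually_at_right_0[OF R(1)])
      fix r assume "0 < r" "r \<le> R"
      then have "hit_sign u r g1 g2 g3 < 0" using R(2)[rule_format, of r] neg by (metis sgn_less)
      then show "hit_sign u r g1 g3 g2 > 0" using hit_sign_swap[of u r g1 g3 g2] by simp
    qed
    then show ?thesis using not_both unfolding ccw_curves_hit_sign by blast
  qed
qed

lemma ccw_curves_theta:
  fixes g1 g2 g3 :: "real \<Rightarrow> real^3"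
  assumes arcs: "arc g1" "arc g2" "arc g3"
    and start: "pathstart g1 = u" "pathstart g2 = u" "pathstart g3 = u"
    and fin: "pathfinish g1 = w" "pathfinish g2 = w" "pathfinish g3 = w"
    and int: "path_image g1 \<inter> path_image g2 = {u, w}" "path_image g1 \<inter> path_image g3 = {u, w}"
      "path_image g2 \<inter> path_image g3 = {u, w}"
    and sub: "path_image g1 \<subseteq> sphere 0 1" "path_image g2 \<subseteq> sphere 0 1" "path_image g3 \<subseteq> sphere 0 1"
  shows "ccw_curves u g1 g2 g3 \<longleftrightarrow> ccw_curves w (reversepath g1) (reversepath g3) (reversepath g2)"
proof -
  obtain R where R: "R > 0" "\<forall>r. 0 < r \<longrightarrow> r \<le> R \<longrightarrow>
    sgn (hit_sign w r (reversepath g1) (reversepath g2) (reversepath g3)) = - sgn (hit_sign u r g1 g2 g3)"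
    using hit_sign_theta[OF assms] by blast
  have ev: "\<forall>\<^sub>F r in at_right 0. (hit_sign u r g1 g2 g3 > 0 \<longleftrightarrow>
      hit_sign w r (reversepath g1) (reversepath g3) (reversepath g2) > 0)"
  proof (rule eventually_at_right_0[OF R(1)])
    fix r assume "0 < r" "r \<le> R"
    from R(2)[rule_format, OF this] hit_sign_swap[of w r "reversepath g1" "reversepath g3" "reversepath g2"]
    show "hit_sign u r g1 g2 g3 > 0 \<longleftrightarrow> hit_sign w r (reversepath g1) (reversepath g3) (reversepath g2) > 0"
      by (auto simp: sgn_if split: if_splits)
  qed
  then show ?thesis unfolding ccw_curves_hit_sign by (rule eventually_subst)
qed

section \<open>Walks and theta subgraphs\<close>

definition rv :: "'e \<times> bool \<Rightarrow> 'e \<times> bool" where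
  "rv h = (fst h, \<not> snd h)"

lemma rv_simps [simp]: "rv (rv h) = h" "fst (rv h) = fst h" "rv h \<noteq> h" "h \<noteq> rv h" "rv h = rv h' \<longleftrightarrow> h = h'"
  by (auto simp: rv_def prod_eq_iff)

lemma half_edge_cases: "fst h = fst h' \<Longrightarrow> h' = h \<or> h' = rv h"
  by (auto simp: rv_def prod_eq_iff)

context
  fixes G :: "('v, 'e) mgraph"
begin

text \<open>A half-edge also stands for its edge directed away from the vertex of the half-edge;
  \<open>tgt\<close> is the far end, and \<open>rv\<close> reverses the direction.\<close>

definition tgt :: "'e \<times> bool \<Rightarrow> 'v" where
  "tgt h = hvert G (rv h)"

lemma tgt_rv [simp]: "tgt (rv h) = hvert G h" and hvert_rv [simp]: "hvert G (rv h) = tgt h"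
  by (simp_all add: tgt_def)

lemma rv_half_edges [simp]: "rv h \<in> half_edges G \<longleftrightarrow> h \<in> half_edges G"
  by (auto simp: half_edges_def rv_def split: prod.splits)

fun walk :: "'v \<Rightarrow> ('e \<times> bool) list \<Rightarrow> 'v \<Rightarrow> bool" where
  "walk u [] w \<longleftrightarrow> u = w"
| "walk u (h # hs) w \<longleftrightarrow> h \<in> half_edges G \<and> hvert G h = u \<and> walk (tgt h) hs w"

definition vset :: "'v \<Rightarrow> ('e \<times> bool) list \<Rightarrow> 'v set" where
  "vset u hs = insert u (tgt ` set hs)"

definition spath :: "'v \<Rightarrow> ('e \<times> bool) list \<Rightarrow> 'v \<Rightarrow> bool" where
  "spath u hs w \<longleftrightarrow> walk u hs w \<and> distinct (u # map tgt hs)"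

lemma walk_append: "walk u (as @ bs) w \<longleftrightarrow> (\<exists>v. walk u as v \<and> walk v bs w)"
  by (induction as arbitrary: u) auto

lemma walk_rev: "walk u hs w \<Longrightarrow> walk w (map rv (rev hs)) u"
  by (induction hs arbitrary: u) (auto simp: walk_append)

lemma walk_half_edges: "walk u hs w \<Longrightarrow> h \<in> set hs \<Longrightarrow> h \<in> half_edges G"
  by (induction hs arbitrary: u) auto

lemma walk_srcs: "walk u hs w \<Longrightarrow> map (hvert G) hs @ [w] = u # map tgt hs"
  by (induction hs arbitrary: u) auto

lemma vset_srcs: "walk u hs w \<Longrightarrow> vset u hs = insert w (hvert G ` set hs)"
  using arg_cong[OF walk_srcs[of u hs w], of set] by (auto simp: vset_def)

lemma walk_rev_targets: "walk u hs w \<Longrightarrow> w # map tgt (map rv (rev hs)) = rev (u # map tgt hs)"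
proof -
  assume w: "walk u hs w"
  have "map tgt (map rv (rev hs)) = rev (map (hvert G) hs)" by (simp add: rev_map comp_def)
  then have "w # map tgt (map rv (rev hs)) = rev (map (hvert G) hs @ [w])" by simp
  then show ?thesis unfolding walk_srcs[OF w] .
qed

lemma spath_rev: "spath u hs w \<Longrightarrow> spath w (map rv (rev hs)) u"
  unfolding spath_def using walk_rev walk_rev_targets by (metis distinct_rev)

lemma vset_rev: "walk u hs w \<Longrightarrow> vset w (map rv (rev hs)) = vset u hs"
  using arg_cong[OF walk_rev_targets[of u hs w], of set] by (simp add: vset_def image_image)

lemma spath_iff_srcs: "spath u hs w \<longleftrightarrow> walk u hs w \<and> distinct (map (hvert G) hs @ [w])"
  unfolding spath_def using walk_srcs by metis

lemma spath_Cons: "spath u (h # hs) w \<longleftrightarrow> h \<in> half_edges G \<and> hvert G h = u \<and> spath (tgt h) hs w \<and> u \<notin> vset (tgt h) hs"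
  by (auto simp: spath_def vset_def)

lemma spath_suffix: "spath z hs y \<Longrightarrow> x \<in> vset z hs \<Longrightarrow> \<exists>ks. spath x ks y \<and> set ks \<subseteq> set hs"
proof (induction hs arbitrary: z)
  case Nil
  then show ?case by (intro exI[of _ "[]"]) (auto simp: vset_def spath_def)
next
  case (Cons h hs)
  show ?case
  proof (cases "x = z")
    case True
    then show ?thesis using Cons.prems by blast
  next
    case False
    then have "x \<in> vset (tgt h) hs" using Cons.prems by (auto simp: vset_def)
    then show ?thesis using Cons.IH[of "tgt h"] Cons.prems(1) by (auto simp: spath_Cons)
  qed
qed

lemma walk_shorten: "walk x hs y \<Longrightarrow> \<exists>ks. spath x ks y \<and> set ks \<subseteq> set hs"
proof (induction hs arbitrary: x)
  case Nil
  then show ?case by (intro exI[of _ "[]"]) (auto simp: spath_def)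
next
  case (Cons h hs)
  then obtain ks where ks: "spath (tgt h) ks y" "set ks \<subseteq> set hs" by fastforce
  show ?case
  proof (cases "x \<in> vset (tgt h) ks")
    case True
    then show ?thesis using spath_suffix[OF ks(1) True] ks(2) by auto
  next
    case False
    then show ?thesis using ks Cons.prems by (intro exI[of _ "h # ks"]) (auto simp: spath_Cons)
  qed
qed

text \<open>The conditions on the edges exclude that two of the paths are one and the same edge
  joining \<open>u\<close> and \<open>w\<close>, which the conditions on the vertices permit.
  Parallel edges are allowed.\<close>

definition theta :: "'v \<Rightarrow> 'v \<Rightarrow> ('e \<times> bool) list \<Rightarrow> ('e \<times> bool) list \<Rightarrow> ('e \<times> bool) list \<Rightarrow> bool" where
  "theta u w as bs cs \<longleftrightarrow> u \<noteq> w \<and> spath u as w \<and> spath u bs w \<and> spath u cs w \<and>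
     vset u as \<inter> vset u bs = {u, w} \<and> vset u as \<inter> vset u cs = {u, w} \<and> vset u bs \<inter> vset u cs = {u, w} \<and>
     fst ` set as \<inter> fst ` set bs = {} \<and> fst ` set as \<inter> fst ` set cs = {} \<and> fst ` set bs \<inter> fst ` set cs = {}"

end

section \<open>Curves of walks in a plane graph\<close>

fun dpath :: "('v, 'e) drawing \<Rightarrow> ('e \<times> bool) list \<Rightarrow> real \<Rightarrow> real^3" where
  "dpath \<Gamma> [] = (\<lambda>_. 0)"
| "dpath \<Gamma> [h] = half_edge_path \<Gamma> h"
| "dpath \<Gamma> (h # k # hs) = half_edge_path \<Gamma> h +++ dpath \<Gamma> (k # hs)"

lemma half_edge_path_rv: "half_edge_path \<Gamma> (rv h) = reversepath (half_edge_path \<Gamma> h)"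
  by (simp add: half_edge_path_def rv_def)

lemma half_edge_path_props:
  assumes "plane_graph G \<Gamma>" "h \<in> half_edges G"
  shows "simple_path (half_edge_path \<Gamma> h)" "pathstart (half_edge_path \<Gamma> h) = vpoint \<Gamma> (hvert G h)"
    "pathfinish (half_edge_path \<Gamma> h) = vpoint \<Gamma> (tgt G h)"
    "path_image (half_edge_path \<Gamma> h) \<subseteq> sphere 0 1"
    "half_edge_path \<Gamma> h ` {0<..<1} = open_edge G \<Gamma> (fst h)"
proof -
  obtain e b where h: "h = (e, b)" by (cases h)
  obtain u v where e: "e \<in> edges G" "ends G e = Some (u, v)" using assms(2) by (auto simp: half_edges_def h)
  have P: "simple_path (epath \<Gamma> e)" "path_image (epath \<Gamma> e) \<subseteq> sphere 0 1"
     "pathstart (epath \<Gamma> e) = vpoint \<Gamma> u" "pathfinish (epath \<Gamma> e) = vpoint \<Gamma> v"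
    using assms(1) e unfolding plane_graph_def by force+
  show "simple_path (half_edge_path \<Gamma> h)" "pathstart (half_edge_path \<Gamma> h) = vpoint \<Gamma> (hvert G h)"
    "pathfinish (half_edge_path \<Gamma> h) = vpoint \<Gamma> (tgt G h)"
    "path_image (half_edge_path \<Gamma> h) \<subseteq> sphere 0 1"
    using P e by (auto simp: half_edge_path_def h hvert_def tgt_def rv_def simple_path_reversepath)
  have "reversepath (epath \<Gamma> e) ` {0<..<1} = epath \<Gamma> e ` {0<..<1}"
  proof -
    have "(\<lambda>t::real. 1 - t) ` {0<..<1} = {0<..<1}" by (auto simp: image_iff intro!: bexI[of _ "1 - _"])
    then show ?thesis unfolding reversepath_def by (metis (no_types, lifting) image_cong image_image)
  qed
  then show "half_edge_path \<Gamma> h ` {0<..<1} = open_edge G \<Gamma> (fst h)"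
    using e by (auto simp: half_edge_path_def h open_edge_def)
qed

lemma path_image_ends:
  "path_image g = {pathstart g, pathfinish g} \<union> g ` {0<..<1}"
proof -
  have "{0..1::real} = {0, 1} \<union> {0<..<1}" by auto
  then show ?thesis by (auto simp: path_image_def pathstart_def pathfinish_def)
qed

lemma half_edge_path_image:
  assumes "plane_graph G \<Gamma>" "h \<in> half_edges G"
  shows "path_image (half_edge_path \<Gamma> h) = vpoint \<Gamma> ` {hvert G h, tgt G h} \<union> open_edge G \<Gamma> (fst h)"
  using path_image_ends[of "half_edge_path \<Gamma> h"] half_edge_path_props[OF assms] by auto

lemma open_edge_disjoint:
  assumes "plane_graph G \<Gamma>"
  shows "e \<in> edges G \<Longrightarrow> open_edge G \<Gamma> e \<inter> vpoint \<Gamma> ` verts G = {}"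
    "e \<in> edges G \<Longrightarrow> f \<in> edges G \<Longrightarrow> e \<noteq> f \<Longrightarrow> open_edge G \<Gamma> e \<inter> open_edge G \<Gamma> f = {}"
    "inj_on (vpoint \<Gamma>) (verts G)"
  using assms unfolding plane_graph_def by blast+

lemma half_edge_verts:
  assumes "multigraph G" "h \<in> half_edges G"
  shows "hvert G h \<in> verts G" "tgt G h \<in> verts G" "fst h \<in> edges G"
  using assms by (auto simp: multigraph_def half_edges_def hvert_def tgt_def rv_def)

lemma walk_verts:
  assumes "multigraph G" "walk G u hs w" "hs \<noteq> []"
  shows "vset G u hs \<subseteq> verts G"
proof -
  have "hvert G (hd hs) = u" "hd hs \<in> half_edges G" using assms(2,3) by (cases hs; simp)+
  then have "u \<in> verts G" using half_edge_verts(1)[OF assms(1)] by blast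
  then show ?thesis using walk_half_edges[OF assms(2)] half_edge_verts(2)[OF assms(1)] by (auto simp: vset_def)
qed

lemma same_edge_ends: "fst h = fst h' \<Longrightarrow> {hvert G h, tgt G h} = {hvert G h', tgt G h'}"
  using half_edge_cases[of h h'] by auto

lemma walk_edge_ends: "walk G u hs w \<Longrightarrow> h \<in> set hs \<Longrightarrow> {hvert G h, tgt G h} \<subseteq> vset G u hs"
  using vset_srcs[of G u hs w] by (auto simp: vset_def)

lemma dpath_props:
  assumes G: "multigraph G" and P: "plane_graph G \<Gamma>" and "spath G u hs w" "hs \<noteq> []"
  shows "arc (dpath \<Gamma> hs) \<and> pathstart (dpath \<Gamma> hs) = vpoint \<Gamma> u \<and> pathfinish (dpath \<Gamma> hs) = vpoint \<Gamma> w \<and>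
    path_image (dpath \<Gamma> hs) = vpoint \<Gamma> ` vset G u hs \<union> (\<Union>h\<in>set hs. open_edge G \<Gamma> (fst h)) \<and>
    path_image (dpath \<Gamma> hs) \<subseteq> sphere 0 1"
  using assms(3,4)
proof (induction hs arbitrary: u)
  case Nil
  then show ?case by simp
next
  case (Cons h hs)
  have h: "h \<in> half_edges G" "hvert G h = u" "spath G (tgt G h) hs w" "u \<notin> vset G (tgt G h) hs"
    using Cons.prems by (auto simp: spath_Cons)
  note hp = half_edge_path_props[OF P h(1)]
  have ne: "u \<noteq> tgt G h" using h(4) by (auto simp: vset_def)
  have uv: "u \<in> verts G" "tgt G h \<in> verts G" "fst h \<in> edges G" using half_edge_verts[OF G h(1)] h(2) by auto
  have "vpoint \<Gamma> u \<noteq> vpoint \<Gamma> (tgt G h)" using open_edge_disjoint(3)[OF P] uv ne by (auto simp: inj_on_def)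
  then have a: "arc (half_edge_path \<Gamma> h)" using hp h(2) by (simp add: arc_simple_path)
  note im = half_edge_path_image[OF P h(1)]
  show ?case
  proof (cases hs)
    case Nil
    then show ?thesis using a hp h im by (auto simp: vset_def spath_def)
  next
    case (Cons k ks)
    then have IH: "arc (dpath \<Gamma> hs)" "pathstart (dpath \<Gamma> hs) = vpoint \<Gamma> (tgt G h)" "pathfinish (dpath \<Gamma> hs) = vpoint \<Gamma> w"
      "path_image (dpath \<Gamma> hs) = vpoint \<Gamma> ` vset G (tgt G h) hs \<union> (\<Union>h\<in>set hs. open_edge G \<Gamma> (fst h))"
      "path_image (dpath \<Gamma> hs) \<subseteq> sphere 0 1"
      using Cons.IH[OF h(3)] by auto
    have wk: "walk G (tgt G h) hs w" using h(3) by (simp add: spath_def)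
    have vs: "vset G (tgt G h) hs \<subseteq> verts G" using walk_verts[OF G wk] Cons by simp
    have ed: "fst k \<in> edges G \<and> fst k \<noteq> fst h" if "k \<in> set hs" for k
    proof -
      have "u \<in> {hvert G h, tgt G h}" using h(2) by simp
      then have "fst k \<noteq> fst h" using walk_edge_ends[OF wk that] h(4) same_edge_ends[of k h G] by blast
      then show ?thesis using half_edge_verts(3)[OF G walk_half_edges[OF wk that]] by simp
    qed
    have d1: "open_edge G \<Gamma> (fst h) \<inter> vpoint \<Gamma> ` vset G (tgt G h) hs = {}"
      using open_edge_disjoint(1)[OF P uv(3)] vs by blast
    have d2: "open_edge G \<Gamma> (fst h) \<inter> open_edge G \<Gamma> (fst k) = {}" if "k \<in> set hs" for k
      using open_edge_disjoint(2)[OF P uv(3)] ed[OF that] by metis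
    have d3: "open_edge G \<Gamma> (fst k) \<inter> vpoint \<Gamma> ` {u, tgt G h} = {}" if "k \<in> set hs" for k
      using open_edge_disjoint(1)[OF P] ed[OF that] uv by blast
    have d4: "vpoint \<Gamma> u \<notin> vpoint \<Gamma> ` vset G (tgt G h) hs"
      using open_edge_disjoint(3)[OF P] vs uv(1) h(4) by (auto simp: inj_on_def)
    have "path_image (half_edge_path \<Gamma> h) \<inter> path_image (dpath \<Gamma> hs) \<subseteq> {vpoint \<Gamma> (tgt G h)}"
      unfolding im IH(4) h(2) using d1 d2 d3 d4 by blast
    then have "arc (half_edge_path \<Gamma> h +++ dpath \<Gamma> hs)"
      by (intro arc_join a IH(1)) (use hp IH(2) in auto)
    moreover have dp: "dpath \<Gamma> (h # hs) = half_edge_path \<Gamma> h +++ dpath \<Gamma> hs" using Cons by simp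
    moreover have "path_image (half_edge_path \<Gamma> h +++ dpath \<Gamma> hs) = path_image (half_edge_path \<Gamma> h) \<union> path_image (dpath \<Gamma> hs)"
      using hp IH(2) by (simp add: path_image_join)
    ultimately show ?thesis unfolding dp using hp IH h(2) im by (auto simp: vset_def)
  qed
qed

lemma first_hit_eqI:
  assumes "0 \<le> t" "t \<le> 1" "dist u (g t) = r" "\<And>x. x \<in> {0..<t} \<Longrightarrow> dist u (g x) \<noteq> r"
  shows "first_hit u r g = g t"
proof -
  have "Inf {t \<in> {0..1}. dist u (g t) = r} = t"
    by (rule cInf_eq_minimum) (use assms in \<open>auto simp: not_less[symmetric]\<close>)
  then show ?thesis by (simp add: first_hit_def)
qed

text \<open>The joined path passes through \<open>g1\<close> at double speed, so the first hit moves
  from time t to t / 2 and is the same point as soon as \<open>g1\<close> reaches the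
  radius.\<close>

lemma first_hit_join:
  fixes g1 g2 :: "real \<Rightarrow> real^3"
  assumes "path g1" "pathstart g1 = u" "0 < r" "s \<in> {0..1}" "r \<le> dist u (g1 s)"
  shows "first_hit u r (g1 +++ g2) = first_hit u r g1"
proof -
  obtain t where t: "first_hit u r g1 = g1 t" "0 < t" "t \<le> s" "dist u (g1 t) = r"
    "\<And>x. x \<in> {0..<t} \<Longrightarrow> dist u (g1 x) < r"
    using first_hit_time[OF assms(1-5)] by blast
  have "first_hit u r (g1 +++ g2) = (g1 +++ g2) (t / 2)"
  proof (rule first_hit_eqI)
    fix x assume "x \<in> {0..<t / 2}"
    then have "2 * x \<in> {0..<t}" "x \<le> 1 / 2" using t assms(4) by auto
    then show "dist u ((g1 +++ g2) x) \<noteq> r" using t(5)[of "2 * x"] by (simp add: joinpaths_def)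
  qed (use t assms(4) in \<open>auto simp: joinpaths_def\<close>)
  then show ?thesis using t assms(4) by (simp add: joinpaths_def)
qed

text \<open>Radii up to the distance from the first to the second vertex are already reached on the
  first edge, so the cyclic order of paths at a vertex is that of their first half-edges.\<close>

lemma first_hit_dpath:
  assumes G: "multigraph G" and P: "plane_graph G \<Gamma>" and sp: "spath G u hs w" "hs \<noteq> []"
    and r: "0 < r" "r \<le> dist (vpoint \<Gamma> u) (vpoint \<Gamma> (tgt G (hd hs)))"
  shows "first_hit (vpoint \<Gamma> u) r (dpath \<Gamma> hs) = first_hit (vpoint \<Gamma> u) r (half_edge_path \<Gamma> (hd hs))"
proof (cases "tl hs")
  case Nil
  then show ?thesis using sp(2) by (cases hs) auto
next
  case (Cons k ks)
  then obtain h where hs: "hs = h # k # ks" using sp(2) by (cases hs) auto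
  have h: "h \<in> half_edges G" "hvert G h = u" using sp hs by (auto simp: spath_Cons)
  note hp = half_edge_path_props[OF P h(1)]
  show ?thesis unfolding hs
    using first_hit_join[OF simple_path_imp_path[OF hp(1)] _ r(1), of _ 1] hp(2,3) h(2) r(2)
    by (simp add: hs pathfinish_def)
qed

lemma first_hit_dpath_rev:
  assumes G: "multigraph G" and P: "plane_graph G \<Gamma>" and sp: "spath G u hs w" "hs \<noteq> []"
    and r: "0 < r" "r \<le> dist (vpoint \<Gamma> w) (vpoint \<Gamma> (hvert G (last hs)))"
  shows "first_hit (vpoint \<Gamma> w) r (reversepath (dpath \<Gamma> hs)) =
    first_hit (vpoint \<Gamma> w) r (half_edge_path \<Gamma> (rv (last hs)))"
  using sp r(2)
proof (induction hs arbitrary: u)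
  case Nil
  then show ?case by simp
next
  case (Cons h hs)
  show ?case
  proof (cases hs)
    case Nil
    then show ?thesis by (simp add: half_edge_path_rv)
  next
    case (Cons k ks)
    have h: "h \<in> half_edges G" "hvert G h = u" "spath G (tgt G h) hs w"
      using Cons.prems by (auto simp: spath_Cons)
    have ne: "hs \<noteq> []" using Cons by simp
    note dp = dpath_props[OF G P h(3) ne]
    note hp = half_edge_path_props[OF P h(1)]
    have wk: "walk G (tgt G h) hs w" using h(3) by (simp add: spath_def)
    have "hvert G (last hs) \<in> vset G (tgt G h) hs" using walk_edge_ends[OF wk, of "last hs"] ne by simp
    then have "vpoint \<Gamma> (hvert G (last hs)) \<in> path_image (reversepath (dpath \<Gamma> hs))" using dp by auto
    then obtain s where s: "s \<in> {0..1}" "reversepath (dpath \<Gamma> hs) s = vpoint \<Gamma> (hvert G (last hs))"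
      by (auto simp: path_image_def)
    have "first_hit (vpoint \<Gamma> w) r (reversepath (dpath \<Gamma> (h # hs))) =
      first_hit (vpoint \<Gamma> w) r (reversepath (dpath \<Gamma> hs) +++ reversepath (half_edge_path \<Gamma> h))"
      using Cons hp(3) dp by (simp add: reversepath_joinpaths)
    also have "\<dots> = first_hit (vpoint \<Gamma> w) r (reversepath (dpath \<Gamma> hs))"
      by (rule first_hit_join[OF _ _ r(1) s(1)]) (use dp s(2) Cons.prems(3) ne in \<open>auto simp: arc_imp_path\<close>)
    also have "\<dots> = first_hit (vpoint \<Gamma> w) r (half_edge_path \<Gamma> (rv (last (h # hs))))"
      using Cons.IH[OF h(3) ne] Cons.prems(3) ne by simp
    finally show ?thesis .
  qed
qed

lemma ccw_curves_cong:
  assumes "R > 0" "\<And>r. 0 < r \<Longrightarrow> r \<le> R \<Longrightarrow> first_hit u r g1 = first_hit u r h1 \<and>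
    first_hit u r g2 = first_hit u r h2 \<and> first_hit u r g3 = first_hit u r h3"
  shows "ccw_curves u g1 g2 g3 \<longleftrightarrow> ccw_curves u h1 h2 h3"
proof -
  have "\<forall>\<^sub>F r in at_right 0. first_hit u r g1 = first_hit u r h1 \<and>
    first_hit u r g2 = first_hit u r h2 \<and> first_hit u r g3 = first_hit u r h3"
    by (rule eventually_at_right_0[OF assms(1)]) (rule assms(2))
  then show ?thesis unfolding ccw_curves_def
    by (intro eventually_subst) (erule eventually_mono, simp)
qed

lemma ccw_curves_cyclic: "ccw_curves u g1 g2 g3 \<longleftrightarrow> ccw_curves u g2 g3 g1"
proof -
  have cyc: "cross3 (b - a) (c - a) = cross3 (c - b) (a - b)" for a b c :: "real^3"
    by (simp add: cross3_simps)
  show ?thesis unfolding ccw_curves_def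
    by (subst cyc[of "first_hit u _ g2" "first_hit u _ g1" "first_hit u _ g3"]) (rule refl)
qed

text \<open>The bound 1/3 is for loops: the two half-edges of a loop run along one curve in opposite
  directions and are disjoint only on short initial pieces.\<close>

lemma half_edge_paths_disjoint:
  assumes G: "multigraph G" and P: "plane_graph G \<Gamma>"
    and h: "h \<in> half_edges_at G v" "k \<in> half_edges_at G v" "h \<noteq> k"
    and st: "s \<in> {0..1/3}" "t \<in> {0..1/3}" "(s, t) \<noteq> (0, 0)"
  shows "half_edge_path \<Gamma> h s \<noteq> half_edge_path \<Gamma> k t"
proof -
  have he: "h \<in> half_edges G" "hvert G h = v" "k \<in> half_edges G" "hvert G k = v"
    using h by (auto simp: half_edges_at_def)
  note hp = half_edge_path_props[OF P he(1)] and kp = half_edge_path_props[OF P he(3)]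
  have vv: "v \<in> verts G" and ed: "fst h \<in> edges G" "fst k \<in> edges G"
    using half_edge_verts[OF G he(1)] half_edge_verts[OF G he(3)] he(2) by auto
  have z: "half_edge_path \<Gamma> h 0 = vpoint \<Gamma> v" "half_edge_path \<Gamma> k 0 = vpoint \<Gamma> v"
    using hp(2) kp(2) he by (auto simp: pathstart_def)
  have oh: "half_edge_path \<Gamma> h s \<in> open_edge G \<Gamma> (fst h)" if "s \<noteq> 0"
    using hp(5) st(1) that by (metis atLeastAtMost_iff greaterThanLessThan_iff imageI le_less_trans
      less_eq_real_def divide_less_eq_1_pos zero_less_numeral one_less_numeral_iff semiring_norm(77))
  have ok: "half_edge_path \<Gamma> k t \<in> open_edge G \<Gamma> (fst k)" if "t \<noteq> 0"
    using kp(5) st(2) that by (metis atLeastAtMost_iff greaterThanLessThan_iff imageI le_less_trans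
      less_eq_real_def divide_less_eq_1_pos zero_less_numeral one_less_numeral_iff semiring_norm(77))
  show ?thesis
  proof (cases "fst h = fst k")
    case False
    show ?thesis
    proof (cases "s = 0 \<or> t = 0")
      case True
      then show ?thesis using z oh ok open_edge_disjoint(1)[OF P] ed vv st(3) by (metis IntI emptyE imageI)
    next
      case F: False
      then show ?thesis using oh ok open_edge_disjoint(2)[OF P ed False] by (metis IntI emptyE)
    qed
  next
    case True
    then have "k = rv h" using half_edge_cases[of h k] h(3) by auto
    then have eq: "half_edge_path \<Gamma> k t = half_edge_path \<Gamma> h (1 - t)" by (simp add: half_edge_path_rv reversepath_def)
    show ?thesis
    proof
      assume "half_edge_path \<Gamma> h s = half_edge_path \<Gamma> k t"
      then have "half_edge_path \<Gamma> h s = half_edge_path \<Gamma> h (1 - t)" using eq by simp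
      moreover have "s \<in> {0..1}" "1 - t \<in> {0..1}" using st by auto
      ultimately have "s = 1 - t \<or> s = 0 \<and> 1 - t = 1 \<or> s = 1 \<and> 1 - t = 0"
        using hp(1) unfolding simple_path_def loop_free_def by blast
      then show False using st by auto
    qed
  qed
qed

lemma ccw_at_total:
  assumes G: "multigraph G" and P: "plane_graph G \<Gamma>"
    and h: "half_edges_at G v = {h, x, y}" "distinct [h, x, y]"
  shows "ccw_at G \<Gamma> v h x y \<noteq> ccw_at G \<Gamma> v h y x"
proof -
  have he: "k \<in> half_edges G" "hvert G k = v" if "k \<in> {h, x, y}" for k
    using that h(1) by (auto simp: half_edges_at_def)
  have "ccw_curves (vpoint \<Gamma> v) (half_edge_path \<Gamma> h) (half_edge_path \<Gamma> x) (half_edge_path \<Gamma> y) \<noteq>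
      ccw_curves (vpoint \<Gamma> v) (half_edge_path \<Gamma> h) (half_edge_path \<Gamma> y) (half_edge_path \<Gamma> x)"
  proof (rule ccw_curves_total[where T = "1/3"])
    show "half_edge_path \<Gamma> h s \<noteq> half_edge_path \<Gamma> y t \<and> half_edge_path \<Gamma> x s \<noteq> half_edge_path \<Gamma> h t \<and>
      half_edge_path \<Gamma> y s \<noteq> half_edge_path \<Gamma> x t" if "s \<in> {0..1/3}" "t \<in> {0..1/3}" "(s, t) \<noteq> (0, 0)" for s t
    proof -
      have "h \<in> half_edges_at G v" "x \<in> half_edges_at G v" "y \<in> half_edges_at G v" "h \<noteq> y" "x \<noteq> h" "y \<noteq> x"
        using h by auto
      then show ?thesis using half_edge_paths_disjoint[OF G P _ _ _ that] by blast
    qed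
  qed (use half_edge_path_props[OF P] he in \<open>auto simp: simple_path_imp_path\<close>)
  then show ?thesis using h by (auto simp: ccw_at_def insert_commute)
qed

lemma ccw_at_cyclic: "ccw_at G \<Gamma> v h x y \<longleftrightarrow> ccw_at G \<Gamma> v x y h"
  using ccw_curves_cyclic[of "vpoint \<Gamma> v" "half_edge_path \<Gamma> h"] unfolding ccw_at_def
  by (auto simp: insert_commute)

section \<open>Vertices at which two drawings differ\<close>

definition flips :: "('v, 'e) mgraph \<Rightarrow> ('v, 'e) drawing \<Rightarrow> ('v, 'e) drawing \<Rightarrow> 'v set" where
  "flips G \<Gamma> \<Gamma>' = {v \<in> verts G. \<exists>h x y. ccw_at G \<Gamma> v h x y \<and> \<not> ccw_at G \<Gamma>' v h x y}"

text \<open>The six orders of three half-edges form two cyclic classes, exactly one of which is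
  counterclockwise in each drawing; hence any single order decides whether the rotations
  differ.\<close>

lemma flips_iff:
  assumes G: "multigraph G" and P: "plane_graph G \<Gamma>" "plane_graph G \<Gamma>'"
    and v: "v \<in> verts G" and h: "half_edges_at G v = {h, x, y}" "distinct [h, x, y]"
  shows "v \<in> flips G \<Gamma> \<Gamma>' \<longleftrightarrow> (ccw_at G \<Gamma> v h x y \<longleftrightarrow> \<not> ccw_at G \<Gamma>' v h x y)"
proof -
  have t: "ccw_at G \<Gamma> v h y x \<longleftrightarrow> \<not> ccw_at G \<Gamma> v h x y" "ccw_at G \<Gamma>' v h y x \<longleftrightarrow> \<not> ccw_at G \<Gamma>' v h x y"
    using ccw_at_total[OF G P(1) h] ccw_at_total[OF G P(2) h] by auto
  have c: "ccw_at G D v x y h \<longleftrightarrow> ccw_at G D v h x y" "ccw_at G D v y h x \<longleftrightarrow> ccw_at G D v h x y"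
    "ccw_at G D v y x h \<longleftrightarrow> ccw_at G D v h y x" "ccw_at G D v x h y \<longleftrightarrow> ccw_at G D v h y x" for D
    using ccw_at_cyclic[of G D v h x y] ccw_at_cyclic[of G D v x y h] ccw_at_cyclic[of G D v h y x]
      ccw_at_cyclic[of G D v y x h] by blast+
  have perm: "(a, b, c) \<in> {(h, x, y), (x, y, h), (y, h, x), (h, y, x), (y, x, h), (x, h, y)}"
    if "ccw_at G \<Gamma> v a b c" for a b c
  proof -
    have "distinct [a, b, c]" "{a, b, c} = {h, x, y}" using that h by (auto simp: ccw_at_def)
    then have "a \<in> {h, x, y}" "b \<in> {h, x, y}" "c \<in> {h, x, y}" "a \<noteq> b" "b \<noteq> c" "a \<noteq> c" by auto
    then show ?thesis using h(2) by (elim insertE emptyE) simp_all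
  qed
  show ?thesis
  proof
    assume "v \<in> flips G \<Gamma> \<Gamma>'"
    then obtain a b c where "ccw_at G \<Gamma> v a b c" "\<not> ccw_at G \<Gamma>' v a b c" by (auto simp: flips_def)
    then show "ccw_at G \<Gamma> v h x y \<longleftrightarrow> \<not> ccw_at G \<Gamma>' v h x y" using perm[of a b c] t c by auto
  next
    assume "ccw_at G \<Gamma> v h x y \<longleftrightarrow> \<not> ccw_at G \<Gamma>' v h x y"
    then show "v \<in> flips G \<Gamma> \<Gamma>'" using t v unfolding flips_def by blast
  qed
qed

text \<open>The curves of the three paths meet only in their ends, and small circles around these
  see only the first or last edges; this transfers the statement on theta curves to
  half-edges.\<close>

lemma theta_ccw:
  assumes G: "multigraph G" and P: "plane_graph G \<Gamma>" and th: "theta G u w as bs cs"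
  shows "ccw_curves (vpoint \<Gamma> u) (half_edge_path \<Gamma> (hd as)) (half_edge_path \<Gamma> (hd bs)) (half_edge_path \<Gamma> (hd cs)) \<longleftrightarrow>
    ccw_curves (vpoint \<Gamma> w) (half_edge_path \<Gamma> (rv (last as))) (half_edge_path \<Gamma> (rv (last cs))) (half_edge_path \<Gamma> (rv (last bs)))"
proof -
  have sp: "spath G u as w" "spath G u bs w" "spath G u cs w" and uw: "u \<noteq> w"
    using th by (auto simp: theta_def)
  have ne: "as \<noteq> []" "bs \<noteq> []" "cs \<noteq> []" using sp uw by (auto simp: spath_def)
  note A = dpath_props[OF G P sp(1) ne(1)] and B = dpath_props[OF G P sp(2) ne(2)] and C = dpath_props[OF G P sp(3) ne(3)]
  have inter: "(vpoint \<Gamma> ` vset G u as \<union> (\<Union>h\<in>set as. open_edge G \<Gamma> (fst h))) \<inter>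
      (vpoint \<Gamma> ` vset G u bs \<union> (\<Union>h\<in>set bs. open_edge G \<Gamma> (fst h))) = {vpoint \<Gamma> u, vpoint \<Gamma> w}"
    if "spath G u as w" "spath G u bs w" "as \<noteq> []" "bs \<noteq> []" "vset G u as \<inter> vset G u bs = {u, w}"
      "fst ` set as \<inter> fst ` set bs = {}" for as bs
  proof -
    have wk: "walk G u as w" "walk G u bs w" using that(1,2) by (auto simp: spath_def)
    have vs: "vset G u as \<subseteq> verts G" "vset G u bs \<subseteq> verts G" using walk_verts[OF G] wk that by blast+
    have ed: "fst h \<in> edges G" if "h \<in> set as \<union> set bs" for h
      using that walk_half_edges[OF wk(1)] walk_half_edges[OF wk(2)] half_edge_verts(3)[OF G] by blast
    have 1: "vpoint \<Gamma> ` vset G u as \<inter> vpoint \<Gamma> ` vset G u bs = vpoint \<Gamma> ` {u, w}"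
      unfolding that(5)[symmetric]
      by (rule inj_on_image_Int[OF open_edge_disjoint(3)[OF P] vs, symmetric])
    have 2: "open_edge G \<Gamma> (fst h) \<inter> vpoint \<Gamma> ` (vset G u as \<union> vset G u bs) = {}" if "h \<in> set as \<union> set bs" for h
      using open_edge_disjoint(1)[OF P ed[OF that]] vs by blast
    have 3: "open_edge G \<Gamma> (fst h) \<inter> open_edge G \<Gamma> (fst k) = {}" if "h \<in> set as" "k \<in> set bs" for h k
    proof -
      have "fst h \<noteq> fst k" using that \<open>fst ` set as \<inter> fst ` set bs = {}\<close> by (metis IntI emptyE imageI)
      then show ?thesis using open_edge_disjoint(2)[OF P] ed that by blast
    qed
    show ?thesis using 1 2 3 by blast
  qed
  have thc: "vset G u as \<inter> vset G u bs = {u, w}" "fst ` set as \<inter> fst ` set bs = {}"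
     "vset G u as \<inter> vset G u cs = {u, w}" "fst ` set as \<inter> fst ` set cs = {}"
     "vset G u bs \<inter> vset G u cs = {u, w}" "fst ` set bs \<inter> fst ` set cs = {}"
    using th by (auto simp: theta_def)
  have i: "path_image (dpath \<Gamma> as) \<inter> path_image (dpath \<Gamma> bs) = {vpoint \<Gamma> u, vpoint \<Gamma> w}"
    "path_image (dpath \<Gamma> as) \<inter> path_image (dpath \<Gamma> cs) = {vpoint \<Gamma> u, vpoint \<Gamma> w}"
    "path_image (dpath \<Gamma> bs) \<inter> path_image (dpath \<Gamma> cs) = {vpoint \<Gamma> u, vpoint \<Gamma> w}"
    using inter[OF sp(1,2) ne(1,2) thc(1,2)] inter[OF sp(1,3) ne(1,3) thc(3,4)] inter[OF sp(2,3) ne(2,3) thc(5,6)]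
      A B C by metis+
  have main: "ccw_curves (vpoint \<Gamma> u) (dpath \<Gamma> as) (dpath \<Gamma> bs) (dpath \<Gamma> cs) \<longleftrightarrow>
     ccw_curves (vpoint \<Gamma> w) (reversepath (dpath \<Gamma> as)) (reversepath (dpath \<Gamma> cs)) (reversepath (dpath \<Gamma> bs))"
    by (rule ccw_curves_theta) (use A B C i in blast)+
  have posd: "dist (vpoint \<Gamma> u) (vpoint \<Gamma> (tgt G (hd hs))) > 0 \<and> dist (vpoint \<Gamma> w) (vpoint \<Gamma> (hvert G (last hs))) > 0"
    if "spath G u hs w" "hs \<noteq> []" for hs
  proof -
    have wk: "walk G u hs w" and ds: "distinct (u # map (tgt G) hs)" "distinct (map (hvert G) hs @ [w])"
      using that(1) spath_iff_srcs[of G u hs w] by (auto simp: spath_def)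
    have "tgt G (hd hs) \<in> tgt G ` set hs" "hvert G (last hs) \<in> hvert G ` set hs" using that(2) by auto
    then have "u \<noteq> tgt G (hd hs)" "w \<noteq> hvert G (last hs)" using ds by auto
    moreover have "{u, w, tgt G (hd hs), hvert G (last hs)} \<subseteq> verts G"
    proof -
      have "u \<in> vset G u hs" "w \<in> vset G u hs" using vset_srcs[OF wk] by (auto simp: vset_def)
      moreover have "tgt G (hd hs) \<in> vset G u hs" "hvert G (last hs) \<in> vset G u hs"
        using walk_edge_ends[OF wk] that(2) by auto
      ultimately show ?thesis using walk_verts[OF G wk that(2)] by blast
    qed
    ultimately show ?thesis using open_edge_disjoint(3)[OF P] by (auto simp: inj_on_def)
  qed
  define R where "R = Min {dist (vpoint \<Gamma> u) (vpoint \<Gamma> (tgt G (hd as))), dist (vpoint \<Gamma> u) (vpoint \<Gamma> (tgt G (hd bs))),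
     dist (vpoint \<Gamma> u) (vpoint \<Gamma> (tgt G (hd cs))), dist (vpoint \<Gamma> w) (vpoint \<Gamma> (hvert G (last as))),
     dist (vpoint \<Gamma> w) (vpoint \<Gamma> (hvert G (last bs))), dist (vpoint \<Gamma> w) (vpoint \<Gamma> (hvert G (last cs)))}"
  have R0: "R > 0" unfolding R_def
    using posd[OF sp(1) ne(1)] posd[OF sp(2) ne(2)] posd[OF sp(3) ne(3)] by (subst Min_gr_iff) auto
  have le: "R \<le> dist (vpoint \<Gamma> u) (vpoint \<Gamma> (tgt G (hd as)))" "R \<le> dist (vpoint \<Gamma> u) (vpoint \<Gamma> (tgt G (hd bs)))"
    "R \<le> dist (vpoint \<Gamma> u) (vpoint \<Gamma> (tgt G (hd cs)))" "R \<le> dist (vpoint \<Gamma> w) (vpoint \<Gamma> (hvert G (last as)))"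
    "R \<le> dist (vpoint \<Gamma> w) (vpoint \<Gamma> (hvert G (last bs)))" "R \<le> dist (vpoint \<Gamma> w) (vpoint \<Gamma> (hvert G (last cs)))"
    unfolding R_def by (rule Min_le; simp)+
  have "ccw_curves (vpoint \<Gamma> u) (dpath \<Gamma> as) (dpath \<Gamma> bs) (dpath \<Gamma> cs) \<longleftrightarrow>
    ccw_curves (vpoint \<Gamma> u) (half_edge_path \<Gamma> (hd as)) (half_edge_path \<Gamma> (hd bs)) (half_edge_path \<Gamma> (hd cs))"
  proof (rule ccw_curves_cong[OF R0])
    fix r assume "0 < r" "r \<le> R"
    then show "first_hit (vpoint \<Gamma> u) r (dpath \<Gamma> as) = first_hit (vpoint \<Gamma> u) r (half_edge_path \<Gamma> (hd as)) \<and>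
      first_hit (vpoint \<Gamma> u) r (dpath \<Gamma> bs) = first_hit (vpoint \<Gamma> u) r (half_edge_path \<Gamma> (hd bs)) \<and>
      first_hit (vpoint \<Gamma> u) r (dpath \<Gamma> cs) = first_hit (vpoint \<Gamma> u) r (half_edge_path \<Gamma> (hd cs))"
      using first_hit_dpath[OF G P sp(1) ne(1)] first_hit_dpath[OF G P sp(2) ne(2)] first_hit_dpath[OF G P sp(3) ne(3)] le
      by auto
  qed
  moreover have "ccw_curves (vpoint \<Gamma> w) (reversepath (dpath \<Gamma> as)) (reversepath (dpath \<Gamma> cs)) (reversepath (dpath \<Gamma> bs)) \<longleftrightarrow>
    ccw_curves (vpoint \<Gamma> w) (half_edge_path \<Gamma> (rv (last as))) (half_edge_path \<Gamma> (rv (last cs))) (half_edge_path \<Gamma> (rv (last bs)))"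
  proof (rule ccw_curves_cong[OF R0])
    fix r assume "0 < r" "r \<le> R"
    then show "first_hit (vpoint \<Gamma> w) r (reversepath (dpath \<Gamma> as)) = first_hit (vpoint \<Gamma> w) r (half_edge_path \<Gamma> (rv (last as))) \<and>
      first_hit (vpoint \<Gamma> w) r (reversepath (dpath \<Gamma> cs)) = first_hit (vpoint \<Gamma> w) r (half_edge_path \<Gamma> (rv (last cs))) \<and>
      first_hit (vpoint \<Gamma> w) r (reversepath (dpath \<Gamma> bs)) = first_hit (vpoint \<Gamma> w) r (half_edge_path \<Gamma> (rv (last bs)))"
      using first_hit_dpath_rev[OF G P sp(1) ne(1)] first_hit_dpath_rev[OF G P sp(2) ne(2)] first_hit_dpath_rev[OF G P sp(3) ne(3)] le
      by auto
  qed
  ultimately show ?thesis using main by blast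
qed

text \<open>By trivalence the theta uses all half-edges at both of its branch vertices, so in each
  drawing the rotation at \<open>u\<close> determines the one at \<open>w\<close> by the same
  rule.\<close>

lemma theta_flips:
  assumes G: "multigraph G" and tri: "trivalent G" and P: "plane_graph G \<Gamma>" "plane_graph G \<Gamma>'"
    and th: "theta G u w as bs cs"
  shows "u \<in> flips G \<Gamma> \<Gamma>' \<longleftrightarrow> w \<in> flips G \<Gamma> \<Gamma>'"
proof -
  have sp: "spath G u as w" "spath G u bs w" "spath G u cs w" and uw: "u \<noteq> w"
    using th by (auto simp: theta_def)
  have ne: "as \<noteq> []" "bs \<noteq> []" "cs \<noteq> []" using sp uw by (auto simp: spath_def)
  have ends: "hd hs \<in> half_edges_at G u" "rv (last hs) \<in> half_edges_at G w" "hd hs \<in> set hs" "last hs \<in> set hs"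
    if "spath G u hs w" "hs \<noteq> []" for hs
  proof -
    have wk: "walk G u hs w" using that by (simp add: spath_def)
    show "hd hs \<in> set hs" "last hs \<in> set hs" using that by auto
    show "hd hs \<in> half_edges_at G u" using wk that(2) by (cases hs) (auto simp: half_edges_at_def)
    have "walk G w (map rv (rev hs)) u" by (rule walk_rev[OF wk])
    then show "rv (last hs) \<in> half_edges_at G w" using that(2)
      by (cases hs rule: rev_cases) (auto simp: half_edges_at_def)
  qed
  have fd: "fst h \<noteq> fst k" if "h \<in> set xs" "k \<in> set ys" "fst ` set xs \<inter> fst ` set ys = {}" for h k xs ys
    using that by (metis IntI emptyE imageI)
  have f: "fst ` set as \<inter> fst ` set bs = {}" "fst ` set as \<inter> fst ` set cs = {}" "fst ` set bs \<inter> fst ` set cs = {}"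
    using th by (auto simp: theta_def)
  note ea = ends[OF sp(1) ne(1)] and eb = ends[OF sp(2) ne(2)] and ec = ends[OF sp(3) ne(3)]
  have d: "fst (hd as) \<noteq> fst (hd bs)" "fst (hd as) \<noteq> fst (hd cs)" "fst (hd bs) \<noteq> fst (hd cs)"
    "fst (last as) \<noteq> fst (last bs)" "fst (last as) \<noteq> fst (last cs)" "fst (last bs) \<noteq> fst (last cs)"
    using fd[OF _ _ f(1)] fd[OF _ _ f(2)] fd[OF _ _ f(3)] ea eb ec by blast+
  have du: "distinct [hd as, hd bs, hd cs]" and dw: "distinct [rv (last as), rv (last cs), rv (last bs)]" using d by auto
  have uv: "u \<in> verts G" "w \<in> verts G"
    using ea(1,2) half_edge_verts(1)[OF G, of "hd as"] half_edge_verts(1)[OF G, of "rv (last as)"]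
    unfolding half_edges_at_def by blast+
  have c3: "card (half_edges_at G u) = 3" "card (half_edges_at G w) = 3" using tri uv by (auto simp: trivalent_def)
  have hu: "half_edges_at G u = {hd as, hd bs, hd cs}"
    by (rule sym, rule card_subset_eq) (use c3 du ea eb ec in \<open>auto intro: card_ge_0_finite\<close>)
  have hw: "half_edges_at G w = {rv (last as), rv (last cs), rv (last bs)}"
    by (rule sym, rule card_subset_eq) (use c3 dw ea eb ec in \<open>auto intro: card_ge_0_finite\<close>)
  have eq: "ccw_at G D u (hd as) (hd bs) (hd cs) \<longleftrightarrow> ccw_at G D w (rv (last as)) (rv (last cs)) (rv (last bs))"
    if "plane_graph G D" for D
    unfolding ccw_at_def using theta_ccw[OF G that th] hu hw du dw by blast
  show ?thesis
    unfolding flips_iff[OF G P uv(1) hu du] flips_iff[OF G P uv(2) hw dw] using eq P by blast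
qed

section \<open>Cycles in trivalent graphs\<close>

lemma bit_add_eq_0 [simp]: "(a::bit) + b = 0 \<longleftrightarrow> a = b"
  by (cases a; cases b) auto

lemma bit_self [simp]: "(a::bit) + a = 0"
  by simp

lemma bit_neq: "(a::bit) + b = 1 \<longleftrightarrow> a \<noteq> b"
  by (cases a; cases b) auto

text \<open>\<open>R\<close> is read as a chord diagram on the positions from \<open>a\<close> to
  \<open>b\<close>. At the leftmost gap not spanned by a chord of the colour of \<open>a\<close>, a
  spanning chord has the other colour. The gap just before its start is spanned by a chord of the
  first colour, and the two chords cross, contrary to \<open>cross\<close>.\<close>

lemma monochromatic_segment:
  fixes R :: "nat \<Rightarrow> nat \<Rightarrow> bool" and col :: "nat \<Rightarrow> bool"
  assumes same: "\<And>i j. a \<le> i \<Longrightarrow> i < j \<Longrightarrow> j \<le> b \<Longrightarrow> R i j \<Longrightarrow> col i = col j"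
    and cross: "\<And>i j l m. a \<le> i \<Longrightarrow> i < j \<Longrightarrow> j < l \<Longrightarrow> l < m \<Longrightarrow> m \<le> b \<Longrightarrow> R i l \<Longrightarrow> R j m \<Longrightarrow> col i = col j"
    and cover: "\<And>t. a \<le> t \<Longrightarrow> t < b \<Longrightarrow> \<exists>p q. a \<le> p \<and> p \<le> t \<and> t < q \<and> q \<le> b \<and> R p q"
    and "a \<le> b"
  shows "col a = col b"
proof (rule ccontr)
  assume ne: "col a \<noteq> col b"
  then have "a < b" using \<open>a \<le> b\<close> by (cases "a = b") auto
  let ?A = "\<lambda>t. \<exists>p q. a \<le> p \<and> p \<le> t \<and> t < q \<and> q \<le> b \<and> R p q \<and> col p = col a"
  \<comment> \<open>A chord spanning the last gap ends in \<open>b\<close> and so has the colour of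
    \<open>b\<close>.\<close>
  have "\<exists>t. a \<le> t \<and> t < b \<and> \<not> ?A t"
  proof (rule ccontr)
    assume "\<not> ?thesis"
    moreover have "a \<le> b - 1" "b - 1 < b" using \<open>a < b\<close> by auto
    ultimately have "?A (b - 1)" by blast
    then obtain p q where "a \<le> p" "p \<le> b - 1" "b - 1 < q" "q \<le> b" "R p q" "col p = col a" by blast
    then have "q = b" "p < b" using \<open>a < b\<close> by auto
    then have "col p = col b" using same[of p b] \<open>a \<le> p\<close> \<open>R p q\<close> by auto
    then show False using ne \<open>col p = col a\<close> by simp
  qed
  then obtain t where t: "a \<le> t" "t < b" "\<not> ?A t" and least: "\<And>s. s < t \<Longrightarrow> \<not> (a \<le> s \<and> s < b \<and> \<not> ?A s)"
    using exists_least_iff[of "\<lambda>t. a \<le> t \<and> t < b \<and> \<not> ?A t"] by blast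
  obtain x y where xy: "a \<le> x" "x \<le> t" "t < y" "y \<le> b" "R x y" using cover[OF t(1,2)] by blast
  then have cx: "col x \<noteq> col a" using t(3) by blast
  then have "a < x" using xy(1) by (cases "a = x") auto
  then have "x - 1 < t" "a \<le> x - 1" "x - 1 < b" using xy t by auto
  then have "?A (x - 1)" using least[of "x - 1"] by blast
  then obtain x' y' where xy': "a \<le> x'" "x' \<le> x - 1" "x - 1 < y'" "y' \<le> b" "R x' y'" "col x' = col a" by blast
  have "col x' = col y'" using same[of x' y'] xy' by auto
  then have "y' \<noteq> x" using cx xy' by auto
  moreover have "y' \<le> t" using t(3) xy' xy \<open>a < x\<close> by (metis le_trans diff_le_self not_le)
  ultimately have "x' < x" "x < y'" "y' < y" using xy' xy \<open>a < x\<close> by auto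
  then have "col x' = col x" using cross[of x' x y' y] xy xy' by auto
  then show False using cx xy' by simp
qed

text \<open>Between consecutive gaps without a spanning chord the colours at both ends agree, so
  every change of colour that affects the comparison of \<open>col 0\<close> with
  \<open>col j\<close> happens at such a gap.\<close>

lemma colour_change_parity:
  fixes R :: "nat \<Rightarrow> nat \<Rightarrow> bool" and col :: "nat \<Rightarrow> bool"
  assumes same: "\<And>i j. i < j \<Longrightarrow> j < k \<Longrightarrow> R i j \<Longrightarrow> col i = col j"
    and cross: "\<And>i j l m. i < j \<Longrightarrow> j < l \<Longrightarrow> l < m \<Longrightarrow> m < k \<Longrightarrow> R i l \<Longrightarrow> R j m \<Longrightarrow> col i = col j"
  defines "closed_at \<equiv> \<lambda>i. \<forall>p q. p \<le> i \<longrightarrow> i < q \<longrightarrow> q < k \<longrightarrow> \<not> R p q"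
  shows "j < k \<Longrightarrow> j = k - 1 \<or> closed_at j \<Longrightarrow>
    even (card {i. i < j \<and> closed_at i \<and> col i \<noteq> col (Suc i)}) \<longleftrightarrow> col 0 = col j"
proof (induction j rule: less_induct)
  case (less j)
  let ?S = "\<lambda>j. {i. i < j \<and> closed_at i \<and> col i \<noteq> col (Suc i)}"
  have seg: "col a = col j" if aj: "a \<le> j" "a = 0 \<or> closed_at (a - 1)" "\<forall>t. a \<le> t \<longrightarrow> t < j \<longrightarrow> \<not> closed_at t" for a
  proof (rule monochromatic_segment[of a j R col])
    fix t assume t: "a \<le> t" "t < j"
    then obtain p q where pq: "p \<le> t" "t < q" "q < k" "R p q" using aj(3) unfolding closed_at_def by blast
    have "a \<le> p"
    proof (rule ccontr)
      assume "\<not> a \<le> p"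
      then have "closed_at (a - 1)" "p \<le> a - 1" "a - 1 < q" using aj(2) pq t by auto
      then show False using pq unfolding closed_at_def by blast
    qed
    moreover have "q \<le> j"
    proof (rule ccontr)
      assume "\<not> q \<le> j"
      then have "j \<noteq> k - 1" using pq by auto
      then have "closed_at j" using less.prems by blast
      moreover have "p \<le> j" "j < q" using pq t \<open>\<not> q \<le> j\<close> by auto
      ultimately show False using pq unfolding closed_at_def by blast
    qed
    ultimately show "\<exists>p q. a \<le> p \<and> p \<le> t \<and> t < q \<and> q \<le> j \<and> R p q" using pq by blast
  next
    show "a \<le> j" by (rule aj(1))
    show "col i = col j'" if "a \<le> i" "i < j'" "j' \<le> j" "R i j'" for i j'
      using same[of i j'] that less.prems(1) by auto
    show "col i = col i'" if "a \<le> i" "i < i'" "i' < l" "l < m" "m \<le> j" "R i l" "R i' m" for i i' l m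
      using cross[of i i' l m] that less.prems(1) by auto
  qed
  show ?case
  proof (cases "\<exists>i<j. closed_at i")
    case False
    then have e: "?S j = {}" by auto
    have "col 0 = col j" using seg[of 0] False by auto
    then show ?thesis unfolding e by simp
  next
    case True
    define i where "i = Max {i. i < j \<and> closed_at i}"
    have fin: "finite {i. i < j \<and> closed_at i}" by simp
    have i: "i < j" "closed_at i" using Max_in[OF fin] True unfolding i_def by auto
    have mx: "t \<le> i" if "t < j" "closed_at t" for t using Max_ge[OF fin, of t] that unfolding i_def by auto
    have c: "col (Suc i) = col j" 
    proof (rule seg)
      show "\<forall>t. Suc i \<le> t \<longrightarrow> t < j \<longrightarrow> \<not> closed_at t" using mx by fastforce
    qed (use i in auto)
    have IH: "even (card (?S i)) \<longleftrightarrow> col 0 = col i" using less.IH[OF i(1)] i less.prems by auto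
    have "?S j = (if col i \<noteq> col (Suc i) then insert i (?S i) else ?S i)"
      using i mx by (auto simp: less_le)
    then have "card (?S j) = card (?S i) + (if col i \<noteq> col (Suc i) then 1 else 0)" by simp
    then show ?thesis using IH c by auto
  qed
qed

section \<open>Cycles and paths off a cycle\<close>

locale cubic_graph =
  fixes G :: "('v, 'e) mgraph"
  assumes mg: "multigraph G" and tri: "trivalent G"
begin

text \<open>Distinct edges are required besides distinct vertices in order to exclude one edge run
  through forth and back.\<close>

definition cyc :: "('e \<times> bool) list \<Rightarrow> bool" where
  "cyc C \<longleftrightarrow> C \<noteq> [] \<and> walk G (hvert G (hd C)) C (hvert G (hd C)) \<and> distinct (map (hvert G) C) \<and> distinct (map fst C)"

definition off :: "('e \<times> bool) list \<Rightarrow> 'v \<Rightarrow> 'v \<Rightarrow> bool" where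
  "off C x y \<longleftrightarrow> (\<exists>hs. walk G x hs y \<and> fst ` set hs \<inter> fst ` set C = {})"

lemma off_refl: "off C x x"
  unfolding off_def by (intro exI[of _ "[]"]) simp

lemma off_sym: "off C x y \<Longrightarrow> off C y x"
proof -
  assume "off C x y"
  then obtain hs where hs: "walk G x hs y" "fst ` set hs \<inter> fst ` set C = {}" unfolding off_def by blast
  have "fst ` set (map rv (rev hs)) = fst ` set hs" by (simp add: image_image)
  then show "off C y x" unfolding off_def using walk_rev[OF hs(1)] hs(2) by blast
qed

lemma off_trans: "off C x y \<Longrightarrow> off C y z \<Longrightarrow> off C x z"
proof -
  assume "off C x y" "off C y z"
  then obtain a b where "walk G x a y" "fst ` set a \<inter> fst ` set C = {}" "walk G y b z" "fst ` set b \<inter> fst ` set C = {}"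
    unfolding off_def by blast
  then show ?thesis unfolding off_def by (intro exI[of _ "a @ b"]) (auto simp: walk_append)
qed

lemma off_edge: "h \<in> half_edges G \<Longrightarrow> fst h \<notin> fst ` set C \<Longrightarrow> off C (hvert G h) (tgt G h)"
  unfolding off_def by (intro exI[of _ "[h]"]) auto

lemma off_set: "set C = set C' \<Longrightarrow> off C = off C'"
  unfolding off_def by (intro ext) simp

lemma off_spath: "off C x y \<Longrightarrow> \<exists>hs. spath G x hs y \<and> fst ` set hs \<inter> fst ` set C = {}"
proof -
  assume "off C x y"
  then obtain ks where ks: "walk G x ks y" "fst ` set ks \<inter> fst ` set C = {}" unfolding off_def by blast
  obtain hs where "spath G x hs y" "set hs \<subseteq> set ks" using walk_shorten[OF ks(1)] by blast
  then show ?thesis using ks(2) by blast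
qed

lemma walk_prefix: "walk G x hs y \<Longrightarrow> z \<in> vset G x hs \<Longrightarrow> \<exists>as. walk G x as z \<and> set as \<subseteq> set hs"
proof (induction hs arbitrary: x)
  case Nil
  then show ?case by (intro exI[of _ "[]"]) (auto simp: vset_def)
next
  case (Cons h hs)
  show ?case
  proof (cases "z = x")
    case True
    then show ?thesis by (intro exI[of _ "[]"]) auto
  next
    case False
    then obtain as where "walk G (tgt G h) as z" "set as \<subseteq> set hs"
      using Cons.IH[of "tgt G h"] Cons.prems by (auto simp: vset_def)
    then show ?thesis using Cons.prems by (intro exI[of _ "h # as"]) auto
  qed
qed

lemma off_vset: "walk G x hs y \<Longrightarrow> fst ` set hs \<inter> fst ` set C = {} \<Longrightarrow> z \<in> vset G x hs \<Longrightarrow> off C x z"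
proof -
  assume a: "walk G x hs y" "fst ` set hs \<inter> fst ` set C = {}" "z \<in> vset G x hs"
  obtain as where "walk G x as z" "set as \<subseteq> set hs" using walk_prefix[OF a(1,3)] by blast
  then show ?thesis using a(2) unfolding off_def by blast
qed

lemma cyc_rotate: "cyc (P @ Q) \<Longrightarrow> Q \<noteq> [] \<Longrightarrow> cyc (Q @ P)"
proof -
  assume c: "cyc (P @ Q)" and Q: "Q \<noteq> []"
  let ?u = "hvert G (hd (P @ Q))"
  obtain v where v: "walk G ?u P v" "walk G v Q ?u" using c by (auto simp: cyc_def walk_append)
  then have "v = hvert G (hd Q)" using Q by (cases Q) auto
  then have "walk G (hvert G (hd (Q @ P))) (Q @ P) (hvert G (hd (Q @ P)))" using v Q by (auto simp: walk_append)
  then show ?thesis using c Q by (auto simp: cyc_def)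
qed

lemma cyc_targets: "cyc C \<Longrightarrow> tgt G ` set C = hvert G ` set C"
proof -
  assume c: "cyc C"
  let ?u = "hvert G (hd C)"
  have w: "walk G ?u C ?u" and ne: "C \<noteq> []" using c by (auto simp: cyc_def)
  have e: "map (hvert G) C @ [?u] = ?u # map (tgt G) C" by (rule walk_srcs[OF w])
  then have "last (map (hvert G) C @ [?u]) = last (?u # map (tgt G) C)" by simp
  then have "?u = tgt G (last C)" using ne by (simp add: last_map)
  then have "?u \<in> tgt G ` set C" using ne by (metis imageI last_in_set)
  moreover have "?u \<in> hvert G ` set C" using ne by simp
  moreover have "insert ?u (hvert G ` set C) = insert ?u (tgt G ` set C)"
    using arg_cong[OF e, of set] by simp
  ultimately show ?thesis by (metis insert_absorb)
qed

text \<open>A cycle uses two of the three half-edges at each of its vertices, which leaves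
  one.\<close>

lemma third_half_edge:
  assumes c: "cyc C" and v: "v \<in> hvert G ` set C"
    and k: "k \<in> half_edges_at G v" "k' \<in> half_edges_at G v" "fst k \<notin> fst ` set C" "fst k' \<notin> fst ` set C"
  shows "k = k'"
proof (rule ccontr)
  assume ne: "k \<noteq> k'"
  obtain h where h: "h \<in> set C" "hvert G h = v" using v unfolding image_def by blast
  have "v \<in> tgt G ` set C" using v by (simp only: cyc_targets[OF c])
  then obtain h' where h': "h' \<in> set C" "tgt G h' = v" unfolding image_def by blast
  have w: "walk G (hvert G (hd C)) C (hvert G (hd C))" using c by (simp add: cyc_def)
  have "h \<noteq> rv h'"
  proof
    assume e: "h = rv h'"
    then have "fst h = fst h'" by simp
    moreover have "inj_on fst (set C)" using c unfolding cyc_def by (simp add: distinct_map)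
    ultimately have "h = h'" using h(1) h'(1) by (simp add: inj_on_def)
    then show False using e by simp
  qed
  moreover have "h \<in> half_edges_at G v" "rv h' \<in> half_edges_at G v"
    using h h' walk_half_edges[OF w] by (auto simp: half_edges_at_def)
  ultimately have "{h, rv h', k, k'} \<subseteq> half_edges_at G v" "card {h, rv h', k, k'} = 4"
    using k ne h(1) h'(1) by (auto simp: card_insert_if)
  moreover have "card (half_edges_at G v) = 3" 
  proof -
    have "v \<in> verts G" using half_edge_verts(1)[OF mg, of k] k(1) unfolding half_edges_at_def by blast
    then show ?thesis using tri by (simp add: trivalent_def)
  qed
  moreover have "finite (half_edges_at G v)" using calculation(3) by (metis card.infinite zero_neq_numeral)
  ultimately show False using card_mono[of "half_edges_at G v" "{h, rv h', k, k'}"] by simp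
qed

text \<open>An inner vertex of the path on the cycle would need two half-edges off the cycle. Only
  one is left there, so the path would turn back along the edge on which it came and repeat a
  vertex.\<close>

lemma ear_meets_cycle:
  assumes c: "cyc C" and sp: "spath G x hs y" and o: "fst ` set hs \<inter> fst ` set C = {}"
    and xy: "x \<in> hvert G ` set C" "y \<in> hvert G ` set C"
  shows "vset G x hs \<inter> hvert G ` set C = {x, y}"
proof -
  have w: "walk G x hs y" and ds: "distinct (map (hvert G) hs @ [y])"
    using sp unfolding spath_iff_srcs by auto
  have "z = x \<or> z = y" if z: "z \<in> vset G x hs" "z \<in> hvert G ` set C" for z
  proof (rule ccontr)
    assume n: "\<not> (z = x \<or> z = y)"
    then obtain k where k: "k \<in> set hs" "hvert G k = z" using z(1) vset_srcs[OF w] by auto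
    then obtain as' bs where hs': "hs = as' @ k # bs" by (meson split_list)
    have "as' \<noteq> []" using n k w hs' by (cases as') auto
    then obtain as h where hs: "hs = as @ h # k # bs" using hs' by (metis append_Cons append_Nil append_assoc rev_exhaust)
    have wk: "tgt G h = z" "h \<in> half_edges G" "k \<in> half_edges G" "walk G (tgt G k) bs y"
      using w k(2) unfolding hs by (auto simp: walk_append)
    have "rv h = k"
      by (rule third_half_edge[OF c z(2)]) (use wk k(2) o hs in \<open>auto simp: half_edges_at_def\<close>)
    then have "tgt G k = hvert G h" by auto
    moreover have "tgt G k \<in> set (map (hvert G) bs @ [y])" using wk(4) by (cases bs) auto
    ultimately show False using ds unfolding hs by auto
  qed
  moreover have "{x, y} \<subseteq> vset G x hs" using vset_srcs[OF w] by (auto simp: vset_def)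
  ultimately show ?thesis using xy by blast
qed

lemma spath_append:
  assumes "spath G u as v" "spath G v bs w" "vset G u as \<inter> vset G v bs = {v}"
  shows "spath G u (as @ bs) w" "vset G u (as @ bs) = vset G u as \<union> vset G v bs"
proof -
  have w: "walk G u as v" "walk G v bs w" using assms by (auto simp: spath_def)
  have v: "v \<in> vset G u as" using vset_srcs[OF w(1)] by simp
  then show "vset G u (as @ bs) = vset G u as \<union> vset G v bs" by (auto simp: vset_def)
  have "v \<notin> tgt G ` set bs" using assms(2) by (simp add: spath_def)
  then have "vset G u as \<inter> tgt G ` set bs = {}" using assms(3) by (auto simp: vset_def)
  then show "spath G u (as @ bs) w" using assms w by (auto simp: spath_def walk_append vset_def)
qed

lemma cyc_part:
  assumes "cyc (A @ B)" "A \<noteq> []" "B \<noteq> []"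
  shows "spath G (hvert G (hd A)) A (hvert G (hd B))" "vset G (hvert G (hd A)) A = insert (hvert G (hd B)) (hvert G ` set A)"
    "hvert G ` set A \<inter> hvert G ` set B = {}" "fst ` set A \<inter> fst ` set B = {}"
proof -
  obtain v where v: "walk G (hvert G (hd A)) A v" "walk G v B (hvert G (hd A))"
    using assms by (auto simp: cyc_def walk_append)
  then have vB: "v = hvert G (hd B)" using assms(3) by (cases B) auto
  show d: "hvert G ` set A \<inter> hvert G ` set B = {}" "fst ` set A \<inter> fst ` set B = {}" using assms(1) by (auto simp: cyc_def)
  have "v \<in> hvert G ` set B" using vB assms(3) by simp
  then have "v \<notin> hvert G ` set A" using d by blast
  then have "distinct (map (hvert G) A @ [v])" using assms(1) by (auto simp: cyc_def)
  then show "spath G (hvert G (hd A)) A (hvert G (hd B))" using v vB by (simp add: spath_iff_srcs)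
  show "vset G (hvert G (hd A)) A = insert (hvert G (hd B)) (hvert G ` set A)" using vset_srcs[OF v(1)] vB by simp
qed

lemma set_rev_fst: "fst ` set (map rv (rev B)) = fst ` set B"
  by (simp add: image_image)

text \<open>The two parts of the cycle and a simple path off the cycle form the theta.\<close>

lemma theta_chord:
  assumes c: "cyc (A @ B)" "A \<noteq> []" "B \<noteq> []" and o: "off (A @ B) (hvert G (hd A)) (hvert G (hd B))"
  shows "\<exists>as bs cs. theta G (hvert G (hd A)) (hvert G (hd B)) as bs cs"
proof -
  let ?u = "hvert G (hd A)" and ?w = "hvert G (hd B)"
  have cB: "cyc (B @ A)" by (rule cyc_rotate[OF c(1,3)])
  note a = cyc_part[OF c] and b = cyc_part[OF cB c(3,2)]
  obtain E where E: "spath G ?u E ?w" "fst ` set E \<inter> fst ` set (A @ B) = {}" using off_spath[OF o] by blast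
  have uA: "?u \<in> hvert G ` set A" "?w \<in> hvert G ` set B" using c by auto
  have VE: "vset G ?u E \<inter> hvert G ` set (A @ B) = {?u, ?w}"
    by (rule ear_meets_cycle[OF c(1) E]) (use uA in auto)
  have VE': "vset G ?u E \<inter> (hvert G ` set A \<union> hvert G ` set B) = {?u, ?w}" using VE by (simp add: image_Un)
  let ?r = "map rv (rev B)"
  have r: "spath G ?u ?r ?w" by (rule spath_rev[OF b(1)])
  have wB: "walk G ?w B ?u" using b(1) by (simp add: spath_def)
  have Vr: "vset G ?u ?r = insert ?u (hvert G ` set B)" using vset_rev[OF wB] b(2) by simp
  have uw: "?u \<noteq> ?w" using a(3) uA by (metis disjoint_iff)
  have Ef: "fst ` set E \<inter> fst ` set A = {}" "fst ` set E \<inter> fst ` set B = {}" using E(2) by auto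
  have "theta G ?u ?w A E ?r"
    unfolding theta_def
  proof (intro conjI uw a(1) E(1) r)
    show "vset G ?u A \<inter> vset G ?u E = {?u, ?w}" unfolding a(2) using VE' uA by blast
    show "vset G ?u A \<inter> vset G ?u ?r = {?u, ?w}" unfolding a(2) Vr using a(3) uA by blast
    show "vset G ?u E \<inter> vset G ?u ?r = {?u, ?w}" unfolding Vr using VE' uA by blast
    show "fst ` set A \<inter> fst ` set E = {}" using Ef by blast
    show "fst ` set A \<inter> fst ` set ?r = {}" using a(4) by (simp only: set_rev_fst)
    show "fst ` set E \<inter> fst ` set ?r = {}" using Ef by (simp only: set_rev_fst)
  qed
  then show ?thesis by blast
qed

text \<open>The bookkeeping of vertices for \<open>theta_crossing\<close>: the sets
  \<open>H1\<close> to \<open>H4\<close> consist of the starting vertices of the edges in four parts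
  of a cycle, \<open>V\<close> and \<open>W\<close> are the vertex sets of two disjoint paths
  joining opposite division points.\<close>

lemma crossing_sets:
  assumes "H1 \<inter> H2 = {}" "H1 \<inter> H3 = {}" "H1 \<inter> H4 = {}" "H2 \<inter> H3 = {}" "H2 \<inter> H4 = {}" "H3 \<inter> H4 = {}"
    and "p \<in> H1" "q \<in> H2" "r \<in> H3" "s \<in> H4"
    and V: "V \<inter> (H1 \<union> H2 \<union> H3 \<union> H4) = {p, r}" and W: "W \<inter> (H1 \<union> H2 \<union> H3 \<union> H4) = {s, q}" and VW: "V \<inter> W = {}"
  shows "V \<inter> insert r H2 = {r}" "insert p H4 \<inter> W = {s}" "p \<noteq> q"
    "insert q H1 \<inter> (V \<union> insert r H2) = {p, q}" "insert q H1 \<inter> (insert p H4 \<union> W) = {p, q}"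
    "(V \<union> insert r H2) \<inter> (insert p H4 \<union> W) = {p, q}"
proof -
  have mem: "p \<in> V" "r \<in> V" "s \<in> W" "q \<in> W" using V W by blast+
  have dis: "x \<in> H1 \<Longrightarrow> x \<notin> H2 \<and> x \<notin> H3 \<and> x \<notin> H4" "x \<in> H2 \<Longrightarrow> x \<notin> H3 \<and> x \<notin> H4" "x \<in> H3 \<Longrightarrow> x \<notin> H4"
    "x \<in> V \<Longrightarrow> x \<notin> W" for x using assms(1-6) VW by blast+
  have nm: "p \<notin> H2" "p \<notin> H4" "q \<notin> H1" "q \<notin> H4" "r \<notin> H1" "r \<notin> H2" "r \<notin> H4" "s \<notin> H1" "s \<notin> H2" "p \<notin> W" "r \<notin> W" "q \<notin> V" "s \<notin> V"
    using assms(7-10) dis mem by metis+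
  show "p \<noteq> q" using nm mem by blast
  have ee: "V \<inter> H1 = {p, r} \<inter> H1" "V \<inter> H2 = {p, r} \<inter> H2" "V \<inter> H4 = {p, r} \<inter> H4"
    "W \<inter> H1 = {s, q} \<inter> H1" "W \<inter> H2 = {s, q} \<inter> H2" "W \<inter> H4 = {s, q} \<inter> H4"
    unfolding V[symmetric] W[symmetric] by blast+
  have e: "V \<inter> H1 = {p}" "V \<inter> H2 = {}" "V \<inter> H4 = {}" "W \<inter> H1 = {}" "W \<inter> H2 = {q}" "W \<inter> H4 = {s}"
    unfolding ee using nm assms(7-10) by simp_all
  show "V \<inter> insert r H2 = {r}" using e(2) mem by blast
  show "insert p H4 \<inter> W = {s}" using e(6) nm by blast
  show "insert q H1 \<inter> (V \<union> insert r H2) = {p, q}" using e(1) nm assms(1,7,8) mem by blast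
  show "insert q H1 \<inter> (insert p H4 \<union> W) = {p, q}" using e(4) nm assms(3,7,8) mem by blast
  show "(V \<union> insert r H2) \<inter> (insert p H4 \<union> W) = {p, q}" using e(3,5) nm assms(5,7,8) mem VW by blast
qed

lemma crossing_edge_sets:
  assumes "K1 \<inter> K2 = {}" "K1 \<inter> K4 = {}" "K2 \<inter> K4 = {}" "Z1 \<inter> K1 = {}" "Z1 \<inter> K2 = {}" "Z1 \<inter> K4 = {}"
     "Z2 \<inter> K1 = {}" "Z2 \<inter> K2 = {}" "Z2 \<inter> K4 = {}" "Z1 \<inter> Z2 = {}"
  shows "K1 \<inter> (Z1 \<union> K2) = {}" "K1 \<inter> (K4 \<union> Z2) = {}" "(Z1 \<union> K2) \<inter> (K4 \<union> Z2) = {}"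
  using assms by (auto simp: disjoint_iff)

text \<open>Let p, q, r, s be the division points in order. If p and q are joined off the cycle,
  \<open>theta_chord\<close> applies. Otherwise the paths from p to r and from s to q lie in
  different components off the cycle and are disjoint. The theta then consists of the part of the
  cycle from p to q, the path from p to r continued backwards along the cycle to q, and the way
  backwards along the cycle from p to s continued by the path to q.\<close>

lemma theta_crossing:
  assumes c: "cyc (A1 @ A2 @ A3 @ A4)" and ne: "A1 \<noteq> []" "A2 \<noteq> []" "A3 \<noteq> []" "A4 \<noteq> []"
    and o: "off (A1 @ A2 @ A3 @ A4) (hvert G (hd A1)) (hvert G (hd A3))"
      "off (A1 @ A2 @ A3 @ A4) (hvert G (hd A2)) (hvert G (hd A4))"
  shows "\<exists>as bs cs. theta G (hvert G (hd A1)) (hvert G (hd A2)) as bs cs"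
proof (cases "off (A1 @ A2 @ A3 @ A4) (hvert G (hd A1)) (hvert G (hd A2))")
  case True
  then show ?thesis using theta_chord[of A1 "A2 @ A3 @ A4"] c ne by simp
next
  case False
  let ?C = "A1 @ A2 @ A3 @ A4"
  let ?p = "hvert G (hd A1)" and ?q = "hvert G (hd A2)" and ?r = "hvert G (hd A3)" and ?s = "hvert G (hd A4)"
  have c2: "cyc (A2 @ (A3 @ A4 @ A1))" using cyc_rotate[of A1 "A2 @ A3 @ A4"] c ne by simp
  have c4: "cyc (A4 @ (A1 @ A2 @ A3))" using cyc_rotate[of "A1 @ A2 @ A3" A4] c ne by simp
  have n: "A2 @ A3 @ A4 \<noteq> []" "A3 @ A4 @ A1 \<noteq> []" "A1 @ A2 @ A3 \<noteq> []" using ne by auto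
  note a1 = cyc_part[OF c ne(1) n(1)] and a2 = cyc_part[OF c2 ne(2) n(2)] and a4 = cyc_part[OF c4 ne(4) n(3)]
  have hds: "hd (A2 @ A3 @ A4) = hd A2" "hd (A3 @ A4 @ A1) = hd A3" "hd (A1 @ A2 @ A3) = hd A1" using ne by auto
  define H1 H2 H3 H4 where "H1 = hvert G ` set A1" and "H2 = hvert G ` set A2" and "H3 = hvert G ` set A3" and "H4 = hvert G ` set A4"
  define K1 K2 K3 K4 where "K1 = fst ` set A1" and "K2 = fst ` set A2" and "K3 = fst ` set A3" and "K4 = fst ` set A4"
  have Hd: "H1 \<inter> H2 = {}" "H1 \<inter> H3 = {}" "H1 \<inter> H4 = {}" "H2 \<inter> H3 = {}" "H2 \<inter> H4 = {}" "H3 \<inter> H4 = {}"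
  proof -
    have "distinct (map (hvert G) A1 @ map (hvert G) A2 @ map (hvert G) A3 @ map (hvert G) A4)" using c by (simp add: cyc_def)
    then show "H1 \<inter> H2 = {}" "H1 \<inter> H3 = {}" "H1 \<inter> H4 = {}" "H2 \<inter> H3 = {}" "H2 \<inter> H4 = {}" "H3 \<inter> H4 = {}"
      unfolding H1_def H2_def H3_def H4_def by (simp_all add: Int_Un_distrib)
  qed
  have Fd: "K1 \<inter> K2 = {}" "K1 \<inter> K4 = {}" "K2 \<inter> K4 = {}"
  proof -
    have "distinct (map fst A1 @ map fst A2 @ map fst A3 @ map fst A4)" using c by (simp add: cyc_def)
    then show "K1 \<inter> K2 = {}" "K1 \<inter> K4 = {}" "K2 \<inter> K4 = {}"
      unfolding K1_def K2_def K4_def by (simp_all add: Int_Un_distrib)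
  qed
  have mem: "?p \<in> H1" "?q \<in> H2" "?r \<in> H3" "?s \<in> H4" using ne by (auto simp: H1_def H2_def H3_def H4_def)
  obtain E1 where E1: "spath G ?p E1 ?r" "fst ` set E1 \<inter> fst ` set ?C = {}" using off_spath[OF o(1)] by blast
  obtain E2 where E2: "spath G ?s E2 ?q" "fst ` set E2 \<inter> fst ` set ?C = {}" using off_spath[OF off_sym[OF o(2)]] by blast
  have HC: "hvert G ` set ?C = H1 \<union> H2 \<union> H3 \<union> H4" unfolding H1_def H2_def H3_def H4_def
    by (simp only: set_append image_Un Un_assoc)
  have memC: "?p \<in> hvert G ` set ?C" "?q \<in> hvert G ` set ?C" "?r \<in> hvert G ` set ?C" "?s \<in> hvert G ` set ?C"
    unfolding HC using mem by blast+
  define V W where "V = vset G ?p E1" and "W = vset G ?s E2"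
  have V0: "V \<inter> (H1 \<union> H2 \<union> H3 \<union> H4) = {?p, ?r}" and W0: "W \<inter> (H1 \<union> H2 \<union> H3 \<union> H4) = {?s, ?q}"
    using ear_meets_cycle[OF c E1 memC(1,3)] ear_meets_cycle[OF c E2 memC(4,2)] unfolding HC V_def W_def by blast+
  have wE: "walk G ?p E1 ?r" "walk G ?s E2 ?q" using E1 E2 by (auto simp: spath_def)
  have V12: "vset G ?p E1 \<inter> vset G ?s E2 = {}"
  proof (rule ccontr)
    assume "vset G ?p E1 \<inter> vset G ?s E2 \<noteq> {}"
    then obtain z where z: "z \<in> vset G ?p E1" "z \<in> vset G ?s E2" by blast
    note p1 = off_vset[OF wE(1) E1(2) z(1)] and p2 = off_vset[OF wE(2) E2(2) z(2)]
    have "off ?C ?p ?q" by (rule off_trans[OF p1 off_trans[OF off_sym[OF p2] off_sym[OF o(2)]]])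
    then show False using False by simp
  qed
  have F12: "fst ` set E1 \<inter> fst ` set E2 = {}"
  proof (rule ccontr)
    assume "fst ` set E1 \<inter> fst ` set E2 \<noteq> {}"
    then obtain f where "f \<in> fst ` set E1" "f \<in> fst ` set E2" by (meson IntE all_not_in_conv)
    then obtain h k where hk: "h \<in> set E1" "f = fst h" "k \<in> set E2" "f = fst k" by (meson imageE)
    have "hvert G h \<in> {hvert G k, tgt G k}" using same_edge_ends[of h k G] hk(2,4) by blast
    then have "hvert G h \<in> vset G ?s E2" using walk_edge_ends[OF wE(2) hk(3)] by (rule rev_subsetD)
    moreover have "hvert G h \<in> vset G ?p E1" using walk_edge_ends[OF wE(1) hk(1)] by simp
    ultimately have "hvert G h \<in> vset G ?p E1 \<inter> vset G ?s E2" by simp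
    then show False unfolding V12 by simp
  qed
  have FE: "fst ` set E1 \<inter> K1 = {}" "fst ` set E1 \<inter> K2 = {}" "fst ` set E1 \<inter> K4 = {}"
      "fst ` set E2 \<inter> K1 = {}" "fst ` set E2 \<inter> K2 = {}" "fst ` set E2 \<inter> K4 = {}"
    using E1(2) E2(2) unfolding K1_def K2_def K4_def by auto
  let ?r2 = "map rv (rev A2)" and ?r4 = "map rv (rev A4)"
  have w24: "walk G ?q A2 ?r" "walk G ?s A4 ?p" using a2(1) a4(1) unfolding hds by (auto simp: spath_def)
  have r2: "spath G ?r ?r2 ?q" "vset G ?r ?r2 = insert ?r H2"
    using spath_rev[OF a2(1)] vset_rev[OF w24(1)] a2(2) unfolding hds H2_def by auto
  have r4: "spath G ?p ?r4 ?s" "vset G ?p ?r4 = insert ?p H4"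
    using spath_rev[OF a4(1)] vset_rev[OF w24(2)] a4(2) unfolding hds H4_def by auto
  have VW: "V \<inter> W = {}" using V12 by (simp add: V_def W_def)
  note S = crossing_sets[OF Hd mem V0 W0 VW]
  note FS = crossing_edge_sets[OF Fd FE F12]
  have b: "spath G ?p (E1 @ ?r2) ?q" "vset G ?p (E1 @ ?r2) = V \<union> insert ?r H2"
    using spath_append[OF E1(1) r2(1)] S(1) unfolding r2(2) V_def by simp_all
  have d: "spath G ?p (?r4 @ E2) ?q" "vset G ?p (?r4 @ E2) = insert ?p H4 \<union> W"
    using spath_append[OF r4(1) E2(1)] S(2) unfolding r4(2) W_def by simp_all
  have a: "spath G ?p A1 ?q" "vset G ?p A1 = insert ?q H1" using a1(1,2) unfolding hds H1_def by auto
  have fs: "fst ` set (E1 @ ?r2) = fst ` set E1 \<union> K2" "fst ` set (?r4 @ E2) = K4 \<union> fst ` set E2"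
    by (simp_all add: image_Un image_image K2_def K4_def)
  have "theta G ?p ?q A1 (E1 @ ?r2) (?r4 @ E2)"
    unfolding theta_def a(2) b(2) d(2) fs K1_def[symmetric]
    by (intro conjI a(1) b(1) d(1) S(3-6) FS)
  then show ?thesis by blast
qed

end

section \<open>The potential of the flipped vertices\<close>

lemma list_split_two: "i < j \<Longrightarrow> j < length C \<Longrightarrow>
  \<exists>P A B. C = P @ A @ B \<and> A \<noteq> [] \<and> B \<noteq> [] \<and> hd A = C ! i \<and> hd B = C ! j"
proof -
  assume ij: "i < j" "j < length C"
  have "drop i C = take (j - i) (drop i C) @ drop j C"
    using append_take_drop_id[of "j - i" "drop i C"] ij by simp
  then have "C = take i C @ take (j - i) (drop i C) @ drop j C" using append_take_drop_id[of i C] by metis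
  moreover have "take (j - i) (drop i C) \<noteq> []" "drop j C \<noteq> []" using ij by auto
  moreover have "hd (take (j - i) (drop i C)) = C ! i" "hd (drop j C) = C ! j"
    using ij by (simp_all add: hd_drop_conv_nth hd_take)
  ultimately show ?thesis by blast
qed

lemma list_split_four:
  assumes "i < j" "j < l" "l < m" "m < length C"
  shows "\<exists>P A1 A2 A3 A4. C = P @ A1 @ A2 @ A3 @ A4 \<and> A1 \<noteq> [] \<and> A2 \<noteq> [] \<and> A3 \<noteq> [] \<and> A4 \<noteq> [] \<and>
    hd A1 = C ! i \<and> hd A2 = C ! j \<and> hd A3 = C ! l \<and> hd A4 = C ! m"
proof -
  define P' A1 A2 A3 A4 where "P' = take i C" and "A1 = take (j - i) (drop i C)" and "A2 = take (l - j) (drop j C)"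
    and "A3 = take (m - l) (drop l C)" and "A4 = drop m C"
  have d: "drop a C = take (b - a) (drop a C) @ drop b C" if "a \<le> b" for a b
    using append_take_drop_id[of "b - a" "drop a C"] that by simp
  have "C = P' @ drop i C" by (simp add: P'_def)
  also have "drop i C = A1 @ drop j C" unfolding A1_def using d[of i j] assms by simp
  also have "drop j C = A2 @ drop l C" unfolding A2_def using d[of j l] assms by simp
  also have "drop l C = A3 @ A4" unfolding A3_def A4_def using d[of l m] assms by simp
  finally have "C = P' @ A1 @ A2 @ A3 @ A4" .
  moreover have "A1 \<noteq> [] \<and> A2 \<noteq> [] \<and> A3 \<noteq> [] \<and> A4 \<noteq> []" using assms by (simp add: A1_def A2_def A3_def A4_def)
  moreover have "hd A1 = C ! i \<and> hd A2 = C ! j \<and> hd A3 = C ! l \<and> hd A4 = C ! m"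
    using assms by (simp add: A1_def A2_def A3_def A4_def hd_drop_conv_nth hd_take)
  ultimately show ?thesis by blast
qed

locale matched_graph = cubic_graph G for G :: "('v, 'e) mgraph" +
  fixes M :: "'e set"
  assumes pm: "perfect_matching G M"
begin

lemma matching_half_edges:
  assumes v: "v \<in> verts G"
  shows "\<exists>h x y. half_edges_at G v = {h, x, y} \<and> distinct [h, x, y] \<and> fst h \<in> M \<and> fst x \<notin> M \<and> fst y \<notin> M"
proof -
  have c: "card (half_edges_at G v) = 3" using tri v by (simp add: trivalent_def)
  obtain e where e: "e \<in> M" "endpoint G e v" and un: "\<And>e'. e' \<in> M \<Longrightarrow> endpoint G e' v \<Longrightarrow> e' = e"
    using pm v unfolding perfect_matching_def by blast
  obtain a b where ab: "ends G e = Some (a, b)" "a \<noteq> b" using pm e(1) unfolding perfect_matching_def by blast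
  have eE: "e \<in> edges G" using pm e(1) unfolding perfect_matching_def by blast
  define h where "h = (e, v = b)"
  have "v = a \<or> v = b" using e(2) ab by (auto simp: endpoint_def)
  then have hh: "h \<in> half_edges_at G v" using ab eE by (auto simp: h_def half_edges_at_def half_edges_def hvert_def)
  have only: "k = h" if "k \<in> half_edges_at G v" "fst k \<in> M" for k
  proof -
    have "endpoint G (fst k) v" using that(1) unfolding half_edges_at_def half_edges_def endpoint_def hvert_def
      by (auto split: if_splits)
    then have "fst k = e" using un that(2) by blast
    moreover have "hvert G k = v" "hvert G h = v" using that hh by (auto simp: half_edges_at_def)
    ultimately show ?thesis using ab by (cases k) (auto simp: h_def hvert_def split: if_splits)
  qed
  have "card (half_edges_at G v - {h}) = 2" using c hh by (simp add: card_Diff_singleton)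
  then obtain x y where xy: "half_edges_at G v - {h} = {x, y}" "x \<noteq> y" by (meson card_2_iff)
  then have "half_edges_at G v = {h, x, y}" "h \<noteq> x" "h \<noteq> y" using hh by blast+
  moreover have "fst x \<notin> M" "fst y \<notin> M" using only xy by blast+
  moreover have "fst h \<in> M" using e(1) by (simp add: h_def)
  ultimately show ?thesis using xy(2) by (intro exI[of _ h] exI[of _ x] exI[of _ y]) auto
qed

lemma finite_half_edges: "finite (half_edges G)"
proof -
  have "half_edges G \<subseteq> edges G \<times> UNIV" by (auto simp: half_edges_def)
  moreover have "finite (edges G \<times> (UNIV :: bool set))" using mg by (simp add: multigraph_def)
  ultimately show ?thesis by (rule finite_subset)
qed

end

text \<open>The sphere enters this part only through the property \<open>theta_F\<close> of the set
  of flipped vertices; all else concerns cuts of the graph.\<close>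

locale cubic_flip = matched_graph G M for G :: "('v, 'e) mgraph" and M :: "'e set" +
  fixes F :: "'v set"
  assumes theta_F: "\<forall>u w as bs cs. theta G u w as bs cs \<longrightarrow> (u \<in> F \<longleftrightarrow> w \<in> F)"
begin

text \<open>Among the edges with ends, those with \<open>c = 1\<close> form the cut between the two
  classes of vertices given by \<xi>. For matching edges, \<open>bridge e\<close> says that {e} is a
  cut, and \<open>sim e g\<close> with different \<open>e\<close> and \<open>g\<close> that {e, g}
  is one.\<close>

definition cobounds :: "('v \<Rightarrow> bit) \<Rightarrow> ('e \<Rightarrow> bit) \<Rightarrow> bool" where
  "cobounds \<xi> c \<longleftrightarrow> (\<forall>h\<in>half_edges G. \<xi> (hvert G h) + \<xi> (tgt G h) = c (fst h))"

definition sim :: "'e \<Rightarrow> 'e \<Rightarrow> bool" where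
  "sim e g \<longleftrightarrow> (\<exists>\<xi>. cobounds \<xi> (\<lambda>d. of_bool (d = e) + of_bool (d = g)))"

definition bridge :: "'e \<Rightarrow> bool" where
  "bridge e \<longleftrightarrow> (\<exists>\<xi>. cobounds \<xi> (\<lambda>d. of_bool (d = e)))"

definition D :: "'e set" where
  "D = {e \<in> M. \<exists>h\<in>half_edges G. fst h = e \<and> (hvert G h \<in> F) \<noteq> (tgt G h \<in> F)}"

lemma cobounds_add: "cobounds \<xi> c \<Longrightarrow> cobounds \<xi>' c' \<Longrightarrow> cobounds (\<lambda>v. \<xi> v + \<xi>' v) (\<lambda>d. c d + c' d)"
  unfolding cobounds_def by (metis (no_types, lifting) add.assoc add.commute)

lemma cobounds_0: "cobounds (\<lambda>_. 0) (\<lambda>_. 0)"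
  by (simp add: cobounds_def)

lemma cobounds_sum: "finite K \<Longrightarrow> (\<And>g. g \<in> K \<Longrightarrow> cobounds (\<xi> g) (c g)) \<Longrightarrow>
    cobounds (\<lambda>v. \<Sum>g\<in>K. \<xi> g v) (\<lambda>d. \<Sum>g\<in>K. c g d)"
proof (induction K rule: finite_induct)
  case empty
  then show ?case using cobounds_0 by simp
next
  case (insert g K)
  then show ?case using cobounds_add[of "\<xi> g" "c g" "\<lambda>v. \<Sum>g\<in>K. \<xi> g v" "\<lambda>d. \<Sum>g\<in>K. c g d"] by simp
qed

lemma sim_refl: "sim e e"
  unfolding sim_def using cobounds_0 by (intro exI[of _ "\<lambda>_. 0"]) simp

lemma sim_sym: "sim e g \<Longrightarrow> sim g e"
  unfolding sim_def by (simp only: add.commute)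

lemma sim_trans: "sim e g \<Longrightarrow> sim g f \<Longrightarrow> sim e f"
proof -
  assume "sim e g" "sim g f"
  then obtain \<xi> \<xi>' where "cobounds \<xi> (\<lambda>d. of_bool (d = e) + of_bool (d = g))" "cobounds \<xi>' (\<lambda>d. of_bool (d = g) + of_bool (d = f))"
    unfolding sim_def by blast
  from cobounds_add[OF this] have "cobounds (\<lambda>v. \<xi> v + \<xi>' v) (\<lambda>d. of_bool (d = e) + of_bool (d = f))"
    by (rule back_subst[of "cobounds _"]) (auto simp: fun_eq_iff)
  then show ?thesis unfolding sim_def by blast
qed

lemma sim_bridge: "sim e g \<Longrightarrow> bridge e \<Longrightarrow> bridge g"
proof -
  assume "sim e g" "bridge e"
  then obtain \<xi> \<xi>' where "cobounds \<xi> (\<lambda>d. of_bool (d = e) + of_bool (d = g))" "cobounds \<xi>' (\<lambda>d. of_bool (d = e))"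
    unfolding sim_def bridge_def by blast
  from cobounds_add[OF this] have "cobounds (\<lambda>v. \<xi> v + \<xi>' v) (\<lambda>d. of_bool (d = g))"
    by (rule back_subst[of "cobounds _"]) (auto simp: fun_eq_iff)
  then show ?thesis unfolding bridge_def by blast
qed

lemma cobounds_walk:
  assumes "cobounds \<xi> c" "walk G x hs y" "\<And>h. h \<in> set hs \<Longrightarrow> c (fst h) = 0"
  shows "\<xi> x = \<xi> y"
  using assms(2,3)
proof (induction hs arbitrary: x)
  case (Cons h hs)
  then have "\<xi> (hvert G h) + \<xi> (tgt G h) = c (fst h)" using assms(1) unfolding cobounds_def walk.simps by blast
  also have "c (fst h) = 0" using Cons.prems(2)[of h] by simp
  finally have "\<xi> (hvert G h) = \<xi> (tgt G h)" by (simp only: bit_add_eq_0)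
  moreover have "\<xi> (tgt G h) = \<xi> y" using Cons.IH[of "tgt G h"] Cons.prems by simp
  ultimately show ?case using Cons.prems(1) by simp
qed auto

text \<open>At each vertex exactly two half-edges do not belong to \<open>M\<close>, so the values
  of \<xi> cancel when summed over all such half-edges; summed edge by edge they give the values of
  \<open>c\<close>. A cut thus contains an even number of edges outside \<open>M\<close>.\<close>

lemma handshake:
  assumes "cobounds \<xi> c"
  shows "(\<Sum>e\<in>edges G - M. c e * of_bool (ends G e \<noteq> None)) = 0"
proof -
  let ?S = "{h \<in> half_edges G. fst h \<in> edges G - M}"
  let ?I = "{e \<in> edges G - M. ends G e \<noteq> None}"
  have fE: "finite (edges G)" and fV: "finite (verts G)" using mg by (auto simp: multigraph_def)
  have fS: "finite ?S" using finite_half_edges by simp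
  have "(\<Sum>h\<in>?S. \<xi> (hvert G h)) = (\<Sum>v\<in>verts G. \<Sum>h\<in>{h \<in> ?S. hvert G h = v}. \<xi> (hvert G h))"
    by (rule sum.group[symmetric, OF fS fV]) (use half_edge_verts(1)[OF mg] in auto)
  also have "\<dots> = (\<Sum>v\<in>verts G. 0)"
  proof (rule sum.cong[OF refl])
    fix v assume v: "v \<in> verts G"
    obtain h x y where h: "half_edges_at G v = {h, x, y}" "distinct [h, x, y]" "fst h \<in> M" "fst x \<notin> M" "fst y \<notin> M"
      using matching_half_edges[OF v] by blast
    have "{h \<in> ?S. hvert G h = v} = {k \<in> half_edges_at G v. fst k \<notin> M}"
      using half_edge_verts(3)[OF mg] by (auto simp: half_edges_at_def)
    also have "\<dots> = {x, y}" unfolding h(1) using h(3-5) by auto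
    finally have e: "{h \<in> ?S. hvert G h = v} = {x, y}" .
    have "hvert G x = v" "hvert G y = v" using h(1) unfolding half_edges_at_def by blast+
    then show "(\<Sum>h\<in>{h \<in> ?S. hvert G h = v}. \<xi> (hvert G h)) = 0" unfolding e using h(2) by simp
  qed
  finally have z: "(\<Sum>h\<in>?S. \<xi> (hvert G h)) = 0" by simp
  have S: "?S = (\<lambda>e. (e, False)) ` ?I \<union> (\<lambda>e. (e, True)) ` ?I" by (auto simp: half_edges_def image_iff)
  have fI: "finite ?I" using fE by simp
  have "(\<Sum>h\<in>?S. \<xi> (hvert G h)) = (\<Sum>e\<in>?I. \<xi> (hvert G (e, False))) + (\<Sum>e\<in>?I. \<xi> (hvert G (e, True)))"
    unfolding S by (subst sum.union_disjoint) (use fI in \<open>auto simp: sum.reindex inj_on_def\<close>)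
  also have "\<dots> = (\<Sum>e\<in>?I. c e)"
    unfolding sum.distrib[symmetric]
  proof (rule sum.cong[OF refl])
    fix e assume "e \<in> ?I"
    then have "(e, False) \<in> half_edges G" by (auto simp: half_edges_def)
    then show "\<xi> (hvert G (e, False)) + \<xi> (hvert G (e, True)) = c e"
      using assms by (force simp: cobounds_def tgt_def rv_def)
  qed
  also have "\<dots> = (\<Sum>e\<in>edges G - M. c e * of_bool (ends G e \<noteq> None))"
    by (rule sum.mono_neutral_cong_left) (use fE in auto)
  finally show ?thesis using z by simp
qed

text \<open>Otherwise \<open>g\<close> would be the only edge of the cut outside \<open>M\<close>,
  against \<open>handshake\<close>.\<close>

lemma sim_matching:
  assumes "sim e g" "e \<in> M" "(g, b) \<in> half_edges G"
  shows "g \<in> M"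
proof (rule ccontr)
  assume g: "g \<notin> M"
  have gE: "g \<in> edges G" "ends G g \<noteq> None" using assms(3) by (auto simp: half_edges_def)
  have fE: "finite (edges G)" using mg by (auto simp: multigraph_def)
  obtain \<xi> where "cobounds \<xi> (\<lambda>d. of_bool (d = e) + of_bool (d = g))" using assms(1) unfolding sim_def by blast
  from handshake[OF this]
  have "(\<Sum>d\<in>edges G - M. (of_bool (d = e) + of_bool (d = g)) * of_bool (ends G d \<noteq> None) :: bit) = 0" .
  moreover have "(\<Sum>d\<in>edges G - M. (of_bool (d = e) + of_bool (d = g)) * of_bool (ends G d \<noteq> None) :: bit) =
      (\<Sum>d\<in>{g}. 1)"
    by (rule sum.mono_neutral_cong_right) (use fE gE g assms(2) in auto)
  ultimately show False by simp
qed

text \<open>The edges \<open>g\<close> forming a 2-edge cut with \<open>e\<close> lie on every cycle through \<open>e\<close>; they are the edges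
  of the cycle not spanned by any path off the cycle.\<close>

lemma even_flipped_class:
  assumes e: "e \<in> M" and nb: "\<not> bridge e"
  shows "even (card {g \<in> D. sim e g})"
proof -
  obtain u v where uv: "ends G e = Some (u, v)" "u \<noteq> v" using pm e unfolding perfect_matching_def by blast
  have eE: "e \<in> edges G" using pm e unfolding perfect_matching_def by blast
  define he where "he = (e, False)"
  have he: "he \<in> half_edges G" "hvert G he = u" "tgt G he = v" "fst he = e"
    using uv eE by (auto simp: he_def half_edges_def hvert_def tgt_def rv_def)
  have hends: "{hvert G h, tgt G h} = {u, v}" if "fst h = e" for h
    using same_edge_ends[of h he G] that he by auto
  \<comment> \<open>If no path leads back, the vertices reachable from \<open>v\<close> without
    \<open>e\<close> form one side of a cut consisting of \<open>e\<close> alone.\<close>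
  have "off [he] v u"
  proof (rule ccontr)
    assume no: "\<not> off [he] v u"
    define \<xi> :: "'v \<Rightarrow> bit" where "\<xi> x = of_bool (off [he] v x)" for x
    have "cobounds \<xi> (\<lambda>d. of_bool (d = e))" unfolding cobounds_def
    proof
      fix h assume h: "h \<in> half_edges G"
      show "\<xi> (hvert G h) + \<xi> (tgt G h) = of_bool (fst h = e)"
      proof (cases "fst h = e")
        case True
        then have "hvert G h = u \<and> tgt G h = v \<or> hvert G h = v \<and> tgt G h = u" using hends[OF True] uv(2) by (auto simp: doubleton_eq_iff)
        then show ?thesis using no off_refl[of "[he]" v] True by (auto simp: \<xi>_def)
      next
        case False
        then have "off [he] (hvert G h) (tgt G h)" using off_edge[OF h, of "[he]"] he by simp
        then have "off [he] v (hvert G h) \<longleftrightarrow> off [he] v (tgt G h)" using off_trans off_sym by blast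
        then show ?thesis using False by (simp add: \<xi>_def)
      qed
    qed
    then show False using nb unfolding bridge_def by blast
  qed
  then obtain hs where hs: "spath G v hs u" "fst ` set hs \<inter> fst ` set [he] = {}" using off_spath by blast
  have wk: "walk G v hs u" and ds: "distinct (map (hvert G) hs @ [u])" using hs(1) unfolding spath_iff_srcs by auto
  have hne: "hs \<noteq> []" using wk uv(2) by auto
  have dfst: "distinct (map fst hs)" using hs(1)
  proof (induction hs arbitrary: v)
    case (Cons h hs)
    have w: "walk G (tgt G h) hs u" and ni: "hvert G h \<notin> vset G (tgt G h) hs" using Cons.prems by (auto simp: spath_Cons) (auto simp: spath_def)
    have "fst h \<notin> fst ` set hs"
    proof
      assume "fst h \<in> fst ` set hs"
      then obtain k where k: "k \<in> set hs" "fst h = fst k" by (meson imageE)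
      have "hvert G h \<in> {hvert G k, tgt G k}" using same_edge_ends[OF k(2), of G] by blast
      then show False using walk_edge_ends[OF w k(1)] ni by blast
    qed
    then show ?case using Cons.IH Cons.prems by (auto simp: spath_Cons)
  qed simp
  \<comment> \<open>With \<open>e\<close> as the last edge of the cycle, the gaps between
    consecutive positions are the other edges, and \<open>e\<close> joins the last position to the
    first.\<close>
  define C where "C = hs @ [he]"
  define k where "k = length C"
  have len: "k = Suc (length hs)" "0 < length hs" using hne by (auto simp: k_def C_def)
  have hdC: "hvert G (hd C) = v" using wk hne by (cases hs) (auto simp: C_def)
  have cC: "cyc C" unfolding cyc_def hdC
    using wk he ds dfst hs(2) by (auto simp: C_def walk_append)
  define c where "c i = hvert G (C ! i)" for i
  \<comment> \<open>The chords of the diagram: pairs of positions joined by a path off the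
    cycle.\<close>
  define R where "R i j \<longleftrightarrow> off C (c i) (c j)" for i j
  define col where "col i \<longleftrightarrow> c i \<in> F" for i
  have dC: "distinct (map fst C)" using cC by (simp add: cyc_def)
  have dH: "distinct (map (hvert G) C)" using cC by (simp add: cyc_def)
  have c0: "c 0 = v" using hdC cC by (simp add: c_def hd_conv_nth cyc_def)
  have ck: "c (k - 1) = u" using he len by (simp add: c_def C_def nth_append)
  have eC: "e \<in> fst ` set C" using he(4) by (force simp: C_def)
  have Clast: "C ! (k - 1) = he" using len by (simp add: C_def nth_append)
  have tg: "tgt G (C ! i) = c (Suc i)" if "Suc i < k" for i
  proof -
    have w: "walk G v C v" using cC unfolding cyc_def hdC by blast
    have "(map (hvert G) C @ [v]) ! Suc i = (v # map (tgt G) C) ! Suc i" using walk_srcs[OF w] by simp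
    then show ?thesis using that by (simp add: nth_append c_def k_def)
  qed
  have same: "col i = col j" if ij: "i < j" "j < k" "R i j" for i j
  proof -
    obtain P A B where PAB: "C = P @ A @ B" "A \<noteq> []" "B \<noteq> []" "hd A = C ! i" "hd B = C ! j"
      using list_split_two[of i j C] ij(1,2) unfolding k_def by blast
    have cy: "cyc (A @ (B @ P))" using cyc_rotate[of P "A @ B"] cC PAB by simp
    have "off (A @ (B @ P)) = off C" by (rule off_set) (auto simp: PAB(1))
    then have "off (A @ (B @ P)) (hvert G (hd A)) (hvert G (hd (B @ P)))" using ij(3) PAB by (simp add: R_def c_def)
    from theta_chord[OF cy PAB(2) _ this] PAB(3) have "hvert G (hd A) \<in> F \<longleftrightarrow> hvert G (hd (B @ P)) \<in> F"
      using theta_F by blast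
    moreover have "hd (B @ P) = hd B" using PAB(3) by simp
    ultimately show ?thesis unfolding col_def c_def PAB(4,5)[symmetric] by simp
  qed
  have cross: "col i = col j" if ij: "i < j" "j < l" "l < m" "m < k" "R i l" "R j m" for i j l m
  proof -
    obtain P A1 A2 A3 A4 where S: "C = P @ A1 @ A2 @ A3 @ A4" "A1 \<noteq> []" "A2 \<noteq> []" "A3 \<noteq> []" "A4 \<noteq> []"
      "hd A1 = C ! i" "hd A2 = C ! j" "hd A3 = C ! l" "hd A4 = C ! m"
      using list_split_four[of i j l m C] ij(1-4) unfolding k_def by blast
    have cy: "cyc (A1 @ A2 @ A3 @ (A4 @ P))" using cyc_rotate[of P "A1 @ A2 @ A3 @ A4"] cC S by simp
    have "off (A1 @ A2 @ A3 @ (A4 @ P)) = off C" by (rule off_set) (auto simp: S(1))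
    then have "off (A1 @ A2 @ A3 @ (A4 @ P)) (hvert G (hd A1)) (hvert G (hd A3))"
      "off (A1 @ A2 @ A3 @ (A4 @ P)) (hvert G (hd A2)) (hvert G (hd (A4 @ P)))"
      using ij(5,6) S by (simp_all add: R_def c_def)
    from theta_crossing[OF cy S(2-4) _ this] S(5) have "hvert G (hd A1) \<in> F \<longleftrightarrow> hvert G (hd A2) \<in> F"
      using theta_F by blast
    then show ?thesis unfolding col_def c_def S(6,7)[symmetric] .
  qed
  define cl where "cl i \<longleftrightarrow> (\<forall>p q. p \<le> i \<longrightarrow> i < q \<longrightarrow> q < k \<longrightarrow> \<not> R p q)" for i
  have par: "even (card {i. i < k - 1 \<and> cl i \<and> col i \<noteq> col (Suc i)}) \<longleftrightarrow> col 0 = col (k - 1)"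
    unfolding cl_def by (rule colour_change_parity[of k R col "k - 1"]) (use same cross len in auto)
  have inC: "fst (C ! i) = fst (C ! j) \<longleftrightarrow> i = j" if "i < k" "j < k" for i j
    using nth_eq_iff_index_eq[OF dC] that by (simp add: k_def)
  have simcl: "sim e (fst (C ! i)) \<longleftrightarrow> cl i" if i: "i < k - 1" for i
  proof
    assume "sim e (fst (C ! i))"
    then obtain \<xi> where \<xi>: "cobounds \<xi> (\<lambda>d. of_bool (d = e) + of_bool (d = fst (C ! i)))" unfolding sim_def by blast
    \<comment> \<open>Along the positions \<xi> changes only across the edge at position i. Off the
      cycle it is constant on paths, so none of them can span that gap.\<close>
    have step: "\<xi> (c j) + \<xi> (c (Suc j)) = of_bool (j = i)" if j: "Suc j < k" for j
    proof -
      have "C ! j \<in> half_edges G" using walk_half_edges cC j unfolding cyc_def k_def by (metis Suc_lessD nth_mem)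
      then have "\<xi> (c j) + \<xi> (c (Suc j)) = of_bool (fst (C ! j) = e) + of_bool (fst (C ! j) = fst (C ! i))"
        using \<xi> tg[OF j] unfolding cobounds_def c_def by metis
      moreover have "fst (C ! j) \<noteq> e" using inC[of j "k - 1"] Clast he j by auto
      moreover have "fst (C ! j) = fst (C ! i) \<longleftrightarrow> j = i" using inC[of j i] i j by auto
      ultimately show ?thesis by simp
    qed
    have flat: "\<xi> (c j) = \<xi> (c (Suc j))" if "Suc j < k" "j \<noteq> i" for j
      using step[OF that(1)] that(2) by (metis bit_add_eq_0 of_bool_eq(1))
    have low: "\<xi> (c p) = \<xi> (c i)" if "p \<le> i" for p
      using that
    proof (induction "i - p" arbitrary: p)
      case (Suc x)
      then have "\<xi> (c p) = \<xi> (c (Suc p))" using flat[of p] i by auto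
      then show ?case using Suc.hyps(1)[of "Suc p"] Suc.hyps(2) Suc.prems by auto
    qed auto
    have high: "\<xi> (c q) = \<xi> (c (Suc i))" if "i < q" "q < k" for q
      using that
    proof (induction q)
      case (Suc q)
      then show ?case using flat[of q] by (cases "q = i") auto
    qed auto
    have jump: "\<xi> (c i) \<noteq> \<xi> (c (Suc i))" using step[of i] i by (metis bit_self less_diff_conv of_bool_eq(2) plus_1_eq_Suc add.commute zero_neq_one)
    show "cl i" unfolding cl_def
    proof (intro allI impI notI)
      fix p q assume pq: "p \<le> i" "i < q" "q < k" "R p q"
      then obtain as where as: "walk G (c p) as (c q)" "fst ` set as \<inter> fst ` set C = {}" unfolding R_def off_def by blast
      have "\<xi> (c p) = \<xi> (c q)"
      proof (rule cobounds_walk[OF \<xi> as(1)])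
        fix h assume "h \<in> set as"
        then have "fst h \<notin> fst ` set C" using as(2) by blast
        moreover have "fst (C ! i) \<in> fst ` set C" "e \<in> fst ` set C" using eC i by (simp_all add: k_def)
        ultimately have "fst h \<noteq> e" "fst h \<noteq> fst (C ! i)" by metis+
        then show "of_bool (fst h = e) + of_bool (fst h = fst (C ! i)) = (0::bit)" by simp
      qed
      then show False using low[OF pq(1)] high[OF pq(2,3)] jump by simp
    qed
  next
    assume cli: "cl i"
    \<comment> \<open>One side of the cut: whatever is joined off the cycle to a position up to
      \<open>i\<close>.\<close>
    define \<xi> :: "'v \<Rightarrow> bit" where "\<xi> x = of_bool (\<exists>p\<le>i. off C (c p) x)" for x
    have \<xi>c: "\<xi> (c j) = of_bool (j \<le> i)" if "j < k" for j
    proof (cases "j \<le> i")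
      case True
      then show ?thesis using off_refl[of C "c j"] by (auto simp: \<xi>_def)
    next
      case False
      then have "\<not> (\<exists>p\<le>i. off C (c p) (c j))" using cli that unfolding cl_def R_def by (meson not_le)
      then show ?thesis using False by (simp add: \<xi>_def)
    qed
    have "cobounds \<xi> (\<lambda>d. of_bool (d = e) + of_bool (d = fst (C ! i)))" unfolding cobounds_def
    proof
      fix h assume h: "h \<in> half_edges G"
      show "\<xi> (hvert G h) + \<xi> (tgt G h) = of_bool (fst h = e) + of_bool (fst h = fst (C ! i))"
      proof (cases "fst h \<in> fst ` set C")
        case False
        then have o: "off C (hvert G h) (tgt G h)" by (rule off_edge[OF h])
        then have "(\<exists>p\<le>i. off C (c p) (hvert G h)) \<longleftrightarrow> (\<exists>p\<le>i. off C (c p) (tgt G h))" using off_trans off_sym by blast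
        moreover have "fst (C ! i) \<in> fst ` set C" "e \<in> fst ` set C" using eC i by (simp_all add: k_def)
        then have "fst h \<noteq> e" "fst h \<noteq> fst (C ! i)" using False by metis+
        ultimately show ?thesis by (simp add: \<xi>_def)
      next
        case True
        then obtain j where j: "j < k" "fst h = fst (C ! j)" unfolding k_def by (metis imageE in_set_conv_nth)
        have hv: "\<xi> (hvert G h) + \<xi> (tgt G h) = \<xi> (hvert G (C ! j)) + \<xi> (tgt G (C ! j))"
          using half_edge_cases[OF j(2)] by (auto simp: add.commute)
        have e1: "fst h = e \<longleftrightarrow> j = k - 1" using inC[of j "k - 1"] Clast he j len by auto
        have e2: "fst h = fst (C ! i) \<longleftrightarrow> j = i" using inC[of j i] i j by auto
        show ?thesis
        proof (cases "j = k - 1")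
          case True
          have "\<xi> (hvert G (C ! j)) + \<xi> (tgt G (C ! j)) = \<xi> (c (k - 1)) + \<xi> (c 0)"
            unfolding True Clast he c0 ck by (rule refl)
          also have "\<dots> = 1" using \<xi>c[of "k - 1"] \<xi>c[of 0] i len by simp
          finally show ?thesis unfolding hv e1 e2 using True i by simp
        next
          case False
          then have "\<xi> (hvert G (C ! j)) + \<xi> (tgt G (C ! j)) = \<xi> (c j) + \<xi> (c (Suc j))" using tg[of j] j by (simp add: c_def)
          also have "\<dots> = of_bool (j \<le> i) + of_bool (Suc j \<le> i)" using \<xi>c[of j] \<xi>c[of "Suc j"] False j by simp
          also have "\<dots> = of_bool (j = i)" by (auto simp: le_less)
          finally show ?thesis unfolding hv e1 e2 using False by simp
        qed
      qed
    qed
    then show "sim e (fst (C ! i))" unfolding sim_def by blast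
  qed
  have Dcross: "fst h \<in> D \<longleftrightarrow> fst h \<in> M \<and> (hvert G h \<in> F) \<noteq> (tgt G h \<in> F)" if "h \<in> half_edges G" for h
  proof -
    have "(hvert G k \<in> F) \<noteq> (tgt G k \<in> F) \<longleftrightarrow> (hvert G h \<in> F) \<noteq> (tgt G h \<in> F)" if "fst k = fst h" for k
      using half_edge_cases[of h k] that by auto
    then show ?thesis using that unfolding D_def by blast
  qed
  have Chalf: "C ! i \<in> half_edges G" if "i < k" for i
    using walk_half_edges cC that unfolding cyc_def k_def by (metis nth_mem)
  have mem: "sim e g \<and> g \<in> D \<and> g \<noteq> e \<longleftrightarrow> g \<in> (\<lambda>i. fst (C ! i)) ` {i. i < k - 1 \<and> cl i \<and> col i \<noteq> col (Suc i)}" for g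
  proof
    assume g: "sim e g \<and> g \<in> D \<and> g \<noteq> e"
    then obtain \<xi> where \<xi>: "cobounds \<xi> (\<lambda>d. of_bool (d = e) + of_bool (d = g))" unfolding sim_def by blast
    have "\<xi> u \<noteq> \<xi> v" using \<xi> he g unfolding cobounds_def bit_neq[symmetric] by auto
    \<comment> \<open>The path from \<open>v\<close> to \<open>u\<close> must cross the cut formed
      by \<open>e\<close> and \<open>g\<close>, and it does not contain \<open>e\<close>.\<close>
    have "g \<in> fst ` set hs"
    proof (rule ccontr)
      assume "g \<notin> fst ` set hs"
      have "fst h \<noteq> e" "fst h \<noteq> g" if "h \<in> set hs" for h
      proof -
        have "fst h \<in> fst ` set hs" using that by simp
        moreover have "e \<notin> fst ` set hs" using hs(2) he(4) by simp
        ultimately show "fst h \<noteq> e" "fst h \<noteq> g" using \<open>g \<notin> fst ` set hs\<close> by metis+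
      qed
      then have "\<xi> v = \<xi> u" by (intro cobounds_walk[OF \<xi> wk]) simp
      then show False using \<open>\<xi> u \<noteq> \<xi> v\<close> by simp
    qed
    then obtain i where i: "i < length hs" "g = fst (hs ! i)" by (metis imageE in_set_conv_nth)
    then have i': "i < k - 1" "g = fst (C ! i)" using len by (auto simp: C_def nth_append)
    then have "cl i" using simcl g by blast
    moreover have "col i \<noteq> col (Suc i)" using Dcross[OF Chalf[of i]] g i' tg[of i] by (auto simp: col_def c_def)
    ultimately show "g \<in> (\<lambda>i. fst (C ! i)) ` {i. i < k - 1 \<and> cl i \<and> col i \<noteq> col (Suc i)}" using i' by blast
  next
    assume "g \<in> (\<lambda>i. fst (C ! i)) ` {i. i < k - 1 \<and> cl i \<and> col i \<noteq> col (Suc i)}"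
    then obtain i where i: "i < k - 1" "cl i" "col i \<noteq> col (Suc i)" "g = fst (C ! i)" by blast
    have s: "sim e g" using simcl i by blast
    have hi: "C ! i \<in> half_edges G" using Chalf i by simp
    have "g \<in> M" using sim_matching[OF s e, of "snd (C ! i)"] hi i(4) by simp
    moreover have "(hvert G (C ! i) \<in> F) \<noteq> (tgt G (C ! i) \<in> F)" using i tg[of i] by (simp add: col_def c_def)
    ultimately have "g \<in> D" using Dcross[OF hi] i(4) by simp
    moreover have "g \<noteq> e" using inC[of i "k - 1"] Clast he i by auto
    ultimately show "sim e g \<and> g \<in> D \<and> g \<noteq> e" using s by blast
  qed
  let ?I = "{i. i < k - 1 \<and> cl i \<and> col i \<noteq> col (Suc i)}"
  have inj: "inj_on (\<lambda>i. fst (C ! i)) ?I" by (rule inj_onI) (use inC in auto)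
  have cardI: "card ((\<lambda>i. fst (C ! i)) ` ?I) = card ?I" by (rule card_image[OF inj])
  \<comment> \<open>The number of the other edges of \<open>D\<close> in the class has the parity of
    the change of colour from the first to the last position. The edge \<open>e\<close>, which
    closes the cycle, belongs to \<open>D\<close> exactly when these colours differ, so it makes the
    total even.\<close>
  have eD: "e \<in> D \<longleftrightarrow> col 0 \<noteq> col (k - 1)" using Dcross[OF he(1)] he e c0 ck by (auto simp: col_def)
  have split: "{g \<in> D. sim e g} = (\<lambda>i. fst (C ! i)) ` ?I \<union> (if col 0 \<noteq> col (k - 1) then {e} else {})"
    using mem eD sim_refl[of e] by (auto simp del: mem_Collect_eq)
  have "e \<notin> (\<lambda>i. fst (C ! i)) ` ?I" using mem[of e] by blast
  then have "card {g \<in> D. sim e g} = card ?I + (if col 0 \<noteq> col (k - 1) then 1 else 0)"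
    unfolding split using cardI by (auto simp: card_insert_if)
  then show ?thesis using par by auto
qed

end

context cubic_flip
begin

lemma finite_D: "finite D"
proof -
  have "D \<subseteq> edges G" unfolding D_def using half_edge_verts(3)[OF mg] by auto
  then show ?thesis using mg by (auto simp: multigraph_def intro: finite_subset)
qed

text \<open>The edge \<open>e\<close> together with each \<open>g\<close> is a cut; in the sum of an
  even number of these cuts \<open>e\<close> cancels.\<close>

lemma even_class_cobounds:
  assumes "finite K" "even (card K)" "\<And>g. g \<in> K \<Longrightarrow> sim e g"
  shows "\<exists>\<xi>. cobounds \<xi> (\<lambda>d. of_bool (d \<in> K))"
proof -
  obtain \<xi> where \<xi>: "\<And>g. g \<in> K \<Longrightarrow> cobounds (\<xi> g) (\<lambda>d. of_bool (d = e) + of_bool (d = g))"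
    using assms(3) unfolding sim_def by metis
  have "cobounds (\<lambda>v. \<Sum>g\<in>K. \<xi> g v) (\<lambda>d. \<Sum>g\<in>K. of_bool (d = e) + of_bool (d = g))"
    by (rule cobounds_sum[OF assms(1)]) (rule \<xi>)
  moreover have "(\<Sum>g\<in>K. of_bool (d = e) + of_bool (d = g)) = (of_bool (d \<in> K) :: bit)" for d
  proof -
    have "(\<Sum>g\<in>K. of_bool (d = e) :: bit) = 0" using assms(2) by (cases "d = e") (auto elim!: evenE)
    moreover have "(\<Sum>g\<in>K. of_bool (d = g) :: bit) = of_bool (d \<in> K)"
      using assms(1) by (simp add: of_bool_def sum.delta')
    ultimately show ?thesis unfolding sum.distrib by simp
  qed
  ultimately show ?thesis by auto
qed

text \<open>In each class of \<open>sim\<close> without bridges the edges of \<open>D\<close> are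
  even in number and hence form a cut; its side function is the coordinate of \<Psi> at a
  representative of the class. Across an edge of \<open>D\<close> in such a class \<Psi> thus
  changes in the coordinate of the representative instead of that of the edge, and these two edges
  form a cut or coincide. Across a bridge \<Psi> does not change, and the bridge alone is the
  required cut.\<close>

lemma potential:
  "\<exists>\<Psi> :: 'v \<Rightarrow> 'e \<Rightarrow> bit. (\<forall>v k. \<Psi> v k \<noteq> 0 \<longrightarrow> k \<in> M) \<and>
    (\<forall>h\<in>half_edges G. fst h \<notin> M \<longrightarrow> \<Psi> (hvert G h) = \<Psi> (tgt G h)) \<and>
    (\<forall>h\<in>half_edges G. fst h \<in> M \<longrightarrow> (\<exists>\<xi>. cobounds \<xi> (\<lambda>d. if d \<in> M
       then \<Psi> (hvert G h) d + \<Psi> (tgt G h) d + of_bool (d = fst h \<and> fst h \<in> D) else 0)))"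
proof -
  define N where "N = {e \<in> D. \<not> bridge e}"
  \<comment> \<open>The choice depends only on the class, because equivalent edges give the same
    predicate.\<close>
  define rep where "rep e = (SOME g. g \<in> D \<and> sim e g)" for e
  have rep: "rep e \<in> D \<and> sim e (rep e)" if "e \<in> D" for e
    unfolding rep_def by (rule someI[of _ e]) (use that sim_refl in blast)
  have rep_eq: "rep e = rep g" if "sim e g" for e g
  proof -
    have "(\<lambda>f. f \<in> D \<and> sim e f) = (\<lambda>f. f \<in> D \<and> sim g f)" using that sim_trans sim_sym by blast
    then show ?thesis unfolding rep_def by simp
  qed
  have DM: "D \<subseteq> M" by (auto simp: D_def)
  have "\<exists>\<xi>. cobounds \<xi> (\<lambda>d. of_bool (d \<in> {g \<in> D. sim k g}))" if "k \<in> N" for k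
    by (rule even_class_cobounds) (use that finite_D even_flipped_class DM in \<open>auto simp: N_def\<close>)
  then obtain \<xi> where \<xi>: "\<And>k. k \<in> N \<Longrightarrow> cobounds (\<xi> k) (\<lambda>d. of_bool (d \<in> {g \<in> D. sim k g}))" by metis
  define \<Psi> where "\<Psi> v k = (if k \<in> N \<and> rep k = k then \<xi> k v else 0)" for v k
  have jump: "\<Psi> (hvert G h) k + \<Psi> (tgt G h) k = of_bool (fst h \<in> N \<and> k = rep (fst h))" if h: "h \<in> half_edges G" for h k
  proof (cases "k \<in> N \<and> rep k = k")
    case True
    then have "\<Psi> (hvert G h) k + \<Psi> (tgt G h) k = of_bool (fst h \<in> D \<and> sim k (fst h))"
      using \<xi>[of k] h by (simp add: \<Psi>_def cobounds_def)
    also have "(fst h \<in> D \<and> sim k (fst h)) \<longleftrightarrow> (fst h \<in> N \<and> k = rep (fst h))"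
    proof
      assume a: "fst h \<in> D \<and> sim k (fst h)"
      then have "\<not> bridge (fst h)" using True sim_bridge sim_sym unfolding N_def by blast
      then show "fst h \<in> N \<and> k = rep (fst h)" using a rep_eq[of k "fst h"] True by (simp add: N_def)
    next
      assume "fst h \<in> N \<and> k = rep (fst h)"
      then show "fst h \<in> D \<and> sim k (fst h)" using rep[of "fst h"] sim_sym unfolding N_def by blast
    qed
    finally show ?thesis .
  next
    case False
    have "\<not> (fst h \<in> N \<and> k = rep (fst h))"
    proof
      assume a: "fst h \<in> N \<and> k = rep (fst h)"
      then have s: "k \<in> D" "sim (fst h) k" using rep[of "fst h"] by (auto simp: N_def)
      have "\<not> bridge k" using a s(2) sim_bridge sim_sym unfolding N_def by blast
      moreover have "rep k = k" using rep_eq[OF s(2)] a by simp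
      ultimately show False using False s(1) by (simp add: N_def)
    qed
    then show ?thesis using False by (auto simp: \<Psi>_def)
  qed
  show ?thesis
  proof (intro exI[of _ \<Psi>] conjI allI ballI impI)
    fix v k assume "\<Psi> v k \<noteq> 0"
    then have "k \<in> N" unfolding \<Psi>_def by (metis (full_types))
    then show "k \<in> M" using DM by (auto simp: N_def)
  next
    fix h assume h: "h \<in> half_edges G" "fst h \<notin> M"
    then have "fst h \<notin> N" using DM by (auto simp: N_def)
    then have "\<Psi> (hvert G h) k + \<Psi> (tgt G h) k = 0" for k using jump[OF h(1), of k] by (simp only: simp_thms of_bool_eq)
    then show "\<Psi> (hvert G h) = \<Psi> (tgt G h)" by (intro ext) (simp only: bit_add_eq_0)
  next
    fix h assume h: "h \<in> half_edges G" "fst h \<in> M"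
    let ?c = "\<lambda>d. if d \<in> M then \<Psi> (hvert G h) d + \<Psi> (tgt G h) d + of_bool (d = fst h \<and> fst h \<in> D) else 0"
    have c: "?c = (\<lambda>d. of_bool (fst h \<in> N \<and> d = rep (fst h)) + of_bool (d = fst h \<and> fst h \<in> D))"
    proof
      fix d
      have "d \<in> M" if "fst h \<in> N \<and> d = rep (fst h) \<or> d = fst h" using that h(2) rep[of "fst h"] DM by (auto simp: N_def)
      then show "?c d = of_bool (fst h \<in> N \<and> d = rep (fst h)) + of_bool (d = fst h \<and> fst h \<in> D)"
        unfolding jump[OF h(1)] by auto
    qed
    show "\<exists>\<xi>. cobounds \<xi> ?c"
    proof (cases "fst h \<in> D")
      case False
      then have "?c = (\<lambda>_. 0)" unfolding c by (auto simp: N_def)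
      then show ?thesis using cobounds_0 by metis
    next
      case True
      show ?thesis
      proof (cases "bridge (fst h)")
        case True
        then have "?c = (\<lambda>d. of_bool (d = fst h))" unfolding c using \<open>fst h \<in> D\<close> by (auto simp: N_def)
        then show ?thesis using True unfolding bridge_def by metis
      next
        case False
        then have "?c = (\<lambda>d. of_bool (d = rep (fst h)) + of_bool (d = fst h))" unfolding c using True by (auto simp: N_def)
        moreover have "sim (rep (fst h)) (fst h)" using rep[OF True] sim_sym by blast
        ultimately show ?thesis unfolding sim_def by metis
      qed
    qed
  qed
qed

end

section \<open>The algebra of squarefree polynomials\<close>

text \<open>These rules rewrite sums and products of bits to \<open>XOR\<close> and \<open>AND\<close>.\<close>

declare Z2.add_bit_eq_xor [simp del] Z2.mult_bit_eq_and [simp del]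

text \<open>The quotient of \<open>\<int>\<^sub>2[x\<^sub>c | c]\<close> by the squares \<open>x\<^sub>c\<^sup>2\<close>: a set \<open>T\<close> stands for the monomial \<open>\<Prod>c\<in>T. x\<^sub>c\<close>.\<close>

typedef 'c sqf = "{f :: 'c set \<Rightarrow> bit. finite {T. f T \<noteq> 0} \<and> (\<forall>T. f T \<noteq> 0 \<longrightarrow> finite T)}"
  morphisms coeff Abs_sqf
  by (rule exI[of _ "\<lambda>_. 0"]) simp

setup_lifting type_definition_sqf

lemma coeff_finite: "finite {T. coeff f T \<noteq> 0}" "coeff f T \<noteq> 0 \<Longrightarrow> finite T"
  using coeff[of f] by auto

lemma coeff_infinite: "infinite T \<Longrightarrow> coeff f T = 0"
  using coeff_finite(2)[of f T] by blast

lemma sqf_eqI: "(\<And>T. coeff f T = coeff g T) \<Longrightarrow> f = g"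
  by (metis coeff_inject ext)

lemma finite_support_add:
  fixes f g :: "'c set \<Rightarrow> bit"
  assumes f: "finite {T. f T \<noteq> 0} \<and> (\<forall>T. f T \<noteq> 0 \<longrightarrow> finite T)"
    and g: "finite {T. g T \<noteq> 0} \<and> (\<forall>T. g T \<noteq> 0 \<longrightarrow> finite T)"
  shows "finite {T. f T + g T \<noteq> 0} \<and> (\<forall>T. f T + g T \<noteq> 0 \<longrightarrow> finite T)"
proof -
  have sub: "{T. f T + g T \<noteq> 0} \<subseteq> {T. f T \<noteq> 0} \<union> {T. g T \<noteq> 0}" by (auto simp del: bit_not_zero_iff)
  have "finite {T. f T + g T \<noteq> 0}" by (rule finite_subset[OF sub]) (use f g in blast)
  then show ?thesis using f g sub by blast
qed

instantiation sqf :: (type) comm_ring_1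
begin

lift_definition zero_sqf :: "'a sqf" is "\<lambda>_. 0"
  by simp

lift_definition one_sqf :: "'a sqf" is "\<lambda>T. of_bool (T = {})"
  by (auto simp: of_bool_def)

lift_definition plus_sqf :: "'a sqf \<Rightarrow> 'a sqf \<Rightarrow> 'a sqf" is "\<lambda>f g T. f T + g T"
  using finite_support_add by blast

lift_definition uminus_sqf :: "'a sqf \<Rightarrow> 'a sqf" is "\<lambda>f. f" .

lift_definition minus_sqf :: "'a sqf \<Rightarrow> 'a sqf \<Rightarrow> 'a sqf" is "\<lambda>f g T. f T + g T"
  using finite_support_add by blast

text \<open>Only splittings into disjoint sets contribute, since a common variable of two monomials
  produces a square.\<close>

lift_definition times_sqf :: "'a sqf \<Rightarrow> 'a sqf \<Rightarrow> 'a sqf" is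
  "\<lambda>f g T. if finite T then \<Sum>A\<in>Pow T. f A * g (T - A) else 0"
proof -
  fix f g :: "'a set \<Rightarrow> bit"
  assume f: "finite {T. f T \<noteq> 0} \<and> (\<forall>T. f T \<noteq> 0 \<longrightarrow> finite T)"
    and g: "finite {T. g T \<noteq> 0} \<and> (\<forall>T. g T \<noteq> 0 \<longrightarrow> finite T)"
  let ?h = "\<lambda>T. if finite T then \<Sum>A\<in>Pow T. f A * g (T - A) else 0"
  have "{T. ?h T \<noteq> 0} \<subseteq> (\<lambda>(A, B). A \<union> B) ` ({T. f T \<noteq> 0} \<times> {T. g T \<noteq> 0})"
  proof
    fix T assume "T \<in> {T. ?h T \<noteq> 0}"
    then have "(\<Sum>A\<in>Pow T. f A * g (T - A)) \<noteq> 0" by (auto split: if_splits)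
    then obtain A where "A \<in> Pow T" "f A * g (T - A) \<noteq> 0" by (meson sum.not_neutral_contains_not_neutral)
    then have "f A \<noteq> 0" "g (T - A) \<noteq> 0" "T = A \<union> (T - A)" by auto
    then show "T \<in> (\<lambda>(A, B). A \<union> B) ` ({T. f T \<noteq> 0} \<times> {T. g T \<noteq> 0})" by (intro image_eqI[of _ _ "(A, T - A)"]) auto
  qed
  moreover have "finite ((\<lambda>(A, B). A \<union> B) ` ({T. f T \<noteq> 0} \<times> {T. g T \<noteq> 0}))" using f g by blast
  ultimately have "finite {T. ?h T \<noteq> 0}" by (rule finite_subset)
  then show "finite {T. ?h T \<noteq> 0} \<and> (\<forall>T. ?h T \<noteq> 0 \<longrightarrow> finite T)" by auto
qed

instance
proof
  fix f g h :: "'a sqf"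
  show "f + g + h = f + (g + h)" by transfer (simp add: add.assoc)
  show "f + g = g + f" by transfer (simp add: add.commute)
  show "0 + f = f" by transfer simp
  show "- f + f = 0" by transfer simp
  show "f - g = f + - g" by transfer simp
  show "(0::'a sqf) \<noteq> 1" by transfer (auto simp: fun_eq_iff)
  show "f * g = g * f"
  proof (rule sqf_eqI)
    fix T :: "'a set"
    show "coeff (f * g) T = coeff (g * f) T"
    proof (cases "finite T")
      case True
      have "(\<Sum>A\<in>Pow T. coeff f A * coeff g (T - A)) = (\<Sum>A\<in>Pow T. coeff g A * coeff f (T - A))"
        by (rule sum.reindex_bij_witness[of _ "\<lambda>A. T - A" "\<lambda>A. T - A"])
           (auto simp: double_diff mult.commute)
      then show ?thesis using True by (simp add: times_sqf.rep_eq)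
    qed (simp add: times_sqf.rep_eq)
  qed
  show "1 * f = f"
  proof (rule sqf_eqI)
    fix T :: "'a set"
    show "coeff (1 * f) T = coeff f T"
    proof (cases "finite T")
      case True
      have "(\<Sum>A\<in>Pow T. coeff 1 A * coeff f (T - A)) = (\<Sum>A\<in>Pow T. if A = {} then coeff f T else 0)"
        by (rule sum.cong) (auto simp: one_sqf.rep_eq)
      then show ?thesis using True by (simp add: times_sqf.rep_eq)
    qed (simp add: times_sqf.rep_eq coeff_infinite)
  qed
  show "(f + g) * h = f * h + g * h"
    by (rule sqf_eqI) (simp add: times_sqf.rep_eq plus_sqf.rep_eq distrib_right sum.distrib)
  show "f * g * h = f * (g * h)"
  proof (rule sqf_eqI)
    fix T :: "'a set"
    show "coeff (f * g * h) T = coeff (f * (g * h)) T"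
    proof (cases "finite T")
      case True
      have fin: "finite A" if "A \<in> Pow T" for A using True that finite_subset by blast
      have "coeff (f * g * h) T = (\<Sum>A\<in>Pow T. (\<Sum>B\<in>Pow A. coeff f B * coeff g (A - B)) * coeff h (T - A))"
        using True fin by (simp add: times_sqf.rep_eq)
      also have "\<dots> = (\<Sum>(A, B)\<in>Sigma (Pow T) Pow. coeff f B * coeff g (A - B) * coeff h (T - A))"
        using True fin by (subst sum.Sigma[symmetric]) (auto simp: sum_distrib_right)
      also have "\<dots> = (\<Sum>(B, C)\<in>Sigma (Pow T) (\<lambda>B. Pow (T - B)). coeff f B * (coeff g C * coeff h (T - B - C)))"
        by (rule sum.reindex_bij_witness[of _ "\<lambda>(B, C). (B \<union> C, B)" "\<lambda>(A, B). (B, A - B)"])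
           (auto simp: Diff_Diff_Int Un_Diff mult.assoc Diff_Un[symmetric] intro!: arg_cong[of _ _ "coeff _"] arg_cong2[of _ _ _ _ "(*)"])
      also have "\<dots> = (\<Sum>B\<in>Pow T. coeff f B * (\<Sum>C\<in>Pow (T - B). coeff g C * coeff h (T - B - C)))"
        using True by (subst sum.Sigma[symmetric]) (auto simp: sum_distrib_left)
      also have "\<dots> = coeff (f * (g * h)) T" using True by (simp add: times_sqf.rep_eq)
      finally show ?thesis .
    qed (simp add: times_sqf.rep_eq)
  qed
qed

end

lemma sqf_char2 [simp]: "(f :: 'c sqf) + f = 0"
  by transfer simp

lemma sqf_two [simp]: "(2 :: 'c sqf) = 0"
  using sqf_char2[of 1] unfolding one_add_one .

lemma sqf_add_eq_0 [simp]: "(f :: 'c sqf) + g = 0 \<longleftrightarrow> f = g"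
  by (metis add_right_cancel sqf_char2)

lemma coeff_simps [simp]: "coeff 0 T = 0" "coeff (f + g) T = coeff f T + coeff g T" "coeff 1 T = of_bool (T = {})"
  by (simp_all add: zero_sqf.rep_eq plus_sqf.rep_eq one_sqf.rep_eq)

lemma coeff_sum: "coeff (sum f I) T = (\<Sum>i\<in>I. coeff (f i) T)"
  by (induction I rule: infinite_finite_induct) auto

lift_definition mono :: "'c set \<Rightarrow> 'c sqf" is "\<lambda>A T. of_bool (T = A \<and> finite A)"
  by (auto simp: of_bool_def)

definition var :: "'c \<Rightarrow> 'c sqf" where
  "var c = mono {c}"

lemma coeff_mono: "coeff (mono A) T = of_bool (T = A \<and> finite A)"
  by (simp add: mono.rep_eq)

lemma mono_empty [simp]: "mono {} = 1"
  by (rule sqf_eqI) (simp add: coeff_mono)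

lemma mono_mult:
  assumes "finite A" "finite B"
  shows "mono A * mono B = (if A \<inter> B = {} then mono (A \<union> B) else 0)"
proof (rule sqf_eqI)
  fix T
  have "(\<Sum>C\<in>Pow T. coeff (mono A) C * coeff (mono B) (T - C)) = of_bool (A \<inter> B = {} \<and> T = A \<union> B)" if "finite T"
  proof -
    have "(\<Sum>C\<in>Pow T. coeff (mono A) C * coeff (mono B) (T - C)) = (\<Sum>C\<in>Pow T. of_bool (C = A) * of_bool (T - A = B))"
      using assms by (intro sum.cong) (auto simp: coeff_mono)
    also have "\<dots> = (\<Sum>C\<in>Pow T. of_bool (C = A)) * of_bool (T - A = B)" by (simp only: sum_distrib_right)
    also have "(\<Sum>C\<in>Pow T. of_bool (C = A) :: bit) = of_bool (A \<subseteq> T)"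
      using that by (simp add: of_bool_def sum.delta)
    finally show ?thesis by (auto simp: of_bool_def)
  qed
  then show "coeff (mono A * mono B) T = coeff (if A \<inter> B = {} then mono (A \<union> B) else 0) T"
    using assms by (auto simp: times_sqf.rep_eq coeff_mono)
qed

lemma var_square [simp]: "var c * var c = 0"
  by (simp add: var_def mono_mult)

lemma var_eq_iff: "var c = var d \<longleftrightarrow> c = d"
proof
  assume "var c = var d"
  then have "coeff (var c) {c} = coeff (var d) {c}" by simp
  then show "c = d" by (simp add: var_def coeff_mono split: if_splits)
qed simp

lemma mono_eq_prod: "finite T \<Longrightarrow> mono T = (\<Prod>c\<in>T. var c)"
proof (induction T rule: finite_induct)
  case (insert c T)
  then show ?case using mono_mult[of "{c}" T] by (simp add: var_def)
qed simp

definition scale :: "bit \<Rightarrow> 'c sqf \<Rightarrow> 'c sqf" where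
  "scale b f = (if b = 1 then f else 0)"

lemma scale_simps [simp]: "scale 0 f = 0" "scale 1 f = f" "scale b 0 = 0"
  by (simp_all add: scale_def)

lemma scale_add: "scale (a + b) f = scale a f + scale b f"
  by (cases a; cases b) (auto simp: scale_def)

lemma scale_mult: "scale a f * scale b g = scale (a * b) (f * g)"
  by (cases a; cases b) (auto simp: scale_def)

lemma coeff_scale: "coeff (scale b f) T = b * coeff f T"
  by (cases b) (auto simp: scale_def)

lemma sqf_expand: "finite W \<Longrightarrow> {T. coeff f T \<noteq> 0} \<subseteq> W \<Longrightarrow> f = (\<Sum>T\<in>W. scale (coeff f T) (mono T))"
proof (rule sqf_eqI)
  fix T assume W: "finite W" "{T. coeff f T \<noteq> 0} \<subseteq> W"
  have "coeff (\<Sum>T\<in>W. scale (coeff f T) (mono T)) T = (\<Sum>U\<in>W. coeff f U * of_bool (T = U \<and> finite U))"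
    by (simp add: coeff_sum coeff_scale coeff_mono)
  also have "\<dots> = (\<Sum>U\<in>W. if U = T then coeff f T else 0)"
    by (rule sum.cong) (auto simp: coeff_infinite)
  also have "\<dots> = coeff f T" using W by (auto simp: sum.delta)
  finally show "coeff f T = coeff (\<Sum>T\<in>W. scale (coeff f T) (mono T)) T" by simp
qed

lemma sqf_induct [case_names mono zero add]:
  assumes "\<And>T. finite T \<Longrightarrow> coeff f T \<noteq> 0 \<Longrightarrow> P (mono T)" "P 0" "\<And>g h. P g \<Longrightarrow> P h \<Longrightarrow> P (g + h)"
  shows "P f"
proof -
  have "P (\<Sum>T\<in>W. scale (coeff f T) (mono T))" if "finite W" "W \<subseteq> {T. coeff f T \<noteq> 0}" for W
    using that
  proof (induction W rule: finite_induct)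
    case (insert T W)
    then have "P (scale (coeff f T) (mono T))" using assms(1)[of T] assms(2) coeff_finite(2)[of f T] by (auto simp: scale_def)
    then show ?case using insert assms(3) by simp
  qed (simp add: assms(2))
  from this[OF coeff_finite(1) subset_refl] show ?thesis using sqf_expand[OF coeff_finite(1) subset_refl, of f] by simp
qed

section \<open>Substitution of elements for variables\<close>

definition ev :: "('c \<Rightarrow> 'd sqf) \<Rightarrow> 'c sqf \<Rightarrow> 'd sqf" where
  "ev g f = (\<Sum>T\<in>{T. coeff f T \<noteq> 0}. scale (coeff f T) (\<Prod>c\<in>T. g c))"

lemma ev_superset: "finite W \<Longrightarrow> {T. coeff f T \<noteq> 0} \<subseteq> W \<Longrightarrow> ev g f = (\<Sum>T\<in>W. scale (coeff f T) (\<Prod>c\<in>T. g c))"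
  unfolding ev_def by (rule sum.mono_neutral_left) auto

lemma ev_add: "ev g (f + h) = ev g f + ev g h"
proof -
  let ?W = "{T. coeff f T \<noteq> 0} \<union> {T. coeff h T \<noteq> 0}"
  have W: "finite ?W" using coeff_finite by blast
  have "{T. coeff (f + h) T \<noteq> 0} \<subseteq> ?W" by auto
  from ev_superset[OF W this, of g] ev_superset[OF W, of f g] ev_superset[OF W, of h g]
  show ?thesis by (simp add: scale_add sum.distrib)
qed

lemma ev_zero [simp]: "ev g 0 = 0"
  by (simp add: ev_def)

lemma ev_sum: "ev g (sum f I) = (\<Sum>i\<in>I. ev g (f i))"
  by (induction I rule: infinite_finite_induct) (auto simp: ev_add)

lemma ev_scale: "ev g (scale b f) = scale b (ev g f)"
  by (simp add: scale_def)

lemma ev_mono: "finite T \<Longrightarrow> ev g (mono T) = (\<Prod>c\<in>T. g c)"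
  using ev_superset[of "{T}" "mono T" g] by (simp add: coeff_mono)

lemma ev_one [simp]: "ev g 1 = 1"
  using ev_mono[of "{}" g] by simp

lemma ev_var [simp]: "ev g (var c) = g c"
  using ev_mono[of "{c}" g] by (simp add: var_def)

lemma prod_overlap_zero:
  fixes g :: "'c \<Rightarrow> 'a::comm_ring_1"
  assumes "finite A" "finite B" "c \<in> A" "c \<in> B" "g c * g c = 0"
  shows "prod g A * prod g B = 0"
proof -
  have "prod g A = g c * prod g (A - {c})" "prod g B = g c * prod g (B - {c})"
    using assms by (auto simp: prod.remove)
  then have "prod g A * prod g B = (g c * g c) * (prod g (A - {c}) * prod g (B - {c}))" by (simp add: ac_simps)
  then show ?thesis using assms(5) by simp
qed

text \<open>The only relations between the variables are their vanishing squares, so a substitution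
  is multiplicative as soon as the substituted elements have square 0.\<close>

lemma ev_mult:
  assumes sq: "\<And>c. g c * g c = 0"
  shows "ev g (f * h) = ev g f * ev g h"
proof -
  have mm: "ev g (mono A * mono B) = ev g (mono A) * ev g (mono B)" if "finite A" "finite B" for A B
  proof (cases "A \<inter> B = {}")
    case True
    then show ?thesis using that by (simp add: mono_mult ev_mono prod.union_disjoint)
  next
    case False
    then obtain c where c: "c \<in> A" "c \<in> B" by blast
    from prod_overlap_zero[OF that c sq] show ?thesis using False that by (simp add: mono_mult ev_mono)
  qed
  have mf: "ev g (mono A * h) = ev g (mono A) * ev g h" if "finite A" for A
    by (induction h rule: sqf_induct) (use mm that in \<open>auto simp: ev_add distrib_left\<close>)
  show ?thesis
    by (induction f rule: sqf_induct) (use mf in \<open>auto simp: ev_add distrib_right\<close>)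
qed

lemma ev_prod:
  assumes "\<And>c. g c * g c = 0"
  shows "ev g (\<Prod>i\<in>I. f i) = (\<Prod>i\<in>I. ev g (f i))"
  by (induction I rule: infinite_finite_induct) (auto simp: ev_mult[OF assms])

lemma ev_ev:
  assumes "\<And>c. h c * h c = 0"
  shows "ev h (ev g f) = ev (\<lambda>c. ev h (g c)) f"
  by (induction f rule: sqf_induct) (auto simp: ev_mono ev_prod[OF assms] ev_add)

lemma ev_id: "ev var f = f"
  by (induction f rule: sqf_induct) (simp_all add: ev_mono mono_eq_prod[symmetric] ev_add)

lemma ev_cong: "(\<And>T c. coeff f T \<noteq> 0 \<Longrightarrow> c \<in> T \<Longrightarrow> g c = h c) \<Longrightarrow> ev g f = ev h f"
  unfolding ev_def by (intro sum.cong refl arg_cong[of _ _ "scale _"] prod.cong) auto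

text \<open>The mixed terms cancel in characteristic 2. Hence every linear form in the variables has
  square 0 and may be substituted for a variable.\<close>

lemma square_add: "(a::'c sqf) * a = 0 \<Longrightarrow> b * b = 0 \<Longrightarrow> (a + b) * (a + b) = 0"
proof -
  assume "a * a = 0" "b * b = 0"
  then have "(a + b) * (a + b) = a * b + a * b" by (simp add: algebra_simps)
  then show ?thesis by simp
qed

lemma square_sum: "(\<And>i. i \<in> I \<Longrightarrow> (f i :: 'c sqf) * f i = 0) \<Longrightarrow> sum f I * sum f I = 0"
  by (induction I rule: infinite_finite_induct) (auto intro!: square_add)

section \<open>Homogeneous elements\<close>

definition homog :: "'c set \<Rightarrow> nat \<Rightarrow> 'c sqf \<Rightarrow> bool" where
  "homog \<Omega> n f \<longleftrightarrow> (\<forall>T. coeff f T \<noteq> 0 \<longrightarrow> T \<subseteq> \<Omega> \<and> card T = n)"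

lemma homog_zero [simp]: "homog \<Omega> n 0"
  by (simp add: homog_def)

lemma homog_one: "homog \<Omega> 0 1"
  by (simp add: homog_def)

lemma homog_add: "homog \<Omega> n f \<Longrightarrow> homog \<Omega> n g \<Longrightarrow> homog \<Omega> n (f + g)"
  unfolding homog_def
proof (intro allI impI)
  fix T assume f: "\<forall>T. coeff f T \<noteq> 0 \<longrightarrow> T \<subseteq> \<Omega> \<and> card T = n" and g: "\<forall>T. coeff g T \<noteq> 0 \<longrightarrow> T \<subseteq> \<Omega> \<and> card T = n"
    and T: "coeff (f + g) T \<noteq> 0"
  from T have "\<not> (coeff f T = 0 \<and> coeff g T = 0)" by (metis add_0 coeff_simps(2))
  then show "T \<subseteq> \<Omega> \<and> card T = n" using f g by metis
qed

lemma homog_sum: "(\<And>i. i \<in> I \<Longrightarrow> homog \<Omega> n (f i)) \<Longrightarrow> homog \<Omega> n (sum f I)"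
  by (induction I rule: infinite_finite_induct) (auto intro: homog_add)

lemma homog_mono: "T \<subseteq> \<Omega> \<Longrightarrow> homog \<Omega> (card T) (mono T)"
  by (simp add: homog_def coeff_mono)

lemma homog_var: "c \<in> \<Omega> \<Longrightarrow> homog \<Omega> 1 (var c)"
  using homog_mono[of "{c}" \<Omega>] by (simp add: var_def)

lemma homog_mult: "homog \<Omega> m f \<Longrightarrow> homog \<Omega> n g \<Longrightarrow> homog \<Omega> (m + n) (f * g)"
  unfolding homog_def
proof (intro allI impI)
  fix T assume f: "\<forall>T. coeff f T \<noteq> 0 \<longrightarrow> T \<subseteq> \<Omega> \<and> card T = m" and g: "\<forall>T. coeff g T \<noteq> 0 \<longrightarrow> T \<subseteq> \<Omega> \<and> card T = n"
    and T: "coeff (f * g) T \<noteq> 0"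
  from T have fin: "finite T" by (rule coeff_finite(2))
  then have "(\<Sum>A\<in>Pow T. coeff f A * coeff g (T - A)) \<noteq> 0" using T by (simp add: times_sqf.rep_eq)
  then obtain A where A: "A \<subseteq> T" "coeff f A * coeff g (T - A) \<noteq> 0" by (meson PowD sum.not_neutral_contains_not_neutral)
  then have "A \<subseteq> \<Omega> \<and> card A = m" "T - A \<subseteq> \<Omega> \<and> card (T - A) = n" using f g by auto
  moreover have "card T = card A + card (T - A)" using A(1) fin by (metis card_Diff_subset card_mono finite_subset le_add_diff_inverse)
  ultimately show "T \<subseteq> \<Omega> \<and> card T = m + n" using A(1) by auto
qed

lemma homog_prod: "finite I \<Longrightarrow> (\<And>i. i \<in> I \<Longrightarrow> homog \<Omega> 1 (f i)) \<Longrightarrow> homog \<Omega> (card I) (prod f I)"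
proof (induction I rule: finite_induct)
  case (insert i I)
  then have "homog \<Omega> (1 + card I) (f i * prod f I)" by (intro homog_mult) auto
  then show ?case using insert by simp
qed (simp add: homog_one)

lemma homog_ev:
  assumes "homog \<Omega> n f" "\<And>c. c \<in> \<Omega> \<Longrightarrow> homog \<Omega>' 1 (g c)"
  shows "homog \<Omega>' n (ev g f)"
  unfolding ev_def
proof (rule homog_sum)
  fix T assume "T \<in> {T. coeff f T \<noteq> 0}"
  then have T: "T \<subseteq> \<Omega>" "card T = n" "finite T" using assms(1) coeff_finite(2)[of f T] by (auto simp: homog_def)
  then have "homog \<Omega>' n (prod g T)" using homog_prod[of T \<Omega>' g] assms(2) by auto
  then show "homog \<Omega>' n (scale (coeff f T) (prod g T))" by (simp add: scale_def)
qed

section \<open>Circles of a state\<close>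

text \<open>\<open>p e s i\<close> is the \<open>i\<close>-th half-edge after \<open>e\<close>, counterclockwise around the end of \<open>e\<close> given
  by \<open>s\<close>, where \<open>i = False\<close> is the first and \<open>i = True\<close> the second.\<close>

locale smoothing =
  fixes E M :: "'e set" and p :: "'e \<Rightarrow> bool \<Rightarrow> bool \<Rightarrow> 'e \<times> bool"
  assumes finite_E: "finite E" and finite_M: "finite M"
    and p_edge: "e \<in> M \<Longrightarrow> fst (p e s i) \<in> E"
    and p_inj: "d \<in> M \<Longrightarrow> e \<in> M \<Longrightarrow> p d t j = p e s i \<Longrightarrow> d = e \<and> t = s \<and> j = i"
    and p_surj: "e \<in> M \<Longrightarrow> \<exists>d\<in>M. \<exists>t j. p d t j = (fst (p e s i), \<not> snd (p e s i))"
begin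

definition open_edges :: "'e set" where
  "open_edges = {fst (p e s i) | e s i. e \<in> M}"

text \<open>Double counting: the half-edges \<open>p e s i\<close> are exactly the two half-edges of
  each open edge, each occurring once.\<close>

lemma sum_ends:
  "(\<Sum>e\<in>M. \<Sum>s\<in>UNIV. \<Sum>i\<in>UNIV. \<phi> (p e s i)) = (\<Sum>f\<in>open_edges. \<phi> (f, False) + \<phi> (f, True))"
proof -
  define P where "P = (\<lambda>(e, s, i). p e s i) ` (M \<times> UNIV \<times> UNIV)"
  have inj: "inj_on (\<lambda>(e, s, i). p e s i) (M \<times> UNIV \<times> UNIV)"
  proof (rule inj_onI)
    fix x y assume *: "x \<in> M \<times> UNIV \<times> UNIV" "y \<in> M \<times> UNIV \<times> UNIV"
      and "(\<lambda>(e, s, i). p e s i) x = (\<lambda>(e, s, i). p e s i) y"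
    then have "p (fst x) (fst (snd x)) (snd (snd x)) = p (fst y) (fst (snd y)) (snd (snd y))" by (simp add: split_beta)
    from p_inj[OF _ _ this] * show "x = y" by (auto simp: prod_eq_iff)
  qed
  have P: "P = open_edges \<times> UNIV"
  proof
    show "P \<subseteq> open_edges \<times> UNIV" 
    proof
      fix h assume "h \<in> P"
      then obtain e s i where "e \<in> M" "h = p e s i" unfolding P_def by auto
      then show "h \<in> open_edges \<times> UNIV" unfolding open_edges_def mem_Times_iff by blast
    qed
    show "open_edges \<times> UNIV \<subseteq> P"
    proof (clarsimp simp: open_edges_def)
      fix e s i b assume e: "e \<in> M"
      show "(fst (p e s i), b) \<in> P"
      proof (cases "b = snd (p e s i)")
        case True
        then show ?thesis unfolding P_def using e by (intro image_eqI[of _ _ "(e, s, i)"]) auto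
      next
        case False
        then have "b = (\<not> snd (p e s i))" by blast
        with p_surj[OF e, of s i] obtain d t j where "d \<in> M" "p d t j = (fst (p e s i), b)" by auto
        then show ?thesis unfolding P_def by (intro image_eqI[of _ _ "(d, t, j)"]) auto
      qed
    qed
  qed
  have "(\<Sum>e\<in>M. \<Sum>s\<in>UNIV. \<Sum>i\<in>UNIV. \<phi> (p e s i)) = (\<Sum>(e, s, i)\<in>M \<times> UNIV \<times> UNIV. \<phi> (p e s i))"
    by (simp only: sum.cartesian_product split_beta)
  also have "\<dots> = (\<Sum>h\<in>P. \<phi> h)" unfolding P_def sum.reindex[OF inj] by (simp add: split_beta)
  also have "\<dots> = (\<Sum>f\<in>open_edges. \<Sum>b\<in>UNIV. \<phi> (f, b))" unfolding P sum.cartesian_product by simp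
  finally show ?thesis by (simp add: UNIV_bool)
qed

text \<open>The index \<open>i = (e \<in> S)\<close> equals \<open>i\<close> for the 1-smoothing and
  its negation for the 0-smoothing.\<close>

definition arcs :: "'e set \<Rightarrow> 'e set \<Rightarrow> ('e \<times> 'e) set" where
  "arcs A S = {(fst (p e False i), fst (p e True (i = (e \<in> S)))) | e i. e \<in> A}"

text \<open>With \<open>A = M\<close> the classes are the circles. With \<open>A = M - {e}\<close>
  the state is cut open at \<open>e\<close>, which is the same before and after a change at
  \<open>e\<close>.\<close>

definition R :: "'e set \<Rightarrow> 'e set \<Rightarrow> ('e \<times> 'e) set" where
  "R A S = (arcs A S \<union> (arcs A S)\<inverse>)\<^sup>*"

definition cl :: "'e set \<Rightarrow> 'e \<Rightarrow> 'e set" where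
  "cl S f = R M S `` {f}"

definition circ :: "'e set \<Rightarrow> 'e set set" where
  "circ S = cl S ` E"

definition thr :: "'e set \<Rightarrow> 'e \<Rightarrow> 'e set set" where
  "thr S e = {cl S (fst (p e False False)), cl S (fst (p e False True))}"

text \<open>The edges on the circles through \<open>e\<close>, described in the state cut open at
  \<open>e\<close> so that the set is visibly unaffected by a change at \<open>e\<close>.\<close>

definition near :: "'e set \<Rightarrow> 'e \<Rightarrow> 'e set" where
  "near S e = (\<Union>s i. R (M - {e}) S `` {fst (p e s i)})"

lemma R_refl: "(f, f) \<in> R A S"
  by (simp add: R_def)

lemma R_trans: "(f, g) \<in> R A S \<Longrightarrow> (g, h) \<in> R A S \<Longrightarrow> (f, h) \<in> R A S"
  unfolding R_def by (rule rtrancl_trans)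

lemma R_sym: "(f, g) \<in> R A S \<Longrightarrow> (g, f) \<in> R A S"
  unfolding R_def by (metis sym_Un_converse sym_def sym_rtrancl)

lemma R_mono: "A \<subseteq> B \<Longrightarrow> (\<And>e. e \<in> A \<Longrightarrow> e \<in> S \<longleftrightarrow> e \<in> S') \<Longrightarrow> R A S \<subseteq> R B S'"
  unfolding R_def by (rule rtrancl_mono) (fastforce simp: arcs_def)

lemma R_arc: "e \<in> A \<Longrightarrow> (fst (p e False i), fst (p e True (i = (e \<in> S)))) \<in> R A S"
  unfolding R_def arcs_def by blast

lemma R_least:
  assumes "equiv UNIV Q" "\<And>e i. e \<in> A \<Longrightarrow> (fst (p e False i), fst (p e True (i = (e \<in> S)))) \<in> Q"
  shows "R A S \<subseteq> Q"
proof -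
  have "arcs A S \<union> (arcs A S)\<inverse> \<subseteq> Q" using assms unfolding arcs_def equiv_def sym_def by auto
  moreover have "Q\<^sup>* = Q"
  proof -
    have "trans Q" "Id \<subseteq> Q" using assms(1) unfolding equiv_def refl_on_def by auto
    then show ?thesis by (simp add: rtrancl_trancl_reflcl trancl_id sup.absorb1)
  qed
  ultimately show ?thesis unfolding R_def using rtrancl_mono by metis
qed

lemma equiv_R: "equiv UNIV (R A S)"
  by (rule equivI) (auto simp: refl_on_def sym_def trans_def intro: R_refl R_sym R_trans)

lemma cl_eq_iff: "cl S f = cl S g \<longleftrightarrow> (f, g) \<in> R M S"
  unfolding cl_def using equiv_class_eq_iff[OF equiv_R] by auto

lemma cl_self: "f \<in> cl S f"
  by (simp add: cl_def R_refl)

lemma R_E: "(f, g) \<in> R A S \<Longrightarrow> A \<subseteq> M \<Longrightarrow> f \<in> E \<longleftrightarrow> g \<in> E"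
proof -
  assume A: "(f, g) \<in> R A S" "A \<subseteq> M"
  have "R A S \<subseteq> {(f, g). f \<in> E \<longleftrightarrow> g \<in> E}"
    by (rule R_least) (use A(2) p_edge in \<open>auto intro!: equivI simp: refl_on_def sym_def trans_def\<close>)
  then show ?thesis using A by blast
qed

lemma cl_subset: "f \<in> E \<Longrightarrow> cl S f \<subseteq> E"
  unfolding cl_def using R_E[of f _ M S] by blast

lemma finite_circ: "finite (circ S)"
  unfolding circ_def using finite_E by simp

lemma cl_in_circ: "f \<in> E \<Longrightarrow> cl S f \<in> circ S"
  by (simp add: circ_def)

lemma thr_subset: "e \<in> M \<Longrightarrow> thr S e \<subseteq> circ S"
  unfolding thr_def using p_edge cl_in_circ by simp

lemma cl_in_thr: "e \<in> M \<Longrightarrow> cl S (fst (p e s i)) \<in> thr S e"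
proof (cases s)
  case True
  assume e: "e \<in> M"
  have "cl S (fst (p e False j)) = cl S (fst (p e True (j = (e \<in> S))))" for j
    unfolding cl_eq_iff using R_arc[OF e] .
  from this[of "i = (e \<in> S)"] have "cl S (fst (p e True i)) = cl S (fst (p e False (i = (e \<in> S))))"
    by (cases i; cases "e \<in> S") simp_all
  then show ?thesis using True by (cases "i = (e \<in> S)") (auto simp: thr_def)
qed (cases i; simp add: thr_def)

lemma R_outside: "R (M - {e}) (insert e S) = R (M - {e}) S"
  by (rule equalityI; rule R_mono) auto

lemma near_insert: "near (insert e S) e = near S e"
  unfolding near_def R_outside ..

lemma near_closed: "(f, g) \<in> R (M - {e}) S \<Longrightarrow> f \<in> near S e \<longleftrightarrow> g \<in> near S e"
  unfolding near_def UN_iff Image_singleton_iff by (meson R_trans R_sym)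

lemma near_ends: "fst (p e s i) \<in> near S e"
  unfolding near_def using R_refl by blast

lemma sum_bits: "(\<Sum>s\<in>UNIV. \<Sum>i\<in>UNIV. of_bool (Q s i) :: nat) =
    of_bool (Q False False) + of_bool (Q False True) + of_bool (Q True False) + of_bool (Q True True)"
  by (simp add: UNIV_bool)

text \<open>A component has an even number of half-edges, and the arcs outside \<open>e\<close> match those not at \<open>e\<close>
  in pairs; so it contains an even number of the four half-edges at \<open>e\<close>.\<close>

lemma even_ends:
  assumes e: "e \<in> M"
  shows "((f, fst (p e False False)) \<in> R (M - {e}) S \<longleftrightarrow> (f, fst (p e False True)) \<in> R (M - {e}) S) \<longleftrightarrow>
    ((f, fst (p e True False)) \<in> R (M - {e}) S \<longleftrightarrow> (f, fst (p e True True)) \<in> R (M - {e}) S)"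
proof -
  define W where "W d s i \<longleftrightarrow> (f, fst (p d s i)) \<in> R (M - {e}) S" for d s i
  define N :: "'e \<Rightarrow> nat" where "N d = (\<Sum>s\<in>UNIV. \<Sum>i\<in>UNIV. of_bool (W d s i))" for d
  have ev: "even (N d)" if "d \<in> M - {e}" for d
  proof -
    have "W d False i \<longleftrightarrow> W d True (i = (d \<in> S))" for i
      unfolding W_def using R_arc[OF that, of i S] R_trans R_sym by blast
    from this[of True] this[of False] show ?thesis unfolding N_def sum_bits by (cases "d \<in> S") auto
  qed
  have "(\<Sum>d\<in>M. N d) = (\<Sum>g\<in>open_edges. of_bool ((f, g) \<in> R (M - {e}) S) + of_bool ((f, g) \<in> R (M - {e}) S))"
    unfolding N_def W_def using sum_ends[of "\<lambda>h. of_bool ((f, fst h) \<in> R (M - {e}) S)"] unfolding fst_conv .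
  also have "even \<dots>" by (rule dvd_sum) simp
  finally have "even (\<Sum>d\<in>M. N d)" .
  moreover have "(\<Sum>d\<in>M. N d) = N e + (\<Sum>d\<in>M - {e}. N d)" using finite_M e by (rule sum.remove)
  moreover have "even (\<Sum>d\<in>M - {e}. N d)" by (rule dvd_sum) (rule ev)
  ultimately have "even (N e)" by simp
  then show ?thesis unfolding N_def sum_bits W_def
    by (cases "(f, fst (p e False False)) \<in> R (M - {e}) S"; cases "(f, fst (p e False True)) \<in> R (M - {e}) S";
        cases "(f, fst (p e True False)) \<in> R (M - {e}) S"; cases "(f, fst (p e True True)) \<in> R (M - {e}) S") simp_all
qed

text \<open>If two different circles pass through \<open>e\<close>, parity forces each arc of the
  smoothing to join edges already connected outside \<open>e\<close>, so cutting open at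
  \<open>e\<close> changes no class. If there is a single circle, it consists of everything near
  \<open>e\<close>.\<close>

lemma R_cases:
  assumes e: "e \<in> M"
  shows "R M S = (if cl S (fst (p e False False)) = cl S (fst (p e False True))
    then R (M - {e}) S \<union> near S e \<times> near S e else R (M - {e}) S)"
proof -
  let ?R = "R (M - {e}) S" and ?N = "near S e"
  have sub: "?R \<subseteq> R M S" by (rule R_mono) auto
  have J: "equiv UNIV (?R \<union> ?N \<times> ?N)"
  proof (rule equivI)
    show "refl (?R \<union> ?N \<times> ?N)" using R_refl by (auto simp: refl_on_def)
    show "sym (?R \<union> ?N \<times> ?N)" unfolding sym_def using R_sym[of _ _ "M - {e}" S] by blast
    show "trans (?R \<union> ?N \<times> ?N)" unfolding trans_def
      using R_trans[of _ _ "M - {e}" S] near_closed[of _ _ e S] by blast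
  qed auto
  have le: "R M S \<subseteq> ?R \<union> ?N \<times> ?N"
  proof (rule R_least[OF J])
    fix d i assume "d \<in> M"
    then show "(fst (p d False i), fst (p d True (i = (d \<in> S)))) \<in> ?R \<union> ?N \<times> ?N"
      using R_arc[of d "M - {e}" i S] near_ends by (cases "d = e") auto
  qed
  show ?thesis
  proof (cases "cl S (fst (p e False False)) = cl S (fst (p e False True))")
    case True
    then have "cl S (fst (p e s i)) = cl S (fst (p e False False))" for s i
      using cl_in_thr[OF e, of S s i] unfolding thr_def by auto
    then have "(fst (p e False False), f) \<in> R M S" if "f \<in> ?N" for f
      using that sub R_trans[of _ _ M S] R_sym[of _ _ M S] unfolding near_def cl_eq_iff by blast
    then have "?N \<times> ?N \<subseteq> R M S" using R_trans[of _ _ M S] R_sym[of _ _ M S] by blast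
    then show ?thesis using le sub True by auto
  next
    case False
    have "R M S \<subseteq> ?R"
    proof (rule R_least[OF equiv_R])
      fix d i assume d: "d \<in> M"
      show "(fst (p d False i), fst (p d True (i = (d \<in> S)))) \<in> ?R"
      proof (cases "d = e")
        case True
        have ar: "(fst (p e False j), fst (p e True (j = (e \<in> S)))) \<in> R M S" for j using R_arc[OF e] .
        have neM: "(fst (p e False j), fst (p e False (\<not> j))) \<notin> R M S" for j
          using False R_sym[of _ _ M S] unfolding cl_eq_iff by (cases j) auto
        then have ne: "(fst (p e False j), fst (p e False (\<not> j))) \<notin> ?R" for j using sub by blast
        have sep: "(fst (p e False j), fst (p e True (j \<noteq> (e \<in> S)))) \<notin> ?R" for j
        proof
          assume "(fst (p e False j), fst (p e True (j \<noteq> (e \<in> S)))) \<in> ?R"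
          moreover have "(fst (p e True (j \<noteq> (e \<in> S))), fst (p e False (\<not> j))) \<in> R M S"
            by (rule R_sym) (use ar[of "\<not> j"] in \<open>cases j; simp\<close>)
          ultimately show False using sub R_trans[of _ _ M S] neM[of j] by blast
        qed
        have "(fst (p e False j), fst (p e True (j = (e \<in> S)))) \<in> ?R" for j
          using even_ends[OF e, of "fst (p e False j)" S] sep[of j] ne[of j] R_refl[of "fst (p e False j)" "M - {e}" S]
          by (cases j; cases "e \<in> S") simp_all
        then show ?thesis using True by simp
      qed (use d R_arc[of d "M - {e}" i S] in simp)
    qed
    then show ?thesis using sub False by auto
  qed
qed

end

section \<open>Circles through one matching edge\<close>

context smoothing
begin

definition single :: "'e set \<Rightarrow> 'e \<Rightarrow> bool" where
  "single S e \<longleftrightarrow> cl S (fst (p e False False)) = cl S (fst (p e False True))"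

lemma R_single: "e \<in> M \<Longrightarrow> R M S = (if single S e then R (M - {e}) S \<union> near S e \<times> near S e else R (M - {e}) S)"
  unfolding single_def by (rule R_cases)

lemma R_single_insert: "e \<in> M \<Longrightarrow> R M (insert e S) =
    (if single (insert e S) e then R (M - {e}) S \<union> near S e \<times> near S e else R (M - {e}) S)"
  using R_single[of e "insert e S"] unfolding R_outside near_insert .

text \<open>If two circles passed through \<open>e\<close> in both states, the classes would both
  times be those of the state cut open at \<open>e\<close>. Then the arcs of both smoothings lie in
  the same classes, and together they connect all four ends at \<open>e\<close>.\<close>

lemma single_or:
  assumes e: "e \<in> M" "e \<notin> S"
  shows "single S e \<or> single (insert e S) e"
proof (rule ccontr)
  assume *: "\<not> (single S e \<or> single (insert e S) e)"
  then have eq: "cl S = cl (insert e S)" unfolding cl_def using R_single[of e S] R_single_insert[of e S] e by auto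
  have 1: "cl S (fst (p e False i)) = cl S (fst (p e True (\<not> i)))" for i
    unfolding cl_eq_iff using R_arc[of e M i S] e by simp
  have 2: "cl S (fst (p e False i)) = cl S (fst (p e True i))" for i
    unfolding eq unfolding cl_eq_iff using R_arc[of e M i "insert e S"] e by simp
  show False using * 1[of False] 2[of True] unfolding single_def by simp
qed

lemma cl_far: "e \<in> M \<Longrightarrow> f \<notin> near S e \<Longrightarrow> cl S f = R (M - {e}) S `` {f}"
  unfolding cl_def R_single[of e S] by auto

lemma cl_far_insert: "e \<in> M \<Longrightarrow> f \<notin> near S e \<Longrightarrow> cl (insert e S) f = cl S f"
  using cl_far[of e f "insert e S"] cl_far[of e f S] unfolding R_outside near_insert by simp

lemma cl_near: "e \<in> M \<Longrightarrow> f \<in> near S e \<Longrightarrow> cl S f \<in> thr S e"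
proof -
  assume e: "e \<in> M" and f: "f \<in> near S e"
  then obtain s i where "(fst (p e s i), f) \<in> R (M - {e}) S" unfolding near_def by blast
  then have "(fst (p e s i), f) \<in> R M S" using R_mono[of "M - {e}" M S S] by blast
  then have "cl S (fst (p e s i)) = cl S f" unfolding cl_eq_iff .
  then show ?thesis using cl_in_thr[OF e, of S s i] by simp
qed

lemma cl_end_subset_near: "e \<in> M \<Longrightarrow> cl S (fst (p e s i)) \<subseteq> near S e"
  unfolding cl_def R_single[of e S] using near_closed[of "fst (p e s i)" _ e S] near_ends[of e s i S] by auto

lemma near_iff_thr: "e \<in> M \<Longrightarrow> f \<in> near S e \<longleftrightarrow> cl S f \<in> thr S e"
proof
  assume "e \<in> M" "cl S f \<in> thr S e"
  then show "f \<in> near S e" using cl_self[of f S] cl_end_subset_near[of e S] unfolding thr_def by blast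
qed (rule cl_near)

lemma circ_diff_thr: "e \<in> M \<Longrightarrow> circ S - thr S e = cl S ` (E - near S e)"
  unfolding circ_def using near_iff_thr[of e _ S] by blast

lemma circ_diff_thr_insert:
  assumes e: "e \<in> M"
  shows "circ (insert e S) - thr (insert e S) e = circ S - thr S e"
  unfolding circ_diff_thr[OF e] near_insert using cl_far_insert[OF e, of _ S] by auto

lemma card_circ: "e \<in> M \<Longrightarrow> card (circ S) = card (circ S - thr S e) + (if single S e then 1 else 2)"
proof -
  assume e: "e \<in> M"
  have "card (thr S e) = (if single S e then 1 else 2)" unfolding thr_def single_def by simp
  then show ?thesis using card_Diff_subset[of "thr S e" "circ S"] thr_subset[OF e, of S] finite_circ[of S]
    card_mono[of "circ S" "thr S e"] finite_subset[of "thr S e" "circ S"] by simp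
qed

text \<open>Circles not through \<open>e\<close> are common to both states, and through
  \<open>e\<close> there pass one or two.\<close>

lemma card_circ_insert:
  "e \<in> M \<Longrightarrow> int (card (circ (insert e S))) = int (card (circ S)) + of_bool (single S e) - of_bool (single (insert e S) e)"
  using card_circ[of e S] card_circ[of e "insert e S"] circ_diff_thr_insert[of e S] by simp

section \<open>The differential on squarefree polynomials\<close>

definition vr :: "'e set \<Rightarrow> 'e \<Rightarrow> 'e set sqf" where
  "vr S f = var (cl S f)"

text \<open>\<open>sd S e\<close> vanishes iff a single circle of the state of \<open>S\<close> passes through \<open>e\<close>. If two circles fuse
  along the edge \<open>S \<rightarrow> S + e\<close> of the cube, the differential is the quotient map identifying their
  variables; if one circle splits into \<open>b\<close> and \<open>c\<close>, it is multiplication by \<open>x\<^sub>b + x\<^sub>c = sd (S + e) e\<close>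
  after an arbitrary choice of \<open>b\<close> or \<open>c\<close>; and if a circle remains one, this factor is \<open>0\<close>.\<close>

definition sd :: "'e set \<Rightarrow> 'e \<Rightarrow> 'e set sqf" where
  "sd S e = vr S (fst (p e False False)) + vr S (fst (p e False True))"

definition sigma :: "'e set \<Rightarrow> 'e \<Rightarrow> 'e set sqf" where
  "sigma S e = (if single S e then sd (insert e S) e else 1)"

text \<open>An arbitrary edge of each circle carries the variable of the circle to the new state.
  After multiplication by \<open>sigma\<close> the choice does not matter, as
  \<open>DD_ev_vr\<close> shows.\<close>

definition DD :: "'e set \<Rightarrow> 'e \<Rightarrow> 'e set sqf \<Rightarrow> 'e set sqf" where
  "DD S e g = sigma S e * ev (\<lambda>t. vr (insert e S) (SOME f. f \<in> t)) g"

lemma vr_square [simp]: "vr S f * vr S f = 0"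
  by (simp add: vr_def)

lemma vr_eq_iff: "vr S f = vr S g \<longleftrightarrow> (f, g) \<in> R M S"
  unfolding vr_def var_eq_iff cl_eq_iff ..

lemma sd_square [simp]: "sd S e * sd S e = 0"
  unfolding sd_def by (rule square_add) simp_all

lemma sd_zero_iff: "sd S e = 0 \<longleftrightarrow> single S e"
  unfolding sd_def sqf_add_eq_0 vr_def var_eq_iff single_def ..

lemma sd_other_side: "e \<in> M \<Longrightarrow> sd S e = vr S (fst (p e True False)) + vr S (fst (p e True True))"
proof -
  assume e: "e \<in> M"
  have "vr S (fst (p e False i)) = vr S (fst (p e True (i = (e \<in> S))))" for i
    unfolding vr_eq_iff using R_arc[OF e] .
  from this[of False] this[of True] show ?thesis unfolding sd_def by (cases "e \<in> S") (simp_all add: add.commute)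
qed

lemma near_sum:
  assumes e: "e \<in> M" and f: "f \<in> near S e" and g: "g \<in> near S e"
  shows "vr S f = vr S g \<or> vr S f + vr S g = sd S e"
proof -
  have "cl S f \<in> thr S e" "cl S g \<in> thr S e" using cl_near[OF e] f g by simp_all
  then show ?thesis unfolding thr_def sd_def vr_def by (auto simp: add.commute)
qed

lemma sd_mult_near:
  assumes e: "e \<in> M" and f: "f \<in> near S e" and g: "g \<in> near S e"
  shows "sd S e * vr S f = sd S e * vr S g"
proof -
  have "sd S e * (vr S f + vr S g) = 0" using near_sum[OF assms] by (auto simp: sqf_char2)
  then show ?thesis unfolding distrib_left sqf_add_eq_0 .
qed

text \<open>Edges of one circle land on different circles only when that circle splits. Then
  \<open>sigma\<close> is the sum of the two new variables, and its products with either of them are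
  the same monomial.\<close>

lemma sigma_cong:
  assumes e: "e \<in> M" "e \<notin> S" and fg: "(f, g) \<in> R M S"
  shows "sigma S e * vr (insert e S) f = sigma S e * vr (insert e S) g"
proof (cases "(f, g) \<in> R (M - {e}) S")
  case True
  then have "(f, g) \<in> R M (insert e S)" unfolding R_single_insert[OF e(1)] by simp
  then show ?thesis unfolding vr_eq_iff[symmetric] by simp
next
  case False
  then have "single S e" "f \<in> near S e" "g \<in> near S e" using fg R_single[OF e(1), of S] by (auto split: if_splits)
  then show ?thesis using sd_mult_near[OF e(1), of f "insert e S" g] by (simp add: sigma_def near_insert)
qed

lemma mult_ev_cong:
  assumes "\<And>c. a * g c = a * h c"
  shows "a * ev g f = a * ev h f"
proof (induction f rule: sqf_induct)
  case (mono T)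
  have "a * prod g T = a * prod h T"
  proof (induction T rule: infinite_finite_induct)
    case (insert c T)
    have "a * prod g (insert c T) = (a * prod g T) * g c" using insert.hyps by (simp add: ac_simps)
    also have "\<dots> = (a * g c) * prod h T" unfolding insert.IH by (simp add: ac_simps)
    also have "\<dots> = a * prod h (insert c T)" using assms insert.hyps by (simp add: ac_simps)
    finally show ?case .
  qed simp_all
  then show ?case using mono by (simp add: ev_mono)
qed (simp_all add: ev_add distrib_left)

text \<open>Polynomials in the variables of the edges serve as lifts common to all states. In terms
  of a lift the differential is multiplication by \<open>sigma\<close>.\<close>

lemma DD_ev_vr:
  assumes e: "e \<in> M" "e \<notin> S"
  shows "DD S e (ev (vr S) f) = sigma S e * ev (vr (insert e S)) f"
proof -
  have "(SOME g. g \<in> cl S c) \<in> cl S c" for c by (rule someI) (rule cl_self)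
  then have "(c, SOME g. g \<in> cl S c) \<in> R M S" for c unfolding cl_def by blast
  then have "sigma S e * vr (insert e S) (SOME g. g \<in> cl S c) = sigma S e * vr (insert e S) c" for c
    by (rule sigma_cong[OF e R_sym])
  then have "sigma S e * ev (\<lambda>c. vr (insert e S) (SOME g. g \<in> cl S c)) f = sigma S e * ev (vr (insert e S)) f"
    by (rule mult_ev_cong)
  moreover have "ev (\<lambda>t. vr (insert e S) (SOME f. f \<in> t)) (ev (vr S) f) = ev (\<lambda>c. vr (insert e S) (SOME g. g \<in> cl S c)) f"
    by (subst ev_ev) (simp_all add: vr_def)
  ultimately show ?thesis unfolding DD_def by simp
qed

lemma DD_add: "DD S e (f + g) = DD S e f + DD S e g"
  by (simp add: DD_def ev_add distrib_left)

lemma DD_zero [simp]: "DD S e 0 = 0"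
  by (simp add: DD_def)

lemma ev_vr_surj:
  assumes "\<And>T. coeff g T \<noteq> 0 \<Longrightarrow> T \<subseteq> circ S"
  obtains f where "g = ev (vr S) f"
proof -
  have "ev (vr S) (ev (\<lambda>t. var (SOME f. f \<in> t)) g) = ev (\<lambda>t. vr S (SOME f. f \<in> t)) g"
    by (subst ev_ev) simp_all
  also have "\<dots> = ev var g"
  proof (rule ev_cong)
    fix T t assume "coeff g T \<noteq> 0" "t \<in> T"
    then have "t \<in> circ S" using assms by blast
    then obtain f where t: "t = cl S f" unfolding circ_def by blast
    have "(SOME g. g \<in> cl S f) \<in> cl S f" by (rule someI) (rule cl_self)
    then have "cl S (SOME g. g \<in> cl S f) = cl S f" unfolding cl_eq_iff by (simp add: cl_def R_sym)
    then show "vr S (SOME f. f \<in> t) = var t" by (simp add: vr_def t)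
  qed
  finally have "g = ev (vr S) (ev (\<lambda>t. var (SOME f. f \<in> t)) g)" by (simp add: ev_id)
  then show thesis by (rule that)
qed

end

text \<open>The capital letters say that a single circle passes through the matching edge being
  changed: \<open>A\<close>, \<open>B\<close> before and after the first step of one path around a
  square, \<open>C\<close>, \<open>D\<close> before and after its second step, and the primed
  letters likewise on the other path. \<open>x\<close> and \<open>y\<close> stand for the elements
  \<open>sd\<close> of the two matching edges in the final state. The equation \<open>c\<close>
  compares the total changes of the number of circles.\<close>

lemma square_cases:
  fixes x y :: "'a::comm_ring_1"
  assumes c: "of_bool A - of_bool B + (of_bool C - of_bool D) = of_bool A' - of_bool B' + (of_bool C' - of_bool D' :: int)"
    and T: "A \<or> B" "C \<or> D" "A' \<or> B'" "C' \<or> D'"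
    and Q: "B \<Longrightarrow> C \<Longrightarrow> x = 0 \<or> x = y" "B' \<Longrightarrow> C' \<Longrightarrow> y = 0 \<or> y = x"
    and q: "C \<Longrightarrow> D \<Longrightarrow> D' \<longleftrightarrow> B" "C' \<Longrightarrow> D' \<Longrightarrow> D \<longleftrightarrow> B'"
    and z: "x = 0 \<longleftrightarrow> D'" "y = 0 \<longleftrightarrow> D"
  shows "(if C then y else 1) * (if A then x else 1) = (if C' then x else 1) * (if A' then y else 1)"
proof -
  consider (1) "\<not> A" "\<not> C" | (2) "\<not> A'" "\<not> C'" | (3) "A" "C" "A'" "C'" | (4) "A" "C" "A'" "\<not> C'"
    | (5) "A" "C" "\<not> A'" "C'" | (6) "A" "\<not> C" "A'" "C'" | (7) "\<not> A" "C" "A'" "C'" | (8) "A" "\<not> C" "A'" "\<not> C'"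
    | (9) "A" "\<not> C" "\<not> A'" "C'" | (10) "\<not> A" "C" "A'" "\<not> C'" | (11) "\<not> A" "C" "\<not> A'" "C'" by blast
  then show ?thesis
  proof cases
    case 1
    then have "B" "D" using T by simp_all
    then have "\<not> A'" "\<not> C'" using c T(3,4) 1 by (cases A'; cases C'; cases B'; cases D'; simp)+
    then show ?thesis using 1 by simp
  next
    case 2
    then have "B'" "D'" using T by simp_all
    then have "\<not> A" "\<not> C" using c T(1,2) 2 by (cases A; cases C; cases B; cases D; simp)+
    then show ?thesis using 2 by simp
  next
    case 4
    then have D': "D'" using T by simp
    then have "D" using c 4 by (cases B; cases D; cases B'; simp)
    then show ?thesis using 4 z D' by simp
  next
    case 5
    then have B': "B'" using T by simp
    have "D'"
    proof (rule ccontr)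
      assume "\<not> D'"
      then have "B" "D" using c 5 B' by (cases B; cases D; simp)+
      then show False using q(1) 5 \<open>\<not> D'\<close> by blast
    qed
    then show ?thesis using 5 z by simp
  next
    case 6
    then have D: "D" using T by simp
    then have "D'" using c 6 by (cases B; cases D'; cases B'; simp)
    then show ?thesis using 6 z D by simp
  next
    case 7
    then have B: "B" using T by simp
    have "D"
    proof (rule ccontr)
      assume "\<not> D"
      then have "B'" "D'" using c 7 B by (cases B'; cases D'; simp)+
      then show False using q(2) 7 \<open>\<not> D\<close> by blast
    qed
    then show ?thesis using 7 z by simp
  next
    case 8
    then show ?thesis using T z by simp
  next
    case 11
    then have "x = y" using T Q z by metis
    then show ?thesis using 11 by simp
  qed (simp_all add: mult.commute)
qed

section \<open>Squares of the cube and relations between the elements \<open>sd\<close>\<close>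

context smoothing
begin

text \<open>A lift of \<open>sigma\<close> to the variables of the edges, so that the factor can be
  evaluated in later states as well.\<close>

definition presigma :: "'e set \<Rightarrow> 'e \<Rightarrow> 'e sqf" where
  "presigma S e = (if single S e then var (fst (p e False False)) + var (fst (p e False True)) else 1)"

lemma ev_presigma: "ev (vr S') (presigma S e) = (if single S e then sd S' e else 1)"
  by (simp add: presigma_def sd_def ev_add)

lemma ev_vr_mult: "ev (vr S) (f * g) = ev (vr S) f * ev (vr S) g"
  by (rule ev_mult) simp

lemma sigma_presigma: "sigma S e = ev (vr (insert e S)) (presigma S e)"
  by (simp add: ev_presigma sigma_def)

text \<open>When one circle becomes one circle, both states identify everything near
  \<open>e\<close> and agree elsewhere, so they have the same classes although the arcs
  differ.\<close>

lemma single_insert_iff: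
  assumes "e \<in> M" "single S e" "single (insert e S) e"
  shows "single (insert e S) d \<longleftrightarrow> single S d"
  using R_single[of e S] R_single_insert[of e S] assms unfolding single_def cl_eq_iff by simp

text \<open>The change at \<open>e\<close> can separate the two edges at \<open>d\<close> only by
  splitting their circle into the two new circles through \<open>e\<close>; then one edge lies on
  each of these.\<close>

lemma sd_insert_cases:
  assumes e: "e \<in> M" and d: "single S d" "single S e"
  shows "sd (insert e S) d = 0 \<or> sd (insert e S) d = sd (insert e S) e"
proof (cases "single (insert e S) d")
  case False
  have "(fst (p d False False), fst (p d False True)) \<in> R M S" using d unfolding single_def cl_eq_iff by simp
  moreover have "(fst (p d False False), fst (p d False True)) \<notin> R M (insert e S)" using False unfolding single_def cl_eq_iff by simp
  ultimately have "fst (p d False False) \<in> near (insert e S) e" "fst (p d False True) \<in> near (insert e S) e"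
    using R_single[of e S] R_single_insert[of e S] e d unfolding near_insert by (auto split: if_splits)
  then have "vr (insert e S) (fst (p d False False)) + vr (insert e S) (fst (p d False True)) = sd (insert e S) e
      \<or> vr (insert e S) (fst (p d False False)) + vr (insert e S) (fst (p d False True)) = 0"
    using near_sum[OF e, of _ "insert e S"] by (metis sqf_char2)
  then show ?thesis unfolding sd_def[of _ d] by blast
qed (simp add: sd_zero_iff)

text \<open>The comparison of the two paths around a square needs only the numbers of circles and the
  coincidences between the classes of \<open>sd\<close> at its corners.\<close>

lemma sigma_square:
  assumes e: "e \<in> M" "e \<notin> S" and f: "f \<in> M" "f \<notin> S" and ef: "e \<noteq> f"
  shows "sigma (insert e S) f * ev (vr (insert f (insert e S))) (presigma S e) =
    sigma (insert f S) e * ev (vr (insert f (insert e S))) (presigma S f)"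
proof -
  let ?S2 = "insert f (insert e S)"
  have S2: "insert e (insert f S) = ?S2" by blast
  note c1 = card_circ_insert[OF e(1), of S] card_circ_insert[OF f(1), of "insert e S"]
    card_circ_insert[OF f(1), of S] card_circ_insert[OF e(1), of "insert f S", unfolded S2]
  have count: "of_bool (single S e) - of_bool (single (insert e S) e) + (of_bool (single (insert e S) f) - of_bool (single ?S2 f))
    = of_bool (single S f) - of_bool (single (insert f S) f) + (of_bool (single (insert f S) e) - of_bool (single ?S2 e) :: int)"
    using c1 by simp
  have T: "single S e \<or> single (insert e S) e" "single (insert e S) f \<or> single ?S2 f"
    "single S f \<or> single (insert f S) f" "single (insert f S) e \<or> single ?S2 e"
    using single_or[OF e] single_or[OF f] single_or[of f "insert e S"] single_or[of e "insert f S", unfolded S2] e f ef by auto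
  have Q: "single (insert e S) e \<Longrightarrow> single (insert e S) f \<Longrightarrow> sd ?S2 e = 0 \<or> sd ?S2 e = sd ?S2 f"
    "single (insert f S) f \<Longrightarrow> single (insert f S) e \<Longrightarrow> sd ?S2 f = 0 \<or> sd ?S2 f = sd ?S2 e"
    using sd_insert_cases[OF f(1), of "insert e S" e] sd_insert_cases[OF e(1), of "insert f S" f, unfolded S2] by blast+
  have q: "single (insert e S) f \<Longrightarrow> single ?S2 f \<Longrightarrow> single ?S2 e \<longleftrightarrow> single (insert e S) e"
    "single (insert f S) e \<Longrightarrow> single ?S2 e \<Longrightarrow> single ?S2 f \<longleftrightarrow> single (insert f S) f"
    using single_insert_iff[OF f(1), of "insert e S" e] single_insert_iff[OF e(1), of "insert f S" f, unfolded S2] by blast+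
  have z: "sd ?S2 e = 0 \<longleftrightarrow> single ?S2 e" "sd ?S2 f = 0 \<longleftrightarrow> single ?S2 f" by (rule sd_zero_iff)+
  have sg: "sigma (insert e S) f = (if single (insert e S) f then sd ?S2 f else 1)"
    "sigma (insert f S) e = (if single (insert f S) e then sd ?S2 e else 1)" unfolding sigma_def S2 by simp_all
  show ?thesis unfolding ev_presigma sg
    by (rule square_cases) (fact count T Q q z)+
qed

text \<open>Both sides are evaluated on one lift in the final state, where only the products of the
  factors remain to be compared.\<close>

lemma DD_square:
  assumes e: "e \<in> M" "e \<notin> S" and f: "f \<in> M" "f \<notin> S" and ef: "e \<noteq> f"
    and g: "\<And>T. coeff g T \<noteq> 0 \<Longrightarrow> T \<subseteq> circ S"
  shows "DD (insert e S) f (DD S e g) = DD (insert f S) e (DD S f g)"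
proof -
  obtain h where h: "g = ev (vr S) h" using ev_vr_surj[OF g] by blast
  have S2: "insert e (insert f S) = insert f (insert e S)" by blast
  have "DD (insert e S) f (DD S e g) = sigma (insert e S) f * ev (vr (insert f (insert e S))) (presigma S e) * ev (vr (insert f (insert e S))) h"
  proof -
    have "DD (insert e S) f (DD S e g) = DD (insert e S) f (ev (vr (insert e S)) (presigma S e * h))"
      unfolding h DD_ev_vr[OF e] sigma_presigma[of S e] ev_vr_mult ..
    also have "\<dots> = sigma (insert e S) f * ev (vr (insert f (insert e S))) (presigma S e * h)"
      by (rule DD_ev_vr) (use f ef in auto)
    finally show ?thesis unfolding ev_vr_mult mult.assoc .
  qed
  moreover have "DD (insert f S) e (DD S f g) = sigma (insert f S) e * ev (vr (insert f (insert e S))) (presigma S f) * ev (vr (insert f (insert e S))) h"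
  proof -
    have "DD (insert f S) e (DD S f g) = DD (insert f S) e (ev (vr (insert f S)) (presigma S f * h))"
      unfolding h DD_ev_vr[OF f] sigma_presigma[of S f] ev_vr_mult ..
    also have "\<dots> = sigma (insert f S) e * ev (vr (insert e (insert f S))) (presigma S f * h)"
      by (rule DD_ev_vr) (use e ef in auto)
    finally show ?thesis unfolding ev_vr_mult mult.assoc S2 .
  qed
  ultimately show ?thesis using sigma_square[OF assms(1-5)] by simp
qed

text \<open>A \<open>0\<close>-cochain on the vertices gives a relation because every edge outside \<open>M\<close> joins equal values.\<close>

lemma coboundary_relation:
  assumes \<xi>: "\<And>d t j e s i. d \<in> M \<Longrightarrow> e \<in> M \<Longrightarrow> fst (p d t j) = fst (p e s i) \<Longrightarrow> \<xi> d t = \<xi> e s"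
  shows "(\<Sum>d\<in>M. scale (\<xi> d False + \<xi> d True) (sd S d)) = 0"
proof -
  define val where "val f = (SOME b. \<exists>d\<in>M. \<exists>t j. fst (p d t j) = f \<and> \<xi> d t = b)" for f
  have val: "val (fst (p d t j)) = \<xi> d t" if "d \<in> M" for d t j
    unfolding val_def using that \<xi> by (intro some_equality) blast+
  have "(\<Sum>d\<in>M. scale (\<xi> d False + \<xi> d True) (sd S d)) =
      (\<Sum>d\<in>M. \<Sum>s\<in>UNIV. \<Sum>i\<in>UNIV. scale (val (fst (p d s i))) (vr S (fst (p d s i))))"
  proof (rule sum.cong)
    fix d assume d: "d \<in> M"
    have sc: "scale b (x + y) = scale b x + scale b y" for b and x y :: "'e set sqf" by (simp add: scale_def)
    have "scale (\<xi> d False + \<xi> d True) (sd S d) = scale (\<xi> d False) (sd S d) + scale (\<xi> d True) (sd S d)" by (rule scale_add)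
    also have "scale (\<xi> d False) (sd S d) = (\<Sum>i\<in>UNIV. scale (val (fst (p d False i))) (vr S (fst (p d False i))))"
      unfolding val[OF d] sd_def by (simp add: UNIV_bool sc)
    also have "scale (\<xi> d True) (sd S d) = (\<Sum>i\<in>UNIV. scale (val (fst (p d True i))) (vr S (fst (p d True i))))"
      unfolding val[OF d] sd_other_side[OF d] by (simp add: UNIV_bool sc)
    finally show "scale (\<xi> d False + \<xi> d True) (sd S d) = (\<Sum>s\<in>UNIV. \<Sum>i\<in>UNIV. scale (val (fst (p d s i))) (vr S (fst (p d s i))))"
      by (simp add: UNIV_bool)
  qed simp
  also have "\<dots> = (\<Sum>f\<in>open_edges. scale (val f) (vr S f) + scale (val f) (vr S f))"
    using sum_ends[of "\<lambda>h. scale (val (fst h)) (vr S (fst h))"] unfolding fst_conv .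
  also have "\<dots> = 0" by simp
  finally show ?thesis .
qed

end

section \<open>Comparison of two rotation systems\<close>

context smoothing
begin

lemma homog_vr: "f \<in> E \<Longrightarrow> homog (circ S) 1 (vr S f)"
  unfolding vr_def by (intro homog_var cl_in_circ)

lemma some_in_circ: "t \<in> circ S \<Longrightarrow> (SOME f. f \<in> t) \<in> E"
proof -
  assume "t \<in> circ S"
  then obtain f where f: "f \<in> E" "t = cl S f" unfolding circ_def by blast
  then have "(SOME f. f \<in> t) \<in> t" using someI[of "\<lambda>f. f \<in> t" f] cl_self by blast
  then show ?thesis using f cl_subset by blast
qed

end

text \<open>\<open>fl\<close> marks the flipped ends, \<kappa> is the potential on the edges outside
  \<open>M\<close>, and \<tau> is the same potential at the ends of the matching edges. The
  relations are demanded in the states of both systems, so that their roles can be exchanged; this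
  provides the inverse map.\<close>

locale smoothing_map = A: smoothing E M p + B: smoothing E M p'
  for E M :: "'e set" and p p' :: "'e \<Rightarrow> bool \<Rightarrow> bool \<Rightarrow> 'e \<times> bool" +
  fixes fl :: "'e \<Rightarrow> bool \<Rightarrow> bool" and \<kappa> :: "'e \<Rightarrow> 'e \<Rightarrow> bit" and \<tau> :: "'e \<Rightarrow> bool \<Rightarrow> 'e \<Rightarrow> bit"
  assumes p': "e \<in> M \<Longrightarrow> p' e s i = p e s (i \<noteq> fl e s)"
    and \<kappa>: "e \<in> M \<Longrightarrow> \<kappa> (fst (p e s i)) = \<tau> e s"
    and relB: "e \<in> M \<Longrightarrow>
      (\<Sum>d\<in>M. scale (\<tau> e False d + \<tau> e True d + of_bool (d = e \<and> fl e False \<noteq> fl e True)) (B.sd S d)) = 0"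
    and relA: "e \<in> M \<Longrightarrow>
      (\<Sum>d\<in>M. scale (\<tau> e False d + \<tau> e True d + of_bool (d = e \<and> fl e False \<noteq> fl e True)) (A.sd S d)) = 0"
begin

definition hs :: "'e \<Rightarrow> 'e sqf" where
  "hs d = var (fst (p d False False)) + var (fst (p d False True))"

text \<open>The substitution \<open>x\<^sub>f \<mapsto> x\<^sub>f + (\<Sum>d. \<kappa> f d * s\<^sub>d)\<close> is an involution which fixes every \<open>s\<^sub>d\<close>. At a matching
  edge with exactly one flipped end it absorbs the difference \<open>s\<^sub>e\<close> between the two ways to join the ends.\<close>

definition hat :: "'e \<Rightarrow> 'e sqf" where
  "hat f = var f + (\<Sum>d\<in>M. scale (\<kappa> f d) (hs d))"

definition phi :: "'e set \<Rightarrow> 'e set sqf \<Rightarrow> 'e set sqf" where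
  "phi S g = ev (\<lambda>t. ev (B.vr S) (hat (SOME f. f \<in> t))) g"

lemma hat_square [simp]: "hat f * hat f = 0"
  unfolding hat_def hs_def by (intro square_add square_sum) (simp_all add: scale_mult square_add)

lemma ev_hs: "ev (A.vr S) (hs d) = A.sd S d" "d \<in> M \<Longrightarrow> ev (B.vr S) (hs d) = B.sd S d"
  unfolding hs_def by (simp_all add: ev_add A.sd_def B.sd_def p') (cases "fl d False"; simp add: add.commute)

lemma ev_hat: "ev (B.vr S) (hat f) = B.vr S f + (\<Sum>d\<in>M. scale (\<kappa> f d) (B.sd S d))"
  unfolding hat_def ev_add ev_sum ev_scale by (simp add: ev_hs)

lemma ev_vr_hat_square [simp]: "ev (B.vr S) (hat f) * ev (B.vr S) (hat f) = 0"
  using B.ev_vr_mult[of S "hat f" "hat f"] by simp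

text \<open>If both ends of \<open>e\<close> are flipped or none is, both systems join the same
  edges at \<open>e\<close>. Otherwise an arc of the first system joins edges lying on the two
  different arcs of the second, and their variables add up to the element \<open>sd\<close> of
  \<open>e\<close>.\<close>

lemma vr_arc:
  assumes e: "e \<in> M"
  shows "B.vr S (fst (p e False i)) + B.vr S (fst (p e True (i = (e \<in> S)))) =
    scale (of_bool (fl e False \<noteq> fl e True)) (B.sd S e)"
proof -
  have "B.vr S (fst (p' e False j)) = B.vr S (fst (p' e True (j = (e \<in> S))))" for j
    unfolding B.vr_eq_iff using B.R_arc[OF e] .
  then have arc: "B.vr S (fst (p e False (j \<noteq> fl e False))) = B.vr S (fst (p e True ((j = (e \<in> S)) \<noteq> fl e True)))" for j
    unfolding p'[OF e] .
  have sd: "B.sd S e = B.vr S (fst (p e False False)) + B.vr S (fst (p e False True))"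
    using ev_hs(2)[OF e, of S] by (simp add: hs_def ev_add)
  show ?thesis
    using arc[of False] arc[of True] unfolding sd
    by (cases i; cases "fl e False"; cases "fl e True"; cases "e \<in> S") (simp_all add: add.commute)
qed

text \<open>Along an arc of the first state at \<open>e\<close> the variables in the second state
  differ by 0 or by \<open>sd\<close> of \<open>e\<close>, and the corrections differ by the jump of
  the potential. By \<open>relB\<close> these two discrepancies are equal, so the substitution is
  well defined on circles.\<close>

lemma hat_cong:
  assumes "(f, g) \<in> A.R M S"
  shows "ev (B.vr S) (hat f) = ev (B.vr S) (hat g)"
proof -
  have "A.R M S \<subseteq> {(f, g). ev (B.vr S) (hat f) = ev (B.vr S) (hat g)}"
  proof (rule A.R_least)
    show "equiv UNIV {(f, g). ev (B.vr S) (hat f) = ev (B.vr S) (hat g)}"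
      by (rule equivI) (auto simp: refl_on_def sym_def trans_def)
    fix e i assume e: "e \<in> M"
    let ?f = "fst (p e False i)" and ?g = "fst (p e True (i = (e \<in> S)))"
    let ?b = "of_bool (fl e False \<noteq> fl e True) :: bit"
    have "ev (B.vr S) (hat ?f) + ev (B.vr S) (hat ?g)
        = (B.vr S ?f + B.vr S ?g) + (\<Sum>d\<in>M. scale (\<tau> e False d + \<tau> e True d) (B.sd S d))"
      unfolding ev_hat \<kappa>[OF e] by (simp add: scale_add sum.distrib algebra_simps)
    also have "B.vr S ?f + B.vr S ?g = (\<Sum>d\<in>M. scale (of_bool (d = e \<and> fl e False \<noteq> fl e True)) (B.sd S d))"
    proof -
      have "(\<Sum>d\<in>M. scale (of_bool (d = e \<and> fl e False \<noteq> fl e True)) (B.sd S d)) = (\<Sum>d\<in>M. if d = e then scale ?b (B.sd S e) else 0)"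
        by (rule sum.cong) auto
      also have "\<dots> = scale ?b (B.sd S e)" using A.finite_M e by simp
      finally show ?thesis using vr_arc[OF e, of S i] by simp
    qed
    also have "\<dots> + (\<Sum>d\<in>M. scale (\<tau> e False d + \<tau> e True d) (B.sd S d)) = 0"
      using relB[OF e, of S] unfolding scale_add[of "\<tau> e False _ + \<tau> e True _"] sum.distrib by (simp add: add.commute)
    finally show "(?f, ?g) \<in> {(f, g). ev (B.vr S) (hat f) = ev (B.vr S) (hat g)}" by simp
  qed
  then show ?thesis using assms by blast
qed

lemma phi_ev_vr: "phi S (ev (A.vr S) f) = ev (B.vr S) (ev hat f)"
proof -
  have "(SOME g. g \<in> A.cl S c) \<in> A.cl S c" for c by (rule someI) (rule A.cl_self)
  then have "(c, SOME g. g \<in> A.cl S c) \<in> A.R M S" for c unfolding A.cl_def by blast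
  then have c: "(SOME g. g \<in> A.cl S c, c) \<in> A.R M S" for c by (rule A.R_sym)
  have "phi S (ev (A.vr S) f) = ev (\<lambda>c. ev (B.vr S) (hat (SOME f. f \<in> A.cl S c))) f"
    unfolding phi_def by (subst ev_ev) (simp_all add: A.vr_def)
  also have "\<dots> = ev (\<lambda>c. ev (B.vr S) (hat c)) f" using hat_cong[OF c] by simp
  finally show ?thesis by (subst ev_ev) simp_all
qed

text \<open>The two edges meeting \<open>d\<close> at one end share the value of the potential, so
  their corrections cancel in the sum.\<close>

lemma ev_hat_hs: "d \<in> M \<Longrightarrow> ev hat (hs d) = hs d"
  unfolding hs_def ev_add ev_var by (simp add: hat_def \<kappa> hs_def algebra_simps)

lemma ev_hat_hat: "ev hat (ev hat f) = f"
proof -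
  have "ev hat (hat c) = var c" for c
    unfolding hat_def[of c] ev_add ev_sum ev_scale ev_var by (simp add: ev_hat_hs hat_def)
  then show ?thesis by (subst ev_ev) (simp_all add: ev_id)
qed

lemma phi_sd: "d \<in> M \<Longrightarrow> phi S (A.sd S d) = B.sd S d"
  using phi_ev_vr[of S "hs d"] by (simp add: ev_hs ev_hat_hs)

lemma phi_add: "phi S (f + g) = phi S f + phi S g"
  by (simp add: phi_def ev_add)

lemma phi_zero [simp]: "phi S 0 = 0"
  by (simp add: phi_def)

lemma single_map: "d \<in> M \<Longrightarrow> A.single S d \<Longrightarrow> B.single S d"
  using phi_sd[of d S] unfolding A.sd_zero_iff[symmetric] B.sd_zero_iff[symmetric] by simp

lemma homog_phi:
  assumes "homog (A.circ S) n g"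
  shows "homog (B.circ S) n (phi S g)"
  unfolding phi_def
proof (rule homog_ev[OF assms])
  fix t assume "t \<in> A.circ S"
  then have "(SOME f. f \<in> t) \<in> E" by (rule A.some_in_circ)
  then show "homog (B.circ S) 1 (ev (B.vr S) (hat (SOME f. f \<in> t)))"
    unfolding ev_hat B.sd_def scale_def
    by (intro homog_add homog_sum B.homog_vr) (auto intro!: homog_add B.homog_vr[unfolded One_nat_def] B.p_edge)
qed

end

lemma smoothing_map_swap: "smoothing_map E M p p' fl \<kappa> \<tau> \<Longrightarrow> smoothing_map E M p' p fl \<kappa> \<tau>"
proof -
  assume "smoothing_map E M p p' fl \<kappa> \<tau>"
  then interpret smoothing_map E M p p' fl \<kappa> \<tau> .
  show ?thesis
  proof unfold_locales
    fix e s i assume e: "e \<in> M"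
    show "p e s i = p' e s (i \<noteq> fl e s)" unfolding p'[OF e] by (cases i; cases "fl e s") simp_all
    show "\<kappa> (fst (p' e s i)) = \<tau> e s" unfolding p'[OF e] by (rule \<kappa>[OF e])
  qed (fact relA relB)+
qed

context smoothing_map
begin

lemma hat_swap: "smoothing_map.hat M p' \<kappa> = hat"
proof -
  interpret I: smoothing_map E M p' p fl \<kappa> \<tau> by (rule smoothing_map_swap) unfold_locales
  have "I.hs d = hs d" if "d \<in> M" for d
    unfolding I.hs_def hs_def p'[OF that] by (cases "fl d False") (simp_all add: add.commute)
  then show ?thesis by (auto simp: I.hat_def hat_def fun_eq_iff)
qed

lemma phi_phi:
  assumes "\<And>T. coeff g T \<noteq> 0 \<Longrightarrow> T \<subseteq> A.circ S"
  shows "smoothing_map.phi M p' p \<kappa> S (phi S g) = g"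
proof -
  interpret I: smoothing_map E M p' p fl \<kappa> \<tau> by (rule smoothing_map_swap) unfold_locales
  obtain f where "g = ev (A.vr S) f" using A.ev_vr_surj[OF assms] by blast
  then show ?thesis by (simp add: phi_ev_vr I.phi_ev_vr hat_swap ev_hat_hat)
qed

lemma single_iff: "d \<in> M \<Longrightarrow> B.single S d \<longleftrightarrow> A.single S d"
proof -
  interpret I: smoothing_map E M p' p fl \<kappa> \<tau> by (rule smoothing_map_swap) unfold_locales
  show "d \<in> M \<Longrightarrow> B.single S d \<longleftrightarrow> A.single S d" using single_map I.single_map by blast
qed

lemma phi_DD:
  assumes e: "e \<in> M" "e \<notin> S" and g: "\<And>T. coeff g T \<noteq> 0 \<Longrightarrow> T \<subseteq> A.circ S"
  shows "phi (insert e S) (A.DD S e g) = B.DD S e (phi S g)"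
proof -
  obtain f where g: "g = ev (A.vr S) f" using A.ev_vr_surj[OF g] by blast
  define k where "k = (if A.single S e then hs e else 1)"
  have A: "A.sigma S e = ev (A.vr (insert e S)) k" unfolding k_def A.sigma_def by (simp add: ev_hs)
  have B: "B.sigma S e = ev (B.vr (insert e S)) k" unfolding k_def B.sigma_def using e by (simp add: ev_hs single_iff)
  have k: "ev hat k = k" unfolding k_def using e by (simp add: ev_hat_hs)
  have "phi (insert e S) (A.DD S e g) = phi (insert e S) (ev (A.vr (insert e S)) (k * f))"
    unfolding g A.DD_ev_vr[OF e] A A.ev_vr_mult ..
  also have "\<dots> = ev (B.vr (insert e S)) (ev hat k * ev hat f)"
    unfolding phi_ev_vr by (subst ev_mult) simp_all
  also have "\<dots> = B.DD S e (phi S g)" unfolding g phi_ev_vr B.DD_ev_vr[OF e] B B.ev_vr_mult k ..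
  finally show ?thesis .
qed

text \<open>The product of the variables of all circles is nonzero, and its degree is the number of
  circles. The map \<open>phi\<close> is injective on the space of the state and preserves degrees,
  so the other state must have at least as many variables.\<close>

lemma card_circ_le: "card (A.circ S) \<le> card (B.circ S)"
proof -
  have h: "homog (A.circ S) (card (A.circ S)) (mono (A.circ S))" by (rule homog_mono) simp
  have "coeff (mono (A.circ S)) (A.circ S) \<noteq> 0" by (simp add: coeff_mono A.finite_circ)
  then have nz: "mono (A.circ S) \<noteq> 0" by (metis coeff_simps(1))
  have "smoothing_map.phi M p' p \<kappa> S (phi S (mono (A.circ S))) = mono (A.circ S)"
    by (rule phi_phi) (auto simp: coeff_mono split: if_splits)
  moreover have "smoothing_map.phi M p' p \<kappa> S 0 = 0"
  proof -
    interpret I: smoothing_map E M p' p fl \<kappa> \<tau> by (rule smoothing_map_swap) unfold_locales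
    show ?thesis by simp
  qed
  ultimately have "phi S (mono (A.circ S)) \<noteq> 0" using nz by metis
  then obtain T where "coeff (phi S (mono (A.circ S))) T \<noteq> 0" by (metis coeff_simps(1) sqf_eqI)
  then have "T \<subseteq> B.circ S" "card T = card (A.circ S)" using homog_phi[OF h] unfolding homog_def by blast+
  then show ?thesis using card_mono[OF B.finite_circ] by metis
qed

lemma card_circ_eq: "card (A.circ S) = card (B.circ S)"
proof -
  interpret I: smoothing_map E M p' p fl \<kappa> \<tau> by (rule smoothing_map_swap) unfold_locales
  show ?thesis using card_circ_le I.card_circ_le by (rule le_antisym)
qed

end

section \<open>The cochain complex\<close>

context smoothing
begin

lemma coeff_mono_mult:
  assumes "finite A" "finite B" "A \<inter> B = {}"
  shows "coeff (mono A * mono B) T = of_bool (T = A \<union> B)"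
  using assms by (simp add: mono_mult coeff_mono)

lemma ev_mono_far:
  assumes e: "e \<in> M" and T: "T \<subseteq> circ S - thr S e"
  shows "ev (\<lambda>t. vr (insert e S) (SOME f. f \<in> t)) (mono T) = mono T"
proof -
  have fin: "finite T" using T finite_circ finite_subset by blast
  have "vr (insert e S) (SOME f. f \<in> t) = var t" if "t \<in> T" for t
  proof -
    have "t \<in> cl S ` (E - near S e)" using that T circ_diff_thr[OF e] by blast
    then obtain f where f: "f \<notin> near S e" "t = cl S f" by blast
    have "(SOME g. g \<in> t) \<in> t" unfolding f(2) by (rule someI) (rule cl_self)
    then have g: "(f, SOME g. g \<in> t) \<in> R M S" unfolding f(2) cl_def by blast
    then have g2: "cl S (SOME g. g \<in> t) = t" unfolding f(2) cl_eq_iff by (rule R_sym)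
    then have "(SOME g. g \<in> t) \<notin> near S e" using f near_iff_thr[OF e, of _ S] by metis
    then show ?thesis unfolding vr_def using cl_far_insert[OF e] g2 by simp
  qed
  then show ?thesis unfolding ev_mono[OF fin] unfolding mono_eq_prod[OF fin] by (rule prod.cong[OF refl])
qed

lemma ev_mono_split:
  assumes e: "e \<in> M" and T: "T \<subseteq> circ S"
  shows "ev (\<lambda>t. vr (insert e S) (SOME f. f \<in> t)) (mono T) =
    mono (T - thr S e) * (\<Prod>t\<in>T \<inter> thr S e. vr (insert e S) (SOME f. f \<in> t))"
proof -
  have fin: "finite T" using T finite_circ finite_subset by blast
  have "mono T = mono (T - thr S e) * mono (T \<inter> thr S e)"
    using fin by (subst mono_mult) (auto simp: Un_commute Int_Diff Diff_Int_distrib2 intro!: arg_cong[of _ _ mono])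
  then show ?thesis using ev_mono_far[OF e, of "T - thr S e" S] T fin
    by (simp add: ev_mult ev_mono Diff_mono)
qed

text \<open>Two circles both before and after the change are impossible by \<open>single_or\<close>;
  what remains is fusion, splitting, and one circle becoming one.\<close>

lemma thr_cases:
  assumes e: "e \<in> M" "e \<notin> S"
  obtains (merge) A B C where "thr S e = {A, B}" "A \<noteq> B" "thr (insert e S) e = {C}" "sigma S e = 1"
      "\<And>t. t \<in> {A, B} \<Longrightarrow> vr (insert e S) (SOME f. f \<in> t) = var C"
    | (split) A B C where "thr S e = {A}" "B \<noteq> C" "thr (insert e S) e = {B, C}" "sigma S e = var B + var C"
      "vr (insert e S) (SOME f. f \<in> A) \<in> {var B, var C}"
    | (same) A C where "thr S e = {A}" "thr (insert e S) e = {C}" "sigma S e = 0"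
proof -
  have mem: "vr (insert e S) (SOME f. f \<in> t) \<in> var ` thr (insert e S) e" if "t \<in> thr S e" for t
  proof -
    obtain f where t: "t = cl S f" using \<open>t \<in> thr S e\<close> unfolding thr_def by blast
    have "(SOME f. f \<in> t) \<in> t" unfolding t by (rule someI) (rule cl_self)
    then have "(f, SOME f. f \<in> t) \<in> R M S" unfolding t cl_def by blast
    then have "cl S (SOME f. f \<in> t) = t" unfolding t cl_eq_iff by (rule R_sym)
    then have "(SOME f. f \<in> t) \<in> near (insert e S) e" using near_iff_thr[OF e(1), of _ S] that near_insert by metis
    then show ?thesis unfolding vr_def using cl_near[OF e(1)] by blast
  qed
  define x y where "x S' = cl S' (fst (p e False False))" and "y S' = cl S' (fst (p e False True))" for S'
  have thr: "thr S' e = {x S', y S'}" and single: "single S' e \<longleftrightarrow> x S' = y S'"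
    and sd: "sd S' e = var (x S') + var (y S')" for S'
    unfolding thr_def single_def sd_def vr_def x_def y_def by (rule refl)+
  consider "\<not> single S e" "single (insert e S) e" | "single S e" "\<not> single (insert e S) e" | "single S e" "single (insert e S) e"
    using single_or[OF e] by blast
  then show thesis
  proof cases
    case 1
    then show thesis using mem unfolding single
      by (intro merge[of "x S" "y S" "x (insert e S)"]) (auto simp: thr sigma_def single)
  next
    case 2
    then show thesis using mem unfolding single
      by (intro split[of "x S" "x (insert e S)" "y (insert e S)"]) (auto simp: thr sigma_def single sd)
  next
    case 3
    then show thesis using mem unfolding single
      by (intro same[of "x S" "x (insert e S)"]) (auto simp: thr sigma_def single sd)
  qed
qed

end

section \<open>Matrix coefficients in the basis of labellings\<close>

lemma local_coeff_eqI:
  assumes "T = {a, b}" "a \<noteq> b" "T' = {c}"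
  shows "local_coeff T T' l l' = mult_coeff (l a) (l b) (l' c)"
proof -
  have "mult_coeff (l b) (l a) (l' c) = mult_coeff (l a) (l b) (l' c)" by (cases "l a"; cases "l b") auto
  moreover have "(\<exists>a' b' c'. a' \<noteq> b' \<and> T = {a', b'} \<and> T' = {c'} \<and> mult_coeff (l a') (l b') (l' c') = 1) \<longleftrightarrow>
      mult_coeff (l a) (l b) (l' c) = 1 \<or> mult_coeff (l b) (l a) (l' c) = 1"
    using assms by (auto simp: doubleton_eq_iff)
  moreover have "\<not> (\<exists>a' b' c'. b' \<noteq> c' \<and> T = {a'} \<and> T' = {b', c'} \<and> comult_coeff (l a') (l' b') (l' c') = 1)"
    using assms by (auto simp: doubleton_eq_iff)
  ultimately have "local_coeff T T' l l' = of_bool (mult_coeff (l a) (l b) (l' c) = 1)"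
    unfolding local_coeff_def by simp
  then show ?thesis by (cases "mult_coeff (l a) (l b) (l' c)") simp_all
qed

lemma local_coeff_split_eqI:
  assumes "T = {a}" "b \<noteq> c" "T' = {b, c}"
  shows "local_coeff T T' l l' = comult_coeff (l a) (l' b) (l' c)"
proof -
  have "comult_coeff (l a) (l' c) (l' b) = comult_coeff (l a) (l' b) (l' c)" by (cases "l a") auto
  moreover have "(\<exists>a' b' c'. b' \<noteq> c' \<and> T = {a'} \<and> T' = {b', c'} \<and> comult_coeff (l a') (l' b') (l' c') = 1) \<longleftrightarrow>
      comult_coeff (l a) (l' b) (l' c) = 1 \<or> comult_coeff (l a) (l' c) (l' b) = 1"
    using assms by (auto simp: doubleton_eq_iff)
  moreover have "\<not> (\<exists>a' b' c'. a' \<noteq> b' \<and> T = {a', b'} \<and> T' = {c'} \<and> mult_coeff (l a') (l b') (l' c') = 1)"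
    using assms by (auto simp: doubleton_eq_iff)
  ultimately have "local_coeff T T' l l' = of_bool (comult_coeff (l a) (l' b) (l' c) = 1)"
    unfolding local_coeff_def by simp
  then show ?thesis by (cases "comult_coeff (l a) (l' b) (l' c)") simp_all
qed

lemma local_coeff_singletons: "local_coeff {a} {b} l l' = 0"
  by (auto simp: local_coeff_def doubleton_eq_iff)

text \<open>The value \<open>undefined\<close> outside \<open>C\<close> makes the labelling
  extensional, so that subsets of \<open>C\<close> and labellings correspond bijectively.\<close>

definition lab :: "'c set \<Rightarrow> 'c set \<Rightarrow> 'c \<Rightarrow> gen" where
  "lab C T = (\<lambda>c. if c \<in> C then (if c \<in> T then X else One) else undefined)"

definition xset :: "'c set \<Rightarrow> ('c \<Rightarrow> gen) \<Rightarrow> 'c set" where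
  "xset C l = {c \<in> C. l c = X}"

lemma lab_in: "lab C T \<in> C \<rightarrow>\<^sub>E UNIV"
  by (auto simp: lab_def)

lemma xset_lab: "T \<subseteq> C \<Longrightarrow> xset C (lab C T) = T"
  by (auto simp: xset_def lab_def)

lemma gen_eq_One: "g \<noteq> X \<longleftrightarrow> g = One"
  by (cases g) auto

lemma lab_xset: "l \<in> C \<rightarrow>\<^sub>E UNIV \<Longrightarrow> lab C (xset C l) = l"
  by (auto simp: xset_def lab_def gen_eq_One PiE_def extensional_def fun_eq_iff)

lemma xset_subset: "xset C l \<subseteq> C"
  by (auto simp: xset_def)

lemma bij_lab: "bij_betw (lab C) (Pow C) (C \<rightarrow>\<^sub>E UNIV)"
proof (rule bij_betw_byWitness[of _ "xset C"])
  show "lab C ` Pow C \<subseteq> C \<rightarrow>\<^sub>E UNIV" by (rule image_subsetI) (rule lab_in)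
  show "xset C ` (C \<rightarrow>\<^sub>E UNIV) \<subseteq> Pow C" by (rule image_subsetI) (simp add: xset_subset)
qed (simp_all add: xset_lab lab_xset)

lemma sum_gen_deg:
  assumes "finite C"
  shows "(\<Sum>c\<in>C. gen_deg (l c)) = int (card C) - 2 * int (card (xset C l))"
proof -
  have "(\<Sum>c\<in>C. gen_deg (l c)) = (\<Sum>c\<in>C. 1 - 2 * (if l c = X then 1 else 0))"
    by (rule sum.cong) (auto simp: gen_eq_One)
  also have "\<dots> = int (card C) - 2 * (\<Sum>c\<in>C. if l c = X then 1 else 0)"
    by (simp add: sum_subtractf sum_distrib_left[symmetric] del: sum.inter_filter)
  also have "(\<Sum>c\<in>C. if l c = X then 1 else 0) = int (card (xset C l))"
    using assms by (simp add: xset_def sum.inter_filter[symmetric])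
  finally show ?thesis .
qed

locale state_complex = smoothing "edges G - M" M p
  for G :: "('v, 'e) mgraph" and M :: "'e set" and p :: "'e \<Rightarrow> bool \<Rightarrow> bool \<Rightarrow> 'e \<times> bool" +
  fixes \<Gamma> :: "('v, 'e) drawing"
  assumes circles_eq: "circles G M \<Gamma> S = circ S"
    and circles_through_eq: "e \<in> M \<Longrightarrow> circles_through G M \<Gamma> S e = thr S e"
begin

lemma labellings_eq: "labellings G M \<Gamma> S = circ S \<rightarrow>\<^sub>E UNIV"
  by (simp add: labellings_def circles_eq)

lemma edge_coeff_lab:
  assumes e: "e \<in> M" and T: "T \<subseteq> circ S" "T' \<subseteq> circ (insert e S)"
  shows "edge_coeff G M \<Gamma> e S (lab (circ S) T) (lab (circ (insert e S)) T') =
    of_bool (T' - thr (insert e S) e = T - thr S e) *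
    local_coeff (thr S e) (thr (insert e S) e) (lab (circ S) T) (lab (circ (insert e S)) T')"
proof -
  have eq: "circ (insert e S) - thr (insert e S) e = circ S - thr S e" by (rule circ_diff_thr_insert[OF e])
  have "(\<forall>c\<in>circ S - thr S e. lab (circ (insert e S)) T' c = lab (circ S) T c) \<longleftrightarrow>
      (\<forall>c\<in>circ S - thr S e. c \<in> T' \<longleftrightarrow> c \<in> T)"
    by (rule ball_cong[OF refl]) (use eq in \<open>auto simp: lab_def\<close>)
  also have "\<dots> \<longleftrightarrow> T' - thr (insert e S) e = T - thr S e" using T eq by blast
  finally show ?thesis unfolding edge_coeff_def Let_def circles_eq circles_through_eq[OF e] by simp
qed

text \<open>Fusion identifies two variables of square 0, which is multiplication in
  \<open>V\<close>. Splitting multiplies by the sum of the two new variables, which sends 1 to 1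
  \<otimes> x + x \<otimes> 1 and x to x \<otimes> x. If one circle becomes one, both sides
  vanish.\<close>

lemma coeff_DD_mono:
  assumes e: "e \<in> M" "e \<notin> S" and T: "T \<subseteq> circ S" "T' \<subseteq> circ (insert e S)"
  shows "coeff (DD S e (mono T)) T' = edge_coeff G M \<Gamma> e S (lab (circ S) T) (lab (circ (insert e S)) T')"
proof -
  let ?C = "circ S" and ?C' = "circ (insert e S)"
  define U where "U = T - thr S e"
  have fU: "finite U" using T finite_circ finite_subset unfolding U_def by blast
  have far: "U \<inter> thr (insert e S) e = {}"
    using circ_diff_thr_insert[OF e(1), of S] T unfolding U_def by blast
  have sub: "thr S e \<subseteq> ?C" "thr (insert e S) e \<subseteq> ?C'" using thr_subset[OF e(1)] by blast+
  have DD: "DD S e (mono T) = sigma S e * (mono U * (\<Prod>t\<in>T \<inter> thr S e. vr (insert e S) (SOME f. f \<in> t)))"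
    unfolding DD_def ev_mono_split[OF e(1) T(1)] U_def ..
  note ec = edge_coeff_lab[OF e(1) T, folded U_def]
  show ?thesis using e
  proof (cases rule: thr_cases)
    case (merge A B C)
    have vC: "var C = mono {C}" by (simp add: var_def)
    have U: "C \<notin> U" using far merge by auto
    have "coeff (DD S e (mono T)) T' = of_bool (T' - {C} = U) * mult_coeff (lab ?C T A) (lab ?C T B) (lab ?C' T' C)"
    proof -
      have l: "lab ?C T A = (if A \<in> T then X else One)" "lab ?C T B = (if B \<in> T then X else One)"
        "lab ?C' T' C = (if C \<in> T' then X else One)" using sub merge(1,3) by (auto simp: lab_def)
      have pr: "(\<Prod>t\<in>T \<inter> thr S e. vr (insert e S) (SOME f. f \<in> t)) = (if A \<in> T then var C else 1) * (if B \<in> T then var C else 1)"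
        unfolding merge(1) using merge(2,5) by (simp add: Int_insert_right)
      have q: "T' = insert C U \<longleftrightarrow> C \<in> T' \<and> T' - {C} = U" "T' = U \<longleftrightarrow> C \<notin> T' \<and> T' - {C} = U" using U by auto
      have c: "coeff (mono U * var C) T' = of_bool (C \<in> T' \<and> T' - {C} = U)" "coeff (mono U) T' = of_bool (C \<notin> T' \<and> T' - {C} = U)"
        unfolding vC q[symmetric] using fU U by (simp_all add: coeff_mono_mult coeff_mono)
      show ?thesis unfolding DD pr merge(4) l
        by (cases "A \<in> T"; cases "B \<in> T"; cases "C \<in> T'") (simp_all add: c)
    qed
    then show ?thesis unfolding ec using local_coeff_eqI[OF merge(1-3), of "lab ?C T" "lab ?C' T'"] merge(3) by simp
  next
    case (split A B C)
    have "coeff (DD S e (mono T)) T' = of_bool (T' - {B, C} = U) * comult_coeff (lab ?C T A) (lab ?C' T' B) (lab ?C' T' C)"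
    proof -
      have l: "lab ?C T A = (if A \<in> T then X else One)" "lab ?C' T' B = (if B \<in> T' then X else One)"
        "lab ?C' T' C = (if C \<in> T' then X else One)" using sub split(1,3) by (auto simp: lab_def)
      have U: "B \<notin> U" "C \<notin> U" using far split by auto
      have eq: "T' = insert B U \<longleftrightarrow> B \<in> T' \<and> C \<notin> T' \<and> T' - {B, C} = U" "T' = insert C U \<longleftrightarrow> B \<notin> T' \<and> C \<in> T' \<and> T' - {B, C} = U"
        "T' = insert B (insert C U) \<longleftrightarrow> B \<in> T' \<and> C \<in> T' \<and> T' - {B, C} = U" using U split(2) by blast+
      show ?thesis
      proof (cases "A \<in> T")
        case False
        have "DD S e (mono T) = mono U * mono {B} + mono U * mono {C}"
          unfolding DD split(1,4) using False by (simp add: var_def algebra_simps)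
        then have "coeff (DD S e (mono T)) T' = of_bool (T' = insert B U) + of_bool (T' = insert C U)"
          using fU U by (simp add: coeff_mono_mult)
        then show ?thesis unfolding eq l using False by auto
      next
        case True
        define v where "v = vr (insert e S) (SOME f. f \<in> A)"
        have "var B * var C = mono {B, C}" using split(2) mono_mult[of "{B}" "{C}"] by (simp add: var_def insert_commute)
        moreover have "v = var B \<or> v = var C" using split(5) unfolding v_def by blast
        ultimately have "(var B + var C) * v = mono {B, C}" by (auto simp: distrib_right mult.commute[of "var C" "var B"])
        moreover have "(var B + var C) * (mono U * v) = mono U * ((var B + var C) * v)" by (simp add: ac_simps)
        ultimately have "DD S e (mono T) = mono U * mono {B, C}"
          unfolding DD split(1,4) v_def using True by (simp add: Int_insert_right)
        then have "coeff (DD S e (mono T)) T' = of_bool (T' = insert B (insert C U))"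
          using fU U by (simp add: coeff_mono_mult)
        then show ?thesis unfolding eq l using True by auto
      qed
    qed
    then show ?thesis unfolding ec using local_coeff_split_eqI[OF split(1-3), of "lab ?C T" "lab ?C' T'"] split(3) by simp
  next
    case (same A C)
    then show ?thesis unfolding ec same(1,2) local_coeff_singletons DD same(3) by simp
  qed
qed

end

text \<open>The terms of (e, f) and (f, e) are equal and cancel in characteristic 2.\<close>

lemma sum_offdiag_eq_0:
  fixes w :: "'a \<Rightarrow> 'a \<Rightarrow> 'c sqf"
  assumes "\<And>e f. e \<in> A \<Longrightarrow> f \<in> A \<Longrightarrow> e \<noteq> f \<Longrightarrow> w e f = w f e" and fin: "finite A"
  shows "(\<Sum>e\<in>A. \<Sum>f\<in>A - {e}. w e f) = 0"
proof -
  have "(\<Sum>e\<in>A. \<Sum>f\<in>A - {e}. w e f) = (\<Sum>(e, f)\<in>Sigma A (\<lambda>e. A - {e}). w e f)"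
    using fin by (subst sum.Sigma) auto
  also have "\<dots> = 0"
    by (rule sum_involution_eq_0[where h = "\<lambda>(e, f). (f, e)"]) (use assms in auto)
  finally show ?thesis .
qed

section \<open>Degrees under the differential\<close>

context smoothing
begin

lemma DD_sum: "DD S e (sum f I) = (\<Sum>i\<in>I. DD S e (f i))"
  by (induction I rule: infinite_finite_induct) (auto simp: DD_add)

lemma DD_scale: "DD S e (scale b f) = scale b (DD S e f)"
  by (simp add: scale_def)

lemma coeff_DD_subset:
  assumes e: "e \<in> M" and g: "\<And>T. coeff g T \<noteq> 0 \<Longrightarrow> T \<subseteq> circ S" and T: "coeff (DD S e g) T \<noteq> 0"
  shows "T \<subseteq> circ (insert e S)"
proof -
  obtain n where n: "homog (circ (insert e S)) n (sigma S e)"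
  proof (cases "single S e")
    case True
    have "homog (circ (insert e S)) 1 (sigma S e)"
      unfolding sigma_def sd_def if_P[OF True] by (intro homog_add homog_vr p_edge e)
    then show thesis by (rule that)
  qed (use that[of 0] in \<open>simp add: sigma_def homog_one\<close>)
  let ?W = "{T. coeff g T \<noteq> 0}"
  have "DD S e g = (\<Sum>U\<in>?W. scale (coeff g U) (DD S e (mono U)))"
    using arg_cong[OF sqf_expand[OF coeff_finite(1) subset_refl, of g], of "DD S e"] unfolding DD_sum DD_scale .
  then have "(\<Sum>U\<in>?W. coeff g U * coeff (DD S e (mono U)) T) \<noteq> 0" using T by (simp add: coeff_sum coeff_scale)
  then obtain U where "U \<in> ?W" "coeff g U * coeff (DD S e (mono U)) T \<noteq> 0" by (meson sum.not_neutral_contains_not_neutral)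
  then have "U \<subseteq> circ S" and U2: "coeff (DD S e (mono U)) T \<noteq> 0" using g[of U] by auto
  have "homog (circ (insert e S)) (card U) (ev (\<lambda>t. vr (insert e S) (SOME f. f \<in> t)) (mono U))"
    by (rule homog_ev[OF homog_mono[OF \<open>U \<subseteq> circ S\<close>]]) (intro homog_vr some_in_circ)
  from homog_mult[OF n this] U2 show ?thesis unfolding DD_def homog_def by blast
qed

text \<open>The monomial of \<open>T\<close> stands for the labelling with \<open>x\<close> exactly on \<open>T\<close>.\<close>

definition graded :: "int \<Rightarrow> 'e set \<Rightarrow> 'e set sqf \<Rightarrow> bool" where
  "graded j S g \<longleftrightarrow> (\<forall>T. coeff g T \<noteq> 0 \<longrightarrow> T \<subseteq> circ S \<and> int (card (circ S)) - 2 * int (card T) + int (card S) = j)"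

lemma graded_homog:
  assumes "graded j S g" "g \<noteq> 0"
  obtains n where "homog (circ S) n g" "int (card (circ S)) - 2 * int n + int (card S) = j"
proof -
  obtain T where T: "coeff g T \<noteq> 0" using assms(2) by (metis coeff_simps(1) sqf_eqI)
  have "homog (circ S) (card T) g" unfolding homog_def
  proof (intro allI impI)
    fix U assume "coeff g U \<noteq> 0"
    then have "U \<subseteq> circ S" "int (card (circ S)) - 2 * int (card U) + int (card S) = j" using assms(1) unfolding graded_def by blast+
    moreover have "int (card (circ S)) - 2 * int (card T) + int (card S) = j" using assms(1) T unfolding graded_def by blast
    ultimately show "U \<subseteq> circ S \<and> card U = card T" by linarith
  qed
  moreover have "int (card (circ S)) - 2 * int (card T) + int (card S) = j" using assms(1) T unfolding graded_def by blast
  ultimately show thesis by (rule that)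
qed

lemma homog_graded: "homog (circ S) n g \<Longrightarrow> int (card (circ S)) - 2 * int n + int (card S) = j \<Longrightarrow> graded j S g"
  unfolding homog_def graded_def by blast

lemma graded_zero [simp]: "graded j S 0"
  by (simp add: graded_def)

lemma graded_sum: "(\<And>i. i \<in> I \<Longrightarrow> graded j S (f i)) \<Longrightarrow> graded j S (sum f I)"
proof (induction I rule: infinite_finite_induct)
  case (insert i I)
  then have *: "graded j S (f i)" "graded j S (sum f I)" by simp_all
  have "coeff (f i) T \<noteq> 0 \<or> coeff (sum f I) T \<noteq> 0" if "coeff (f i + sum f I) T \<noteq> 0" for T
    using that by (metis add_0 coeff_simps(2))
  then have "graded j S (f i + sum f I)" using * unfolding graded_def by metis
  then show ?case using insert by simp
qed simp_all

text \<open>A fusion lowers the number of circles by one and keeps the size of monomials; a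
  splitting raises both by one, and a variable in a monomial counts -2. So the unshifted degree
  drops by one in either case, which the increase of \<open>card S\<close> compensates.\<close>

lemma graded_DD:
  assumes e: "e \<in> M" "e \<notin> S" and S: "finite S" and g: "graded j S g"
  shows "graded j (insert e S) (DD S e g)"
proof (cases "g = 0")
  case False
  then obtain n where n: "homog (circ S) n g" "int (card (circ S)) - 2 * int n + int (card S) = j"
    using graded_homog[OF g] by blast
  have ev: "homog (circ (insert e S)) n (ev (\<lambda>t. vr (insert e S) (SOME f. f \<in> t)) g)"
    by (rule homog_ev[OF n(1)]) (intro homog_vr some_in_circ)
  have c: "int (card (insert e S)) = int (card S) + 1" using S e by simp
  have hs: "homog (circ (insert e S)) 1 (sd (insert e S) e)"
    unfolding sd_def by (intro homog_add homog_vr p_edge e)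
  show ?thesis
  proof (cases "single S e")
    case True
    have h: "homog (circ (insert e S)) (1 + n) (DD S e g)" unfolding DD_def sigma_def using True homog_mult[OF hs ev] by simp
    show ?thesis
    proof (cases "single (insert e S) e")
      case True
      then show ?thesis using \<open>single S e\<close> unfolding DD_def sigma_def by (simp add: sd_zero_iff[THEN iffD2])
    next
      case False
      then show ?thesis using card_circ_insert[OF e(1), of S] n(2) \<open>single S e\<close> c by (intro homog_graded[OF h]) simp
    qed
  next
    case False
    have h: "homog (circ (insert e S)) n (DD S e g)" unfolding DD_def sigma_def using False ev by simp
    have "single (insert e S) e" using single_or[OF e] False by blast
    then show ?thesis using card_circ_insert[OF e(1), of S] n(2) False c by (intro homog_graded[OF h]) simp
  qed
qed simp

end

section \<open>Cochains as families of polynomials\<close>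

context state_complex
begin

text \<open>The component of a cochain at the vertex \<open>S\<close> of the cube.\<close>

definition el :: "('e set \<times> 'e labelling \<Rightarrow> bit) \<Rightarrow> 'e set \<Rightarrow> 'e set sqf" where
  "el c S = (\<Sum>T\<in>Pow (circ S). scale (c (S, lab (circ S) T)) (mono T))"

lemma coeff_el: "coeff (el c S) T = (if T \<subseteq> circ S then c (S, lab (circ S) T) else 0)"
proof -
  have "coeff (el c S) T = (\<Sum>U\<in>Pow (circ S). if U = T then c (S, lab (circ S) T) else 0)"
    unfolding el_def coeff_sum
  proof (rule sum.cong[OF refl])
    fix U assume "U \<in> Pow (circ S)"
    then have "finite U" using finite_circ finite_subset by blast
    then show "coeff (scale (c (S, lab (circ S) U)) (mono U)) T = (if U = T then c (S, lab (circ S) T) else 0)"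
      by (auto simp: coeff_scale coeff_mono)
  qed
  also have "\<dots> = (if T \<subseteq> circ S then c (S, lab (circ S) T) else 0)" using finite_circ by simp
  finally show ?thesis .
qed

lemma coeff_el_subset: "coeff (el c S) T \<noteq> 0 \<Longrightarrow> T \<subseteq> circ S"
  unfolding coeff_el by (auto split: if_splits)

lemma el_add: "el (\<lambda>s. c s + d s) S = el c S + el d S"
  by (rule sqf_eqI) (simp add: coeff_el)

lemma el_zero [simp]: "el (\<lambda>_. 0) S = 0"
  by (rule sqf_eqI) (simp add: coeff_el)

lemma el_xset: "l \<in> labellings G M \<Gamma> S \<Longrightarrow> c (S, l) = coeff (el c S) (xset (circ S) l)"
  unfolding labellings_eq by (simp add: coeff_el xset_subset lab_xset)

definition valid :: "('e set \<times> 'e labelling) set" where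
  "valid = {(S, l). S \<subseteq> M \<and> l \<in> labellings G M \<Gamma> S}"

lemma cochain_eqI:
  assumes "\<And>s. s \<notin> valid \<Longrightarrow> c s = 0" "\<And>s. s \<notin> valid \<Longrightarrow> d s = 0" "\<And>S. S \<subseteq> M \<Longrightarrow> el c S = el d S"
  shows "c = d"
proof
  fix s
  show "c s = d s"
  proof (cases "s \<in> valid")
    case True
    then obtain S l where s: "s = (S, l)" "S \<subseteq> M" "l \<in> labellings G M \<Gamma> S" unfolding valid_def by blast
    then show ?thesis unfolding s(1) using assms(3)[OF s(2)] el_xset[OF s(3), of c] el_xset[OF s(3), of d] by simp
  qed (simp add: assms)
qed

lemma coeff_DD_el:
  assumes e: "e \<in> M" "e \<notin> S" and l': "l' \<in> labellings G M \<Gamma> (insert e S)"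
  shows "coeff (DD S e (el c S)) (xset (circ (insert e S)) l') =
    (\<Sum>l\<in>labellings G M \<Gamma> S. edge_coeff G M \<Gamma> e S l l' * c (S, l))"
proof -
  have l: "lab (circ (insert e S)) (xset (circ (insert e S)) l') = l'" using l' unfolding labellings_eq by (rule lab_xset)
  have "coeff (DD S e (el c S)) (xset (circ (insert e S)) l') =
      (\<Sum>T\<in>Pow (circ S). c (S, lab (circ S) T) * coeff (DD S e (mono T)) (xset (circ (insert e S)) l'))"
    unfolding el_def DD_sum DD_scale coeff_sum coeff_scale ..
  also have "\<dots> = (\<Sum>T\<in>Pow (circ S). edge_coeff G M \<Gamma> e S (lab (circ S) T) l' * c (S, lab (circ S) T))"
    by (rule sum.cong[OF refl]) (simp add: coeff_DD_mono[OF e] xset_subset l mult.commute)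
  also have "\<dots> = (\<Sum>l\<in>labellings G M \<Gamma> S. edge_coeff G M \<Gamma> e S l l' * c (S, l))"
    unfolding labellings_eq by (rule sum.reindex_bij_betw[OF bij_lab])
  finally show ?thesis .
qed

lemma el_differential:
  assumes S: "S \<subseteq> M"
  shows "el (differential G M \<Gamma> c) S = (\<Sum>e\<in>S. DD (S - {e}) e (el c (S - {e})))"
proof (rule sqf_eqI)
  fix T
  show "coeff (el (differential G M \<Gamma> c) S) T = coeff (\<Sum>e\<in>S. DD (S - {e}) e (el c (S - {e}))) T"
  proof (cases "T \<subseteq> circ S")
    case True
    have l: "lab (circ S) T \<in> labellings G M \<Gamma> S" unfolding labellings_eq by (rule lab_in)
    have "coeff (el (differential G M \<Gamma> c) S) T = (\<Sum>e\<in>S. \<Sum>l\<in>labellings G M \<Gamma> (S - {e}). edge_coeff G M \<Gamma> e (S - {e}) l (lab (circ S) T) * c (S - {e}, l))"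
      using True l S by (simp add: coeff_el differential_def)
    also have "\<dots> = (\<Sum>e\<in>S. coeff (DD (S - {e}) e (el c (S - {e}))) T)"
    proof (rule sum.cong[OF refl])
      fix e assume e: "e \<in> S"
      then have "insert e (S - {e}) = S" by blast
      then show "(\<Sum>l\<in>labellings G M \<Gamma> (S - {e}). edge_coeff G M \<Gamma> e (S - {e}) l (lab (circ S) T) * c (S - {e}, l)) = coeff (DD (S - {e}) e (el c (S - {e}))) T"
        using coeff_DD_el[of e "S - {e}" "lab (circ S) T" c] e S l True by (auto simp: xset_lab)
    qed
    finally show ?thesis by (simp add: coeff_sum)
  next
    case False
    have "coeff (DD (S - {e}) e (el c (S - {e}))) T = 0" if "e \<in> S" for e
    proof (rule ccontr)
      assume "coeff (DD (S - {e}) e (el c (S - {e}))) T \<noteq> 0"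
      then have "T \<subseteq> circ (insert e (S - {e}))" using coeff_DD_subset[of e] coeff_el_subset that S by blast
      then show False using False that by (simp add: insert_absorb)
    qed
    then show ?thesis using False by (simp add: coeff_sum coeff_el)
  qed
qed

lemma differential_valid: "s \<notin> valid \<Longrightarrow> differential G M \<Gamma> c s = 0"
  by (auto simp: differential_def valid_def split: prod.splits)

text \<open>Modulo 2 commuting squares need no signs: the two orders of changing the same two
  entries contribute equal terms.\<close>

lemma differential_differential: "differential G M \<Gamma> (differential G M \<Gamma> c) = (\<lambda>_. 0)"
proof (rule cochain_eqI)
  fix S assume S: "S \<subseteq> M"
  define w where "w e f = DD (S - {e}) e (DD (S - {e} - {f}) f (el c (S - {e} - {f})))" for e f
  have "el (differential G M \<Gamma> (differential G M \<Gamma> c)) S = (\<Sum>e\<in>S. \<Sum>f\<in>S - {e}. w e f)"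
    unfolding el_differential[OF S] w_def
  proof (rule sum.cong[OF refl])
    fix e assume "e \<in> S"
    have "S - {e} \<subseteq> M" using S by blast
    from el_differential[OF this, of c]
    show "DD (S - {e}) e (el (differential G M \<Gamma> c) (S - {e})) = (\<Sum>f\<in>S - {e}. DD (S - {e}) e (DD (S - {e} - {f}) f (el c (S - {e} - {f}))))"
      by (simp add: DD_sum)
  qed
  also have "\<dots> = 0"
  proof (rule sum_offdiag_eq_0)
    fix e f assume ef: "e \<in> S" "f \<in> S" "e \<noteq> f"
    let ?S = "S - {e} - {f}"
    have eq: "insert f ?S = S - {e}" "insert e ?S = S - {f}" "S - {f} - {e} = ?S" using ef by blast+
    have "DD (insert f ?S) e (DD ?S f (el c ?S)) = DD (insert e ?S) f (DD ?S e (el c ?S))"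
      by (rule DD_square) (use ef S coeff_el_subset in auto)
    then show "w e f = w f e" unfolding w_def eq .
  qed (use S finite_M finite_subset in blast)
  finally show "el (differential G M \<Gamma> (differential G M \<Gamma> c)) S = el (\<lambda>_. 0) S" by simp
qed (simp_all add: differential_valid)

lemma carrier_cochains: "c \<in> carrier (cochains G M \<Gamma> i j) \<longleftrightarrow>
  (\<forall>s. s \<notin> valid \<longrightarrow> c s = 0) \<and> (\<forall>S\<subseteq>M. graded j S (el c S) \<and> (int (card S) \<noteq> i \<longrightarrow> el c S = 0))"
proof -
  have basis: "(S, l) \<in> cochain_basis G M \<Gamma> i j \<longleftrightarrow> (S, l) \<in> valid \<and> int (card S) = i \<and>
      int (card (circ S)) - 2 * int (card (xset (circ S) l)) + int (card S) = j" for S l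
    unfolding cochain_basis_def valid_def circles_eq sum_gen_deg[OF finite_circ] by auto
  show ?thesis
  proof
    assume "c \<in> carrier (cochains G M \<Gamma> i j)"
    then have c: "c s = 0" if "s \<notin> cochain_basis G M \<Gamma> i j" for s
      using that by (simp add: cochains_def free_space_def del: split_paired_All)
    show "(\<forall>s. s \<notin> valid \<longrightarrow> c s = 0) \<and> (\<forall>S\<subseteq>M. graded j S (el c S) \<and> (int (card S) \<noteq> i \<longrightarrow> el c S = 0))"
    proof (intro conjI allI impI)
      fix s assume "s \<notin> valid"
      then show "c s = 0" using c[of s] basis by (cases s) blast
    next
      fix S assume S: "S \<subseteq> M"
      show "graded j S (el c S)" unfolding graded_def
      proof (intro allI impI)
        fix T assume T: "coeff (el c S) T \<noteq> 0"
        then have sub: "T \<subseteq> circ S" by (rule coeff_el_subset)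
        then have "c (S, lab (circ S) T) \<noteq> 0" using T by (simp add: coeff_el)
        then have "(S, lab (circ S) T) \<in> cochain_basis G M \<Gamma> i j" using c by blast
        then show "T \<subseteq> circ S \<and> int (card (circ S)) - 2 * int (card T) + int (card S) = j"
          unfolding basis using sub by (simp add: xset_lab)
      qed
      assume "int (card S) \<noteq> i"
      then have "c (S, l) = 0" for l using c basis by blast
      then show "el c S = 0" by (intro sqf_eqI) (simp add: coeff_el)
    qed
  next
    assume *: "(\<forall>s. s \<notin> valid \<longrightarrow> c s = 0) \<and> (\<forall>S\<subseteq>M. graded j S (el c S) \<and> (int (card S) \<noteq> i \<longrightarrow> el c S = 0))"
    have "s \<in> cochain_basis G M \<Gamma> i j" if "c s \<noteq> 0" for s
    proof -
      obtain S l where s: "s = (S, l)" by (cases s)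
      have v: "(S, l) \<in> valid" using * that s by blast
      then have S: "S \<subseteq> M" and l: "l \<in> labellings G M \<Gamma> S" unfolding valid_def by auto
      have "coeff (el c S) (xset (circ S) l) \<noteq> 0" using that s el_xset[OF l, of c] by simp
      moreover from this have "el c S \<noteq> 0" by auto
      ultimately show ?thesis using * S v unfolding s basis graded_def by blast
    qed
    then have "\<forall>s. s \<notin> cochain_basis G M \<Gamma> i j \<longrightarrow> c s = 0" by blast
    then show "c \<in> carrier (cochains G M \<Gamma> i j)" by (simp add: cochains_def free_space_def del: split_paired_All)
  qed
qed

lemma differential_carrier:
  assumes "c \<in> carrier (cochains G M \<Gamma> i j)"
  shows "differential G M \<Gamma> c \<in> carrier (cochains G M \<Gamma> (i + 1) j)"
  unfolding carrier_cochains
proof (intro conjI allI impI)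
  have c: "graded j S (el c S)" "int (card S) \<noteq> i \<Longrightarrow> el c S = 0" if "S \<subseteq> M" for S
    using assms that unfolding carrier_cochains by blast+
  fix S assume S: "S \<subseteq> M"
  have fin: "finite S" using S finite_M finite_subset by blast
  show "graded j S (el (differential G M \<Gamma> c) S)" unfolding el_differential[OF S]
  proof (rule graded_sum)
    fix e assume e: "e \<in> S"
    have "S - {e} \<subseteq> M" using S by blast
    then have "graded j (insert e (S - {e})) (DD (S - {e}) e (el c (S - {e})))"
      using e S fin c(1) by (intro graded_DD) auto
    then show "graded j S (DD (S - {e}) e (el c (S - {e})))" using e by (simp add: insert_absorb)
  qed
  assume "int (card S) \<noteq> i + 1"
  have "el c (S - {e}) = 0" if e: "e \<in> S" for e
  proof (rule c(2))
    have "card S = Suc (card (S - {e}))" using e fin by (rule card.remove[rotated, THEN trans]) simp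
    then show "int (card (S - {e})) \<noteq> i" using \<open>int (card S) \<noteq> i + 1\<close> by simp
  qed (use S in blast)
  then show "el (differential G M \<Gamma> c) S = 0" unfolding el_differential[OF S] by simp
qed (simp add: differential_valid)

lemma differential_add: "differential G M \<Gamma> (\<lambda>s. c s + d s) = (\<lambda>s. differential G M \<Gamma> c s + differential G M \<Gamma> d s)"
  by (rule cochain_eqI) (simp_all add: differential_valid el_differential el_add DD_add sum.distrib)

end

section \<open>Quotients of spaces of functions\<close>

text \<open>Cochains, cocycles and coboundaries all live in one space of functions with pointwise
  operations. The basis enters \<open>free_space\<close> only through the carrier, which is replaced
  here.\<close>

definition fun_space :: "('x \<Rightarrow> bit) set \<Rightarrow> (bit, 'x \<Rightarrow> bit) module" where
  "fun_space Z = (free_space UNIV)\<lparr>carrier := Z\<rparr>"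

definition vadd :: "('x \<Rightarrow> bit) \<Rightarrow> ('x \<Rightarrow> bit) \<Rightarrow> 'x \<Rightarrow> bit" where
  "vadd f g = (\<lambda>s. f s + g s)"

definition coset :: "('x \<Rightarrow> bit) set \<Rightarrow> ('x \<Rightarrow> bit) \<Rightarrow> ('x \<Rightarrow> bit) set" where
  "coset B z = (\<lambda>b. vadd b z) ` B"

definition vclosed :: "('x \<Rightarrow> bit) set \<Rightarrow> bool" where
  "vclosed Z \<longleftrightarrow> (\<lambda>_. 0) \<in> Z \<and> (\<forall>f\<in>Z. \<forall>g\<in>Z. vadd f g \<in> Z)"

lemma vadd_laws: "vadd f g = vadd g f" "vadd (vadd f g) h = vadd f (vadd g h)" "vadd f (\<lambda>_. 0) = f" "vadd (\<lambda>_. 0) f = f" "vadd f f = (\<lambda>_. 0)"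
  by (simp_all add: vadd_def fun_eq_iff algebra_simps)

lemma vadd_cancel: "vadd f (vadd f g) = g"
  by (simp flip: vadd_laws(2) add: vadd_laws(3-5))

lemma free_space_carrier: "(free_space Y)\<lparr>carrier := Z\<rparr> = fun_space Z"
  by (simp add: free_space_def fun_space_def)

lemma fun_space_simps: "carrier (fun_space Z) = Z" "zero (fun_space Z) = (\<lambda>_. 0)" "add (fun_space Z) f g = vadd f g"
    "smult (fun_space Z) a f = (if a = 1 then f else (\<lambda>_. 0))"
  by (cases a; simp add: fun_space_def free_space_def vadd_def)+

lemma fun_space_coset: "N +>\<^bsub>fun_space Z\<^esub> z = coset N z"
  unfolding a_r_coset_def' by (auto simp: coset_def fun_space_simps)

lemma fun_space_rcosets: "a_rcosets\<^bsub>fun_space Z\<^esub> N = coset N ` Z"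
  unfolding A_RCOSETS_def' by (auto simp: fun_space_coset fun_space_simps)

lemma fun_space_set_add: "A <+>\<^bsub>fun_space Z\<^esub> B = (\<Union>a\<in>A. \<Union>b\<in>B. {vadd a b})"
  unfolding set_add_def' by (simp add: fun_space_simps)

lemma coset_add:
  assumes "vclosed B"
  shows "coset B z <+>\<^bsub>fun_space Z\<^esub> coset B w = coset B (vadd z w)"
proof
  show "coset B z <+>\<^bsub>fun_space Z\<^esub> coset B w \<subseteq> coset B (vadd z w)"
  proof
    fix f assume "f \<in> coset B z <+>\<^bsub>fun_space Z\<^esub> coset B w"
    then obtain b c where bc: "b \<in> B" "c \<in> B" "f = vadd (vadd b z) (vadd c w)"
      unfolding fun_space_set_add coset_def by blast
    have "f = vadd (vadd b c) (vadd z w)" unfolding bc(3) by (simp add: vadd_def algebra_simps)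
    moreover have "vadd b c \<in> B" using assms bc unfolding vclosed_def by blast
    ultimately show "f \<in> coset B (vadd z w)" unfolding coset_def by blast
  qed
  show "coset B (vadd z w) \<subseteq> coset B z <+>\<^bsub>fun_space Z\<^esub> coset B w"
  proof
    fix f assume "f \<in> coset B (vadd z w)"
    then obtain b where b: "b \<in> B" "f = vadd b (vadd z w)" unfolding coset_def by blast
    have "f = vadd (vadd b z) (vadd (\<lambda>_. 0) w)" unfolding b(2) by (simp add: vadd_laws(2,4))
    moreover have "(\<lambda>_. 0) \<in> B" using assms unfolding vclosed_def by blast
    ultimately show "f \<in> coset B z <+>\<^bsub>fun_space Z\<^esub> coset B w" unfolding fun_space_set_add coset_def using b(1) by blast
  qed
qed

lemma coset_zero: "coset B (\<lambda>_. 0) = B"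
  by (simp add: coset_def vadd_laws)

lemma coset_absorb:
  assumes "vclosed B" "w \<in> coset B z"
  shows "coset B w = coset B z"
proof -
  obtain b where b: "b \<in> B" "w = vadd b z" using assms(2) unfolding coset_def by blast
  have "vadd c w = vadd (vadd c b) z" "vadd c z = vadd (vadd c b) w" for c
    unfolding b(2) by (simp_all add: vadd_laws(2) vadd_cancel)
  moreover have "vadd c b \<in> B" if "c \<in> B" for c using assms(1) b that unfolding vclosed_def by blast
  ultimately show ?thesis unfolding coset_def by (auto simp: image_iff)+
qed

lemma coset_self: "vclosed B \<Longrightarrow> z \<in> coset B z"
  unfolding vclosed_def coset_def by (rule image_eqI[of _ _ "\<lambda>_. 0"]) (simp_all add: vadd_laws)

lemma quotient_simps:
  "carrier (quotient_space (fun_space Z) B) = coset B ` Z" "zero (quotient_space (fun_space Z) B) = B"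
  "add (quotient_space (fun_space Z) B) A A' = A <+>\<^bsub>fun_space Z\<^esub> A'"
  by (simp_all add: quotient_space_def fun_space_rcosets)

lemma quotient_smult:
  assumes "vclosed B"
  shows "smult (quotient_space (fun_space Z) B) a (coset B z) = (if a = 1 then coset B z else B)"
proof -
  have "smult (quotient_space (fun_space Z) B) a (coset B z) = (\<Union>w\<in>coset B z. coset B (if a = 1 then w else (\<lambda>_. 0)))"
    by (simp add: quotient_space_def fun_space_coset fun_space_simps)
  also have "\<dots> = (if a = 1 then coset B z else B)"
  proof (cases "a = 1")
    case True
    have "(\<Union>w\<in>coset B z. coset B w) = (\<Union>w\<in>coset B z. coset B z)"
      by (rule SUP_cong[OF refl]) (rule coset_absorb[OF assms])
    then show ?thesis using True coset_self[OF assms, of z] by auto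
  next
    case False
    then show ?thesis using coset_self[OF assms, of z] by (auto simp: coset_zero)
  qed
  finally show ?thesis .
qed

lemma field_F2: "field F2"
proof -
  have "cring F2"
  proof (rule cringI)
    show "abelian_group F2"
    proof (rule abelian_groupI)
      fix x assume "x \<in> carrier F2"
      show "\<exists>y\<in>carrier F2. y \<oplus>\<^bsub>F2\<^esub> x = \<zero>\<^bsub>F2\<^esub>" by (rule bexI[of _ x]) (simp_all add: F2_def)
    qed (simp_all add: F2_def algebra_simps)
    show "comm_monoid F2" by (rule comm_monoidI) (simp_all add: F2_def algebra_simps)
  qed (simp add: F2_def algebra_simps)
  then interpret cring F2 .
  show ?thesis
  proof (rule cring_fieldI2)
    fix a assume "a \<in> carrier F2" "a \<noteq> \<zero>\<^bsub>F2\<^esub>"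
    then show "\<exists>b\<in>carrier F2. a \<otimes>\<^bsub>F2\<^esub> b = \<one>\<^bsub>F2\<^esub>" by (intro bexI[of _ 1]) (auto simp: F2_def)
  qed (simp add: F2_def)
qed

lemma vectorspace_quotient:
  assumes Z: "vclosed Z" and B: "vclosed B" "B \<subseteq> Z"
  shows "vectorspace F2 (quotient_space (fun_space Z) B)"
proof (rule vs_criteria[OF field_F2])
  let ?Q = "quotient_space (fun_space Z) B"
  have add: "coset B z \<oplus>\<^bsub>?Q\<^esub> coset B w = coset B (vadd z w)" for z w
    unfolding quotient_simps by (rule coset_add[OF B(1)])
  have zero: "\<zero>\<^bsub>?Q\<^esub> = coset B (\<lambda>_. 0)" by (simp add: quotient_simps coset_zero)
  have smult: "a \<odot>\<^bsub>?Q\<^esub> coset B z = coset B (if a = 1 then z else (\<lambda>_. 0))" for a z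
    unfolding quotient_smult[OF B(1)] by (simp add: coset_zero)
  have z0: "(\<lambda>_. 0) \<in> Z" and zadd: "f \<in> Z \<Longrightarrow> g \<in> Z \<Longrightarrow> vadd f g \<in> Z" for f g using Z unfolding vclosed_def by blast+
  show "\<zero>\<^bsub>?Q\<^esub> \<in> carrier ?Q" unfolding zero quotient_simps(1) using z0 by blast
  show "\<forall>v w. v \<in> carrier ?Q \<and> w \<in> carrier ?Q \<longrightarrow> v \<oplus>\<^bsub>?Q\<^esub> w \<in> carrier ?Q"
    unfolding quotient_simps(1) using zadd by (auto simp: add)
  show "\<forall>v\<in>carrier ?Q. \<exists>w\<in>carrier ?Q. v \<oplus>\<^bsub>?Q\<^esub> w = \<zero>\<^bsub>?Q\<^esub>"
  proof
    fix v assume v: "v \<in> carrier ?Q"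
    then obtain z where "z \<in> Z" "v = coset B z" unfolding quotient_simps by blast
    then have "v \<oplus>\<^bsub>?Q\<^esub> v = \<zero>\<^bsub>?Q\<^esub>" by (simp add: add zero vadd_laws)
    then show "\<exists>w\<in>carrier ?Q. v \<oplus>\<^bsub>?Q\<^esub> w = \<zero>\<^bsub>?Q\<^esub>" using v by blast
  qed
  show "\<forall>c v. c \<in> carrier F2 \<and> v \<in> carrier ?Q \<longrightarrow> c \<odot>\<^bsub>?Q\<^esub> v \<in> carrier ?Q"
    unfolding quotient_simps(1) using z0 by (auto simp: smult)
  show "\<forall>v w. v \<in> carrier ?Q \<and> w \<in> carrier ?Q \<longrightarrow> v \<oplus>\<^bsub>?Q\<^esub> w = w \<oplus>\<^bsub>?Q\<^esub> v"
    unfolding quotient_simps(1) by (auto simp: add vadd_laws(1))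
  show "\<forall>v w x. v \<in> carrier ?Q \<and> w \<in> carrier ?Q \<and> x \<in> carrier ?Q \<longrightarrow> v \<oplus>\<^bsub>?Q\<^esub> w \<oplus>\<^bsub>?Q\<^esub> x = v \<oplus>\<^bsub>?Q\<^esub> (w \<oplus>\<^bsub>?Q\<^esub> x)"
    unfolding quotient_simps(1) by (auto simp: add vadd_laws(2))
  show "\<forall>v\<in>carrier ?Q. v \<oplus>\<^bsub>?Q\<^esub> \<zero>\<^bsub>?Q\<^esub> = v"
    unfolding quotient_simps(1) zero by (auto simp: add vadd_laws(3))
  show "\<forall>a b v. a \<in> carrier F2 \<and> b \<in> carrier F2 \<and> v \<in> carrier ?Q \<longrightarrow> (a \<otimes>\<^bsub>F2\<^esub> b) \<odot>\<^bsub>?Q\<^esub> v = a \<odot>\<^bsub>?Q\<^esub> (b \<odot>\<^bsub>?Q\<^esub> v)"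
  proof (intro allI impI)
    fix a b v assume "a \<in> carrier F2 \<and> b \<in> carrier F2 \<and> v \<in> carrier ?Q"
    then obtain z where "v = coset B z" unfolding quotient_simps(1) by blast
    then show "(a \<otimes>\<^bsub>F2\<^esub> b) \<odot>\<^bsub>?Q\<^esub> v = a \<odot>\<^bsub>?Q\<^esub> (b \<odot>\<^bsub>?Q\<^esub> v)"
      by (cases a; cases b) (simp_all add: smult F2_def)
  qed
  show "\<forall>v\<in>carrier ?Q. \<one>\<^bsub>F2\<^esub> \<odot>\<^bsub>?Q\<^esub> v = v"
    unfolding quotient_simps(1) by (auto simp: smult F2_def)
  show "\<forall>a b v. a \<in> carrier F2 \<and> b \<in> carrier F2 \<and> v \<in> carrier ?Q \<longrightarrow> (a \<oplus>\<^bsub>F2\<^esub> b) \<odot>\<^bsub>?Q\<^esub> v = a \<odot>\<^bsub>?Q\<^esub> v \<oplus>\<^bsub>?Q\<^esub> b \<odot>\<^bsub>?Q\<^esub> v"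
  proof (intro allI impI)
    fix a b v assume "a \<in> carrier F2 \<and> b \<in> carrier F2 \<and> v \<in> carrier ?Q"
    then obtain z where "v = coset B z" unfolding quotient_simps(1) by blast
    then show "(a \<oplus>\<^bsub>F2\<^esub> b) \<odot>\<^bsub>?Q\<^esub> v = a \<odot>\<^bsub>?Q\<^esub> v \<oplus>\<^bsub>?Q\<^esub> b \<odot>\<^bsub>?Q\<^esub> v"
      by (cases a; cases b) (simp_all add: smult add F2_def vadd_laws(3-5))
  qed
  show "\<forall>a v w. a \<in> carrier F2 \<and> v \<in> carrier ?Q \<and> w \<in> carrier ?Q \<longrightarrow> a \<odot>\<^bsub>?Q\<^esub> (v \<oplus>\<^bsub>?Q\<^esub> w) = a \<odot>\<^bsub>?Q\<^esub> v \<oplus>\<^bsub>?Q\<^esub> a \<odot>\<^bsub>?Q\<^esub> w"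
    unfolding quotient_simps(1) by (auto simp: smult add vadd_laws)
qed

text \<open>Over the field with two elements dimensions can be read off from numbers of elements;
  counting thus replaces rank arguments in the computation of the Euler characteristic.\<close>

lemma card_vectorspace_F2:
  assumes "vectorspace F2 W" "finite (carrier W)"
  shows "card (carrier W) = 2 ^ vectorspace.dim F2 W"
proof -
  interpret vectorspace F2 W by fact
  have "gen_set (carrier W)" by (meson span_is_subspace span_self subset_antisym subset_refl span_is_subset2 subsetI in_own_span)
  then have "fin_dim" unfolding fin_dim_def using assms(2) by blast
  then obtain \<beta> where \<beta>: "finite \<beta>" "basis \<beta>" using finite_basis_exists by blast
  have sub: "\<beta> \<subseteq> carrier W" using \<beta>(2) unfolding basis_def by blast
  have uniq: "\<exists>!a. a \<in> \<beta> \<rightarrow>\<^sub>E carrier F2 \<and> lincomb a \<beta> = v" if "v \<in> carrier W" for v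
    using basis_criterion[OF \<beta>(1) sub] \<beta>(2) that by blast
  have cl: "lincomb a \<beta> \<in> carrier W" if "a \<in> \<beta> \<rightarrow>\<^sub>E carrier F2" for a
    using sub that by (intro lincomb_closed) auto
  have "bij_betw (\<lambda>a. lincomb a \<beta>) (\<beta> \<rightarrow>\<^sub>E carrier F2) (carrier W)"
    unfolding bij_betw_def inj_on_def using uniq cl by (auto simp: image_iff) metis+
  then have "card (carrier W) = card (\<beta> \<rightarrow>\<^sub>E carrier F2)" by (metis bij_betw_same_card)
  also have "\<dots> = 2 ^ card \<beta>"
  proof -
    have "card (UNIV :: bit set) = 2"
    proof -
      have "(UNIV :: bit set) = {0, 1}" by (auto intro: bit.exhaust)
      then show ?thesis by (metis card_2_iff zero_neq_one)
    qed
    then show ?thesis using \<beta>(1) by (simp add: card_PiE F2_def)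
  qed
  also have "card \<beta> = dim" using dim_basis[OF \<beta>] by simp
  finally show ?thesis .
qed

text \<open>The cosets partition \<open>Z\<close> into sets of the size of \<open>B\<close>.\<close>

lemma card_quotient:
  assumes Z: "vclosed Z" "finite Z" and B: "vclosed B" "B \<subseteq> Z"
  shows "card (carrier (quotient_space (fun_space Z) B)) * card B = card Z"
proof -
  have card: "card A = card B" if A: "A \<in> coset B ` Z" for A
  proof -
    obtain z where A: "A = coset B z" using A by blast
    have "inj_on (\<lambda>b. vadd b z) B" by (rule inj_onI) (metis vadd_laws(1) vadd_cancel)
    then show ?thesis unfolding A coset_def by (rule card_image)
  qed
  have sub: "coset B z \<subseteq> Z" if "z \<in> Z" for z using Z(1) B(2) that unfolding vclosed_def coset_def by blast
  have U: "\<Union> (coset B ` Z) = Z" using sub coset_self[OF B(1)] by blast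
  have disj: "A \<inter> A' = {}" if "A \<in> coset B ` Z" "A' \<in> coset B ` Z" "A \<noteq> A'" for A A'
  proof (rule ccontr)
    assume "A \<inter> A' \<noteq> {}"
    then obtain w where "w \<in> A" "w \<in> A'" by blast
    then show False using that coset_absorb[OF B(1)] by (metis imageE)
  qed
  have "card B * card (coset B ` Z) = card (\<Union> (coset B ` Z))"
    by (rule card_partition) (use Z(2) U card disj in auto)
  then show ?thesis unfolding U quotient_simps by (simp add: mult.commute)
qed

lemma isomorphic_quotients:
  assumes Z: "vclosed Z" and B: "vclosed B" "B \<subseteq> Z" and B': "vclosed B'"
    and f: "bij_betw f Z Z'" "\<And>z w. z \<in> Z \<Longrightarrow> w \<in> Z \<Longrightarrow> f (vadd z w) = vadd (f z) (f w)" "f ` B = B'"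
  shows "isomorphic_spaces (quotient_space (fun_space Z) B) (quotient_space (fun_space Z') B')"
  unfolding isomorphic_spaces_def
proof (rule bexI)
  let ?Q = "quotient_space (fun_space Z) B" and ?Q' = "quotient_space (fun_space Z') B'"
  have sub: "coset B z \<subseteq> Z" if "z \<in> Z" for z using Z B(2) that unfolding vclosed_def coset_def by blast
  have fc: "f ` coset B z = coset B' (f z)" if "z \<in> Z" for z
  proof -
    have "f (vadd b z) = vadd (f b) (f z)" if "b \<in> B" for b using f(2) B(2) \<open>z \<in> Z\<close> that by blast
    then show ?thesis unfolding coset_def f(3)[symmetric] by (force simp: image_image)
  qed
  have im: "f ` Z = Z'" using f(1) by (simp add: bij_betw_def)
  show "bij_betw (image f) (carrier ?Q) (carrier ?Q')" unfolding bij_betw_def quotient_simps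
  proof
    show "inj_on (image f) (coset B ` Z)"
      by (rule inj_on_subset[OF inj_on_image_Pow[of f Z]]) (use f(1) sub in \<open>auto simp: bij_betw_def\<close>)
    show "image f ` coset B ` Z = coset B' ` Z'" unfolding im[symmetric] image_image
      by (rule image_cong[OF refl]) (rule fc)
  qed
  show "image f \<in> LinearCombinations.module_hom F2 ?Q ?Q'"
    unfolding LinearCombinations.module_hom_def
  proof (intro CollectI conjI allI impI)
    show "image f \<in> carrier ?Q \<rightarrow> carrier ?Q'" unfolding quotient_simps using fc im by blast
  next
    fix A A' assume "A \<in> carrier ?Q \<and> A' \<in> carrier ?Q"
    then obtain z w where zw: "z \<in> Z" "w \<in> Z" "A = coset B z" "A' = coset B w" unfolding quotient_simps by blast
    moreover have "vadd z w \<in> Z" using Z zw unfolding vclosed_def by blast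
    ultimately show "f ` (A \<oplus>\<^bsub>?Q\<^esub> A') = f ` A \<oplus>\<^bsub>?Q'\<^esub> f ` A'"
      unfolding quotient_simps by (simp add: fc coset_add[OF B(1)] coset_add[OF B'] f(2))
  next
    fix r :: bit and A assume "r \<in> carrier F2 \<and> A \<in> carrier ?Q"
    then obtain z where "z \<in> Z" "A = coset B z" unfolding quotient_simps by blast
    then show "f ` (r \<odot>\<^bsub>?Q\<^esub> A) = r \<odot>\<^bsub>?Q'\<^esub> f ` A"
      by (simp add: fc quotient_smult[OF B(1)] quotient_smult[OF B'] f(3))
  qed
qed

section \<open>Cocycles, coboundaries and cohomology\<close>

context state_complex
begin

abbreviation "CC i j \<equiv> carrier (cochains G M \<Gamma> i j)"
abbreviation "dd \<equiv> differential G M \<Gamma>"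

definition ZZ where "ZZ i j = {c \<in> CC i j. dd c = (\<lambda>_. 0)}"
definition BB where "BB i j = dd ` CC (i - 1) j"

lemma cohomology_eq: "cohomology G M \<Gamma> i j = quotient_space (fun_space (ZZ i j)) (BB i j)"
  unfolding cohomology_def Let_def ZZ_def BB_def cochains_def free_space_carrier ..

lemma dd_vadd: "dd (vadd c d) = vadd (dd c) (dd d)"
  unfolding vadd_def by (rule differential_add)

lemma dd_zero: "dd (\<lambda>_. 0) = (\<lambda>_. 0)"
  using dd_vadd[of "\<lambda>_. 0" "\<lambda>_. 0"] unfolding vadd_laws(5) .

lemma vclosed_CC: "vclosed (CC i j)"
  unfolding cochains_def free_space_def vclosed_def by (simp add: vadd_def)

lemma vclosed_ZZ: "vclosed (ZZ i j)"
  using vclosed_CC[of i j] unfolding vclosed_def ZZ_def by (simp add: dd_zero dd_vadd vadd_laws(3))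

lemma vclosed_BB: "vclosed (BB i j)"
  unfolding vclosed_def BB_def
proof (intro conjI ballI)
  have 0: "(\<lambda>_. 0) \<in> CC (i - 1) j" and add: "\<forall>c\<in>CC (i - 1) j. \<forall>d\<in>CC (i - 1) j. vadd c d \<in> CC (i - 1) j"
    using vclosed_CC[of "i - 1" j] unfolding vclosed_def by blast+
  show "(\<lambda>_. 0) \<in> dd ` CC (i - 1) j" by (rule image_eqI[OF _ 0]) (simp add: dd_zero)
  fix f g assume "f \<in> dd ` CC (i - 1) j" "g \<in> dd ` CC (i - 1) j"
  then obtain c d where "c \<in> CC (i - 1) j" "d \<in> CC (i - 1) j" "f = dd c" "g = dd d" by blast
  then show "vadd f g \<in> dd ` CC (i - 1) j" using add by (intro image_eqI[of _ _ "vadd c d"]) (simp_all add: dd_vadd)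
qed

lemma BB_subset_ZZ: "BB i j \<subseteq> ZZ i j"
  unfolding BB_def ZZ_def using differential_carrier[of _ "i - 1" j] differential_differential by auto

end

section \<open>The isomorphism of the two complexes\<close>

locale complex_map = C: state_complex G M p \<Gamma> + C': state_complex G M p' \<Gamma>' + smoothing_map "edges G - M" M p p' fl \<kappa> \<tau>
  for G :: "('v, 'e) mgraph" and M p \<Gamma> p' \<Gamma>' fl \<kappa> \<tau>
begin

definition Phi where
  "Phi c = (\<lambda>(S, l). if (S, l) \<in> C'.valid then coeff (phi S (C.el c S)) (xset (C'.circ S) l) else 0)"

lemma graded_phi: "C.graded j S g \<Longrightarrow> C'.graded j S (phi S g)"
proof (cases "g = 0")
  case False
  assume "C.graded j S g"
  then obtain n where n: "homog (C.circ S) n g" "int (card (C.circ S)) - 2 * int n + int (card S) = j"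
    using C.graded_homog False by blast
  then show ?thesis using homog_phi[OF n(1)] card_circ_eq[of S] by (intro C'.homog_graded) auto
qed simp

lemma Phi_valid: "s \<notin> C'.valid \<Longrightarrow> Phi c s = 0"
  by (cases s) (simp add: Phi_def)

lemma el_Phi:
  assumes c: "c \<in> C.CC i j" and S: "S \<subseteq> M"
  shows "C'.el (Phi c) S = phi S (C.el c S)"
proof (rule sqf_eqI)
  fix T
  have g: "C'.graded j S (phi S (C.el c S))"
    by (rule graded_phi) (use c S in \<open>auto simp: C.carrier_cochains\<close>)
  show "coeff (C'.el (Phi c) S) T = coeff (phi S (C.el c S)) T"
  proof (cases "T \<subseteq> C'.circ S")
    case True
    have "(S, lab (C'.circ S) T) \<in> C'.valid" using S lab_in by (simp add: C'.valid_def C'.labellings_eq)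
    then show ?thesis using True by (simp add: C'.coeff_el Phi_def xset_lab)
  next
    case False
    then have "coeff (phi S (C.el c S)) T = 0" using g unfolding C'.graded_def by blast
    then show ?thesis using False by (simp add: C'.coeff_el)
  qed
qed

lemma Phi_carrier: "c \<in> C.CC i j \<Longrightarrow> Phi c \<in> C'.CC i j"
  unfolding C'.carrier_cochains
proof (intro conjI allI impI)
  assume c: "c \<in> C.CC i j"
  fix S assume S: "S \<subseteq> M"
  show "C'.graded j S (C'.el (Phi c) S)" unfolding el_Phi[OF c S]
    by (rule graded_phi) (use c S in \<open>auto simp: C.carrier_cochains\<close>)
  assume "int (card S) \<noteq> i"
  then have "C.el c S = 0" using c S by (auto simp: C.carrier_cochains)
  then show "C'.el (Phi c) S = 0" unfolding el_Phi[OF c S] by simp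
qed (simp add: Phi_valid)

lemma Phi_vadd: "Phi (vadd c d) = vadd (Phi c) (Phi d)"
  unfolding Phi_def vadd_def by (auto simp: C.el_add phi_add fun_eq_iff)

lemma phi_sum: "phi S (sum f I) = (\<Sum>i\<in>I. phi S (f i))"
  by (induction I rule: infinite_finite_induct) (auto simp: phi_add)

lemma Phi_dd:
  assumes c: "c \<in> C.CC i j"
  shows "C'.dd (Phi c) = Phi (C.dd c)"
proof (rule C'.cochain_eqI)
  fix S assume S: "S \<subseteq> M"
  have "C'.el (C'.dd (Phi c)) S = (\<Sum>e\<in>S. C'.DD (S - {e}) e (phi (S - {e}) (C.el c (S - {e}))))"
    unfolding C'.el_differential[OF S]
  proof (rule sum.cong[OF refl])
    fix e assume "e \<in> S"
    have "S - {e} \<subseteq> M" using S by blast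
    then show "C'.DD (S - {e}) e (C'.el (Phi c) (S - {e})) = C'.DD (S - {e}) e (phi (S - {e}) (C.el c (S - {e})))"
      using el_Phi[OF c] by simp
  qed
  also have "\<dots> = (\<Sum>e\<in>S. phi S (C.DD (S - {e}) e (C.el c (S - {e}))))"
  proof (rule sum.cong[OF refl])
    fix e assume e: "e \<in> S"
    have "phi (insert e (S - {e})) (C.DD (S - {e}) e (C.el c (S - {e}))) = C'.DD (S - {e}) e (phi (S - {e}) (C.el c (S - {e})))"
      by (rule phi_DD) (use e S C.coeff_el_subset in auto)
    then show "C'.DD (S - {e}) e (phi (S - {e}) (C.el c (S - {e}))) = phi S (C.DD (S - {e}) e (C.el c (S - {e})))"
      using e by (simp add: insert_absorb)
  qed
  also have "\<dots> = phi S (C.el (C.dd c) S)" unfolding C.el_differential[OF S] phi_sum ..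
  also have "\<dots> = C'.el (Phi (C.dd c)) S" using el_Phi[OF C.differential_carrier[OF c] S] by simp
  finally show "C'.el (C'.dd (Phi c)) S = C'.el (Phi (C.dd c)) S" .
qed (simp_all add: Phi_valid C'.differential_valid)

end

lemma complex_map_swap: "complex_map G M p \<Gamma> p' \<Gamma>' fl \<kappa> \<tau> \<Longrightarrow> complex_map G M p' \<Gamma>' p \<Gamma> fl \<kappa> \<tau>"
  unfolding complex_map_def using smoothing_map_swap by blast

context complex_map
begin

lemma Phi_Phi:
  assumes c: "c \<in> C.CC i j"
  shows "complex_map.Phi G M p' p \<Gamma> \<kappa> (Phi c) = c"
proof -
  interpret I: complex_map G M p' \<Gamma>' p \<Gamma> fl \<kappa> \<tau> by (rule complex_map_swap) unfold_locales
  show ?thesis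
  proof (rule C.cochain_eqI)
    fix S assume S: "S \<subseteq> M"
    have "C.el (I.Phi (Phi c)) S = I.phi S (phi S (C.el c S))"
      unfolding I.el_Phi[OF Phi_carrier[OF c] S] el_Phi[OF c S] ..
    also have "\<dots> = C.el c S" by (rule phi_phi) (rule C.coeff_el_subset)
    finally show "C.el (I.Phi (Phi c)) S = C.el c S" .
  qed (use c in \<open>auto simp: I.Phi_valid C.carrier_cochains\<close>)
qed

lemma cohomology_isomorphic: "bigraded_isomorphic (cohomology G M \<Gamma>) (cohomology G M \<Gamma>')"
  unfolding bigraded_isomorphic_def C.cohomology_eq C'.cohomology_eq
proof (intro allI)
  fix i j
  interpret I: complex_map G M p' \<Gamma>' p \<Gamma> fl \<kappa> \<tau> by (rule complex_map_swap) unfold_locales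
  have Phi_zero: "Phi (\<lambda>_. 0) = (\<lambda>_. 0)" "I.Phi (\<lambda>_. 0) = (\<lambda>_. 0)"
    using Phi_vadd[of "\<lambda>_. 0" "\<lambda>_. 0"] I.Phi_vadd[of "\<lambda>_. 0" "\<lambda>_. 0"] unfolding vadd_laws(5) by simp_all
  have inv: "c \<in> C.CC i j \<Longrightarrow> I.Phi (Phi c) = c" "c' \<in> C'.CC i j \<Longrightarrow> Phi (I.Phi c') = c'" for c c' i j
    using Phi_Phi I.Phi_Phi by blast+
  show "isomorphic_spaces (quotient_space (fun_space (C.ZZ i j)) (C.BB i j)) (quotient_space (fun_space (C'.ZZ i j)) (C'.BB i j))"
  proof (rule isomorphic_quotients[OF C.vclosed_ZZ C.vclosed_BB C.BB_subset_ZZ C'.vclosed_BB])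
    show "bij_betw Phi (C.ZZ i j) (C'.ZZ i j)"
    proof (rule bij_betw_byWitness[of _ I.Phi])
      show "Phi ` C.ZZ i j \<subseteq> C'.ZZ i j" using Phi_carrier Phi_dd Phi_zero unfolding C.ZZ_def C'.ZZ_def by auto
      show "I.Phi ` C'.ZZ i j \<subseteq> C.ZZ i j" using I.Phi_carrier I.Phi_dd Phi_zero unfolding C.ZZ_def C'.ZZ_def by auto
    qed (use inv in \<open>auto simp: C.ZZ_def C'.ZZ_def\<close>)
    show "Phi ` C.BB i j = C'.BB i j"
    proof
      show "Phi ` C.BB i j \<subseteq> C'.BB i j" unfolding C.BB_def C'.BB_def using Phi_carrier Phi_dd[symmetric] by auto
      show "C'.BB i j \<subseteq> Phi ` C.BB i j"
      proof
        fix b assume "b \<in> C'.BB i j"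
        then obtain c where c: "c \<in> C'.CC (i - 1) j" "b = C'.dd c" unfolding C'.BB_def by blast
        have "b = Phi (C.dd (I.Phi c))" using Phi_dd[OF I.Phi_carrier[OF c(1)]] inv(2)[OF c(1)] c(2) by simp
        then show "b \<in> Phi ` C.BB i j" unfolding C.BB_def using I.Phi_carrier[OF c(1)] by blast
      qed
    qed
  qed (rule Phi_vadd)
qed

end

section \<open>The graded Euler characteristic\<close>

lemma card_free_space:
  assumes "finite Y"
  shows "finite (carrier (free_space Y))" "card (carrier (free_space Y)) = 2 ^ card Y"
proof -
  have "bij_betw (\<lambda>A s. of_bool (s \<in> A)) (Pow Y) (carrier (free_space Y))"
  proof (rule bij_betw_byWitness[of _ "\<lambda>c. {s. c s \<noteq> 0}"])
    show "\<forall>c\<in>carrier (free_space Y). (\<lambda>s. of_bool (s \<in> {s. c s \<noteq> 0})) = c"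
    proof (intro ballI ext)
      fix c :: "'a \<Rightarrow> bit" and s
      show "of_bool (s \<in> {s. c s \<noteq> 0}) = c s" by (cases "c s") simp_all
    qed
    show "(\<lambda>c. {s. c s \<noteq> 0}) ` carrier (free_space Y) \<subseteq> Pow Y" unfolding free_space_def by auto
  qed (auto simp: free_space_def)
  then show "finite (carrier (free_space Y))" "card (carrier (free_space Y)) = 2 ^ card Y"
    using assms by (auto simp: bij_betw_finite[symmetric] bij_betw_same_card[symmetric] card_Pow)
qed

text \<open>It will be applied to the passage to cosets of the cocycles and to the differential,
  which identify the same pairs of cochains. It thus gives the size of the image of a map as that of
  the space modulo the kernel.\<close>

lemma card_image_cong:
  assumes "\<And>x y. x \<in> A \<Longrightarrow> y \<in> A \<Longrightarrow> f x = f y \<longleftrightarrow> g x = g y"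
  shows "card (f ` A) = card (g ` A)"
proof (rule bij_betw_same_card)
  have inv: "g (inv_into A f (f x)) = g x" if x: "x \<in> A" for x
  proof -
    have "inv_into A f (f x) \<in> A" "f (inv_into A f (f x)) = f x" using x by (auto intro: inv_into_into f_inv_into_f)
    then show ?thesis using assms x by blast
  qed
  show "bij_betw (\<lambda>y. g (inv_into A f y)) (f ` A) (g ` A)"
    unfolding bij_betw_def
  proof
    show "inj_on (\<lambda>y. g (inv_into A f y)) (f ` A)"
    proof (rule inj_onI)
      fix y y' assume "y \<in> f ` A" "y' \<in> f ` A" and eq: "g (inv_into A f y) = g (inv_into A f y')"
      then obtain x x' where x: "x \<in> A" "x' \<in> A" "y = f x" "y' = f x'" by blast
      then have "g x = g x'" using eq inv by metis
      then show "y = y'" using assms x by blast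
    qed
    show "(\<lambda>y. g (inv_into A f y)) ` f ` A = g ` A"
      unfolding image_image by (rule image_cong[OF refl]) (rule inv)
  qed
qed

context state_complex
begin

definition nb where "nb i j = card (cochain_basis G M \<Gamma> i j)"
text \<open>The dimension of the coboundaries, presented as a quotient by the zero space so that the
  counting lemmas for quotients apply.\<close>

definition bb where "bb i j = vectorspace.dim F2 (quotient_space (fun_space (BB i j)) {\<lambda>_. 0})"
definition hh where "hh i j = vectorspace.dim F2 (cohomology G M \<Gamma> i j)"

lemma finite_labellings: "finite (labellings G M \<Gamma> S)"
proof -
  have "UNIV = {One, X}" using gen.exhaust by blast
  then have "finite (UNIV :: gen set)" by (metis finite.emptyI finite.insertI)
  then show ?thesis unfolding labellings_eq using finite_circ by (simp add: finite_PiE)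
qed

lemma finite_valid: "finite valid"
proof -
  have "valid = Sigma (Pow M) (labellings G M \<Gamma>)" unfolding valid_def by auto
  moreover have "finite (Sigma (Pow M) (labellings G M \<Gamma>))" using finite_M finite_labellings by (intro finite_SigmaI) simp_all
  ultimately show ?thesis by simp
qed

lemma basis_valid: "cochain_basis G M \<Gamma> i j \<subseteq> valid"
  unfolding cochain_basis_def valid_def by auto

lemma finite_basis: "finite (cochain_basis G M \<Gamma> i j)"
  using basis_valid finite_valid finite_subset by blast

lemma card_CC: "finite (CC i j)" "card (CC i j) = 2 ^ nb i j"
  unfolding cochains_def nb_def using card_free_space[OF finite_basis] by simp_all

lemma ZZ_subset: "ZZ i j \<subseteq> CC i j"
  unfolding ZZ_def by blast

lemma finite_ZZ: "finite (ZZ i j)"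
  using ZZ_subset card_CC(1) finite_subset by blast

lemma finite_BB: "finite (BB i j)"
  using BB_subset_ZZ finite_ZZ finite_subset by blast

lemma card_BB: "card (BB i j) = 2 ^ bb i j"
proof -
  have z: "vclosed {\<lambda>_. 0 :: bit}" "{\<lambda>_. 0} \<subseteq> BB i j" using vclosed_BB[of i j] by (simp_all add: vclosed_def vadd_laws)
  have "card (carrier (quotient_space (fun_space (BB i j)) {\<lambda>_. 0})) = 2 ^ bb i j"
    unfolding bb_def by (rule card_vectorspace_F2[OF vectorspace_quotient[OF vclosed_BB z]]) (simp add: quotient_simps finite_BB)
  then show ?thesis using card_quotient[OF vclosed_BB finite_BB z] by simp
qed

text \<open>Counting cosets gives |Z| = |H| |B| and |C| = |Z| |B'|, where B' are the coboundaries
  one degree up. All these numbers are powers of 2, and the relation compares exponents.\<close>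

lemma dim_relation: "hh i j + bb i j + bb (i + 1) j = nb i j"
proof -
  have Q: "card (carrier (cohomology G M \<Gamma> i j)) = 2 ^ hh i j"
    unfolding hh_def cohomology_eq
    by (rule card_vectorspace_F2[OF vectorspace_quotient[OF vclosed_ZZ vclosed_BB BB_subset_ZZ]]) (simp add: quotient_simps finite_ZZ)
  have 1: "2 ^ hh i j * 2 ^ bb i j = card (ZZ i j)"
    using card_quotient[OF vclosed_ZZ finite_ZZ vclosed_BB BB_subset_ZZ, of i j] unfolding Q[unfolded cohomology_eq] card_BB .
  have "card (carrier (quotient_space (fun_space (CC i j)) (ZZ i j))) = card (BB (i + 1) j)"
    unfolding quotient_simps BB_def add_diff_cancel_right'
  proof (rule card_image_cong)
    fix c d assume c: "c \<in> CC i j" and d: "d \<in> CC i j"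
    show "coset (ZZ i j) c = coset (ZZ i j) d \<longleftrightarrow> dd c = dd d"
    proof
      assume "coset (ZZ i j) c = coset (ZZ i j) d"
      then have "c \<in> coset (ZZ i j) d" using coset_self[OF vclosed_ZZ] by blast
      then obtain z where "z \<in> ZZ i j" "c = vadd z d" unfolding coset_def by blast
      then show "dd c = dd d" by (simp add: dd_vadd ZZ_def vadd_laws(4))
    next
      assume "dd c = dd d"
      then have "vadd c d \<in> ZZ i j" using vclosed_CC[of i j] c d by (simp add: ZZ_def dd_vadd vadd_laws(5) vclosed_def)
      then have "c \<in> coset (ZZ i j) d" unfolding coset_def
        by (rule image_eqI[rotated]) (simp add: vadd_laws(2,3,5))
      then show "coset (ZZ i j) c = coset (ZZ i j) d" by (rule coset_absorb[OF vclosed_ZZ])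
    qed
  qed
  then have "card (BB (i + 1) j) * card (ZZ i j) = card (CC i j)"
    using card_quotient[OF vclosed_CC card_CC(1) vclosed_ZZ ZZ_subset, of i j] by simp
  then have "2 ^ (hh i j + bb i j + bb (i + 1) j) = (2 ^ nb i j :: nat)"
    unfolding card_BB card_CC(2) 1[symmetric] by (simp add: power_add mult.commute)
  then show ?thesis by simp
qed

lemma nb_zero: "i \<notin> int ` {..card M} \<Longrightarrow> nb i j = 0"
proof -
  assume i: "i \<notin> int ` {..card M}"
  have "cochain_basis G M \<Gamma> i j = {}"
  proof (rule ccontr)
    assume "cochain_basis G M \<Gamma> i j \<noteq> {}"
    then obtain S where "S \<subseteq> M" "int (card S) = i" unfolding cochain_basis_def by blast
    then show False using i card_mono[OF finite_M] by (metis atMost_iff imageI)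
  qed
  then show ?thesis by (simp add: nb_def)
qed

lemma bb_zero: "i \<le> 0 \<or> int (card M) < i \<Longrightarrow> bb i j = 0"
proof -
  assume "i \<le> 0 \<or> int (card M) < i"
  then have "i - 1 \<notin> int ` {..card M} \<or> i \<notin> int ` {..card M}" by auto
  then have "nb (i - 1) j = 0 \<or> nb i j = 0" using nb_zero[of "i - 1" j] nb_zero[of i j] by argo
  then show ?thesis using dim_relation[of "i - 1" j] dim_relation[of i j] by auto
qed

text \<open>The dimensions of the coboundaries telescope; the term left over at the top vanishes
  once \<open>m\<close> reaches \<open>card M\<close>.\<close>

lemma alternating_sum:
  "(\<Sum>i\<le>m. (- 1) ^ i * int (hh (int i) j)) = (\<Sum>i\<le>m. (- 1) ^ i * int (nb (int i) j)) - (- 1) ^ m * int (bb (int m + 1) j)"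
proof (induction m)
  case 0
  then show ?case using dim_relation[of 0 j] bb_zero[of 0 j] by simp
next
  case (Suc m)
  have "int (nb (int (Suc m)) j) = int (hh (int (Suc m)) j) + int (bb (int m + 1) j) + int (bb (int (Suc m) + 1) j)"
    using dim_relation[of "int (Suc m)" j] by (simp add: add.commute)
  then show ?case using Suc by (simp add: algebra_simps)
qed

definition deg :: "'e set \<times> 'e labelling \<Rightarrow> int" where
  "deg s = (\<Sum>c\<in>circ (fst s). gen_deg (snd s c)) + int (card (fst s))"

lemma basis_eq: "cochain_basis G M \<Gamma> i j = {s \<in> valid. int (card (fst s)) = i \<and> deg s = j}"
  unfolding cochain_basis_def valid_def deg_def circles_eq by auto

lemma hh_zero: "j \<notin> deg ` valid \<Longrightarrow> hh i j = 0" "i \<notin> int ` {..card M} \<Longrightarrow> hh i j = 0"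
proof -
  have h: "nb i j = 0 \<Longrightarrow> hh i j = 0" using dim_relation[of i j] by simp
  show "i \<notin> int ` {..card M} \<Longrightarrow> hh i j = 0" using h nb_zero[of i j] by simp
  assume "j \<notin> deg ` valid"
  then have "cochain_basis G M \<Gamma> i j = {}" unfolding basis_eq by auto
  then show "hh i j = 0" using h by (simp add: nb_def)
qed

lemma qdim_eq: "qdim (cohomology G M \<Gamma> i) = (\<Sum>j\<in>deg ` valid. fls_const (int (hh i j)) * fls_X_intpow j)"
  unfolding qdim_def hh_def[symmetric]
proof (rule Sum_any.expand_superset)
  show "{j. fls_const (int (hh i j)) * fls_X_intpow j \<noteq> 0} \<subseteq> deg ` valid"
  proof
    fix j assume "j \<in> {j. fls_const (int (hh i j)) * fls_X_intpow j \<noteq> 0}"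
    then have "hh i j \<noteq> 0" by auto
    then show "j \<in> deg ` valid" using hh_zero(1)[of j i] by (metis neq0_conv)
  qed
qed (use finite_valid in simp)

lemma euler_eq: "graded_euler_characteristic (cohomology G M \<Gamma>) = (\<Sum>i\<le>card M. (- 1) ^ i * qdim (cohomology G M \<Gamma> (int i)))"
proof -
  have "qdim (cohomology G M \<Gamma> i) = 0" if "i \<notin> int ` {..card M}" for i
    unfolding qdim_eq using hh_zero(2)[OF that] by simp
  then have "graded_euler_characteristic (cohomology G M \<Gamma>) = (\<Sum>i\<in>int ` {..card M}. (- 1) ^ nat \<bar>i\<bar> * qdim (cohomology G M \<Gamma> i))"
    unfolding graded_euler_characteristic_def by (intro Sum_any.expand_superset) auto
  then show ?thesis by (simp add: sum.reindex)
qed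

lemma fls_const_sum: "fls_const (sum f A) = (\<Sum>a\<in>A. fls_const (f a))"
  by (induction A rule: infinite_finite_induct) (simp_all add: fls_plus_const[symmetric])

lemma fls_const_sign: "fls_const ((- 1) ^ n * a) = (- 1) ^ n * fls_const (a :: int)"
proof (induction n)
  case (Suc n)
  then show ?case using Suc by simp
qed simp

text \<open>The alternating sum of dimensions may be taken over the cochains, where each basis
  element contributes one signed power of q.\<close>

lemma euler_valid: "graded_euler_characteristic (cohomology G M \<Gamma>) = (\<Sum>s\<in>valid. (- 1) ^ card (fst s) * fls_X_intpow (deg s))"
proof -
  have fin: "finite (deg ` valid)" using finite_valid by blast
  have "graded_euler_characteristic (cohomology G M \<Gamma>) =
      (\<Sum>i\<le>card M. \<Sum>j\<in>deg ` valid. fls_const ((- 1) ^ i * int (hh (int i) j)) * fls_X_intpow j)"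
    unfolding euler_eq qdim_eq fls_const_sign by (simp add: sum_distrib_left mult.assoc)
  also have "\<dots> = (\<Sum>j\<in>deg ` valid. fls_const (\<Sum>i\<le>card M. (- 1) ^ i * int (hh (int i) j)) * fls_X_intpow j)"
    unfolding fls_const_sum sum_distrib_right by (rule sum.swap)
  also have "\<dots> = (\<Sum>j\<in>deg ` valid. fls_const (\<Sum>i\<le>card M. (- 1) ^ i * int (nb (int i) j)) * fls_X_intpow j)"
    unfolding alternating_sum by (simp add: bb_zero)
  also have "\<dots> = (\<Sum>j\<in>deg ` valid. \<Sum>s | s \<in> valid \<and> deg s = j. (- 1) ^ card (fst s) * fls_X_intpow (deg s))"
  proof (rule sum.cong[OF refl])
    fix j
    have "(\<Sum>i\<le>card M. (- 1) ^ i * int (nb (int i) j)) = (\<Sum>i\<le>card M. \<Sum>s | s \<in> {s \<in> valid. deg s = j} \<and> card (fst s) = i. (- 1) ^ card (fst s))"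
    proof (rule sum.cong[OF refl])
      fix i
      have "(\<Sum>s | s \<in> {s \<in> valid. deg s = j} \<and> card (fst s) = i. (- 1) ^ card (fst s)) =
          (\<Sum>s | s \<in> {s \<in> valid. deg s = j} \<and> card (fst s) = i. (- 1 :: int) ^ i)"
        by (rule sum.cong) auto
      also have "\<dots> = (- 1) ^ i * int (nb (int i) j)"
      proof -
        have "{s. s \<in> {s \<in> valid. deg s = j} \<and> card (fst s) = i} = cochain_basis G M \<Gamma> (int i) j"
          unfolding basis_eq by auto
        then show ?thesis by (simp only: nb_def sum_constant mult.commute)
      qed
      finally show "(- 1) ^ i * int (nb (int i) j) = (\<Sum>s | s \<in> {s \<in> valid. deg s = j} \<and> card (fst s) = i. (- 1) ^ card (fst s))" ..
    qed
    also have "\<dots> = (\<Sum>s | s \<in> valid \<and> deg s = j. (- 1) ^ card (fst s))"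
    proof (rule sum.group)
      show "finite {s \<in> valid. deg s = j}" using finite_valid by simp
      show "(\<lambda>s. card (fst s)) ` {s \<in> valid. deg s = j} \<subseteq> {..card M}"
        using card_mono[OF finite_M] by (auto simp: valid_def)
    qed simp
    finally have "fls_const (\<Sum>i\<le>card M. (- 1) ^ i * int (nb (int i) j)) = (\<Sum>s | s \<in> valid \<and> deg s = j. (- 1) ^ card (fst s))"
      using fls_const_sign[of _ 1] by (simp add: fls_const_sum)
    then show "fls_const (\<Sum>i\<le>card M. (- 1) ^ i * int (nb (int i) j)) * fls_X_intpow j =
        (\<Sum>s | s \<in> valid \<and> deg s = j. (- 1) ^ card (fst s) * fls_X_intpow (deg s))"
      unfolding sum_distrib_right by (auto intro!: sum.cong simp: sum_distrib_right)
  qed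
  also have "\<dots> = (\<Sum>s\<in>valid. (- 1) ^ card (fst s) * fls_X_intpow (deg s))"
    by (rule sum.group) (use finite_valid in auto)
  finally show ?thesis .
qed

text \<open>Expanding the power selects one of the two terms for each circle; the circles with the
  term of exponent -1 are those labelled by x.\<close>

lemma laurent_power: "(\<Sum>l\<in>labellings G M \<Gamma> S. fls_X_intpow (\<Sum>c\<in>circ S. gen_deg (l c))) = (fls_X_inv + fls_X :: int fls) ^ card (circ S)"
proof -
  have "(fls_X_inv + fls_X :: int fls) ^ card (circ S) = (\<Prod>c\<in>circ S. fls_X_intpow (- 1) + fls_X_intpow 1)"
    by (simp add: fls_X_conv_shift_1 fls_X_inv_conv_shift_1)
  also have "\<dots> = (\<Sum>T\<in>Pow (circ S). (\<Prod>c\<in>T. fls_X_intpow (- 1)) * (\<Prod>c\<in>circ S - T. fls_X_intpow 1))"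
    by (rule prod_add) (rule finite_circ)
  also have "\<dots> = (\<Sum>T\<in>Pow (circ S). fls_X_intpow (\<Sum>c\<in>circ S. gen_deg (lab (circ S) T c)))"
  proof (rule sum.cong[OF refl])
    fix T assume T: "T \<in> Pow (circ S)"
    have "int (card (circ S - T)) = int (card (circ S)) - int (card T)"
      using T finite_circ[of S] by (simp add: card_Diff_subset finite_subset of_nat_diff card_mono)
    then have "int (card T) * - 1 + int (card (circ S - T)) * 1 = (\<Sum>c\<in>circ S. gen_deg (lab (circ S) T c))"
      unfolding sum_gen_deg[OF finite_circ] using T by (simp add: xset_lab)
    then show "(\<Prod>c\<in>T. fls_X_intpow (- 1)) * (\<Prod>c\<in>circ S - T. fls_X_intpow 1) = fls_X_intpow (\<Sum>c\<in>circ S. gen_deg (lab (circ S) T c))"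
      unfolding prod_constant fls_X_intpow_power fls_X_intpow_times_fls_X_intpow by simp
  qed
  also have "\<dots> = (\<Sum>l\<in>labellings G M \<Gamma> S. fls_X_intpow (\<Sum>c\<in>circ S. gen_deg (l c)))"
    unfolding labellings_eq by (rule sum.reindex_bij_betw[OF bij_lab])
  finally show ?thesis by simp
qed

theorem euler_characteristic: "graded_euler_characteristic (cohomology G M \<Gamma>) = two_factor_polynomial G M \<Gamma>"
proof -
  have "valid = Sigma (Pow M) (labellings G M \<Gamma>)" unfolding valid_def by auto
  moreover note finite_labellings
  ultimately have "graded_euler_characteristic (cohomology G M \<Gamma>) =
      (\<Sum>S\<in>Pow M. \<Sum>l\<in>labellings G M \<Gamma> S. (- 1) ^ card S * fls_X_intpow (deg (S, l)))"
    unfolding euler_valid using finite_M by (simp add: sum.Sigma split_beta)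
  also have "\<dots> = (\<Sum>S\<in>Pow M. (- fls_X) ^ card S * (fls_X_inv + fls_X) ^ card (circ S))"
  proof (rule sum.cong[OF refl])
    fix S
    have "fls_X_intpow (deg (S, l)) = fls_X ^ card S * (fls_X_intpow (\<Sum>c\<in>circ S. gen_deg (l c)) :: int fls)" for l
      unfolding deg_def by (simp add: fls_X_power_conv_shift_1 fls_X_intpow_times_conv_shift algebra_simps)
    then show "(\<Sum>l\<in>labellings G M \<Gamma> S. (- 1) ^ card S * fls_X_intpow (deg (S, l))) = (- fls_X :: int fls) ^ card S * (fls_X_inv + fls_X) ^ card (circ S)"
      unfolding laurent_power[symmetric] by (simp add: sum_distrib_left power_minus[of fls_X] mult.assoc)
  qed
  finally show ?thesis unfolding two_factor_polynomial_def circles_eq .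
qed

end

section \<open>States of plane graphs\<close>

lemma ccw_at_unique:
  assumes "multigraph G" "plane_graph G \<Gamma>" "half_edges_at G v = {h, x, y}" "distinct [h, x, y]"
  obtains a b where "{a, b} = {x, y}" "a \<noteq> b" "\<And>a' b'. ccw_at G \<Gamma> v h a' b' \<longleftrightarrow> a' = a \<and> b' = b"
proof -
  have t: "ccw_at G \<Gamma> v h x y \<noteq> ccw_at G \<Gamma> v h y x" by (rule ccw_at_total[OF assms])
  have c: "a' = x \<and> b' = y \<or> a' = y \<and> b' = x" if "ccw_at G \<Gamma> v h a' b'" for a' b'
    using that assms(3,4) unfolding ccw_at_def by auto
  show thesis
  proof (cases "ccw_at G \<Gamma> v h x y")
    case True
    show ?thesis by (rule that[of x y]) (use True t c assms(4) in auto)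
  next
    case False
    show ?thesis by (rule that[of y x]) (use False t c assms(4) in auto)
  qed
qed

locale plane_matched_graph = matched_graph G M for G :: "('v, 'e) mgraph" and M +
  fixes \<Gamma> :: "('v, 'e) drawing"
  assumes pl: "plane_graph G \<Gamma>"
begin

text \<open>For a matching edge exactly one pair satisfies the condition, so the choice is
  determined there.\<close>

definition p :: "'e \<Rightarrow> bool \<Rightarrow> bool \<Rightarrow> 'e \<times> bool" where
  "p e s i = (if i then snd else fst) (SOME z. ccw_at G \<Gamma> (hvert G (e, s)) (e, s) (fst z) (snd z))"

lemma M_edge: "e \<in> M \<Longrightarrow> (e, s) \<in> half_edges G" "e \<in> M \<Longrightarrow> \<exists>u v. ends G e = Some (u, v) \<and> u \<noteq> v"
  using pm unfolding perfect_matching_def half_edges_def by fastforce+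

lemma ends_hvert: "e \<in> M \<Longrightarrow> ends G e = Some (hvert G (e, False), hvert G (e, True))"
  using M_edge(2)[of e] by (auto simp: hvert_def)

lemma p_at:
  assumes e: "e \<in> M"
  shows "half_edges_at G (hvert G (e, s)) = {(e, s), p e s False, p e s True}" "distinct [(e, s), p e s False, p e s True]"
    "fst (p e s i) \<notin> M" "ccw_at G \<Gamma> (hvert G (e, s)) (e, s) a b \<longleftrightarrow> a = p e s False \<and> b = p e s True"
proof -
  let ?v = "hvert G (e, s)"
  obtain h x y where hxy: "half_edges_at G ?v = {h, x, y}" "distinct [h, x, y]" "fst h \<in> M" "fst x \<notin> M" "fst y \<notin> M"
    using matching_half_edges half_edge_verts(1)[OF mg M_edge(1)[OF e]] by metis
  have "(e, s) \<in> half_edges_at G ?v" using M_edge(1)[OF e] by (simp add: half_edges_at_def)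
  then have h: "h = (e, s)" using hxy e by auto
  obtain c d where cd: "{c, d} = {x, y}" "c \<noteq> d" "\<And>a' b'. ccw_at G \<Gamma> ?v h a' b' \<longleftrightarrow> a' = c \<and> b' = d"
    using ccw_at_unique[OF mg pl hxy(1,2)] by blast
  have "(SOME z. ccw_at G \<Gamma> ?v (e, s) (fst z) (snd z)) = (c, d)"
    by (rule some_equality) (use cd(3) h in auto)
  then have p: "p e s False = c" "p e s True = d" unfolding p_def by simp_all
  show "half_edges_at G ?v = {(e, s), p e s False, p e s True}" "distinct [(e, s), p e s False, p e s True]"
    unfolding p using hxy(1,2) cd(1,2) h by (auto simp: doubleton_eq_iff)
  show "fst (p e s i) \<notin> M" using p hxy(4,5) cd(1) by (cases i) (auto simp: doubleton_eq_iff)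
  show "ccw_at G \<Gamma> ?v (e, s) a b \<longleftrightarrow> a = p e s False \<and> b = p e s True" using cd(3) unfolding p h .
qed

lemma p_half_edge: "e \<in> M \<Longrightarrow> p e s i \<in> half_edges G" "e \<in> M \<Longrightarrow> hvert G (p e s i) = hvert G (e, s)"
proof -
  assume e: "e \<in> M"
  have "p e s i \<in> half_edges_at G (hvert G (e, s))" unfolding p_at(1)[OF e] by (cases i) simp_all
  then show "p e s i \<in> half_edges G" "hvert G (p e s i) = hvert G (e, s)" by (simp_all add: half_edges_at_def)
qed

lemma p_edges: "e \<in> M \<Longrightarrow> fst (p e s i) \<in> edges G - M"
  using half_edge_verts(3)[OF mg p_half_edge(1)] p_at(3) by blast

lemma matching_unique: "e \<in> M \<Longrightarrow> d \<in> M \<Longrightarrow> hvert G (d, t) = hvert G (e, s) \<Longrightarrow> d = e \<and> t = s"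
proof -
  assume e: "e \<in> M" and d: "d \<in> M" and v: "hvert G (d, t) = hvert G (e, s)"
  have "(d, t) \<in> half_edges_at G (hvert G (e, s))" using M_edge(1)[OF d] v by (simp add: half_edges_at_def)
  then have "(d, t) \<in> {(e, s), p e s False, p e s True}" unfolding p_at(1)[OF e] .
  moreover have "(d, t) \<noteq> p e s i" for i using p_at(3)[OF e, of s i] d by (metis fst_conv)
  ultimately show "d = e \<and> t = s" by blast
qed

lemma p_cover:
  assumes h: "h \<in> half_edges G" "fst h \<notin> M"
  shows "\<exists>d\<in>M. \<exists>t j. p d t j = h \<and> hvert G (d, t) = hvert G h"
proof -
  obtain k x y where k: "half_edges_at G (hvert G h) = {k, x, y}" "fst k \<in> M"
    using matching_half_edges half_edge_verts(1)[OF mg h(1)] by metis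
  obtain d t where dt: "k = (d, t)" by (cases k)
  have "k \<in> half_edges_at G (hvert G h)" using k by blast
  then have v: "hvert G (d, t) = hvert G h" unfolding dt by (simp add: half_edges_at_def)
  have "h \<in> half_edges_at G (hvert G (d, t))" using h v by (simp add: half_edges_at_def)
  moreover have d: "d \<in> M" using k dt by simp
  ultimately have "h \<in> {(d, t), p d t False, p d t True}" unfolding p_at(1)[OF d] by blast
  then have "\<exists>j. p d t j = h" using h(2) d by auto
  then show ?thesis using d v by blast
qed

sublocale smoothing "edges G - M" M p
proof
  show "finite (edges G - M)" "finite M" using mg pm finite_subset by (auto simp: multigraph_def perfect_matching_def)
  fix e s i assume e: "e \<in> M"
  show "fst (p e s i) \<in> edges G - M" by (rule p_edges[OF e])
  have "rv (p e s i) \<in> half_edges G" "fst (rv (p e s i)) \<notin> M" using p_half_edge(1)[OF e] p_at(3)[OF e] by simp_all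
  from p_cover[OF this] show "\<exists>d\<in>M. \<exists>t j. p d t j = (fst (p e s i), \<not> snd (p e s i))" unfolding rv_def by blast
next
  fix d e t j s i assume d: "d \<in> M" and e: "e \<in> M" and eq: "p d t j = p e s i"
  then have "hvert G (d, t) = hvert G (e, s)" using p_half_edge(2) by metis
  then have de: "d = e" "t = s" using matching_unique[OF e d] by blast+
  then have "p e s j = p e s i" using eq by simp
  then have "j = i" using p_at(2)[OF e, of s] by (cases j; cases i) auto
  then show "d = e \<and> t = s \<and> j = i" using de by blast
qed

lemma arc_joins_iff: "arc_joins G M \<Gamma> S h h' \<longleftrightarrow> (\<exists>e\<in>M. \<exists>i. {h, h'} = {p e False i, p e True (i = (e \<in> S))})"
proof -
  have "(\<exists>u v x1 x2 y1 y2. ends G e = Some (u, v) \<and> ccw_at G \<Gamma> u (e, False) x1 x2 \<and> ccw_at G \<Gamma> v (e, True) y1 y2 \<and>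
        {h, h'} \<in> (if e \<in> S then {{x1, y1}, {x2, y2}} else {{x1, y2}, {x2, y1}})) \<longleftrightarrow>
      (\<exists>i. {h, h'} = {p e False i, p e True (i = (e \<in> S))})" if e: "e \<in> M" for e
    unfolding ends_hvert[OF e] by (cases "e \<in> S") (simp_all add: p_at(4)[OF e] ex_bool_eq disj_commute del: split_paired_Ex)
  then show ?thesis unfolding arc_joins_def by (rule bex_cong[OF refl])
qed

lemma adjacent_eq: "adjacent_in_state G M \<Gamma> S = arcs M S \<union> (arcs M S)\<inverse>"
proof -
  have "(\<exists>b b'. arc_joins G M \<Gamma> S (f, b) (f', b')) \<longleftrightarrow> (f, f') \<in> arcs M S \<union> (arcs M S)\<inverse>" for f f'
  proof
    assume "\<exists>b b'. arc_joins G M \<Gamma> S (f, b) (f', b')"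
    then obtain b b' e i where e: "e \<in> M" "{(f, b), (f', b')} = {p e False i, p e True (i = (e \<in> S))}"
      unfolding arc_joins_iff by blast
    then have "f = fst (p e False i) \<and> f' = fst (p e True (i = (e \<in> S))) \<or> f' = fst (p e False i) \<and> f = fst (p e True (i = (e \<in> S)))"
      unfolding doubleton_eq_iff by (metis fst_conv)
    then show "(f, f') \<in> arcs M S \<union> (arcs M S)\<inverse>" unfolding arcs_def using e(1) by blast
  next
    assume "(f, f') \<in> arcs M S \<union> (arcs M S)\<inverse>"
    then obtain e i where e: "e \<in> M" "f = fst (p e False i) \<and> f' = fst (p e True (i = (e \<in> S))) \<or> f' = fst (p e False i) \<and> f = fst (p e True (i = (e \<in> S)))"
      unfolding arcs_def by blast
    let ?h = "p e False i" and ?k = "p e True (i = (e \<in> S))"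
    have "\<exists>b b'. {(f, b), (f', b')} = {?h, ?k}"
      using e(2)
    proof
      assume "f = fst ?h \<and> f' = fst ?k"
      then have "{(f, snd ?h), (f', snd ?k)} = {?h, ?k}" by simp
      then show ?thesis by blast
    next
      assume "f' = fst ?h \<and> f = fst ?k"
      then have "{(f, snd ?k), (f', snd ?h)} = {?h, ?k}" by (simp add: insert_commute)
      then show ?thesis by blast
    qed
    then obtain b b' where "{(f, b), (f', b')} = {?h, ?k}" by (elim exE)
    then have "arc_joins G M \<Gamma> S (f, b) (f', b')" unfolding arc_joins_iff by (intro bexI[OF _ e(1)] exI)
    then show "\<exists>b b'. arc_joins G M \<Gamma> S (f, b) (f', b')" by (intro exI)
  qed
  moreover have "f \<in> edges G - M \<and> f' \<in> edges G - M" if "(f, f') \<in> arcs M S \<union> (arcs M S)\<inverse>" for f f'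
  proof -
    have "arcs M S \<subseteq> (edges G - M) \<times> (edges G - M)"
    proof
      fix z assume "z \<in> arcs M S"
      then obtain e i where "e \<in> M" "z = (fst (p e False i), fst (p e True (i = (e \<in> S))))" unfolding arcs_def by blast
      then show "z \<in> (edges G - M) \<times> (edges G - M)" using p_edges by simp
    qed
    then show ?thesis using that by blast
  qed
  ultimately show ?thesis unfolding adjacent_in_state_def by blast
qed

lemma circles_circ: "circles G M \<Gamma> S = circ S"
  unfolding circles_def adjacent_eq circ_def cl_def R_def quotient_def by blast

text \<open>An edge outside \<open>M\<close> with an end in common with \<open>e\<close> is one of
  the four edges \<open>fst (p e s i)\<close>, and their circles already occur at the first end of
  \<open>e\<close>.\<close>

lemma circles_through_thr:
  assumes e: "e \<in> M"
  shows "circles_through G M \<Gamma> S e = thr S e"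
proof
  show "circles_through G M \<Gamma> S e \<subseteq> thr S e"
  proof
    fix c assume "c \<in> circles_through G M \<Gamma> S e"
    then obtain f v where f: "c \<in> circ S" "f \<in> c" "endpoint G e v" "endpoint G f v"
      unfolding circles_through_def circles_circ by blast
    then obtain g where g: "g \<in> edges G - M" "c = cl S g" unfolding circ_def by blast
    have fE: "f \<in> edges G - M" using f(2) g cl_subset by blast
    obtain s where s: "v = hvert G (e, s)" using f(3) ends_hvert[OF e] unfolding endpoint_def by auto
    obtain b where b: "(f, b) \<in> half_edges G" "hvert G (f, b) = v"
    proof -
      obtain u w where "ends G f = Some (u, w)" "v = u \<or> v = w" using f(4) unfolding endpoint_def by blast
      then show thesis using fE that[of "v \<noteq> u"] by (auto simp: half_edges_def hvert_def)
    qed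
    then obtain d t j where d: "d \<in> M" "p d t j = (f, b)" "hvert G (d, t) = v" using p_cover[of "(f, b)"] fE by auto
    then have "d = e" "t = s" using matching_unique[OF e d(1)] s by blast+
    then have "f = fst (p e s j)" using d(2) by simp
    moreover have "c = cl S f" using f(2) unfolding g(2) cl_eq_iff by (simp add: cl_def)
    ultimately show "c \<in> thr S e" using cl_in_thr[OF e] by simp
  qed
  show "thr S e \<subseteq> circles_through G M \<Gamma> S e"
  proof
    fix c assume "c \<in> thr S e"
    then obtain i where c: "c = cl S (fst (p e False i))" unfolding thr_def by blast
    have "endpoint G e (hvert G (e, False))" unfolding endpoint_def using ends_hvert[OF e] by blast
    moreover have "endpoint G (fst (p e False i)) (hvert G (e, False))"
      using p_half_edge[OF e, of False i] unfolding endpoint_def half_edges_def hvert_def by (auto split: if_splits)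
    ultimately show "c \<in> circles_through G M \<Gamma> S e"
      unfolding circles_through_def circles_circ c using cl_self cl_in_circ[OF p_edges[OF e]] by blast
  qed
qed

text \<open>Since \<open>c\<close> vanishes off \<open>M\<close>, the function \<xi> has a single
  value on each edge outside \<open>M\<close> that has ends, which is the hypothesis of
  \<open>coboundary_relation\<close>.\<close>

lemma coboundary_sd:
  assumes \<xi>: "\<forall>h\<in>half_edges G. \<xi> (hvert G h) + \<xi> (tgt G h) = c (fst h)" and c: "\<And>f. f \<notin> M \<Longrightarrow> c f = (0 :: bit)"
  shows "(\<Sum>d\<in>M. scale (c d) (sd S d)) = 0"
proof -
  have eq: "\<xi> (hvert G k) = \<xi> (hvert G h)" if "k \<in> half_edges G" "h \<in> half_edges G" "fst k = fst h" "fst h \<notin> M" for h k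
  proof -
    have "\<xi> (hvert G h) + \<xi> (tgt G h) = 0" using \<xi> that c by simp
    then have "\<xi> (hvert G h) = \<xi> (tgt G h)" by (simp only: bit_add_eq_0)
    then show ?thesis using half_edge_cases[of h k] that(3) by auto
  qed
  have "(\<Sum>d\<in>M. scale (\<xi> (hvert G (d, False)) + \<xi> (hvert G (d, True))) (sd S d)) = 0"
  proof (rule coboundary_relation)
    fix d t j e s i assume d: "d \<in> M" and e: "e \<in> M" and f: "fst (p d t j) = fst (p e s i)"
    show "\<xi> (hvert G (d, t)) = \<xi> (hvert G (e, s))"
      using eq[OF p_half_edge(1)[OF d] p_half_edge(1)[OF e] f p_at(3)[OF e]] unfolding p_half_edge(2)[OF d] p_half_edge(2)[OF e] .
  qed
  moreover have "\<xi> (hvert G (d, False)) + \<xi> (hvert G (d, True)) = c d" if "d \<in> M" for d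
    using \<xi> M_edge(1)[OF that, of False] by (auto simp: tgt_def rv_def)
  ultimately show ?thesis by simp
qed

sublocale state_complex G M p \<Gamma>
  by unfold_locales (simp_all add: circles_circ circles_through_thr)

end

theorem theorem2:
  fixes G :: "('v, 'e) mgraph" and M :: "'e set"
  assumes "multigraph G" and "planar G" and "trivalent G" and "perfect_matching G M"
  shows "(\<forall>\<Gamma> \<Gamma>'. plane_graph G \<Gamma> \<longrightarrow> plane_graph G \<Gamma>' \<longrightarrow>
            bigraded_isomorphic (cohomology G M \<Gamma>) (cohomology G M \<Gamma>')) \<and>
         (\<forall>\<Gamma> \<Gamma>'. plane_graph G \<Gamma> \<longrightarrow> plane_graph G \<Gamma>' \<longrightarrow>
            two_factor_polynomial G M \<Gamma> = graded_euler_characteristic (cohomology G M \<Gamma>'))"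
proof -
  interpret matched_graph G M by unfold_locales (fact assms)+
  have "bigraded_isomorphic (cohomology G M \<Gamma>) (cohomology G M \<Gamma>') \<and>
      two_factor_polynomial G M \<Gamma> = graded_euler_characteristic (cohomology G M \<Gamma>')"
    if P: "plane_graph G \<Gamma>" "plane_graph G \<Gamma>'" for \<Gamma> \<Gamma>' :: "('v, 'e) drawing"
  proof -
    interpret P: plane_matched_graph G M \<Gamma> by unfold_locales (rule P(1))
    interpret P': plane_matched_graph G M \<Gamma>' by unfold_locales (rule P(2))
    interpret T: cubic_flip G M "flips G \<Gamma> \<Gamma>'"
      by unfold_locales (use theta_flips[OF mg tri P] in blast)
    obtain \<Psi> :: "'v \<Rightarrow> 'e \<Rightarrow> bit" where \<Psi>: "\<forall>h\<in>half_edges G. fst h \<notin> M \<longrightarrow> \<Psi> (hvert G h) = \<Psi> (tgt G h)"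
        "\<forall>h\<in>half_edges G. fst h \<in> M \<longrightarrow> (\<exists>\<xi>. T.cobounds \<xi> (\<lambda>d. if d \<in> M
          then \<Psi> (hvert G h) d + \<Psi> (tgt G h) d + of_bool (d = fst h \<and> fst h \<in> T.D) else 0))"
      using T.potential by (elim exE conjE) (rule that)
    define fl where "fl e s \<longleftrightarrow> hvert G (e, s) \<in> flips G \<Gamma> \<Gamma>'" for e s
    \<comment> \<open>The potential agrees at both ends of an edge outside \<open>M\<close>, so
      reading it at the first end is no restriction. For a vertexless circle the value is arbitrary;
      \<open>smoothing_map\<close> constrains \<kappa> only at edges meeting a matching
      edge.\<close>
    define \<kappa> where "\<kappa> f = \<Psi> (hvert G (f, False))" for f
    define \<tau> where "\<tau> e s = \<Psi> (hvert G (e, s))" for e s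
    have D: "e \<in> T.D \<longleftrightarrow> fl e False \<noteq> fl e True" if e: "e \<in> M" for e
    proof
      assume "e \<in> T.D"
      then obtain h where "fst h = e" "(hvert G h \<in> flips G \<Gamma> \<Gamma>') \<noteq> (tgt G h \<in> flips G \<Gamma> \<Gamma>')" unfolding T.D_def by blast
      then show "fl e False \<noteq> fl e True" unfolding fl_def tgt_def rv_def by (cases h; cases "snd h") auto
    next
      assume "fl e False \<noteq> fl e True"
      then show "e \<in> T.D" using e P.M_edge(1)[OF e, of False] unfolding T.D_def fl_def
        by (auto simp: tgt_def rv_def intro!: bexI[of _ "(e, False)"])
    qed
    \<comment> \<open>The value 0 off \<open>M\<close> records that the cuts in question lie inside
      \<open>M\<close>, as the relations between the elements \<open>sd\<close> demand.\<close>
    define c where "c e d = (if d \<in> M then \<tau> e False d + \<tau> e True d + of_bool (d = e \<and> fl e False \<noteq> fl e True) else 0)" for e d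
    have cob: "\<exists>\<xi>. \<forall>h\<in>half_edges G. \<xi> (hvert G h) + \<xi> (tgt G h) = c e (fst h)" if e: "e \<in> M" for e
    proof -
      have t: "tgt G (e, False) = hvert G (e, True)" by (simp add: tgt_def rv_def)
      show ?thesis using \<Psi>(2)[rule_format, OF P.M_edge(1)[OF e, of False], unfolded fst_conv, OF e]
        unfolding T.cobounds_def c_def \<tau>_def D[OF e] t .
    qed
    interpret complex_map G M P.p \<Gamma> P'.p \<Gamma>' fl \<kappa> \<tau>
    proof unfold_locales
      fix e s i assume e: "e \<in> M"
      let ?v = "hvert G (e, s)"
      have v: "?v \<in> verts G" using half_edge_verts(1)[OF mg P.M_edge(1)[OF e]] .
      have x: "ccw_at G \<Gamma> ?v (e, s) (P.p e s False) (P.p e s True)" by (simp add: P.p_at(4)[OF e])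
      have "fl e s \<longleftrightarrow> \<not> ccw_at G \<Gamma>' ?v (e, s) (P.p e s False) (P.p e s True)"
        using flips_iff[OF mg P v P.p_at(1,2)[OF e]] x unfolding fl_def by simp
      moreover have "ccw_at G \<Gamma>' ?v (e, s) (P.p e s False) (P.p e s True) \<noteq> ccw_at G \<Gamma>' ?v (e, s) (P.p e s True) (P.p e s False)"
        by (rule ccw_at_total[OF mg P(2) P.p_at(1,2)[OF e]])
      ultimately show "P'.p e s i = P.p e s (i \<noteq> fl e s)"
        unfolding P'.p_at(4)[OF e] by (cases i; cases "fl e s") auto
      have "\<Psi> (hvert G (P.p e s i)) = \<Psi> (tgt G (P.p e s i))" using \<Psi>(1) P.p_half_edge(1)[OF e] P.p_at(3)[OF e] by blast
      moreover have "hvert G (P.p e s i) = ?v" by (rule P.p_half_edge(2)[OF e])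
      moreover have "hvert G (fst h, False) = hvert G h \<or> hvert G (fst h, False) = tgt G h" for h
        by (cases h; cases "snd h") (auto simp: tgt_def rv_def)
      ultimately show "\<kappa> (fst (P.p e s i)) = \<tau> e s" unfolding \<kappa>_def \<tau>_def by metis
    next
      fix e S assume e: "e \<in> M"
      obtain \<xi> where \<xi>: "\<forall>h\<in>half_edges G. \<xi> (hvert G h) + \<xi> (tgt G h) = c e (fst h)" using cob[OF e] by blast
      have "c e f = 0" if "f \<notin> M" for f using that by (simp add: c_def)
      from P.coboundary_sd[OF \<xi> this] P'.coboundary_sd[OF \<xi> this]
      have "(\<Sum>d\<in>M. scale (c e d) (P.sd S d)) = 0" "(\<Sum>d\<in>M. scale (c e d) (P'.sd S d)) = 0" by blast+
      then show "(\<Sum>d\<in>M. scale (\<tau> e False d + \<tau> e True d + of_bool (d = e \<and> fl e False \<noteq> fl e True)) (P'.sd S d)) = 0"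
        "(\<Sum>d\<in>M. scale (\<tau> e False d + \<tau> e True d + of_bool (d = e \<and> fl e False \<noteq> fl e True)) (P.sd S d)) = 0"
        by (simp_all add: c_def)
    qed
    \<comment> \<open>Corresponding states have equally many circles, so the polynomial can be moved
      to the plane graph whose Euler characteristic is considered.\<close>
    have "two_factor_polynomial G M \<Gamma> = two_factor_polynomial G M \<Gamma>'"
      unfolding two_factor_polynomial_def P.circles_circ P'.circles_circ card_circ_eq ..
    then show ?thesis using cohomology_isomorphic P'.euler_characteristic by simp
  qed
  then show ?thesis by blast
qed

end
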